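(* Let $\mathcal{C}$ be the monoidal category of finite dimensional complex $\mathfrak{sl}_2$-modules, acting on modules over the Lie algebra $\mathfrak{g}=\mathfrak{sl}_2\ltimes L(4)$ (where $L(4)$ is an abelian ideal) by pulling back along the natural projection $\mathfrak{g}\twoheadrightarrow\mathfrak{sl}_2$ and tensoring over $\mathbb{C}$. Let $\mu\in\mathbb{C}\setminus\{0\}$ and let $\mathcal{Y}'$ be the additive closure of the simple $\mathfrak{g}$-modules $V'(0,\mu)$, $V'(2,\mu)$ and $V(n,\mu)$, $n\in\mathbb{Z}_{\geq 1}$. Then $\mathcal{Y}'$ is a simple transitive $\mathcal{C}$-module category of type $D_\infty$.
   Context: Everything is over $\mathbb{C}$; $\mathfrak{sl}_2$ has standard basis $e,f,h$. $\mathcal{C}$ is the monoidal category (under $\otimes_{\mathbb{C}}$) of finite dimensional $\mathfrak{sl}_2$-modules; for $m\in\mathbb{Z}_{\ge 0}$, $L(m)$ is the simple module of dimension $m+1$. The additive closure of a set of modules is the full subcategory of modules isomorphic to direct summands of finite direct sums of them. Let $\{v_i: i\in\{0,\pm2,\pm4\}\}$ be the basis of $L(4)$ with $h\cdot v_i=iv_i$, $e\cdot v_4=0$ and $e\cdot v_{4-2i}=(5-i)v_{6-2i}$ for $i=1,2,3,4$. The following elements are central in $U(\mathfrak{g})$: $C_2=v_0^2-3v_{-2}v_2+12v_{-4}v_4$ and $C_3=v_0^3-\frac92 v_{-2}v_0v_2+\frac{27}{2}v_{-2}^2v_4+\frac{27}{2}v_{-4}v_2^2-36v_{-4}v_0v_4$.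 For $\mu\in\mathbb{C}\setminus\{0\}$, the modules $V'(0,\mu)$, $V'(2,\mu)$, $V(n,\mu)$ ($n\geq1$) are the simple $\mathfrak{g}$-modules on which $C_2$ and $C_3$ act as $\mu^2$ and $\mu^3$, respectively, and whose restriction to $\mathfrak{sl}_2$ is a direct sum of simple finite dimensional modules with finite multiplicities; they are distinguished by their restrictions to $\mathfrak{sl}_2$: $V'(0,\mu)\cong L(0)\oplus L(4)\oplus L(8)\oplus\cdots$, $V'(2,\mu)\cong L(2)\oplus L(6)\oplus L(10)\oplus\cdots$, $V(n,\mu)\cong L(n)\oplus L(n+2)\oplus L(n+4)\oplus\cdots$. A $\mathcal{C}$-module category $\mathcal{M}$ is locally finitary if it is $\mathbb{C}$-linear, additive, idempotent split, Krull-Schmidt, has at most countably many indecomposable objects up to isomorphism, and has finite dimensional hom-spaces. It is simple transitive if it has no non-trivial $\mathcal{C}$-invariant ideals (ideals other than $0$ and $\mathcal{M}$). A locally finitary $\mathcal{C}$-module category is of type $D_\infty$ if its indecomposables, up to isomorphism, can be listed without repetition as $Y_0,Y_1,Y_2,\dots$ so that $L(1)\cdot Y_0\cong L(1)\cdot Y_1\cong Y_2$, $L(1)\cdot Y_2\cong Y_0\oplus Y_1\oplus Y_3$, and $L(1)\cdot Y_i\cong Y_{i-1}\oplus Y_{i+1}$ for $i\geq 3$. *)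

theory Defs
  imports
    "HOL-Analysis.Analysis"
    "HOL-Library.Poly_Mapping"
    "HOL-Library.Function_Algebras"
    "HOL-Library.Nat_Bijection"
begin

section \<open>Complex-linear categories\<close>

text \<open>
  All hom-spaces of a category are subspaces of one ambient complex vector space (the type
  \<open>'m\<close> with scalar multiplication \<open>Scl\<close>); hom-spaces of different pairs of objects may overlap.
  Composition is written in the usual order, \<open>g \<cdot> f\<close> being \<open>g\<close> after \<open>f\<close>.
\<close>

record ('o, 'm) lin_cat =
  Obj :: "'o set"
  Hom :: "'o \<Rightarrow> 'o \<Rightarrow> 'm set"
  Idn :: "'o \<Rightarrow> 'm"
  Cmp :: "'m \<Rightarrow> 'm \<Rightarrow> 'm" (infixl "\<cdot>\<index>" 70)
  Scl :: "complex \<Rightarrow> 'm \<Rightarrow> 'm"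

locale linear_category = vector_space "Scl C"
  for C :: "('o, 'm::ab_group_add, 'z) lin_cat_scheme" (structure) +
  assumes hom_subspace: "\<lbrakk>X \<in> Obj C; Y \<in> Obj C\<rbrakk> \<Longrightarrow> subspace (Hom C X Y)"
    and id_hom: "X \<in> Obj C \<Longrightarrow> Idn C X \<in> Hom C X X"
    and comp_hom: "\<lbrakk>X \<in> Obj C; Y \<in> Obj C; Z \<in> Obj C; f \<in> Hom C X Y; g \<in> Hom C Y Z\<rbrakk>
      \<Longrightarrow> g \<cdot> f \<in> Hom C X Z"
    and comp_id_right: "\<lbrakk>X \<in> Obj C; Y \<in> Obj C; f \<in> Hom C X Y\<rbrakk> \<Longrightarrow> f \<cdot> Idn C X = f"
    and comp_id_left: "\<lbrakk>X \<in> Obj C; Y \<in> Obj C; f \<in> Hom C X Y\<rbrakk> \<Longrightarrow> Idn C Y \<cdot> f = f"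
    and comp_assoc: "\<lbrakk>W \<in> Obj C; X \<in> Obj C; Y \<in> Obj C; Z \<in> Obj C;
        f \<in> Hom C W X; g \<in> Hom C X Y; h \<in> Hom C Y Z\<rbrakk>
      \<Longrightarrow> h \<cdot> (g \<cdot> f) = (h \<cdot> g) \<cdot> f"
    and comp_add_right: "\<lbrakk>X \<in> Obj C; Y \<in> Obj C; Z \<in> Obj C;
        f \<in> Hom C X Y; f' \<in> Hom C X Y; g \<in> Hom C Y Z\<rbrakk>
      \<Longrightarrow> g \<cdot> (f + f') = g \<cdot> f + g \<cdot> f'"
    and comp_add_left: "\<lbrakk>X \<in> Obj C; Y \<in> Obj C; Z \<in> Obj C;
        f \<in> Hom C X Y; g \<in> Hom C Y Z; g' \<in> Hom C Y Z\<rbrakk>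
      \<Longrightarrow> (g + g') \<cdot> f = g \<cdot> f + g' \<cdot> f"
    and comp_scale_right: "\<lbrakk>X \<in> Obj C; Y \<in> Obj C; Z \<in> Obj C; f \<in> Hom C X Y; g \<in> Hom C Y Z\<rbrakk>
      \<Longrightarrow> g \<cdot> Scl C c f = Scl C c (g \<cdot> f)"
    and comp_scale_left: "\<lbrakk>X \<in> Obj C; Y \<in> Obj C; Z \<in> Obj C; f \<in> Hom C X Y; g \<in> Hom C Y Z\<rbrakk>
      \<Longrightarrow> Scl C c g \<cdot> f = Scl C c (g \<cdot> f)"

definition iso_in :: "('o, 'm, 'z) lin_cat_scheme \<Rightarrow> 'o \<Rightarrow> 'o \<Rightarrow> 'm \<Rightarrow> bool" where
  "iso_in C X Y f \<longleftrightarrow> f \<in> Hom C X Y \<and>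
     (\<exists>g \<in> Hom C Y X. g \<cdot>\<^bsub>C\<^esub> f = Idn C X \<and> f \<cdot>\<^bsub>C\<^esub> g = Idn C Y)"

definition isomorphic :: "('o, 'm, 'z) lin_cat_scheme \<Rightarrow> 'o \<Rightarrow> 'o \<Rightarrow> bool" where
  "isomorphic C X Y \<longleftrightarrow> (\<exists>f. iso_in C X Y f)"

text \<open>\<open>Z\<close> is a finite direct sum (biproduct) of the listed objects; the empty list gives zero objects.\<close>

definition direct_sum_in ::
  "('o, 'm::ab_group_add, 'z) lin_cat_scheme \<Rightarrow> 'o list \<Rightarrow> 'o \<Rightarrow> bool" where
  "direct_sum_in C Xs Z \<longleftrightarrow> Z \<in> Obj C \<and> set Xs \<subseteq> Obj C \<and>
     (\<exists>i p. (\<forall>k < length Xs. i k \<in> Hom C (Xs ! k) Z \<and> p k \<in> Hom C Z (Xs ! k)) \<and>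
        (\<forall>k < length Xs. \<forall>l < length Xs.
           p k \<cdot>\<^bsub>C\<^esub> i l = (if k = l then Idn C (Xs ! k) else 0)) \<and>
        (\<Sum>k < length Xs. i k \<cdot>\<^bsub>C\<^esub> p k) = Idn C Z)"

definition additive_category :: "('o, 'm::ab_group_add, 'z) lin_cat_scheme \<Rightarrow> bool" where
  "additive_category C \<longleftrightarrow> (\<forall>Xs. set Xs \<subseteq> Obj C \<longrightarrow> (\<exists>Z. direct_sum_in C Xs Z))"

definition zero_object :: "('o, 'm::ab_group_add, 'z) lin_cat_scheme \<Rightarrow> 'o \<Rightarrow> bool" where
  "zero_object C X \<longleftrightarrow> X \<in> Obj C \<and> Idn C X = 0"

definition indecomposable :: "('o, 'm::ab_group_add, 'z) lin_cat_scheme \<Rightarrow> 'o \<Rightarrow> bool" where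
  "indecomposable C X \<longleftrightarrow> X \<in> Obj C \<and> \<not> zero_object C X \<and>
     (\<forall>A B. direct_sum_in C [A, B] X \<longrightarrow> zero_object C A \<or> zero_object C B)"

definition idempotent_split :: "('o, 'm, 'z) lin_cat_scheme \<Rightarrow> bool" where
  "idempotent_split C \<longleftrightarrow> (\<forall>X \<in> Obj C. \<forall>e \<in> Hom C X X. e \<cdot>\<^bsub>C\<^esub> e = e \<longrightarrow>
     (\<exists>Y \<in> Obj C. \<exists>r \<in> Hom C X Y. \<exists>s \<in> Hom C Y X.
        r \<cdot>\<^bsub>C\<^esub> s = Idn C Y \<and> s \<cdot>\<^bsub>C\<^esub> r = e))"

definition local_endomorphism_ring :: "('o, 'm::ab_group_add, 'z) lin_cat_scheme \<Rightarrow> 'o \<Rightarrow> bool" where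
  "local_endomorphism_ring C X \<longleftrightarrow> Idn C X \<noteq> 0 \<and>
     (\<forall>f \<in> Hom C X X. iso_in C X X f \<or> iso_in C X X (Idn C X - f))"

definition krull_schmidt :: "('o, 'm::ab_group_add, 'z) lin_cat_scheme \<Rightarrow> bool" where
  "krull_schmidt C \<longleftrightarrow> (\<forall>X \<in> Obj C. \<exists>Xs. direct_sum_in C Xs X \<and>
     (\<forall>A \<in> set Xs. local_endomorphism_ring C A))"

definition countably_many_indecomposables :: "('o, 'm::ab_group_add, 'z) lin_cat_scheme \<Rightarrow> bool" where
  "countably_many_indecomposables C \<longleftrightarrow>
     (\<exists>S \<subseteq> Obj C. countable S \<and> (\<forall>X. indecomposable C X \<longrightarrow> (\<exists>Y \<in> S. isomorphic C X Y)))"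

definition finite_dimensional_homs :: "('o, 'm::ab_group_add, 'z) lin_cat_scheme \<Rightarrow> bool" where
  "finite_dimensional_homs C \<longleftrightarrow>
     (\<forall>X \<in> Obj C. \<forall>Y \<in> Obj C. \<exists>B. finite B \<and> module.span (Scl C) B = Hom C X Y)"

definition locally_finitary :: "('o, 'm::ab_group_add, 'z) lin_cat_scheme \<Rightarrow> bool" where
  "locally_finitary C \<longleftrightarrow> linear_category C \<and> additive_category C \<and> idempotent_split C \<and> krull_schmidt C \<and>
     countably_many_indecomposables C \<and> finite_dimensional_homs C"

definition full_subcategory ::
  "('o, 'm, 'z) lin_cat_scheme \<Rightarrow> 'o set \<Rightarrow> ('o, 'm, 'z) lin_cat_scheme" where
  "full_subcategory C S = C\<lparr>Obj := S\<rparr>"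

definition additive_closure ::
  "('o, 'm::ab_group_add, 'z) lin_cat_scheme \<Rightarrow> 'o set \<Rightarrow> ('o, 'm, 'z) lin_cat_scheme" where
  "additive_closure C S = full_subcategory C
     {X \<in> Obj C. \<exists>Vs X' Z. set Vs \<subseteq> S \<and> direct_sum_in C Vs Z \<and> direct_sum_in C [X, X'] Z}"


section \<open>Monoidal categories and module categories\<close>

record ('o, 'm) mon_cat = "('o, 'm) lin_cat" +
  Ten :: "'o \<Rightarrow> 'o \<Rightarrow> 'o"
  TenM :: "'m \<Rightarrow> 'm \<Rightarrow> 'm"
  Unit :: 'o
  Assoc :: "'o \<Rightarrow> 'o \<Rightarrow> 'o \<Rightarrow> 'm"  \<comment> \<open>\<open>(F \<otimes> G) \<otimes> H \<rightarrow> F \<otimes> (G \<otimes> H)\<close>\<close>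
  LUnit :: "'o \<Rightarrow> 'm"
  RUnit :: "'o \<Rightarrow> 'm"

locale monoidal_category = linear_category C
  for C :: "('o, 'm::ab_group_add, 'z) mon_cat_scheme" (structure) +
  assumes unit_obj: "Unit C \<in> Obj C"
    and ten_obj: "\<lbrakk>F \<in> Obj C; G \<in> Obj C\<rbrakk> \<Longrightarrow> Ten C F G \<in> Obj C"
    and ten_hom: "\<lbrakk>F \<in> Obj C; F' \<in> Obj C; G \<in> Obj C; G' \<in> Obj C; a \<in> Hom C F F'; b \<in> Hom C G G'\<rbrakk>
      \<Longrightarrow> TenM C a b \<in> Hom C (Ten C F G) (Ten C F' G')"
    and ten_id: "\<lbrakk>F \<in> Obj C; G \<in> Obj C\<rbrakk> \<Longrightarrow> TenM C (Idn C F) (Idn C G) = Idn C (Ten C F G)"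
    and ten_comp: "\<lbrakk>F \<in> Obj C; F' \<in> Obj C; F'' \<in> Obj C; G \<in> Obj C; G' \<in> Obj C; G'' \<in> Obj C;
        a \<in> Hom C F F'; a' \<in> Hom C F' F''; b \<in> Hom C G G'; b' \<in> Hom C G' G''\<rbrakk>
      \<Longrightarrow> TenM C (a' \<cdot> a) (b' \<cdot> b) = TenM C a' b' \<cdot> TenM C a b"
    and ten_add_left: "\<lbrakk>F \<in> Obj C; F' \<in> Obj C; G \<in> Obj C; G' \<in> Obj C;
        a \<in> Hom C F F'; a' \<in> Hom C F F'; b \<in> Hom C G G'\<rbrakk>
      \<Longrightarrow> TenM C (a + a') b = TenM C a b + TenM C a' b"
    and ten_add_right: "\<lbrakk>F \<in> Obj C; F' \<in> Obj C; G \<in> Obj C; G' \<in> Obj C;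
        a \<in> Hom C F F'; b \<in> Hom C G G'; b' \<in> Hom C G G'\<rbrakk>
      \<Longrightarrow> TenM C a (b + b') = TenM C a b + TenM C a b'"
    and ten_scale_left: "\<lbrakk>F \<in> Obj C; F' \<in> Obj C; G \<in> Obj C; G' \<in> Obj C;
        a \<in> Hom C F F'; b \<in> Hom C G G'\<rbrakk>
      \<Longrightarrow> TenM C (Scl C c a) b = Scl C c (TenM C a b)"
    and ten_scale_right: "\<lbrakk>F \<in> Obj C; F' \<in> Obj C; G \<in> Obj C; G' \<in> Obj C;
        a \<in> Hom C F F'; b \<in> Hom C G G'\<rbrakk>
      \<Longrightarrow> TenM C a (Scl C c b) = Scl C c (TenM C a b)"
    and assoc_iso: "\<lbrakk>F \<in> Obj C; G \<in> Obj C; H \<in> Obj C\<rbrakk>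
      \<Longrightarrow> iso_in C (Ten C (Ten C F G) H) (Ten C F (Ten C G H)) (Assoc C F G H)"
    and assoc_natural: "\<lbrakk>F \<in> Obj C; F' \<in> Obj C; G \<in> Obj C; G' \<in> Obj C; H \<in> Obj C; H' \<in> Obj C;
        a \<in> Hom C F F'; b \<in> Hom C G G'; d \<in> Hom C H H'\<rbrakk>
      \<Longrightarrow> Assoc C F' G' H' \<cdot> TenM C (TenM C a b) d = TenM C a (TenM C b d) \<cdot> Assoc C F G H"
    and lunit_iso: "F \<in> Obj C \<Longrightarrow> iso_in C (Ten C (Unit C) F) F (LUnit C F)"
    and lunit_natural: "\<lbrakk>F \<in> Obj C; F' \<in> Obj C; a \<in> Hom C F F'\<rbrakk>
      \<Longrightarrow> LUnit C F' \<cdot> TenM C (Idn C (Unit C)) a = a \<cdot> LUnit C F"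
    and runit_iso: "F \<in> Obj C \<Longrightarrow> iso_in C (Ten C F (Unit C)) F (RUnit C F)"
    and runit_natural: "\<lbrakk>F \<in> Obj C; F' \<in> Obj C; a \<in> Hom C F F'\<rbrakk>
      \<Longrightarrow> RUnit C F' \<cdot> TenM C a (Idn C (Unit C)) = a \<cdot> RUnit C F"
    and pentagon: "\<lbrakk>F \<in> Obj C; G \<in> Obj C; H \<in> Obj C; K \<in> Obj C\<rbrakk>
      \<Longrightarrow> Assoc C F G (Ten C H K) \<cdot> Assoc C (Ten C F G) H K =
          TenM C (Idn C F) (Assoc C G H K) \<cdot> Assoc C F (Ten C G H) K
            \<cdot> TenM C (Assoc C F G H) (Idn C K)"
    and triangle: "\<lbrakk>F \<in> Obj C; G \<in> Obj C\<rbrakk>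
      \<Longrightarrow> TenM C (Idn C F) (LUnit C G) \<cdot> Assoc C F (Unit C) G = TenM C (RUnit C F) (Idn C G)"

record ('c, 'n, 'o, 'm) mod_cat = "('o, 'm) lin_cat" +
  Act :: "'c \<Rightarrow> 'o \<Rightarrow> 'o"
  ActM :: "'n \<Rightarrow> 'm \<Rightarrow> 'm"
  ActAssoc :: "'c \<Rightarrow> 'c \<Rightarrow> 'o \<Rightarrow> 'm"  \<comment> \<open>\<open>(F \<otimes> G) \<cdot> X \<rightarrow> F \<cdot> (G \<cdot> X)\<close>\<close>
  ActUnit :: "'o \<Rightarrow> 'm"

locale module_category = C: monoidal_category C + M: linear_category M
  for C :: "('c, 'n::ab_group_add, 'z) mon_cat_scheme"
  and M :: "('c, 'n, 'o, 'm::ab_group_add, 'y) mod_cat_scheme" +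
  assumes act_obj: "\<lbrakk>F \<in> Obj C; X \<in> Obj M\<rbrakk> \<Longrightarrow> Act M F X \<in> Obj M"
    and act_hom: "\<lbrakk>F \<in> Obj C; F' \<in> Obj C; X \<in> Obj M; X' \<in> Obj M; a \<in> Hom C F F'; f \<in> Hom M X X'\<rbrakk>
      \<Longrightarrow> ActM M a f \<in> Hom M (Act M F X) (Act M F' X')"
    and act_id: "\<lbrakk>F \<in> Obj C; X \<in> Obj M\<rbrakk> \<Longrightarrow> ActM M (Idn C F) (Idn M X) = Idn M (Act M F X)"
    and act_comp: "\<lbrakk>F \<in> Obj C; F' \<in> Obj C; F'' \<in> Obj C; X \<in> Obj M; X' \<in> Obj M; X'' \<in> Obj M;
        a \<in> Hom C F F'; a' \<in> Hom C F' F''; f \<in> Hom M X X'; f' \<in> Hom M X' X''\<rbrakk>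
      \<Longrightarrow> ActM M (a' \<cdot>\<^bsub>C\<^esub> a) (f' \<cdot>\<^bsub>M\<^esub> f) = ActM M a' f' \<cdot>\<^bsub>M\<^esub> ActM M a f"
    and act_add_left: "\<lbrakk>F \<in> Obj C; F' \<in> Obj C; X \<in> Obj M; X' \<in> Obj M;
        a \<in> Hom C F F'; a' \<in> Hom C F F'; f \<in> Hom M X X'\<rbrakk>
      \<Longrightarrow> ActM M (a + a') f = ActM M a f + ActM M a' f"
    and act_add_right: "\<lbrakk>F \<in> Obj C; F' \<in> Obj C; X \<in> Obj M; X' \<in> Obj M;
        a \<in> Hom C F F'; f \<in> Hom M X X'; f' \<in> Hom M X X'\<rbrakk>
      \<Longrightarrow> ActM M a (f + f') = ActM M a f + ActM M a f'"
    and act_scale_left: "\<lbrakk>F \<in> Obj C; F' \<in> Obj C; X \<in> Obj M; X' \<in> Obj M;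
        a \<in> Hom C F F'; f \<in> Hom M X X'\<rbrakk>
      \<Longrightarrow> ActM M (Scl C c a) f = Scl M c (ActM M a f)"
    and act_scale_right: "\<lbrakk>F \<in> Obj C; F' \<in> Obj C; X \<in> Obj M; X' \<in> Obj M;
        a \<in> Hom C F F'; f \<in> Hom M X X'\<rbrakk>
      \<Longrightarrow> ActM M a (Scl M c f) = Scl M c (ActM M a f)"
    and act_assoc_iso: "\<lbrakk>F \<in> Obj C; G \<in> Obj C; X \<in> Obj M\<rbrakk>
      \<Longrightarrow> iso_in M (Act M (Ten C F G) X) (Act M F (Act M G X)) (ActAssoc M F G X)"
    and act_assoc_natural: "\<lbrakk>F \<in> Obj C; F' \<in> Obj C; G \<in> Obj C; G' \<in> Obj C; X \<in> Obj M; X' \<in> Obj M;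
        a \<in> Hom C F F'; b \<in> Hom C G G'; f \<in> Hom M X X'\<rbrakk>
      \<Longrightarrow> ActAssoc M F' G' X' \<cdot>\<^bsub>M\<^esub> ActM M (TenM C a b) f =
          ActM M a (ActM M b f) \<cdot>\<^bsub>M\<^esub> ActAssoc M F G X"
    and act_unit_iso: "X \<in> Obj M \<Longrightarrow> iso_in M (Act M (Unit C) X) X (ActUnit M X)"
    and act_unit_natural: "\<lbrakk>X \<in> Obj M; X' \<in> Obj M; f \<in> Hom M X X'\<rbrakk>
      \<Longrightarrow> ActUnit M X' \<cdot>\<^bsub>M\<^esub> ActM M (Idn C (Unit C)) f = f \<cdot>\<^bsub>M\<^esub> ActUnit M X"
    and act_pentagon: "\<lbrakk>F \<in> Obj C; G \<in> Obj C; H \<in> Obj C; X \<in> Obj M\<rbrakk>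
      \<Longrightarrow> ActAssoc M F G (Act M H X) \<cdot>\<^bsub>M\<^esub> ActAssoc M (Ten C F G) H X =
          ActM M (Idn C F) (ActAssoc M G H X) \<cdot>\<^bsub>M\<^esub> ActAssoc M F (Ten C G H) X
            \<cdot>\<^bsub>M\<^esub> ActM M (Assoc C F G H) (Idn M X)"
    and act_triangle: "\<lbrakk>F \<in> Obj C; X \<in> Obj M\<rbrakk>
      \<Longrightarrow> ActM M (Idn C F) (ActUnit M X) \<cdot>\<^bsub>M\<^esub> ActAssoc M F (Unit C) X =
          ActM M (RUnit C F) (Idn M X)"

definition locally_finitary_module_category ::
  "('c, 'n::ab_group_add, 'z) mon_cat_scheme \<Rightarrow>
   ('c, 'n, 'o, 'm::ab_group_add, 'y) mod_cat_scheme \<Rightarrow> bool" where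
  "locally_finitary_module_category C M \<longleftrightarrow> module_category C M \<and> locally_finitary M"

definition category_ideal ::
  "('o, 'm::ab_group_add, 'z) lin_cat_scheme \<Rightarrow> ('o \<Rightarrow> 'o \<Rightarrow> 'm set) \<Rightarrow> bool" where
  "category_ideal M I \<longleftrightarrow>
     (\<forall>X \<in> Obj M. \<forall>Y \<in> Obj M. I X Y \<subseteq> Hom M X Y \<and> module.subspace (Scl M) (I X Y)) \<and>
     (\<forall>X \<in> Obj M. \<forall>Y \<in> Obj M. \<forall>Z \<in> Obj M. \<forall>f \<in> I X Y. \<forall>g \<in> Hom M Y Z. g \<cdot>\<^bsub>M\<^esub> f \<in> I X Z) \<and>
     (\<forall>X \<in> Obj M. \<forall>Y \<in> Obj M. \<forall>Z \<in> Obj M. \<forall>f \<in> Hom M X Y. \<forall>g \<in> I Y Z. g \<cdot>\<^bsub>M\<^esub> f \<in> I X Z)"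

definition invariant_ideal ::
  "('c, 'n, 'z) mon_cat_scheme \<Rightarrow> ('c, 'n, 'o, 'm::ab_group_add, 'y) mod_cat_scheme \<Rightarrow>
   ('o \<Rightarrow> 'o \<Rightarrow> 'm set) \<Rightarrow> bool" where
  "invariant_ideal C M I \<longleftrightarrow> category_ideal M I \<and>
     (\<forall>F \<in> Obj C. \<forall>X \<in> Obj M. \<forall>Y \<in> Obj M. \<forall>f \<in> I X Y.
        ActM M (Idn C F) f \<in> I (Act M F X) (Act M F Y))"

definition simple_transitive ::
  "('c, 'n, 'z) mon_cat_scheme \<Rightarrow> ('c, 'n, 'o, 'm::ab_group_add, 'y) mod_cat_scheme \<Rightarrow> bool" where
  "simple_transitive C M \<longleftrightarrow> (\<forall>I. invariant_ideal C M I \<longrightarrow>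
     (\<forall>X \<in> Obj M. \<forall>Y \<in> Obj M. I X Y = {0}) \<or>
     (\<forall>X \<in> Obj M. \<forall>Y \<in> Obj M. I X Y = Hom M X Y))"

text \<open>The shape of the action of one object \<open>L\<close> (to be \<open>L(1)\<close>) on the indecomposables of \<open>M\<close>.\<close>

definition type_D_infinity :: "'c \<Rightarrow> ('c, 'n, 'o, 'm::ab_group_add, 'y) mod_cat_scheme \<Rightarrow> bool" where
  "type_D_infinity L M \<longleftrightarrow> (\<exists>Y :: nat \<Rightarrow> 'o.
     (\<forall>i. indecomposable M (Y i)) \<and>
     (\<forall>X. indecomposable M X \<longrightarrow> (\<exists>i. isomorphic M X (Y i))) \<and>
     (\<forall>i j. i \<noteq> j \<longrightarrow> \<not> isomorphic M (Y i) (Y j)) \<and>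
     isomorphic M (Act M L (Y 0)) (Y 2) \<and>
     isomorphic M (Act M L (Y 1)) (Y 2) \<and>
     direct_sum_in M [Y 0, Y 1, Y 3] (Act M L (Y 2)) \<and>
     (\<forall>i \<ge> 3. direct_sum_in M [Y (i - 1), Y (i + 1)] (Act M L (Y i))))"


section \<open>Based vector spaces\<close>

text \<open>
  The universe of vectors consists of the finitely supported functions \<open>nat \<Rightarrow> complex\<close>.
  A vector space is \<open>space_on I\<close>, the space with standard basis indexed by \<open>I \<subseteq> nat\<close>; up to
  isomorphism these are exactly the complex vector spaces of at most countable dimension.  Linear maps
  from \<open>space_on I\<close> to \<open>space_on J\<close> are represented by their extensions by zero on the basis
  vectors outside \<open>I\<close>, so that equality of representatives is equality of maps.
\<close>

type_synonym cvec = "nat \<Rightarrow>\<^sub>0 complex"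

definition scl :: "complex \<Rightarrow> cvec \<Rightarrow> cvec" where
  "scl c v = Poly_Mapping.map (\<lambda>z. c * z) v"

lemma lookup_scl [simp]: "Poly_Mapping.lookup (scl c v) k = c * Poly_Mapping.lookup v k"
  unfolding scl_def by transfer (simp add: when_def)

global_interpretation cvec: vector_space scl
  by unfold_locales
    (auto intro!: poly_mapping_eqI simp: lookup_add algebra_simps)

definition bas :: "nat \<Rightarrow> cvec" where
  "bas k = Poly_Mapping.single k 1"

definition space_on :: "nat set \<Rightarrow> cvec set" where
  "space_on I = {v. Poly_Mapping.keys v \<subseteq> I}"

definition lin_ext :: "(nat \<Rightarrow> cvec) \<Rightarrow> cvec \<Rightarrow> cvec" where
  "lin_ext b v = (\<Sum>k \<in> Poly_Mapping.keys v. scl (Poly_Mapping.lookup v k) (b k))"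

definition lin_maps :: "nat set \<Rightarrow> nat set \<Rightarrow> (cvec \<Rightarrow> cvec) set" where
  "lin_maps I J = {f. Vector_Spaces.linear scl scl f \<and> range f \<subseteq> space_on J \<and>
     (\<forall>k. k \<notin> I \<longrightarrow> f (bas k) = 0)}"

definition id_on :: "nat set \<Rightarrow> cvec \<Rightarrow> cvec" where
  "id_on I = lin_ext (\<lambda>k. if k \<in> I then bas k else 0)"

text \<open>
  The tensor product of \<open>space_on I\<close> and \<open>space_on J\<close> has the basis indexed by
  \<open>prod_encode ` (I \<times> J)\<close>.
\<close>

definition tens :: "cvec \<Rightarrow> cvec \<Rightarrow> cvec" where
  "tens v w = (\<Sum>i \<in> Poly_Mapping.keys v. \<Sum>j \<in> Poly_Mapping.keys w.
     scl (Poly_Mapping.lookup v i * Poly_Mapping.lookup w j) (bas (prod_encode (i, j))))"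

definition tens_map :: "(cvec \<Rightarrow> cvec) \<Rightarrow> (cvec \<Rightarrow> cvec) \<Rightarrow> cvec \<Rightarrow> cvec" where
  "tens_map f g = lin_ext (\<lambda>k. case prod_decode k of (i, j) \<Rightarrow> tens (f (bas i)) (g (bas j)))"

definition reindex :: "nat set \<Rightarrow> (nat \<Rightarrow> nat) \<Rightarrow> cvec \<Rightarrow> cvec" where
  "reindex I s = lin_ext (\<lambda>k. if k \<in> I then bas (s k) else 0)"

definition prod_reassoc :: "nat \<Rightarrow> nat" where
  "prod_reassoc n = (case prod_decode n of (p, k) \<Rightarrow>
     case prod_decode p of (i, j) \<Rightarrow> prod_encode (i, prod_encode (j, k)))"


section \<open>Lie algebras and their modules\<close>

record 'g lie_alg =
  lcarrier :: "'g set"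
  lscale :: "complex \<Rightarrow> 'g \<Rightarrow> 'g"
  lbracket :: "'g \<Rightarrow> 'g \<Rightarrow> 'g"

record 'g lie_mod =
  idx :: "nat set"
  act :: "'g \<Rightarrow> cvec \<Rightarrow> cvec"

definition lie_module :: "'g::ab_group_add lie_alg \<Rightarrow> 'g lie_mod \<Rightarrow> bool" where
  "lie_module \<gg> M \<longleftrightarrow>
     (\<forall>x \<in> lcarrier \<gg>. act M x \<in> lin_maps (idx M) (idx M)) \<and>
     (\<forall>x \<in> lcarrier \<gg>. \<forall>y \<in> lcarrier \<gg>. act M (x + y) = act M x + act M y) \<and>
     (\<forall>c. \<forall>x \<in> lcarrier \<gg>. \<forall>v. act M (lscale \<gg> c x) v = scl c (act M x v)) \<and>
     (\<forall>x \<in> lcarrier \<gg>. \<forall>y \<in> lcarrier \<gg>. \<forall>v.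
        act M (lbracket \<gg> x y) v = act M x (act M y v) - act M y (act M x v))"

definition module_homs :: "'g lie_alg \<Rightarrow> 'g lie_mod \<Rightarrow> 'g lie_mod \<Rightarrow> (cvec \<Rightarrow> cvec) set" where
  "module_homs \<gg> M N = {f \<in> lin_maps (idx M) (idx N).
     \<forall>x \<in> lcarrier \<gg>. \<forall>v. f (act M x v) = act N x (f v)}"

definition simple_module :: "'g::ab_group_add lie_alg \<Rightarrow> 'g lie_mod \<Rightarrow> bool" where
  "simple_module \<gg> M \<longleftrightarrow> lie_module \<gg> M \<and> idx M \<noteq> {} \<and>
     (\<forall>S. cvec.subspace S \<and> S \<subseteq> space_on (idx M) \<and> (\<forall>x \<in> lcarrier \<gg>. act M x ` S \<subseteq> S)
        \<longrightarrow> S = {0} \<or> S = space_on (idx M))"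

definition tens_module :: "'g lie_mod \<Rightarrow> 'g lie_mod \<Rightarrow> 'g lie_mod" where
  "tens_module M N = \<lparr>idx = prod_encode ` (idx M \<times> idx N),
     act = (\<lambda>x. tens_map (act M x) (id_on (idx N)) + tens_map (id_on (idx M)) (act N x))\<rparr>"

text \<open>The direct sum of a sequence of modules; the pair \<open>(j, i)\<close> indexes the \<open>i\<close>-th basis vector
  of the \<open>j\<close>-th summand.\<close>

definition infinite_direct_sum :: "(nat \<Rightarrow> 'g lie_mod) \<Rightarrow> 'g lie_mod" where
  "infinite_direct_sum N = \<lparr>idx = prod_encode ` (SIGMA j:UNIV. idx (N j)),
     act = (\<lambda>x. lin_ext (\<lambda>k. case prod_decode k of (j, i) \<Rightarrow>
       tens (bas j) (act (N j) x (bas i))))\<rparr>"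

definition pullback :: "('g \<Rightarrow> 'h) \<Rightarrow> 'h lie_mod \<Rightarrow> 'g lie_mod" where
  "pullback \<phi> M = \<lparr>idx = idx M, act = (\<lambda>x. act M (\<phi> x))\<rparr>"

definition module_cat :: "'g::ab_group_add lie_alg \<Rightarrow> ('g lie_mod, cvec \<Rightarrow> cvec) lin_cat" where
  "module_cat \<gg> = \<lparr>Obj = {M. lie_module \<gg> M}, Hom = module_homs \<gg>,
     Idn = (\<lambda>M. id_on (idx M)), Cmp = (\<circ>), Scl = (\<lambda>c f v. scl c (f v))\<rparr>"


section \<open>The Lie algebras \<open>sl\<^sub>2\<close> and \<open>sl\<^sub>2 \<ltimes> L(4)\<close>\<close>

type_synonym mat2 = "complex^2^2"

definition sl2 :: "mat2 lie_alg" where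
  "sl2 = \<lparr>lcarrier = {A. trace A = 0}, lscale = (\<lambda>c. map_matrix (\<lambda>z. c * z)),
     lbracket = (\<lambda>A B. A ** B - B ** A)\<rparr>"

text \<open>
  \<open>L m\<close> is the simple module of dimension \<open>m + 1\<close>, with basis \<open>w\<^sub>0, \<dots>, w\<^sub>m\<close> satisfying
  \<open>h w\<^sub>i = (m - 2i) w\<^sub>i\<close>, \<open>e w\<^sub>i = (m + 1 - i) w\<^sub>i\<^sub>-\<^sub>1\<close> and \<open>f w\<^sub>i = (i + 1) w\<^sub>i\<^sub>+\<^sub>1\<close>.  The matrix \<open>x\<close> is
  \<open>(x $ 1 $ 1) h + (x $ 1 $ 2) e + (x $ 2 $ 1) f\<close>.
\<close>

definition L :: "nat \<Rightarrow> mat2 lie_mod" where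
  "L m = \<lparr>idx = {..m}, act = (\<lambda>x. lin_ext (\<lambda>i. if i \<le> m then
       scl (x $ 1 $ 1 * (of_nat m - 2 * of_nat i)) (bas i)
       + (if i = 0 then 0 else scl (x $ 1 $ 2 * of_nat (m + 1 - i)) (bas (i - 1)))
       + (if i = m then 0 else scl (x $ 2 $ 1 * of_nat (i + 1)) (bas (i + 1)))
     else 0))\<rparr>"

text \<open>The vector \<open>v\<^sub>j\<close> of \<open>L(4)\<close>, for \<open>j \<in> {0, \<plusminus>2, \<plusminus>4}\<close>; thus \<open>v\<^sub>4\<^sub>-\<^sub>2\<^sub>i\<close> is \<open>w\<^sub>i\<close>.\<close>

definition v4 :: "int \<Rightarrow> cvec" where
  "v4 j = bas (nat ((4 - j) div 2))"

definition semidirect :: "'g lie_alg \<Rightarrow> 'g lie_mod \<Rightarrow> ('g \<times> cvec) lie_alg" where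
  "semidirect \<gg> N = \<lparr>lcarrier = lcarrier \<gg> \<times> space_on (idx N),
     lscale = (\<lambda>c (x, u). (lscale \<gg> c x, scl c u)),
     lbracket = (\<lambda>(x, u) (y, w). (lbracket \<gg> x y, act N x w - act N y u))\<rparr>"

type_synonym gelt = "mat2 \<times> cvec"

definition g_alg :: "gelt lie_alg" where
  "g_alg = semidirect sl2 (L 4)"

definition restrict_sl2 :: "gelt lie_mod \<Rightarrow> mat2 lie_mod" where
  "restrict_sl2 M = pullback (\<lambda>x. (x, 0)) M"

text \<open>The elements \<open>C\<^sub>2\<close> and \<open>C\<^sub>3\<close> of the enveloping algebra, as operators on a module.\<close>

definition C2_op :: "gelt lie_mod \<Rightarrow> cvec \<Rightarrow> cvec" where
  "C2_op M w = (let a = (\<lambda>j. act M (0, v4 j)) in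
     a 0 (a 0 w) - scl 3 (a (-2) (a 2 w)) + scl 12 (a (-4) (a 4 w)))"

definition C3_op :: "gelt lie_mod \<Rightarrow> cvec \<Rightarrow> cvec" where
  "C3_op M w = (let a = (\<lambda>j. act M (0, v4 j)) in
     a 0 (a 0 (a 0 w)) - scl (9/2) (a (-2) (a 0 (a 2 w))) + scl (27/2) (a (-2) (a (-2) (a 4 w)))
     + scl (27/2) (a (-4) (a 2 (a 2 w))) - scl 36 (a (-4) (a 0 (a 4 w))))"

definition simple_with_restriction ::
  "complex \<Rightarrow> (nat \<Rightarrow> mat2 lie_mod) \<Rightarrow> gelt lie_mod \<Rightarrow> bool" where
  "simple_with_restriction \<mu> N M \<longleftrightarrow> simple_module g_alg M \<and>
     (\<forall>w \<in> space_on (idx M). C2_op M w = scl (\<mu>^2) w \<and> C3_op M w = scl (\<mu>^3) w) \<and>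
     isomorphic (module_cat sl2) (restrict_sl2 M) (infinite_direct_sum N)"

definition is_V'0 :: "complex \<Rightarrow> gelt lie_mod \<Rightarrow> bool" where
  "is_V'0 \<mu> = simple_with_restriction \<mu> (\<lambda>k. L (4 * k))"

definition is_V'2 :: "complex \<Rightarrow> gelt lie_mod \<Rightarrow> bool" where
  "is_V'2 \<mu> = simple_with_restriction \<mu> (\<lambda>k. L (4 * k + 2))"

definition is_V :: "nat \<Rightarrow> complex \<Rightarrow> gelt lie_mod \<Rightarrow> bool" where
  "is_V n \<mu> = simple_with_restriction \<mu> (\<lambda>k. L (n + 2 * k))"


section \<open>The monoidal category and its action on \<open>sl\<^sub>2 \<ltimes> L(4)\<close>-modules\<close>

definition fd_sl2_cat :: "(mat2 lie_mod, cvec \<Rightarrow> cvec) mon_cat" where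
  "fd_sl2_cat = \<lparr>Obj = {M. lie_module sl2 M \<and> finite (idx M)}, Hom = Hom (module_cat sl2),
     Idn = Idn (module_cat sl2), Cmp = Cmp (module_cat sl2), Scl = Scl (module_cat sl2),
     Ten = tens_module, TenM = tens_map, Unit = L 0,
     Assoc = (\<lambda>F G H. reindex (idx (tens_module (tens_module F G) H)) prod_reassoc),
     LUnit = (\<lambda>F. reindex (idx (tens_module (L 0) F)) (\<lambda>k. snd (prod_decode k))),
     RUnit = (\<lambda>F. reindex (idx (tens_module F (L 0))) (\<lambda>k. fst (prod_decode k)))\<rparr>"

definition act_on_g_module :: "mat2 lie_mod \<Rightarrow> gelt lie_mod \<Rightarrow> gelt lie_mod" where
  "act_on_g_module F X = tens_module (pullback fst F) X"

definition g_module_cat :: "(mat2 lie_mod, cvec \<Rightarrow> cvec, gelt lie_mod, cvec \<Rightarrow> cvec) mod_cat" where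
  "g_module_cat = \<lparr>Obj = Obj (module_cat g_alg), Hom = Hom (module_cat g_alg),
     Idn = Idn (module_cat g_alg), Cmp = Cmp (module_cat g_alg), Scl = Scl (module_cat g_alg),
     Act = act_on_g_module, ActM = tens_map,
     ActAssoc = (\<lambda>F G X. reindex (idx (act_on_g_module (tens_module F G) X)) prod_reassoc),
     ActUnit = (\<lambda>X. reindex (idx (act_on_g_module (L 0) X)) (\<lambda>k. snd (prod_decode k)))\<rparr>"

end

theory Submission
  imports Defs "HOL-Computational_Algebra.Polynomial"
begin

text \<open>
  On the modules \<open>V(n,\<mu>)\<close>, \<open>V'(0,\<mu>)\<close>, \<open>V'(2,\<mu>)\<close> the element \<open>v\<^sub>4\<close> acts injectively, and the values of \<open>C\<^sub>2\<close> and
  \<open>C\<^sub>3\<close> force the quartic with coefficients \<open>v\<^sub>j\<close> to be proportional to its Hessian, the leading coefficient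
  of which gives \<open>8 v\<^sub>4 v\<^sub>0 = 3 v\<^sub>2\<^sup>2 - 4 \<mu> v\<^sub>4\<close>. The highest weight vectors form a sequence \<open>u\<^sub>t\<close> of weights
  \<open>n + 2t\<close> with \<open>v\<^sub>4 u\<^sub>t = u\<^sub>t\<^sub>+\<^sub>2\<close> and \<open>4 v\<^sub>4 f u\<^sub>t = (n + 2t) v\<^sub>2 u\<^sub>t + 4 \<delta> u\<^sub>t\<^sub>+\<^sub>1\<close>, and these relations determine the
  module: the graph of a map prescribed on highest weight vectors generates a submodule of the direct sum.
  Since \<open>f\<^sup>n\<^sup>+\<^sup>1 u\<^sub>0 = 0\<close>, only the values \<open>\<delta> = (2N - n) \<sigma> / 2\<close> with \<open>\<sigma>\<^sup>2 = \<mu>\<close> are possible, and by comparison with the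
  modules of smaller lowest weight \<open>\<delta> = n \<sigma> / 2\<close>. In \<open>L(1) \<otimes> V(n,\<mu>)\<close> there are explicit sequences of highest weight
  vectors that satisfy the same relations for \<open>(n \<plusminus> 1, \<delta> \<plusminus> \<sigma> / 2)\<close>; the images of the corresponding
  homomorphisms span, which gives the graph \<open>D\<^sub>\<infinity>\<close>. As every finite dimensional \<open>sl\<^sub>2\<close>-module is a sum of
  modules \<open>L(m)\<close> and \<open>L(m + 1)\<close> is a summand of \<open>L(1) \<otimes> L(m)\<close>, the additive closure is stable under the action.
  Schur's lemma makes it locally finitary. A non-zero invariant ideal contains the identity of one of the
  simple modules, hence, the graph being connected, of all of them.
\<close>

text \<open>The modules are not constructed, only characterised, so every homomorphism has to be
  extracted from relations between highest weight vectors. Geometrically, the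
  \<open>v\<^sub>j\<close> are the coefficients of a binary quartic and \<open>C\<^sub>2\<close>,
  \<open>C\<^sub>3\<close> are its two invariants. The prescribed values make the discriminant
  vanish, so there is a multiple root; proportionality to the Hessian then singles out the squares
  of quadratic forms, here with non-zero discriminant. The stabiliser of such a square in SL(2) is
  the normaliser of a torus. Its irreducible representations are two characters and a sequence of
  two-dimensional ones, and tensoring them with L(1) gives the graph
  \<open>D\<^sub>\<infinity>\<close>. The scalar \<delta> records the torus weight n, scaled by a
  square root of \<mu>; its sign can be changed by rescaling every second highest weight vector. The
  obstacle that shapes the calculations is that \<open>v\<^sub>4\<close> is injective but cannot be
  inverted: relations are proved after multiplication by powers of \<open>v\<^sub>4\<close>, and
  submodules are saturated with respect to it.\<close>

abbreviation lin :: "(cvec \<Rightarrow> cvec) \<Rightarrow> bool" where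
  "lin \<equiv> Vector_Spaces.linear scl scl"

global_interpretation cp: vector_space_pair scl scl
  by unfold_locales

lemma linI:
  assumes "\<And>x y. f (x + y) = f x + f y" and "\<And>c x. f (scl c x) = scl c (f x)"
  shows "lin f"
  using assms by (simp add: Vector_Spaces.linear_iff cvec.vector_space_axioms)

lemma lin_add: "lin f \<Longrightarrow> f (x + y) = f x + f y"
  and lin_scl: "lin f \<Longrightarrow> f (scl c x) = scl c (f x)"
  and lin_0: "lin f \<Longrightarrow> f 0 = 0"
  and lin_diff: "lin f \<Longrightarrow> f (x - y) = f x - f y"
  and lin_neg: "lin f \<Longrightarrow> f (- x) = - f x"
  and lin_sum: "lin f \<Longrightarrow> f (sum g A) = (\<Sum>a\<in>A. f (g a))"
  by (auto simp: cp.linear_add cp.linear_scale cp.linear_0 cp.linear_diff cp.linear_neg cp.linear_sum)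

lemmas lin_simps = lin_add lin_scl lin_0 lin_diff lin_neg lin_sum

lemma lin_comp: "lin f \<Longrightarrow> lin g \<Longrightarrow> lin (f \<circ> g)"
  by (rule linI) (simp_all add: lin_simps)

lemma lin_comp': "lin f \<Longrightarrow> lin g \<Longrightarrow> lin (\<lambda>x. f (g x))"
  by (rule linI) (simp_all add: lin_simps)

lemma lin_plus: "lin f \<Longrightarrow> lin g \<Longrightarrow> lin (f + g)"
  by (rule linI) (simp_all add: lin_simps cvec.scale_right_distrib)

lemma lin_minus': "lin f \<Longrightarrow> lin g \<Longrightarrow> lin (\<lambda>x. f x - g x)"
  by (rule linI) (simp_all add: lin_simps cvec.scale_right_diff_distrib)

lemma lin_scl': "lin f \<Longrightarrow> lin (\<lambda>x. scl c (f x))"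
  by (rule linI) (simp_all add: lin_simps cvec.scale_right_distrib mult.commute)

lemma lin_zero: "lin (\<lambda>x. 0)" "lin 0"
  by (auto intro!: linI)

lemma lin_id: "lin (\<lambda>x. x)"
  by (rule linI) auto

section \<open>Expansion in the standard basis and spaces of linear maps\<close>

lemma lookup_sum_pm: "Poly_Mapping.lookup (sum f A) k = (\<Sum>a\<in>A. Poly_Mapping.lookup (f a) k)"
  by (induction A rule: infinite_finite_induct) (auto simp: lookup_add)

lemma cvec_expand:
  assumes "finite A" "Poly_Mapping.keys v \<subseteq> A"
  shows "v = (\<Sum>k\<in>A. scl (Poly_Mapping.lookup v k) (bas k))"
proof (rule poly_mapping_eqI)
  fix j
  have "Poly_Mapping.lookup (\<Sum>k\<in>A. scl (Poly_Mapping.lookup v k) (bas k)) j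
      = (\<Sum>k\<in>A. if k = j then Poly_Mapping.lookup v k else 0)"
    unfolding lookup_sum_pm by (intro sum.cong) (auto simp: bas_def lookup_single when_def)
  also have "\<dots> = Poly_Mapping.lookup v j"
    using assms by (auto simp: sum.delta in_keys_iff)
  finally show "Poly_Mapping.lookup v j = Poly_Mapping.lookup (\<Sum>k\<in>A. scl (Poly_Mapping.lookup v k) (bas k)) j" ..
qed

lemma cvec_expand_keys:
  "v = (\<Sum>k\<in>Poly_Mapping.keys v. scl (Poly_Mapping.lookup v k) (bas k))"
  by (rule cvec_expand) auto

lemma keys_bas [simp]: "Poly_Mapping.keys (bas k) = {k}"
  by (simp add: bas_def)

lemma bas_nz [simp]: "bas k \<noteq> 0"
  by (metis keys_bas insert_not_empty keys_zero)

lemma lookup_bas [simp]: "Poly_Mapping.lookup (bas k) j = (if j = k then 1 else 0)"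
  by (simp add: bas_def lookup_single when_def)

lemma lin_ext_over:
  assumes "finite A" "Poly_Mapping.keys v \<subseteq> A"
  shows "lin_ext b v = (\<Sum>k\<in>A. scl (Poly_Mapping.lookup v k) (b k))"
  unfolding lin_ext_def
  by (rule sum.mono_neutral_left) (use assms in \<open>auto simp: in_keys_iff\<close>)

lemma lin_lin_ext: "lin (lin_ext b)"
proof (rule linI)
  fix x y :: cvec
  let ?A = "Poly_Mapping.keys x \<union> Poly_Mapping.keys y \<union> Poly_Mapping.keys (x + y)"
  show "lin_ext b (x + y) = lin_ext b x + lin_ext b y"
    by (subst (1 2 3) lin_ext_over[where A = ?A])
       (auto simp: lookup_add cvec.scale_left_distrib sum.distrib)
next
  fix c :: complex and x :: cvec
  let ?A = "Poly_Mapping.keys x \<union> Poly_Mapping.keys (scl c x)"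
  show "lin_ext b (scl c x) = scl c (lin_ext b x)"
    by (subst (1 2) lin_ext_over[where A = ?A]) (auto simp: cvec.scale_sum_right)
qed

lemma lin_ext_bas [simp]: "lin_ext b (bas k) = b k"
  by (simp add: lin_ext_def)

lemma lin_apply:
  "lin f \<Longrightarrow> f v = (\<Sum>k\<in>Poly_Mapping.keys v. scl (Poly_Mapping.lookup v k) (f (bas k)))"
  by (subst cvec_expand_keys[of v]) (simp add: lin_simps)

lemma lin_eqI:
  assumes "lin f" "lin g" "\<And>k. f (bas k) = g (bas k)"
  shows "f = g"
proof
  fix v show "f v = g v" by (subst (1 2) lin_apply) (use assms in auto)
qed

lemma lin_eq_onI:
  assumes "lin f" "lin g" "\<And>k. k \<in> I \<Longrightarrow> f (bas k) = g (bas k)" "v \<in> space_on I"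
  shows "f v = g v"
  by (subst (1 2) lin_apply) (use assms in \<open>auto simp: space_on_def intro!: sum.cong\<close>)

lemma subspace_space_on [simp]: "cvec.subspace (space_on I)"
proof -
  have "Poly_Mapping.keys (x + y) \<subseteq> I"
    if "Poly_Mapping.keys x \<subseteq> I" "Poly_Mapping.keys y \<subseteq> I" for x y :: cvec
    using that Poly_Mapping.keys_add[of x y] by blast
  moreover have "Poly_Mapping.keys (scl c x) \<subseteq> I" if "Poly_Mapping.keys x \<subseteq> I" for c x
    using that by (auto simp: in_keys_iff)
  ultimately show ?thesis
    by (auto simp: cvec.subspace_def space_on_def)
qed

lemmas space_on_add = cvec.subspace_add[OF subspace_space_on]
  and space_on_diff = cvec.subspace_diff[OF subspace_space_on]
  and space_on_neg = cvec.subspace_neg[OF subspace_space_on]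
  and space_on_scl = cvec.subspace_scale[OF subspace_space_on]
  and space_on_0 = cvec.subspace_0[OF subspace_space_on]
  and space_on_sum = cvec.subspace_sum[OF subspace_space_on]

lemma bas_space_on [simp]: "bas k \<in> space_on I \<longleftrightarrow> k \<in> I"
  by (simp add: space_on_def)

lemma space_on_UNIV [simp]: "space_on UNIV = UNIV"
  by (simp add: space_on_def)

lemma space_on_eq_span: "space_on I = cvec.span (bas ` I)"
proof
  show "space_on I \<subseteq> cvec.span (bas ` I)"
  proof
    fix v assume v: "v \<in> space_on I"
    show "v \<in> cvec.span (bas ` I)"
      by (subst cvec_expand_keys, intro cvec.span_sum cvec.span_scale cvec.span_base)
         (use v in \<open>auto simp: space_on_def\<close>)
  qed
  show "cvec.span (bas ` I) \<subseteq> space_on I"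
    by (rule cvec.span_minimal) auto
qed

lemma lin_maps_lin: "f \<in> lin_maps I J \<Longrightarrow> lin f"
  and lin_maps_space: "f \<in> lin_maps I J \<Longrightarrow> f v \<in> space_on J"
  and lin_maps_off: "f \<in> lin_maps I J \<Longrightarrow> k \<notin> I \<Longrightarrow> f (bas k) = 0"
  by (auto simp: lin_maps_def)

lemma lin_mapsI:
  assumes "lin f" "\<And>k. k \<in> I \<Longrightarrow> f (bas k) \<in> space_on J" "\<And>k. k \<notin> I \<Longrightarrow> f (bas k) = 0"
  shows "f \<in> lin_maps I J"
proof -
  have "f (bas k) \<in> space_on J" for k
    using assms by (cases "k \<in> I") (auto intro: space_on_0)
  then have "f v \<in> space_on J" for v
    by (subst lin_apply) (use assms in \<open>auto intro!: space_on_sum space_on_scl\<close>)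
  then show ?thesis using assms by (auto simp: lin_maps_def)
qed

lemma lin_maps_eqI:
  assumes "f \<in> lin_maps I J" "g \<in> lin_maps I J'" "\<And>k. k \<in> I \<Longrightarrow> f (bas k) = g (bas k)"
  shows "f = g"
  by (rule lin_eqI) (metis assms lin_maps_lin lin_maps_off)+

lemma lin_maps_comp: "f \<in> lin_maps I J \<Longrightarrow> g \<in> lin_maps J K \<Longrightarrow> g \<circ> f \<in> lin_maps I K"
  by (rule lin_mapsI) (auto intro: lin_comp simp: lin_maps_lin lin_maps_off lin_maps_space lin_0)

lemma lin_maps_add: "f \<in> lin_maps I J \<Longrightarrow> g \<in> lin_maps I J \<Longrightarrow> f + g \<in> lin_maps I J"
  by (rule lin_mapsI) (auto intro: lin_plus space_on_add simp: lin_maps_lin lin_maps_off lin_maps_space)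

lemma lin_maps_scl: "f \<in> lin_maps I J \<Longrightarrow> (\<lambda>v. scl c (f v)) \<in> lin_maps I J"
  by (rule lin_mapsI) (auto intro: lin_scl' space_on_scl simp: lin_maps_lin lin_maps_off lin_maps_space)

lemma lin_maps_0: "0 \<in> lin_maps I J"
  by (rule lin_mapsI) (auto intro: lin_zero space_on_0)

lemma id_on_lin_maps: "id_on I \<in> lin_maps I I"
  by (rule lin_mapsI) (auto simp: id_on_def lin_lin_ext)

lemma id_on_bas: "id_on I (bas k) = (if k \<in> I then bas k else 0)"
  by (simp add: id_on_def)

lemma lin_id_on: "lin (id_on I)"
  by (simp add: id_on_def lin_lin_ext)

lemma id_on_id: "v \<in> space_on I \<Longrightarrow> id_on I v = v"
  using lin_eq_onI[OF lin_id_on lin_id] by (auto simp: id_on_bas)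

lemma id_on_space: "id_on I v \<in> space_on I"
  using id_on_lin_maps lin_maps_space by blast

lemma lin_maps_id_right: "f \<in> lin_maps I J \<Longrightarrow> f (id_on I v) = f v"
  using lin_eqI[of "\<lambda>v. f (id_on I v)" f]
  by (metis id_on_bas lin_0 lin_comp' lin_id_on lin_maps_lin lin_maps_off)

lemma lin_maps_id_left: "f \<in> lin_maps I J \<Longrightarrow> id_on J (f v) = f v"
  by (simp add: id_on_id lin_maps_space)

subsection \<open>Tensor products of vectors and of maps\<close>

lemma tens_over:
  assumes "finite A" "finite B" "Poly_Mapping.keys v \<subseteq> A" "Poly_Mapping.keys w \<subseteq> B"
  shows "tens v w = (\<Sum>i\<in>A. \<Sum>j\<in>B.
     scl (Poly_Mapping.lookup v i * Poly_Mapping.lookup w j) (bas (prod_encode (i, j))))"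
proof -
  have "tens v w = (\<Sum>i\<in>Poly_Mapping.keys v. \<Sum>j\<in>B.
     scl (Poly_Mapping.lookup v i * Poly_Mapping.lookup w j) (bas (prod_encode (i, j))))"
    unfolding tens_def
    by (intro sum.cong[OF refl] sum.mono_neutral_left) (use assms in \<open>auto simp: in_keys_iff\<close>)
  also have "\<dots> = (\<Sum>i\<in>A. \<Sum>j\<in>B.
     scl (Poly_Mapping.lookup v i * Poly_Mapping.lookup w j) (bas (prod_encode (i, j))))"
    by (intro sum.mono_neutral_left) (use assms in \<open>auto simp: in_keys_iff\<close>)
  finally show ?thesis .
qed

lemma tens_lin_left: "lin (\<lambda>v. tens v w)"
proof (rule linI)
  fix x y :: cvec
  let ?A = "Poly_Mapping.keys x \<union> Poly_Mapping.keys y \<union> Poly_Mapping.keys (x + y)"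
  show "tens (x + y) w = tens x w + tens y w"
    by (subst (1 2 3) tens_over[where A = ?A and B = "Poly_Mapping.keys w"])
       (auto simp: lookup_add cvec.scale_left_distrib sum.distrib algebra_simps)
next
  fix c :: complex and x :: cvec
  let ?A = "Poly_Mapping.keys x \<union> Poly_Mapping.keys (scl c x)"
  show "tens (scl c x) w = scl c (tens x w)"
    by (subst (1 2) tens_over[where A = ?A and B = "Poly_Mapping.keys w"])
       (auto simp: cvec.scale_sum_right mult.assoc)
qed

lemma tens_lin_right: "lin (tens v)"
proof (rule linI)
  fix x y :: cvec
  let ?A = "Poly_Mapping.keys x \<union> Poly_Mapping.keys y \<union> Poly_Mapping.keys (x + y)"
  show "tens v (x + y) = tens v x + tens v y"
    by (subst (1 2 3) tens_over[where A = "Poly_Mapping.keys v" and B = ?A])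
       (auto simp: lookup_add cvec.scale_left_distrib sum.distrib algebra_simps)
next
  fix c :: complex and x :: cvec
  let ?A = "Poly_Mapping.keys x \<union> Poly_Mapping.keys (scl c x)"
  show "tens v (scl c x) = scl c (tens v x)"
    by (subst (1 2) tens_over[where A = "Poly_Mapping.keys v" and B = ?A])
       (auto simp: cvec.scale_sum_right mult.left_commute)
qed

lemmas tens_simps =
  lin_add[OF tens_lin_left] lin_scl[OF tens_lin_left] lin_0[OF tens_lin_left]
  lin_diff[OF tens_lin_left] lin_neg[OF tens_lin_left] lin_sum[OF tens_lin_left]
  lin_add[OF tens_lin_right] lin_scl[OF tens_lin_right] lin_0[OF tens_lin_right]
  lin_diff[OF tens_lin_right] lin_neg[OF tens_lin_right] lin_sum[OF tens_lin_right]

lemma tens_bas [simp]: "tens (bas i) (bas j) = bas (prod_encode (i, j))"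
  by (simp add: tens_def)

lemma tens_space:
  "v \<in> space_on I \<Longrightarrow> w \<in> space_on J \<Longrightarrow> tens v w \<in> space_on (prod_encode ` (I \<times> J))"
  unfolding tens_def space_on_def[of I] space_on_def[of J]
  by (intro space_on_sum space_on_scl) auto

lemma lin_eq_tensI:
  assumes "lin f" "lin g" "\<And>i j. f (tens (bas i) (bas j)) = g (tens (bas i) (bas j))"
  shows "f = g"
proof (rule lin_eqI[OF assms(1,2)])
  fix k
  obtain i j where "k = prod_encode (i, j)" by (metis prod_decode_inverse surj_pair)
  then show "f (bas k) = g (bas k)" using assms(3)[of i j] by simp
qed

lemma lin_maps_eq_tensI:
  assumes "f \<in> lin_maps (prod_encode ` (I \<times> J)) K" "g \<in> lin_maps (prod_encode ` (I \<times> J)) K'"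
    "\<And>i j. i \<in> I \<Longrightarrow> j \<in> J \<Longrightarrow> f (tens (bas i) (bas j)) = g (tens (bas i) (bas j))"
  shows "f = g"
  by (rule lin_maps_eqI[OF assms(1,2)]) (use assms(3) in auto)

lemma lin_tens_map: "lin (tens_map f g)"
  by (simp add: tens_map_def lin_lin_ext)

lemma tens_map_tens:
  assumes "lin f" "lin g"
  shows "tens_map f g (tens v w) = tens (f v) (g w)"
proof -
  have 1: "tens_map f g (tens (bas i) (bas j)) = tens (f (bas i)) (g (bas j))" for i j
    by (simp add: tens_map_def)
  have 2: "(\<lambda>w. tens_map f g (tens (bas i) w)) = (\<lambda>w. tens (f (bas i)) (g w))" for i
    by (rule lin_eqI) (auto intro!: lin_comp'[OF lin_tens_map tens_lin_right] lin_comp'[OF tens_lin_right] 1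
      simp del: tens_bas simp: assms)
  have "(\<lambda>v. tens_map f g (tens v w)) = (\<lambda>v. tens (f v) (g w))"
    by (rule lin_eqI) (auto intro!: lin_comp'[OF lin_tens_map tens_lin_left]
       lin_comp'[OF tens_lin_left, of f] fun_cong[OF 2] simp: assms)
  then show ?thesis by (rule fun_cong)
qed

lemma tens_map_lin_maps:
  assumes "f \<in> lin_maps I J" "g \<in> lin_maps I' J'"
  shows "tens_map f g \<in> lin_maps (prod_encode ` (I \<times> I')) (prod_encode ` (J \<times> J'))"
proof (rule lin_mapsI[OF lin_tens_map])
  fix k
  obtain i j where k: "k = prod_encode (i, j)" by (metis prod_decode_inverse surj_pair)
  have "tens_map f g (bas k) = tens (f (bas i)) (g (bas j))"
    by (simp add: tens_map_def k)
  then show "k \<in> prod_encode ` (I \<times> I') \<Longrightarrow> tens_map f g (bas k) \<in> space_on (prod_encode ` (J \<times> J'))"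
    "k \<notin> prod_encode ` (I \<times> I') \<Longrightarrow> tens_map f g (bas k) = 0"
    using assms by (auto simp: k tens_space lin_maps_space lin_maps_off tens_simps image_iff)
qed

lemma tens_map_comp:
  assumes "lin f" "lin g" "lin f'" "lin g'"
  shows "tens_map (f' \<circ> f) (g' \<circ> g) = tens_map f' g' \<circ> tens_map f g"
  by (rule lin_eq_tensI)
     (auto intro!: lin_comp lin_tens_map simp del: tens_bas simp: tens_map_tens assms lin_comp)

lemma tens_map_add_left: "lin f \<Longrightarrow> lin f' \<Longrightarrow> lin g \<Longrightarrow> tens_map (f + f') g = tens_map f g + tens_map f' g"
  by (rule lin_eq_tensI)
     (auto intro!: lin_plus lin_tens_map simp del: tens_bas simp: tens_map_tens tens_simps lin_plus)

lemma tens_map_add_right: "lin f \<Longrightarrow> lin g' \<Longrightarrow> lin g \<Longrightarrow> tens_map f (g + g') = tens_map f g + tens_map f g'"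
  by (rule lin_eq_tensI)
     (auto intro!: lin_plus lin_tens_map simp del: tens_bas simp: tens_map_tens tens_simps lin_plus)

lemma tens_map_scl_left: "lin f \<Longrightarrow> lin g \<Longrightarrow> tens_map (\<lambda>v. scl c (f v)) g = (\<lambda>v. scl c (tens_map f g v))"
  by (rule lin_eq_tensI)
     (auto intro!: lin_scl' lin_tens_map simp del: tens_bas simp: tens_map_tens tens_simps lin_scl')

lemma tens_map_scl_right: "lin f \<Longrightarrow> lin g \<Longrightarrow> tens_map f (\<lambda>v. scl c (g v)) = (\<lambda>v. scl c (tens_map f g v))"
  by (rule lin_eq_tensI)
     (auto intro!: lin_scl' lin_tens_map simp del: tens_bas simp: tens_map_tens tens_simps lin_scl')

lemma tens_map_id: "tens_map (id_on I) (id_on J) = id_on (prod_encode ` (I \<times> J))"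
  by (rule lin_maps_eq_tensI[OF tens_map_lin_maps[OF id_on_lin_maps id_on_lin_maps] id_on_lin_maps])
     (auto simp del: tens_bas simp: id_on_lin_maps tens_map_tens lin_id_on id_on_id tens_space)

lemma reindex_lin_maps:
  assumes "s ` I \<subseteq> J" shows "reindex I s \<in> lin_maps I J"
  by (rule lin_mapsI) (use assms in \<open>auto simp: reindex_def lin_lin_ext\<close>)

lemma reindex_bas: "reindex I s (bas k) = (if k \<in> I then bas (s k) else 0)"
  by (simp add: reindex_def)

lemma lin_reindex: "lin (reindex I s)"
  by (simp add: reindex_def lin_lin_ext)

lemma reindex_comp:
  assumes "bij_betw s I J"
  shows "reindex J (the_inv_into I s) \<circ> reindex I s = id_on I"
    and "reindex I s \<circ> reindex J (the_inv_into I s) = id_on J"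
proof -
  have s: "s k \<in> J" if "k \<in> I" for k using assms that by (auto simp: bij_betw_def)
  have t: "the_inv_into I s k \<in> I" if "k \<in> J" for k
    using assms that bij_betw_apply bij_betw_the_inv_into by metis
  show "reindex J (the_inv_into I s) \<circ> reindex I s = id_on I"
    by (rule lin_eqI) (use assms in \<open>auto simp: reindex_bas id_on_bas s lin_0 lin_reindex lin_id_on
        bij_betw_def the_inv_into_f_f intro!: lin_comp lin_reindex\<close>)
  show "reindex I s \<circ> reindex J (the_inv_into I s) = id_on J"
    by (rule lin_eqI) (use assms t in \<open>auto simp: reindex_bas id_on_bas lin_0 lin_reindex lin_id_on
        bij_betw_def f_the_inv_into_f intro!: lin_comp lin_reindex\<close>)
qed

subsection \<open>Coherence isomorphisms of based vector spaces\<close>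

abbreviation pe :: "nat set \<Rightarrow> nat set \<Rightarrow> nat set" where
  "pe I J \<equiv> prod_encode ` (I \<times> J)"

abbreviation rea :: "nat set \<Rightarrow> nat set \<Rightarrow> nat set \<Rightarrow> cvec \<Rightarrow> cvec" where
  "rea I J K \<equiv> reindex (pe (pe I J) K) prod_reassoc"

abbreviation lun :: "nat set \<Rightarrow> cvec \<Rightarrow> cvec" where
  "lun I \<equiv> reindex (pe {0} I) (\<lambda>k. snd (prod_decode k))"

abbreviation run :: "nat set \<Rightarrow> cvec \<Rightarrow> cvec" where
  "run I \<equiv> reindex (pe I {0}) (\<lambda>k. fst (prod_decode k))"

lemma pe_mem [simp]: "prod_encode (i, j) \<in> pe I J \<longleftrightarrow> i \<in> I \<and> j \<in> J"
  by auto

lemma tens_map_bas [simp]: "tens_map f g (bas (prod_encode (i, j))) = tens (f (bas i)) (g (bas j))"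
  by (simp add: tens_map_def)

lemma prod_reassoc_bij: "bij_betw prod_reassoc (pe (pe I J) K) (pe I (pe J K))"
  by (intro bij_betw_imageI inj_onI) (auto simp: prod_reassoc_def image_iff)

lemma snd_decode_bij: "bij_betw (\<lambda>k. snd (prod_decode k)) (pe {0} I) I"
  by (intro bij_betw_imageI inj_onI) (auto simp: image_iff)

lemma fst_decode_bij: "bij_betw (\<lambda>k. fst (prod_decode k)) (pe I {0}) I"
  by (intro bij_betw_imageI inj_onI) (auto simp: image_iff)

lemma rea_lin_maps: "rea I J K \<in> lin_maps (pe (pe I J) K) (pe I (pe J K))"
  by (rule reindex_lin_maps) (use prod_reassoc_bij in \<open>auto simp: bij_betw_def\<close>)

lemma lun_lin_maps: "lun I \<in> lin_maps (pe {0} I) I"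
  by (rule reindex_lin_maps) auto

lemma run_lin_maps: "run I \<in> lin_maps (pe I {0}) I"
  by (rule reindex_lin_maps) auto

lemma space_on_induct [consumes 1, case_names bas add scl]:
  assumes "v \<in> space_on I" "\<And>i. i \<in> I \<Longrightarrow> P (bas i)"
    "\<And>x y. x \<in> space_on I \<Longrightarrow> y \<in> space_on I \<Longrightarrow> P x \<Longrightarrow> P y \<Longrightarrow> P (x + y)"
    "\<And>c x. x \<in> space_on I \<Longrightarrow> P x \<Longrightarrow> P (scl c x)" "P 0"
  shows "P v"
proof -
  have "v \<in> cvec.span (bas ` I)" using assms(1) by (simp add: space_on_eq_span)
  then have "v \<in> space_on I \<and> P v"
    by (induction rule: cvec.span_induct_alt)
       (auto intro!: assms space_on_0 space_on_add space_on_scl)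
  then show ?thesis ..
qed

text \<open>Trilinearity carries the definition on basis vectors over to all vectors. This form is
  needed as soon as the entries are images under module actions.\<close>

lemma rea_tens:
  assumes "u \<in> space_on I" "v \<in> space_on J" "w \<in> space_on K"
  shows "rea I J K (tens (tens u v) w) = tens u (tens v w)"
  using assms
proof (induction u rule: space_on_induct)
  case (bas i)
  show ?case using bas(2,3) bas(1)
  proof (induction v rule: space_on_induct)
    case (bas j)
    show ?case using bas(2) bas(1,3)
      by (induction w rule: space_on_induct)
         (simp_all add: reindex_bas prod_reassoc_def tens_simps lin_simps[OF lin_reindex])
  qed (simp_all add: tens_simps lin_simps[OF lin_reindex])
qed (simp_all add: tens_simps lin_simps[OF lin_reindex])

lemma lun_tens: "v \<in> space_on I \<Longrightarrow> lun I (tens (bas 0) v) = v"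
  by (induction v rule: space_on_induct) (simp_all add: reindex_bas tens_simps lin_simps[OF lin_reindex])

lemma run_tens: "v \<in> space_on I \<Longrightarrow> run I (tens v (bas 0)) = v"
  by (induction v rule: space_on_induct) (simp_all add: reindex_bas tens_simps lin_simps[OF lin_reindex])

lemma rea_natural:
  assumes "a \<in> lin_maps I I'" "b \<in> lin_maps J J'" "d \<in> lin_maps K K'"
  shows "rea I' J' K' \<circ> tens_map (tens_map a b) d = tens_map a (tens_map b d) \<circ> rea I J K"
  by (rule lin_maps_eqI[OF lin_maps_comp[OF tens_map_lin_maps[OF tens_map_lin_maps] rea_lin_maps]
        lin_maps_comp[OF rea_lin_maps tens_map_lin_maps[OF _ tens_map_lin_maps]]])
     (use assms in \<open>auto simp: reindex_bas prod_reassoc_def tens_map_tens lin_tens_map lin_maps_lin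
        rea_tens lin_maps_space\<close>)

lemma lun_natural:
  assumes "a \<in> lin_maps I I'"
  shows "lun I' \<circ> tens_map (id_on {0}) a = a \<circ> lun I"
  by (rule lin_maps_eqI[OF lin_maps_comp[OF tens_map_lin_maps[OF id_on_lin_maps] lun_lin_maps]
        lin_maps_comp[OF lun_lin_maps]])
     (use assms in \<open>auto simp: reindex_bas id_on_bas lun_tens lin_maps_space\<close>)

lemma run_natural:
  assumes "a \<in> lin_maps I I'"
  shows "run I' \<circ> tens_map a (id_on {0}) = a \<circ> run I"
  by (rule lin_maps_eqI[OF lin_maps_comp[OF tens_map_lin_maps[OF _ id_on_lin_maps] run_lin_maps]
        lin_maps_comp[OF run_lin_maps]])
     (use assms in \<open>auto simp: reindex_bas id_on_bas run_tens lin_maps_space\<close>)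

lemma rea_pentagon:
  "rea I J (pe K M) \<circ> rea (pe I J) K M =
   tens_map (id_on I) (rea J K M) \<circ> rea I (pe J K) M \<circ> tens_map (rea I J K) (id_on M)"
proof (rule lin_maps_eqI)
  show "rea I J (pe K M) \<circ> rea (pe I J) K M \<in> lin_maps (pe (pe (pe I J) K) M) (pe I (pe J (pe K M)))"
    by (rule lin_maps_comp[OF rea_lin_maps rea_lin_maps])
  show "tens_map (id_on I) (rea J K M) \<circ> rea I (pe J K) M \<circ> tens_map (rea I J K) (id_on M)
     \<in> lin_maps (pe (pe (pe I J) K) M) (pe I (pe J (pe K M)))"
    by (intro lin_maps_comp[OF tens_map_lin_maps[OF rea_lin_maps id_on_lin_maps]
          lin_maps_comp[OF rea_lin_maps tens_map_lin_maps[OF id_on_lin_maps rea_lin_maps]]])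
qed (auto simp: reindex_bas prod_reassoc_def id_on_bas)

lemma rea_triangle:
  "tens_map (id_on I) (lun J) \<circ> rea I {0} J = tens_map (run I) (id_on J)"
proof (rule lin_maps_eqI)
  show "tens_map (id_on I) (lun J) \<circ> rea I {0} J \<in> lin_maps (pe (pe I {0}) J) (pe I J)"
    by (intro lin_maps_comp[OF rea_lin_maps tens_map_lin_maps[OF id_on_lin_maps lun_lin_maps]])
  show "tens_map (run I) (id_on J) \<in> lin_maps (pe (pe I {0}) J) (pe I J)"
    by (intro tens_map_lin_maps id_on_lin_maps run_lin_maps)
qed (auto simp: reindex_bas prod_reassoc_def id_on_bas)

subsection \<open>Modules over a Lie algebra\<close>

lemma
  shows Obj_module_cat [simp]: "Obj (module_cat \<gg>) = {M. lie_module \<gg> M}"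
    and Hom_module_cat [simp]: "Hom (module_cat \<gg>) = module_homs \<gg>"
    and Idn_module_cat [simp]: "Idn (module_cat \<gg>) M = id_on (idx M)"
    and Cmp_module_cat [simp]: "Cmp (module_cat \<gg>) f g = f \<circ> g"
    and Scl_module_cat [simp]: "Scl (module_cat \<gg>) c f = (\<lambda>v. scl c (f v))"
  by (simp_all add: module_cat_def)

lemma lie_module_lin_maps: "lie_module \<gg> M \<Longrightarrow> x \<in> lcarrier \<gg> \<Longrightarrow> act M x \<in> lin_maps (idx M) (idx M)"
  and lie_module_lin: "lie_module \<gg> M \<Longrightarrow> x \<in> lcarrier \<gg> \<Longrightarrow> lin (act M x)"
  and lie_module_space: "lie_module \<gg> M \<Longrightarrow> x \<in> lcarrier \<gg> \<Longrightarrow> act M x v \<in> space_on (idx M)"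
  and lie_module_add: "lie_module \<gg> M \<Longrightarrow> x \<in> lcarrier \<gg> \<Longrightarrow> y \<in> lcarrier \<gg> \<Longrightarrow>
     act M (x + y) v = act M x v + act M y v"
  and lie_module_scl: "lie_module \<gg> M \<Longrightarrow> x \<in> lcarrier \<gg> \<Longrightarrow> act M (lscale \<gg> c x) v = scl c (act M x v)"
  and lie_module_bracket: "lie_module \<gg> M \<Longrightarrow> x \<in> lcarrier \<gg> \<Longrightarrow> y \<in> lcarrier \<gg> \<Longrightarrow>
     act M (lbracket \<gg> x y) v = act M x (act M y v) - act M y (act M x v)"
  by (auto simp: lie_module_def lin_maps_def)

lemma module_homs_lin_maps: "f \<in> module_homs \<gg> M N \<Longrightarrow> f \<in> lin_maps (idx M) (idx N)"
  and module_homs_lin: "f \<in> module_homs \<gg> M N \<Longrightarrow> lin f"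
  and module_homs_space: "f \<in> module_homs \<gg> M N \<Longrightarrow> f v \<in> space_on (idx N)"
  and module_homs_act: "f \<in> module_homs \<gg> M N \<Longrightarrow> x \<in> lcarrier \<gg> \<Longrightarrow> f (act M x v) = act N x (f v)"
  by (auto simp: module_homs_def lin_maps_def)

lemma module_homsI:
  "f \<in> lin_maps (idx M) (idx N) \<Longrightarrow> (\<And>x v. x \<in> lcarrier \<gg> \<Longrightarrow> f (act M x v) = act N x (f v)) \<Longrightarrow>
   f \<in> module_homs \<gg> M N"
  by (auto simp: module_homs_def)

lemma module_homs_id: "lie_module \<gg> M \<Longrightarrow> id_on (idx M) \<in> module_homs \<gg> M M"
  by (rule module_homsI[OF id_on_lin_maps])
     (metis lie_module_lin_maps lin_maps_id_left lin_maps_id_right)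

lemma module_homs_comp: "f \<in> module_homs \<gg> M N \<Longrightarrow> g \<in> module_homs \<gg> N P \<Longrightarrow> g \<circ> f \<in> module_homs \<gg> M P"
  by (auto simp: module_homs_def intro: lin_maps_comp)

lemma module_homs_add: "lie_module \<gg> N \<Longrightarrow> f \<in> module_homs \<gg> M N \<Longrightarrow> g \<in> module_homs \<gg> M N \<Longrightarrow> f + g \<in> module_homs \<gg> M N"
  by (auto simp: module_homs_def intro: lin_maps_add simp: lin_add[OF lie_module_lin])

lemma module_homs_scl: "lie_module \<gg> N \<Longrightarrow> f \<in> module_homs \<gg> M N \<Longrightarrow> (\<lambda>v. scl c (f v)) \<in> module_homs \<gg> M N"
  by (auto simp: module_homs_def intro: lin_maps_scl simp: lin_scl[OF lie_module_lin])

lemma module_homs_0: "lie_module \<gg> N \<Longrightarrow> 0 \<in> module_homs \<gg> M N"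
  by (auto simp: module_homs_def intro: lin_maps_0 simp: lin_0[OF lie_module_lin])

lemma vector_space_maps: "vector_space (\<lambda>c (f :: cvec \<Rightarrow> cvec) v. scl c (f v))"
  by unfold_locales (auto simp: fun_eq_iff cvec.scale_right_distrib cvec.scale_left_distrib)

lemma linear_category_module_cat: "linear_category (module_cat \<gg>)"
proof -
  interpret vs: vector_space "\<lambda>c (f :: cvec \<Rightarrow> cvec) v. scl c (f v)" by (rule vector_space_maps)
  have sc: "Scl (module_cat \<gg>) = (\<lambda>c f v. scl c (f v))" by (simp add: module_cat_def)
  have sub: "vs.subspace (module_homs \<gg> X Y)" if "lie_module \<gg> Y" for X Y
    by (auto simp: vs.subspace_def intro: module_homs_add module_homs_scl module_homs_0 that)
  show ?thesis
  proof (intro linear_category.intro linear_category_axioms.intro)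
    show "vector_space (Scl (module_cat \<gg>))" by (simp add: sc vector_space_maps)
  qed (auto simp: sc sub fun_eq_iff lin_maps_id_right[OF module_homs_lin_maps] lin_maps_id_left[OF module_homs_lin_maps]
       lin_simps[OF module_homs_lin] intro: module_homs_id module_homs_comp)
qed

lemma hom_inverse:
  assumes "f \<in> module_homs \<gg> M N" "g \<in> lin_maps (idx N) (idx M)" "lie_module \<gg> M" "lie_module \<gg> N"
    "g \<circ> f = id_on (idx M)" "f \<circ> g = id_on (idx N)"
  shows "g \<in> module_homs \<gg> N M"
proof (rule module_homsI[OF assms(2)])
  fix x v assume x: "x \<in> lcarrier \<gg>"
  have "act N x v = act N x (f (g v))"
    using fun_cong[OF assms(6), of v] lin_maps_id_right[OF lie_module_lin_maps[OF assms(4) x]] by simp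
  also have "\<dots> = f (act M x (g v))" by (simp add: module_homs_act[OF assms(1) x])
  finally have "g (act N x v) = id_on (idx M) (act M x (g v))"
    using fun_cong[OF assms(5), of "act M x (g v)"] by simp
  then show "g (act N x v) = act M x (g v)"
    by (simp add: id_on_id lie_module_space[OF assms(3) x])
qed

lemma iso_in_reindex:
  assumes "reindex (idx M) s \<in> module_homs \<gg> M N" "bij_betw s (idx M) (idx N)"
    "lie_module \<gg> M" "lie_module \<gg> N"
  shows "iso_in (module_cat \<gg>) M N (reindex (idx M) s)"
proof -
  let ?g = "reindex (idx N) (the_inv_into (idx M) s)"
  have "?g \<in> lin_maps (idx N) (idx M)"
    by (rule reindex_lin_maps) (use bij_betw_the_inv_into[OF assms(2)] in \<open>auto simp: bij_betw_def\<close>)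
  from hom_inverse[OF assms(1) this assms(3,4)] show ?thesis
    unfolding iso_in_def using assms(1) reindex_comp[OF assms(2)] by auto
qed

lemma idx_tens [simp]: "idx (tens_module M N) = pe (idx M) (idx N)"
  by (simp add: tens_module_def)

lemma act_tens:
  assumes "lin (act M x)" "lin (act N x)" "v \<in> space_on (idx M)" "w \<in> space_on (idx N)"
  shows "act (tens_module M N) x (tens v w) = tens (act M x v) w + tens v (act N x w)"
  using assms by (simp add: tens_module_def tens_map_tens lin_id_on id_on_id)

lemma act_tens_lin_maps:
  assumes "act M x \<in> lin_maps (idx M) (idx M)" "act N x \<in> lin_maps (idx N) (idx N)"
  shows "act (tens_module M N) x \<in> lin_maps (pe (idx M) (idx N)) (pe (idx M) (idx N))"
  using assms by (simp add: tens_module_def lin_maps_add tens_map_lin_maps id_on_lin_maps)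

lemma lin_maps_commutator:
  assumes "f \<in> lin_maps I I" "g \<in> lin_maps I I"
  shows "(\<lambda>v. f (g v) - g (f v)) \<in> lin_maps I I"
proof (rule lin_mapsI)
  show "lin (\<lambda>v. f (g v) - g (f v))"
    using assms by (intro lin_minus' lin_comp'[of f g] lin_comp'[of g f]) (auto intro: lin_maps_lin)
qed (use assms in \<open>auto intro!: space_on_diff simp: lin_maps_off lin_maps_space lin_0[OF lin_maps_lin]\<close>)

lemma lie_module_tens:
  assumes M: "lie_module \<gg> M" and N: "lie_module \<gg> N"
  shows "lie_module \<gg> (tens_module M N)"
proof -
  let ?T = "tens_module M N"
  note lm = lie_module_lin_maps[OF M] lie_module_lin_maps[OF N]
  have T: "act ?T x \<in> lin_maps (pe (idx M) (idx N)) (pe (idx M) (idx N))" if "x \<in> lcarrier \<gg>" for x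
    by (rule act_tens_lin_maps) (simp_all add: lm that)
  have at: "act ?T x (tens v w) = tens (act M x v) w + tens v (act N x w)"
    if "x \<in> lcarrier \<gg>" "v \<in> space_on (idx M)" "w \<in> space_on (idx N)" for x v w
    by (rule act_tens) (use that M N in \<open>auto intro: lie_module_lin\<close>)
  have "act ?T (x + y) = act ?T x + act ?T y" if "x \<in> lcarrier \<gg>" "y \<in> lcarrier \<gg>" for x y
  proof -
    have "act M (x + y) = act M x + act M y" "act N (x + y) = act N x + act N y"
      using M N that by (auto simp: lie_module_def)
    then show ?thesis
      using that M N by (simp add: tens_module_def tens_map_add_left tens_map_add_right lie_module_lin lin_id_on)
  qed
  moreover have "act ?T (lscale \<gg> c x) v = scl c (act ?T x v)" if "x \<in> lcarrier \<gg>" for c x v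
  proof -
    have "act M (lscale \<gg> c x) = (\<lambda>v. scl c (act M x v))" "act N (lscale \<gg> c x) = (\<lambda>v. scl c (act N x v))"
      using M N that by (auto simp: lie_module_def)
    then show ?thesis
      using that M N by (simp add: tens_module_def tens_map_scl_left tens_map_scl_right lie_module_lin lin_id_on
          cvec.scale_right_distrib)
  qed
  moreover have "act ?T (lbracket \<gg> x y) v = act ?T x (act ?T y v) - act ?T y (act ?T x v)"
    if x: "x \<in> lcarrier \<gg>" and y: "y \<in> lcarrier \<gg>" for x y v
  proof -
    have 1: "act M (lbracket \<gg> x y) = (\<lambda>v. act M x (act M y v) - act M y (act M x v))"
      "act N (lbracket \<gg> x y) = (\<lambda>v. act N x (act N y v) - act N y (act N x v))"
      using M N that by (auto simp: lie_module_def)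
    have 2: "(\<lambda>v. act P x (act P y v) - act P y (act P x v)) \<in> lin_maps (idx P) (idx P)"
      if "lie_module \<gg> P" for P
      by (rule lin_maps_commutator) (use lie_module_lin_maps[OF that] x y in auto)
    have "act ?T (lbracket \<gg> x y) = (\<lambda>v. act ?T x (act ?T y v) - act ?T y (act ?T x v))"
    proof (rule lin_maps_eq_tensI)
      show "act ?T (lbracket \<gg> x y) \<in> lin_maps (pe (idx M) (idx N)) (pe (idx M) (idx N))"
        by (rule act_tens_lin_maps) (simp_all add: 1 2 M N)
      show "(\<lambda>v. act ?T x (act ?T y v) - act ?T y (act ?T x v))
         \<in> lin_maps (pe (idx M) (idx N)) (pe (idx M) (idx N))"
        by (rule lin_maps_commutator) (use T x y in auto)
      fix i j assume ij: "i \<in> idx M" "j \<in> idx N"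
      have lb: "lin (act M (lbracket \<gg> x y))" "lin (act N (lbracket \<gg> x y))"
        by (simp_all add: 1 lin_maps_lin[OF 2] M N)
      show "act ?T (lbracket \<gg> x y) (tens (bas i) (bas j)) =
        act ?T x (act ?T y (tens (bas i) (bas j))) - act ?T y (act ?T x (tens (bas i) (bas j)))"
        using ij x y
        by (simp add: act_tens[OF lb] at lie_module_space[OF M] lie_module_space[OF N]
            lin_add[OF lin_maps_lin[OF T]] 1 tens_simps del: tens_bas)
    qed
    then show ?thesis by (rule fun_cong)
  qed
  ultimately show ?thesis using T by (simp add: lie_module_def)
qed

lemma tens_map_hom:
  assumes "lie_module \<gg> F" "lie_module \<gg> F'" "lie_module \<gg> G" "lie_module \<gg> G'"
    "a \<in> module_homs \<gg> F F'" "b \<in> module_homs \<gg> G G'"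
  shows "tens_map a b \<in> module_homs \<gg> (tens_module F G) (tens_module F' G')"
proof (rule module_homsI)
  show tm: "tens_map a b \<in> lin_maps (idx (tens_module F G)) (idx (tens_module F' G'))"
    using assms by (simp add: tens_map_lin_maps module_homs_lin_maps)
  fix x v assume x: "x \<in> lcarrier \<gg>"
  have "tens_map a b \<circ> act (tens_module F G) x = act (tens_module F' G') x \<circ> tens_map a b"
  proof (rule lin_maps_eq_tensI)
    show "tens_map a b \<circ> act (tens_module F G) x \<in> lin_maps (pe (idx F) (idx G)) (pe (idx F') (idx G'))"
      using lin_maps_comp[OF lie_module_lin_maps[OF lie_module_tens[OF assms(1,3)] x] tm] by simp
    show "act (tens_module F' G') x \<circ> tens_map a b \<in> lin_maps (pe (idx F) (idx G)) (pe (idx F') (idx G'))"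
      using lin_maps_comp[OF tm lie_module_lin_maps[OF lie_module_tens[OF assms(2,4)] x]] by simp
    fix i j assume "i \<in> idx F" "j \<in> idx G"
    then show "(tens_map a b \<circ> act (tens_module F G) x) (tens (bas i) (bas j)) =
       (act (tens_module F' G') x \<circ> tens_map a b) (tens (bas i) (bas j))"
      using assms x by (simp del: tens_bas tens_map_bas add: act_tens lie_module_lin tens_map_tens module_homs_lin
        lin_add[OF lin_tens_map] module_homs_space module_homs_act)
  qed
  then show "tens_map a b (act (tens_module F G) x v) = act (tens_module F' G') x (tens_map a b v)"
    by (metis comp_apply)
qed

lemma rea_iso:
  assumes A: "lie_module \<gg> A" and B: "lie_module \<gg> B" and C: "lie_module \<gg> C"
  shows "iso_in (module_cat \<gg>) (tens_module (tens_module A B) C) (tens_module A (tens_module B C))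
     (rea (idx A) (idx B) (idx C))"
proof -
  note AB = lie_module_tens[OF A B] and BC = lie_module_tens[OF B C]
  note L = lie_module_tens[OF AB C] and R = lie_module_tens[OF A BC]
  let ?r = "rea (idx A) (idx B) (idx C)" and ?L = "tens_module (tens_module A B) C"
    and ?R = "tens_module A (tens_module B C)"
  have "?r (act ?L x v) = act ?R x (?r v)" if x: "x \<in> lcarrier \<gg>" for x v
  proof -
    have "?r \<circ> act ?L x = act ?R x \<circ> ?r"
    proof (rule lin_maps_eqI[OF lin_maps_comp[OF _ rea_lin_maps] lin_maps_comp[OF rea_lin_maps]])
      show "act ?L x \<in> lin_maps (pe (pe (idx A) (idx B)) (idx C)) (pe (pe (idx A) (idx B)) (idx C))"
        using lie_module_lin_maps[OF L x] by simp
      show "act ?R x \<in> lin_maps (pe (idx A) (pe (idx B) (idx C))) (pe (idx A) (pe (idx B) (idx C)))"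
        using lie_module_lin_maps[OF R x] by simp
      fix n assume "n \<in> pe (pe (idx A) (idx B)) (idx C)"
      then obtain i j k where n: "bas n = tens (tens (bas i) (bas j)) (bas k)"
        and i: "i \<in> idx A" and j: "j \<in> idx B" and k: "k \<in> idx C" by auto
      have s: "tens (act A x (bas i)) (bas j) \<in> space_on (pe (idx A) (idx B))"
        "tens (bas i) (act B x (bas j)) \<in> space_on (pe (idx A) (idx B))"
        "tens (bas i) (bas j) \<in> space_on (pe (idx A) (idx B))"
        "tens (bas j) (bas k) \<in> space_on (pe (idx B) (idx C))"
        using i j k x A B C by (auto intro!: tens_space lie_module_space simp del: tens_bas)
      show "(?r \<circ> act ?L x) (bas n) = (act ?R x \<circ> ?r) (bas n)"
        using i j k x A B C AB BC s unfolding n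
        by (simp del: tens_bas add: act_tens lie_module_lin rea_tens lie_module_space tens_simps
          lin_add[OF lin_reindex] space_on_add)
    qed
    then show ?thesis by (metis comp_apply)
  qed
  then have "?r \<in> module_homs \<gg> ?L ?R"
    by (intro module_homsI) (auto simp: rea_lin_maps simp del: prod_encode_eq)
  then show ?thesis
    using iso_in_reindex[of ?L prod_reassoc \<gg> ?R] prod_reassoc_bij L R by simp
qed

lemma lun_iso:
  assumes A: "lie_module \<gg> A" and U: "lie_module \<gg> U" "idx U = {0}" "\<And>x. x \<in> lcarrier \<gg> \<Longrightarrow> act U x (bas 0) = 0"
  shows "iso_in (module_cat \<gg>) (tens_module U A) A (lun (idx A))"
proof -
  note T = lie_module_tens[OF U(1) A]
  have "lun (idx A) (act (tens_module U A) x v) = act A x (lun (idx A) v)" if x: "x \<in> lcarrier \<gg>" for x v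
  proof -
    have "lun (idx A) \<circ> act (tens_module U A) x = act A x \<circ> lun (idx A)"
    proof (rule lin_maps_eqI[OF lin_maps_comp[OF _ lun_lin_maps] lin_maps_comp[OF lun_lin_maps]])
      show "act (tens_module U A) x \<in> lin_maps (pe {0} (idx A)) (pe {0} (idx A))"
        using lie_module_lin_maps[OF T x] by (simp add: U)
      show "act A x \<in> lin_maps (idx A) (idx A)" by (rule lie_module_lin_maps[OF A x])
      fix n assume "n \<in> pe {0} (idx A)"
      then obtain j where n: "bas n = tens (bas 0) (bas j)" and j: "j \<in> idx A" by auto
      show "(lun (idx A) \<circ> act (tens_module U A) x) (bas n) = (act A x \<circ> lun (idx A)) (bas n)"
        using j x A U unfolding n
        by (simp del: tens_bas add: act_tens lie_module_lin lun_tens lie_module_space tens_simps)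
    qed
    then show ?thesis by (metis comp_apply)
  qed
  then have "lun (idx A) \<in> module_homs \<gg> (tens_module U A) A"
    by (intro module_homsI) (auto simp: lun_lin_maps U)
  then show ?thesis
    using iso_in_reindex[of "tens_module U A" _ \<gg> A] snd_decode_bij T A by (simp add: U)
qed

lemma run_iso:
  assumes A: "lie_module \<gg> A" and U: "lie_module \<gg> U" "idx U = {0}" "\<And>x. x \<in> lcarrier \<gg> \<Longrightarrow> act U x (bas 0) = 0"
  shows "iso_in (module_cat \<gg>) (tens_module A U) A (run (idx A))"
proof -
  note T = lie_module_tens[OF A U(1)]
  have "run (idx A) (act (tens_module A U) x v) = act A x (run (idx A) v)" if x: "x \<in> lcarrier \<gg>" for x v
  proof -
    have "run (idx A) \<circ> act (tens_module A U) x = act A x \<circ> run (idx A)"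
    proof (rule lin_maps_eqI[OF lin_maps_comp[OF _ run_lin_maps] lin_maps_comp[OF run_lin_maps]])
      show "act (tens_module A U) x \<in> lin_maps (pe (idx A) {0}) (pe (idx A) {0})"
        using lie_module_lin_maps[OF T x] by (simp add: U)
      show "act A x \<in> lin_maps (idx A) (idx A)" by (rule lie_module_lin_maps[OF A x])
      fix n assume "n \<in> pe (idx A) {0}"
      then obtain j where n: "bas n = tens (bas j) (bas 0)" and j: "j \<in> idx A" by auto
      show "(run (idx A) \<circ> act (tens_module A U) x) (bas n) = (act A x \<circ> run (idx A)) (bas n)"
        using j x A U unfolding n
        by (simp del: tens_bas add: act_tens lie_module_lin run_tens lie_module_space tens_simps)
    qed
    then show ?thesis by (metis comp_apply)
  qed
  then have "run (idx A) \<in> module_homs \<gg> (tens_module A U) A"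
    by (intro module_homsI) (auto simp: run_lin_maps U)
  then show ?thesis
    using iso_in_reindex[of "tens_module A U" _ \<gg> A] fst_decode_bij T A by (simp add: U)
qed

subsection \<open>The modules \<open>L m\<close>\<close>

lemma lcarrier_sl2: "x \<in> lcarrier sl2 \<longleftrightarrow> x $ 2 $ 2 = - (x $ 1 $ 1)"
  by (auto simp: sl2_def trace_def sum_2 add_eq_0_iff)

lemma lscale_sl2: "lscale sl2 c x $ i $ j = c * (x $ i $ j)"
  by (simp add: sl2_def map_matrix_def)

lemma lbracket_sl2:
  assumes "x \<in> lcarrier sl2" "y \<in> lcarrier sl2"
  shows "lbracket sl2 x y $ 1 $ 1 = x $ 1 $ 2 * y $ 2 $ 1 - y $ 1 $ 2 * x $ 2 $ 1"
    and "lbracket sl2 x y $ 1 $ 2 = 2 * (x $ 1 $ 1 * y $ 1 $ 2 - y $ 1 $ 1 * x $ 1 $ 2)"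
    and "lbracket sl2 x y $ 2 $ 1 = 2 * (y $ 1 $ 1 * x $ 2 $ 1 - x $ 1 $ 1 * y $ 2 $ 1)"
    and "lbracket sl2 x y $ 2 $ 2 = y $ 1 $ 2 * x $ 2 $ 1 - x $ 1 $ 2 * y $ 2 $ 1"
  using assms unfolding lcarrier_sl2
  by (simp_all add: sl2_def matrix_matrix_mult_def sum_2 algebra_simps)

lemma idx_L [simp]: "idx (L m) = {..m}"
  by (simp add: L_def)

lemma lin_act_L: "lin (act (L m) x)"
  by (simp add: L_def lin_lin_ext)

text \<open>Extending the basis of \<open>L m\<close> by zero to all integers removes the boundary cases.\<close>

definition wb :: "nat \<Rightarrow> int \<Rightarrow> cvec" where
  "wb m j = (if 0 \<le> j \<and> j \<le> int m then bas (nat j) else 0)"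

text \<open>The formula survives at the ends because the coefficient \<open>m + 1 - j\<close> of e
  vanishes at \<open>j = m + 1\<close> and the coefficient \<open>j + 1\<close> of f vanishes at
  \<open>j = -1\<close>; the module axioms can then be checked without case distinctions.\<close>

lemma L_act_wb: "act (L m) x (wb m j) =
   scl (x $ 1 $ 1 * (of_nat m - 2 * of_int j)) (wb m j)
   + scl (x $ 1 $ 2 * (of_nat m + 1 - of_int j)) (wb m (j - 1))
   + scl (x $ 2 $ 1 * (of_int j + 1)) (wb m (j + 1))"
proof (cases "0 \<le> j \<and> j \<le> int m")
  case True
  then obtain i where j: "j = int i" "i \<le> m" by (metis nonneg_int_cases of_nat_le_iff)
  have 1: "of_nat (m + 1 - i) = (of_nat m + 1 - of_nat i :: complex)"
    using j by (simp add: of_nat_diff)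
  have 2: "nat (int k - 1) = k - 1" "nat (int k + 1) = k + 1" "nat (1 + int k) = k + 1" for k by auto
  show ?thesis
    using j(2) unfolding j(1)
    by (simp add: L_def wb_def 1 2 algebra_simps del: of_nat_Suc of_nat_diff) (auto simp: le_less algebra_simps 2)
next
  case False
  then consider "j = -1" | "j = int m + 1" | "j < -1" | "j > int m + 1" by linarith
  then show ?thesis
    by cases (auto simp: wb_def lin_0[OF lin_act_L])
qed

lemma wb_bas: "i \<le> m \<Longrightarrow> bas i = wb m (int i)"
  by (simp add: wb_def)

lemma wb_space: "wb m j \<in> space_on {..m}"
  by (auto simp: wb_def space_on_0)

lemma L_off: "i > m \<Longrightarrow> act (L m) x (bas i) = 0"
  by (simp add: L_def)

lemma L_lin_maps: "act (L m) x \<in> lin_maps {..m} {..m}"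
proof (rule lin_mapsI[OF lin_act_L])
  fix k
  show "k \<in> {..m} \<Longrightarrow> act (L m) x (bas k) \<in> space_on {..m}"
    by (auto simp: wb_bas[of k m] L_act_wb intro!: space_on_add space_on_scl wb_space)
  show "k \<notin> {..m} \<Longrightarrow> act (L m) x (bas k) = 0"
    by (simp add: L_off)
qed

lemma lie_module_L: "lie_module sl2 (L m)"
proof -
  let ?a = "act (L m)"
  note ls = lin_simps[OF lin_act_L]
  have eq: "f = g" if "f \<in> lin_maps {..m} {..m}" "g \<in> lin_maps {..m} {..m}" "\<And>j. f (wb m j) = g (wb m j)" for f g
    by (rule lin_maps_eqI[OF that(1,2)]) (simp add: wb_bas[of _ m] that(3))
  have "?a (x + y) = ?a x + ?a y" for x y
    by (rule eq[OF L_lin_maps lin_maps_add[OF L_lin_maps L_lin_maps]])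
       (rule poly_mapping_eqI, simp add: L_act_wb lookup_add algebra_simps)
  moreover have "?a (lscale sl2 c x) v = scl c (?a x v)" for c x v
    by (rule fun_cong[OF eq[OF L_lin_maps lin_maps_scl[OF L_lin_maps]]])
       (rule poly_mapping_eqI, simp add: L_act_wb lookup_add lscale_sl2 algebra_simps)
  moreover have "?a (lbracket sl2 x y) v = ?a x (?a y v) - ?a y (?a x v)"
    if "x \<in> lcarrier sl2" "y \<in> lcarrier sl2" for x y v
    by (rule fun_cong[OF eq[OF L_lin_maps lin_maps_commutator[OF L_lin_maps L_lin_maps]]])
       (rule poly_mapping_eqI, simp only: L_act_wb ls lookup_add lookup_minus lookup_scl,
        simp add: lbracket_sl2[OF that] algebra_simps)
  ultimately show ?thesis by (simp add: lie_module_def L_lin_maps)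
qed

lemma L0_act: "act (L 0) x (bas 0) = 0"
  using L_act_wb[of 0 x 0] by (simp add: wb_def)

subsection \<open>The monoidal category of finite dimensional modules\<close>

lemma
  shows Obj_fd [simp]: "Obj fd_sl2_cat = {M. lie_module sl2 M \<and> finite (idx M)}"
    and Hom_fd [simp]: "Hom fd_sl2_cat = module_homs sl2"
    and Idn_fd [simp]: "Idn fd_sl2_cat M = id_on (idx M)"
    and Cmp_fd [simp]: "Cmp fd_sl2_cat f g = f \<circ> g"
    and Scl_fd: "Scl fd_sl2_cat = Scl (module_cat sl2)"
    and Scl_fd' [simp]: "Scl fd_sl2_cat c f = (\<lambda>v. scl c (f v))"
    and Ten_fd [simp]: "Ten fd_sl2_cat = tens_module"
    and TenM_fd [simp]: "TenM fd_sl2_cat = tens_map"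
    and Unit_fd [simp]: "Unit fd_sl2_cat = L 0"
    and Assoc_fd [simp]: "Assoc fd_sl2_cat F G H = rea (idx F) (idx G) (idx H)"
    and LUnit_fd [simp]: "LUnit fd_sl2_cat F = lun (idx F)"
    and RUnit_fd [simp]: "RUnit fd_sl2_cat F = run (idx F)"
  by (simp_all add: fd_sl2_cat_def)

lemma linear_category_fd: "linear_category fd_sl2_cat"
proof -
  interpret M: linear_category "module_cat sl2" by (rule linear_category_module_cat)
  have "vector_space (Scl fd_sl2_cat)" unfolding Scl_fd by (rule M.vector_space_axioms)
  then show ?thesis
    apply (intro linear_category.intro linear_category_axioms.intro)
    using M.hom_subspace by (auto simp: Scl_fd fun_eq_iff lin_maps_id_right[OF module_homs_lin_maps]
       lin_maps_id_left[OF module_homs_lin_maps] lin_simps[OF module_homs_lin]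
       intro: module_homs_id module_homs_comp)
qed

lemma iso_in_fd: "iso_in fd_sl2_cat X Y f \<longleftrightarrow> iso_in (module_cat sl2) X Y f"
  by (simp add: iso_in_def)

lemma monoidal_fd: "monoidal_category fd_sl2_cat"
proof (intro monoidal_category.intro monoidal_category_axioms.intro linear_category_fd)
  fix F G H K assume "F \<in> Obj fd_sl2_cat" "G \<in> Obj fd_sl2_cat" "H \<in> Obj fd_sl2_cat" "K \<in> Obj fd_sl2_cat"
  show "Assoc fd_sl2_cat F G (Ten fd_sl2_cat H K) \<cdot>\<^bsub>fd_sl2_cat\<^esub> Assoc fd_sl2_cat (Ten fd_sl2_cat F G) H K =
          TenM fd_sl2_cat (Idn fd_sl2_cat F) (Assoc fd_sl2_cat G H K) \<cdot>\<^bsub>fd_sl2_cat\<^esub> Assoc fd_sl2_cat F (Ten fd_sl2_cat G H) K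
            \<cdot>\<^bsub>fd_sl2_cat\<^esub> TenM fd_sl2_cat (Assoc fd_sl2_cat F G H) (Idn fd_sl2_cat K)"
    using rea_pentagon by simp
next
  fix F G assume "F \<in> Obj fd_sl2_cat" "G \<in> Obj fd_sl2_cat"
  show "TenM fd_sl2_cat (Idn fd_sl2_cat F) (LUnit fd_sl2_cat G) \<cdot>\<^bsub>fd_sl2_cat\<^esub> Assoc fd_sl2_cat F (Unit fd_sl2_cat) G
      = TenM fd_sl2_cat (RUnit fd_sl2_cat F) (Idn fd_sl2_cat G)"
    using rea_triangle[of "idx F" "idx G"] by (simp add: atMost_0)
qed (auto simp: lie_module_L lie_module_tens tens_map_hom tens_map_id tens_map_comp module_homs_lin
      tens_map_add_left tens_map_add_right tens_map_scl_left tens_map_scl_right iso_in_fd rea_iso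
      lun_iso[OF _ lie_module_L] run_iso[OF _ lie_module_L] atMost_0 L0_act
      rea_natural[OF module_homs_lin_maps module_homs_lin_maps module_homs_lin_maps]
      lun_natural[OF module_homs_lin_maps] run_natural[OF module_homs_lin_maps])

subsection \<open>The action on modules over the semidirect product\<close>

lemma lcarrier_g: "x \<in> lcarrier g_alg \<longleftrightarrow> fst x \<in> lcarrier sl2 \<and> snd x \<in> space_on {..4}"
  by (cases x) (simp add: g_alg_def semidirect_def)

lemma fst_lscale_g: "fst (lscale g_alg c x) = lscale sl2 c (fst x)"
  by (cases x) (simp add: g_alg_def semidirect_def)

lemma fst_lbracket_g: "fst (lbracket g_alg x y) = lbracket sl2 (fst x) (fst y)"
  by (cases x; cases y) (simp add: g_alg_def semidirect_def)

lemma lbracket_g: "lbracket g_alg (x, u) (y, w) = (lbracket sl2 x y, act (L 4) x w - act (L 4) y u)"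
  by (simp add: g_alg_def semidirect_def)

lemma lscale_g: "lscale g_alg c (x, u) = (lscale sl2 c x, scl c u)"
  by (simp add: g_alg_def semidirect_def)

lemma idx_pullback [simp]: "idx (pullback \<phi> M) = idx M"
  and act_pullback [simp]: "act (pullback \<phi> M) x = act M (\<phi> x)"
  by (simp_all add: pullback_def)

lemma lie_module_pullback_fst: "lie_module sl2 F \<Longrightarrow> lie_module g_alg (pullback fst F)"
  by (simp add: lie_module_def lcarrier_g fst_lscale_g fst_lbracket_g)

lemma pullback_hom: "a \<in> module_homs sl2 F G \<Longrightarrow> a \<in> module_homs g_alg (pullback fst F) (pullback fst G)"
  by (simp add: module_homs_def lcarrier_g)

lemma pullback_tens: "pullback fst (tens_module F G) = tens_module (pullback fst F) (pullback fst G)"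
  by (simp add: pullback_def tens_module_def)

lemma
  shows Obj_g [simp]: "Obj g_module_cat = {M. lie_module g_alg M}"
    and Hom_g [simp]: "Hom g_module_cat = module_homs g_alg"
    and Idn_g [simp]: "Idn g_module_cat M = id_on (idx M)"
    and Cmp_g [simp]: "Cmp g_module_cat f g = f \<circ> g"
    and Scl_g: "Scl g_module_cat = Scl (module_cat g_alg)"
    and Scl_g' [simp]: "Scl g_module_cat c f = (\<lambda>v. scl c (f v))"
    and Act_g [simp]: "Act g_module_cat F X = tens_module (pullback fst F) X"
    and ActM_g [simp]: "ActM g_module_cat = tens_map"
    and ActAssoc_g [simp]: "ActAssoc g_module_cat F G X = rea (idx F) (idx G) (idx X)"
    and ActUnit_g [simp]: "ActUnit g_module_cat X = lun (idx X)"
  by (simp_all add: g_module_cat_def act_on_g_module_def atMost_0)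

lemma linear_category_g: "linear_category g_module_cat"
proof -
  interpret M: linear_category "module_cat g_alg" by (rule linear_category_module_cat)
  have "vector_space (Scl g_module_cat)" unfolding Scl_g by (rule M.vector_space_axioms)
  then show ?thesis
    apply (intro linear_category.intro linear_category_axioms.intro)
    using M.hom_subspace by (auto simp: Scl_g fun_eq_iff lin_maps_id_right[OF module_homs_lin_maps]
       lin_maps_id_left[OF module_homs_lin_maps] lin_simps[OF module_homs_lin]
       intro: module_homs_id module_homs_comp)
qed

lemma iso_in_g: "iso_in g_module_cat X Y f \<longleftrightarrow> iso_in (module_cat g_alg) X Y f"
  by (simp add: iso_in_def)

lemma module_category_g: "module_category fd_sl2_cat g_module_cat"
proof (intro module_category.intro module_category_axioms.intro linear_category_g monoidal_fd)
  fix F G H X assume "F \<in> Obj fd_sl2_cat" "G \<in> Obj fd_sl2_cat" "H \<in> Obj fd_sl2_cat" "X \<in> Obj g_module_cat"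
  show "ActAssoc g_module_cat F G (Act g_module_cat H X) \<cdot>\<^bsub>g_module_cat\<^esub> ActAssoc g_module_cat (Ten fd_sl2_cat F G) H X =
          ActM g_module_cat (Idn fd_sl2_cat F) (ActAssoc g_module_cat G H X) \<cdot>\<^bsub>g_module_cat\<^esub> ActAssoc g_module_cat F (Ten fd_sl2_cat G H) X
            \<cdot>\<^bsub>g_module_cat\<^esub> ActM g_module_cat (Assoc fd_sl2_cat F G H) (Idn g_module_cat X)"
    using rea_pentagon by simp
next
  fix F X assume "F \<in> Obj fd_sl2_cat" "X \<in> Obj g_module_cat"
  show "ActM g_module_cat (Idn fd_sl2_cat F) (ActUnit g_module_cat X) \<cdot>\<^bsub>g_module_cat\<^esub> ActAssoc g_module_cat F (Unit fd_sl2_cat) X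
      = ActM g_module_cat (RUnit fd_sl2_cat F) (Idn g_module_cat X)"
    using rea_triangle[of "idx F" "idx X"] by (simp add: atMost_0)
next
  fix F G X assume "F \<in> Obj fd_sl2_cat" "G \<in> Obj fd_sl2_cat" "X \<in> Obj g_module_cat"
  then show "iso_in g_module_cat (Act g_module_cat (Ten fd_sl2_cat F G) X)
     (Act g_module_cat F (Act g_module_cat G X)) (ActAssoc g_module_cat F G X)"
    using rea_iso[of g_alg "pullback fst F" "pullback fst G" X]
    by (simp add: iso_in_g pullback_tens lie_module_pullback_fst)
next
  fix X assume "X \<in> Obj g_module_cat"
  then show "iso_in g_module_cat (Act g_module_cat (Unit fd_sl2_cat) X) X (ActUnit g_module_cat X)"
    using lun_iso[of g_alg X "pullback fst (L 0)"]
    by (simp add: iso_in_g lie_module_pullback_fst lie_module_L L0_act atMost_0)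
next
  fix F F' X X' a f assume "F \<in> Obj fd_sl2_cat" "F' \<in> Obj fd_sl2_cat" "X \<in> Obj g_module_cat" "X' \<in> Obj g_module_cat"
    "a \<in> Hom fd_sl2_cat F F'" "f \<in> Hom g_module_cat X X'"
  then show "ActM g_module_cat a f \<in> Hom g_module_cat (Act g_module_cat F X) (Act g_module_cat F' X')"
    by (simp add: tens_map_hom lie_module_pullback_fst pullback_hom)
qed (auto simp: lie_module_tens lie_module_pullback_fst tens_map_id tens_map_comp module_homs_lin
      tens_map_add_left tens_map_add_right tens_map_scl_left tens_map_scl_right atMost_0
      rea_natural[OF module_homs_lin_maps module_homs_lin_maps module_homs_lin_maps]
      lun_natural[OF module_homs_lin_maps])

subsection \<open>Finite direct sums\<close>

lemma sum_fun_apply: "(\<Sum>a\<in>A. f a) x = (\<Sum>a\<in>A. f a x)"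
  by (induction A rule: infinite_finite_induct) auto

text \<open>Biproduct data with explicit inclusions and projections in the category of all modules;
  membership of the objects in a subcategory is tracked separately.\<close>

definition dsum :: "'g::ab_group_add lie_alg \<Rightarrow> 'g lie_mod list \<Rightarrow> 'g lie_mod \<Rightarrow>
    (nat \<Rightarrow> cvec \<Rightarrow> cvec) \<Rightarrow> (nat \<Rightarrow> cvec \<Rightarrow> cvec) \<Rightarrow> bool" where
  "dsum \<gg> Xs Z i p \<longleftrightarrow> lie_module \<gg> Z \<and> (\<forall>X \<in> set Xs. lie_module \<gg> X) \<and>
     (\<forall>k < length Xs. i k \<in> module_homs \<gg> (Xs ! k) Z \<and> p k \<in> module_homs \<gg> Z (Xs ! k)) \<and>
     (\<forall>k < length Xs. \<forall>l < length Xs. p k \<circ> i l = (if k = l then id_on (idx (Xs ! k)) else 0)) \<and>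
     (\<Sum>k < length Xs. i k \<circ> p k) = id_on (idx Z)"

definition sinj :: "(nat \<Rightarrow> 'g lie_mod) \<Rightarrow> nat \<Rightarrow> cvec \<Rightarrow> cvec" where
  "sinj N j v = tens (bas j) (id_on (idx (N j)) v)"

definition sproj :: "(nat \<Rightarrow> 'g lie_mod) \<Rightarrow> nat \<Rightarrow> cvec \<Rightarrow> cvec" where
  "sproj N j = lin_ext (\<lambda>n. case prod_decode n of (j', i) \<Rightarrow> if j' = j then id_on (idx (N j)) (bas i) else 0)"

lemma idx_ds: "prod_encode (j, i) \<in> idx (infinite_direct_sum N) \<longleftrightarrow> i \<in> idx (N j)"
  by (auto simp: infinite_direct_sum_def)

lemma tens_bas_bas: "bas (prod_encode (i, j)) = tens (bas i) (bas j)" by simp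

lemma lin_act_ds: "lin (act (infinite_direct_sum N) x)"
  by (simp add: infinite_direct_sum_def lin_lin_ext)

lemma act_ds:
  assumes "lin (act (N j) x)"
  shows "act (infinite_direct_sum N) x (tens (bas j) v) = tens (bas j) (act (N j) x v)"
proof -
  have "(\<lambda>v. act (infinite_direct_sum N) x (tens (bas j) v)) = (\<lambda>v. tens (bas j) (act (N j) x v))"
    by (rule lin_eqI[OF lin_comp'[OF lin_act_ds tens_lin_right] lin_comp'[OF tens_lin_right assms]])
       (simp add: infinite_direct_sum_def)
  then show ?thesis by (rule fun_cong)
qed

lemma lie_module_ds:
  assumes N: "\<And>j. lie_module \<gg> (N j)"
  shows "lie_module \<gg> (infinite_direct_sum N)"
proof -
  let ?D = "infinite_direct_sum N"
  note ad = act_ds[OF lie_module_lin[OF N]]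
  have lm: "act ?D x \<in> lin_maps (idx ?D) (idx ?D)" if x: "x \<in> lcarrier \<gg>" for x
  proof (rule lin_mapsI[OF lin_act_ds])
    fix k
    obtain j i where k: "k = prod_encode (j, i)" by (metis prod_decode_inverse surj_pair)
    show "k \<in> idx ?D \<Longrightarrow> act ?D x (bas k) \<in> space_on (idx ?D)"
    proof -
      have "tens (bas j) (act (N j) x (bas i)) \<in> space_on (pe {j} (idx (N j)))"
        by (intro tens_space) (auto simp: lie_module_space[OF N x])
      moreover have "pe {j} (idx (N j)) \<subseteq> idx ?D" by (auto simp: infinite_direct_sum_def)
      ultimately show ?thesis
        unfolding k tens_bas_bas ad[OF x] by (auto simp: space_on_def)
    qed
    show "k \<notin> idx ?D \<Longrightarrow> act ?D x (bas k) = 0"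
      unfolding k tens_bas_bas ad[OF x] idx_ds
      by (simp add: tens_simps lin_maps_off[OF lie_module_lin_maps[OF N x]] idx_ds)
  qed
  have "act ?D (x + y) = act ?D x + act ?D y" if x: "x \<in> lcarrier \<gg>" "y \<in> lcarrier \<gg>" for x y
  proof (rule lin_eq_tensI[OF lin_act_ds lin_plus[OF lin_act_ds lin_act_ds]])
    fix j i
    have e: "act (N j) (x + y) = act (N j) x + act (N j) y" using N[of j] x by (auto simp: lie_module_def)
    have "lin (act (N j) (x + y))" by (simp add: e lin_plus lie_module_lin[OF N] x)
    from act_ds[where N = N and j = j, OF this] show "act ?D (x + y) (tens (bas j) (bas i)) = (act ?D x + act ?D y) (tens (bas j) (bas i))"
      by (simp add: e ad x tens_simps del: tens_bas)
  qed
  moreover have "act ?D (lscale \<gg> c x) v = scl c (act ?D x v)" if x: "x \<in> lcarrier \<gg>" for c x v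
  proof -
    have "act ?D (lscale \<gg> c x) = (\<lambda>v. scl c (act ?D x v))"
    proof (rule lin_eq_tensI[OF lin_act_ds lin_scl'[OF lin_act_ds]])
      fix j i
      have e: "act (N j) (lscale \<gg> c x) = (\<lambda>v. scl c (act (N j) x v))" using N[of j] x by (auto simp: lie_module_def)
      have "lin (act (N j) (lscale \<gg> c x))" by (simp add: e lin_scl' lie_module_lin[OF N] x)
      from act_ds[where N = N and j = j, OF this] show "act ?D (lscale \<gg> c x) (tens (bas j) (bas i)) = scl c (act ?D x (tens (bas j) (bas i)))"
        by (simp add: e ad x tens_simps del: tens_bas)
    qed
    then show ?thesis by (rule fun_cong)
  qed
  moreover have "act ?D (lbracket \<gg> x y) v = act ?D x (act ?D y v) - act ?D y (act ?D x v)"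
    if x: "x \<in> lcarrier \<gg>" "y \<in> lcarrier \<gg>" for x y v
  proof -
    have "act ?D (lbracket \<gg> x y) = (\<lambda>v. act ?D x (act ?D y v) - act ?D y (act ?D x v))"
    proof (rule lin_eq_tensI[OF lin_act_ds lin_minus'[OF lin_comp'[OF lin_act_ds lin_act_ds] lin_comp'[OF lin_act_ds lin_act_ds]]])
      fix j i
      have e: "act (N j) (lbracket \<gg> x y) = (\<lambda>v. act (N j) x (act (N j) y v) - act (N j) y (act (N j) x v))"
        using N[of j] x by (auto simp: lie_module_def)
      have "lin (act (N j) (lbracket \<gg> x y))"
        unfolding e by (rule lin_maps_lin[OF lin_maps_commutator[OF lie_module_lin_maps[OF N x(1)] lie_module_lin_maps[OF N x(2)]]])
      from act_ds[where N = N and j = j, OF this] show "act ?D (lbracket \<gg> x y) (tens (bas j) (bas i)) =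
          act ?D x (act ?D y (tens (bas j) (bas i))) - act ?D y (act ?D x (tens (bas j) (bas i)))"
        by (simp add: e ad x tens_simps del: tens_bas)
    qed
    then show ?thesis by (rule fun_cong)
  qed
  ultimately show ?thesis using lm by (simp add: lie_module_def)
qed

lemma lin_sinj: "lin (sinj N j)"
  unfolding sinj_def by (intro lin_comp'[OF tens_lin_right lin_id_on])

lemma lin_sproj: "lin (sproj N j)"
  by (simp add: sproj_def lin_lin_ext)

lemma sproj_tens: "sproj N j (tens (bas j') v) = (if j' = j then id_on (idx (N j)) v else 0)"
proof -
  have "(\<lambda>v. sproj N j (tens (bas j') v)) = (\<lambda>v. if j' = j then id_on (idx (N j)) v else 0)"
    by (rule lin_eqI[OF lin_comp'[OF lin_sproj tens_lin_right]])
       (cases "j' = j"; simp add: sproj_def lin_id_on lin_zero)+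
  then show ?thesis by (rule fun_cong)
qed

lemma id_on_idem [simp]: "id_on I (id_on I v) = id_on I v"
  by (simp add: id_on_id id_on_space)

lemma sproj_sinj: "sproj N j \<circ> sinj N j' = (if j = j' then id_on (idx (N j)) else 0)"
  by (auto simp: fun_eq_iff sinj_def sproj_tens)

lemma sinj_hom:
  assumes N: "\<And>j. lie_module \<gg> (N j)"
  shows "sinj N j \<in> module_homs \<gg> (N j) (infinite_direct_sum N)"
proof (rule module_homsI)
  show "sinj N j \<in> lin_maps (idx (N j)) (idx (infinite_direct_sum N))"
    by (rule lin_mapsI[OF lin_sinj]) (auto simp: sinj_def id_on_bas tens_simps idx_ds)
qed (auto simp: sinj_def act_ds lie_module_lin[OF N] lin_maps_id_right[OF lie_module_lin_maps[OF N]]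
       lin_maps_id_left[OF lie_module_lin_maps[OF N]])

lemma sproj_hom:
  assumes N: "\<And>j. lie_module \<gg> (N j)"
  shows "sproj N j \<in> module_homs \<gg> (infinite_direct_sum N) (N j)"
proof (rule module_homsI)
  show "sproj N j \<in> lin_maps (idx (infinite_direct_sum N)) (idx (N j))"
  proof (rule lin_mapsI[OF lin_sproj])
    fix k
    obtain j' i where k: "k = prod_encode (j', i)" by (metis prod_decode_inverse surj_pair)
    show "k \<in> idx (infinite_direct_sum N) \<Longrightarrow> sproj N j (bas k) \<in> space_on (idx (N j))"
      by (auto simp: k tens_bas_bas sproj_tens id_on_space space_on_0 simp del: tens_bas)
    show "k \<notin> idx (infinite_direct_sum N) \<Longrightarrow> sproj N j (bas k) = 0"
      unfolding k idx_ds by (auto simp: tens_bas_bas sproj_tens id_on_bas simp del: tens_bas)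
  qed
  fix x v assume x: "x \<in> lcarrier \<gg>"
  have "sproj N j \<circ> act (infinite_direct_sum N) x = act (N j) x \<circ> sproj N j"
    by (rule lin_eq_tensI)
       (auto intro!: lin_comp lin_sproj lin_act_ds lie_module_lin[OF N x] simp del: tens_bas
         simp: act_ds lie_module_lin[OF N x] sproj_tens lin_0[OF lie_module_lin[OF N x]]
           lin_maps_id_right[OF lie_module_lin_maps[OF N x]] lin_maps_id_left[OF lie_module_lin_maps[OF N x]])
  then show "sproj N j (act (infinite_direct_sum N) x v) = act (N j) x (sproj N j v)"
    by (metis comp_apply)
qed

definition zero_module :: "'g lie_mod" where
  "zero_module = \<lparr>idx = {}, act = (\<lambda>_ _. 0)\<rparr>"

lemma lie_module_zero: "lie_module \<gg> zero_module"
  by (auto simp: lie_module_def zero_module_def fun_eq_iff intro!: lin_mapsI lin_zero)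

text \<open>The list is padded with zero modules to a sequence, so that
  \<open>infinite_direct_sum\<close> also provides finite sums.\<close>

lemma dsum_exists:
  assumes "\<forall>X \<in> set Xs. lie_module \<gg> X"
  shows "\<exists>Z i p. dsum \<gg> Xs Z i p"
proof -
  define N where "N j = (if j < length Xs then Xs ! j else zero_module)" for j
  have N: "lie_module \<gg> (N j)" for j
    using assms by (simp add: N_def lie_module_zero)
  have N_eq: "N k = Xs ! k" if "k < length Xs" for k
    using that by (simp add: N_def)
  let ?Z = "infinite_direct_sum N"
  have lmi: "(\<Sum>k<length Xs. sinj N k \<circ> sproj N k) (tens (bas j) (bas i)) = id_on (idx ?Z) (tens (bas j) (bas i))" for i j
  proof -
    have "(\<Sum>k<length Xs. sinj N k \<circ> sproj N k) (tens (bas j) (bas i)) =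
      (\<Sum>k<length Xs. if k = j then sinj N j (id_on (idx (N j)) (bas i)) else 0)"
      unfolding sum_fun_apply by (intro sum.cong) (auto simp: sproj_tens lin_0[OF lin_sinj] simp del: tens_bas)
    also have "\<dots> = (if j < length Xs then tens (bas j) (id_on (idx (N j)) (bas i)) else 0)"
      by (simp add: sinj_def)
    also have "\<dots> = id_on (idx ?Z) (tens (bas j) (bas i))"
      by (auto simp: id_on_bas idx_ds N_def zero_module_def tens_simps)
    finally show ?thesis .
  qed
  have "(\<Sum>k<length Xs. sinj N k \<circ> sproj N k) = id_on (idx ?Z)"
    by (rule lin_eq_tensI[OF _ lin_id_on lmi], rule linI)
       (simp_all add: sum_fun_apply lin_simps[OF lin_sproj] lin_simps[OF lin_sinj] sum.distrib cvec.scale_sum_right)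
  then have "dsum \<gg> Xs ?Z (sinj N) (sproj N)"
    unfolding dsum_def
    using assms sinj_hom[of \<gg> N, OF N] sproj_hom[of \<gg> N, OF N] lie_module_ds[of \<gg> N, OF N]
    unfolding sproj_sinj by (simp add: N_eq[symmetric])
  then show ?thesis by blast
qed

subsection \<open>Simple modules\<close>

definition submodule :: "'g lie_alg \<Rightarrow> 'g lie_mod \<Rightarrow> cvec set \<Rightarrow> bool" where
  "submodule \<gg> M S \<longleftrightarrow> cvec.subspace S \<and> S \<subseteq> space_on (idx M) \<and> (\<forall>x \<in> lcarrier \<gg>. act M x ` S \<subseteq> S)"

lemma simple_submodule:
  "simple_module \<gg> M \<Longrightarrow> submodule \<gg> M S \<Longrightarrow> x \<in> S \<Longrightarrow> x \<noteq> 0 \<Longrightarrow> S = space_on (idx M)"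
  unfolding simple_module_def submodule_def by blast

lemma simple_lie_module: "simple_module \<gg> M \<Longrightarrow> lie_module \<gg> M"
  by (simp add: simple_module_def)

lemma simple_space_nz: "simple_module \<gg> M \<Longrightarrow> \<exists>k. bas k \<in> space_on (idx M)"
  by (auto simp: simple_module_def)

lemma submodule_kernel:
  assumes "lie_module \<gg> M" "lie_module \<gg> N" "f \<in> module_homs \<gg> M N"
  shows "submodule \<gg> M {v \<in> space_on (idx M). f v = 0}"
  unfolding submodule_def cvec.subspace_def
  using assms by (auto simp: lin_simps[OF module_homs_lin] space_on_0 space_on_add space_on_scl
      lie_module_space module_homs_act lin_simps[OF lie_module_lin])

lemma submodule_image:
  assumes "lie_module \<gg> M" "f \<in> module_homs \<gg> M N" "submodule \<gg> M S"
  shows "submodule \<gg> N (f ` S)"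
  unfolding submodule_def
proof (intro conjI ballI)
  have S: "cvec.subspace S" using assms(3) by (simp add: submodule_def)
  show "cvec.subspace (f ` S)"
    using S module_homs_lin[OF assms(2)] cp.linear_subspace_image by blast
  show "f ` S \<subseteq> space_on (idx N)" using module_homs_space[OF assms(2)] by auto
  show "act N x ` f ` S \<subseteq> f ` S" if "x \<in> lcarrier \<gg>" for x
    using assms(3) that module_homs_act[OF assms(2) that, symmetric]
    by (force simp: submodule_def image_iff)
qed

lemma hom_eq_zeroI:
  "f \<in> module_homs \<gg> M N \<Longrightarrow> (\<And>v. v \<in> space_on (idx M) \<Longrightarrow> f v = 0) \<Longrightarrow> f = 0"
  by (metis bas_space_on lin_eqI lin_maps_off lin_zero(2) module_homs_lin module_homs_lin_maps zero_fun_apply)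

lemma simple_hom_inj:
  assumes M: "simple_module \<gg> M" and N: "lie_module \<gg> N" and f: "f \<in> module_homs \<gg> M N" "f \<noteq> 0"
    and v: "v \<in> space_on (idx M)" "f v = 0"
  shows "v = 0"
proof (rule ccontr)
  assume "v \<noteq> 0"
  with v have "{v \<in> space_on (idx M). f v = 0} = space_on (idx M)"
    by (intro simple_submodule[OF M submodule_kernel[OF simple_lie_module[OF M] N f(1)]]) auto
  then have "f = 0" by (intro hom_eq_zeroI[OF f(1)]) auto
  with f(2) show False by simp
qed

lemma submodule_space: "lie_module \<gg> M \<Longrightarrow> submodule \<gg> M (space_on (idx M))"
  by (auto simp: submodule_def lie_module_space)

lemma simple_hom_surj:
  assumes M: "lie_module \<gg> M" and N: "simple_module \<gg> N" and f: "f \<in> module_homs \<gg> M N" "f \<noteq> 0"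
  shows "f ` space_on (idx M) = space_on (idx N)"
proof -
  obtain v where v: "v \<in> space_on (idx M)" "f v \<noteq> 0" using hom_eq_zeroI[OF f(1)] f(2) by blast
  then show ?thesis
    by (intro simple_submodule[OF N submodule_image[OF M f(1) submodule_space[OF M]], of "f v"]) auto
qed

text \<open>A homomorphism that is bijective on a submodule has a section with values in that submodule.\<close>

lemma section_hom:
  assumes Z: "lie_module \<gg> Z" and M: "lie_module \<gg> M" and p: "p \<in> module_homs \<gg> Z M"
    and T: "submodule \<gg> Z T" and inj: "\<And>z. z \<in> T \<Longrightarrow> p z = 0 \<Longrightarrow> z = 0"
    and surj: "space_on (idx M) \<subseteq> p ` T"
  obtains s where "s \<in> module_homs \<gg> M Z" "p \<circ> s = id_on (idx M)" "\<And>x. s x \<in> T" "\<And>z. z \<in> T \<Longrightarrow> s (p z) = z"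
proof -
  have sT: "cvec.subspace T" and TZ: "T \<subseteq> space_on (idx Z)"
    and Tact: "\<And>x z. x \<in> lcarrier \<gg> \<Longrightarrow> z \<in> T \<Longrightarrow> act Z x z \<in> T"
    using T by (auto simp: submodule_def)
  note lp = lin_simps[OF module_homs_lin[OF p]]
  have ij: "z = z'" if "z \<in> T" "z' \<in> T" "p z = p z'" for z z'
    using inj[of "z - z'"] that by (simp add: cvec.subspace_diff[OF sT] lp)
  define s where "s x = inv_into T p (id_on (idx M) x)" for x
  have sx: "s x \<in> T" "p (s x) = id_on (idx M) x" for x
    using surj id_on_space[of "idx M" x] by (auto simp: s_def inv_into_into f_inv_into_f)
  have u: "s x = z" if "z \<in> T" "p z = id_on (idx M) x" for x z
    by (rule ij) (use that sx in auto)
  have l: "lin s"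
    by (rule linI; rule u)
       (auto simp: sx cvec.subspace_add[OF sT] cvec.subspace_scale[OF sT] lp lin_simps[OF lin_id_on])
  have "s \<in> module_homs \<gg> M Z"
  proof (rule module_homsI[OF lin_mapsI[OF l]])
    show "s (bas k) \<in> space_on (idx Z)" for k using sx TZ by auto
    show "k \<notin> idx M \<Longrightarrow> s (bas k) = 0" for k
      by (rule u) (auto simp: cvec.subspace_0[OF sT] lp id_on_bas)
    fix x v assume x: "x \<in> lcarrier \<gg>"
    show "s (act M x v) = act Z x (s v)"
      by (rule u) (use x in \<open>auto simp: Tact sx module_homs_act[OF p] lin_maps_id_right[OF lie_module_lin_maps[OF M x]]
        lin_maps_id_left[OF lie_module_lin_maps[OF M x]]\<close>)
  qed
  moreover have "s (p z) = z" if "z \<in> T" for z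
    by (rule u) (use that TZ in \<open>auto simp: id_on_id module_homs_space[OF p]\<close>)
  ultimately show ?thesis using sx that by (auto simp: fun_eq_iff)
qed

lemma hom_bij_inverse:
  assumes "lie_module \<gg> M" "lie_module \<gg> N" "f \<in> module_homs \<gg> M N"
    "\<And>v. v \<in> space_on (idx M) \<Longrightarrow> f v = 0 \<Longrightarrow> v = 0" "space_on (idx N) \<subseteq> f ` space_on (idx M)"
  obtains g where "g \<in> module_homs \<gg> N M" "f \<circ> g = id_on (idx N)" "g \<circ> f = id_on (idx M)"
proof -
  obtain g where g: "g \<in> module_homs \<gg> N M" "f \<circ> g = id_on (idx N)"
    "\<And>x. g x \<in> space_on (idx M)" "\<And>z. z \<in> space_on (idx M) \<Longrightarrow> g (f z) = z"
    using section_hom[OF assms(1,2,3) submodule_space[OF assms(1)] assms(4,5)] by blast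
  have "g \<circ> f = id_on (idx M)"
    by (rule lin_maps_eqI[OF lin_maps_comp[OF module_homs_lin_maps[OF assms(3)] module_homs_lin_maps[OF g(1)]] id_on_lin_maps])
       (auto simp: g(4) id_on_bas)
  then show ?thesis using g that by blast
qed

lemma simple_hom_inverse:
  assumes "simple_module \<gg> M" "simple_module \<gg> N" "f \<in> module_homs \<gg> M N" "f \<noteq> 0"
  obtains g where "g \<in> module_homs \<gg> N M" "f \<circ> g = id_on (idx N)" "g \<circ> f = id_on (idx M)"
proof (rule hom_bij_inverse[OF simple_lie_module[OF assms(1)] simple_lie_module[OF assms(2)] assms(3)])
  show "v = 0" if "v \<in> space_on (idx M)" "f v = 0" for v
    using simple_hom_inj[OF assms(1) simple_lie_module[OF assms(2)] assms(3,4) that] .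
  show "space_on (idx N) \<subseteq> f ` space_on (idx M)"
    using simple_hom_surj[OF simple_lie_module[OF assms(1)] assms(2,3,4)] by simp
qed (rule that)

subsection \<open>Sums of simple modules are direct sums\<close>

definition sum_image :: "('i \<Rightarrow> 'g lie_mod) \<Rightarrow> ('i \<Rightarrow> cvec \<Rightarrow> cvec) \<Rightarrow> 'i set \<Rightarrow> cvec set" where
  "sum_image V \<phi> K = {\<Sum>k\<in>K. \<phi> k (x k) | x. \<forall>k\<in>K. x k \<in> space_on (idx (V k))}"

definition sum_indep :: "('i \<Rightarrow> 'g lie_mod) \<Rightarrow> ('i \<Rightarrow> cvec \<Rightarrow> cvec) \<Rightarrow> 'i set \<Rightarrow> bool" where
  "sum_indep V \<phi> K \<longleftrightarrow> (\<forall>x. (\<forall>k\<in>K. x k \<in> space_on (idx (V k))) \<longrightarrow> (\<Sum>k\<in>K. \<phi> k (x k)) = 0 \<longrightarrow> (\<forall>k\<in>K. x k = 0))"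

lemma submodule_sum_image:
  assumes T: "lie_module \<gg> T" and V: "\<And>k. k \<in> K \<Longrightarrow> lie_module \<gg> (V k)"
    and \<phi>: "\<And>k. k \<in> K \<Longrightarrow> \<phi> k \<in> module_homs \<gg> (V k) T"
  shows "submodule \<gg> T (sum_image V \<phi> K)"
proof -
  note l = lin_simps[OF module_homs_lin[OF \<phi>]]
  have "sum_image V \<phi> K \<subseteq> space_on (idx T)"
    by (auto simp: sum_image_def intro!: space_on_sum module_homs_space[OF \<phi>])
  moreover have "cvec.subspace (sum_image V \<phi> K)"
    unfolding cvec.subspace_def
  proof (intro conjI ballI allI)
    show "0 \<in> sum_image V \<phi> K"
      unfolding sum_image_def by (rule CollectI, rule exI[of _ "\<lambda>_. 0"]) (auto simp: l space_on_0)
  next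
    fix a b assume "a \<in> sum_image V \<phi> K" "b \<in> sum_image V \<phi> K"
    then obtain x y where "a = (\<Sum>k\<in>K. \<phi> k (x k))" "b = (\<Sum>k\<in>K. \<phi> k (y k))"
      "\<forall>k\<in>K. x k \<in> space_on (idx (V k))" "\<forall>k\<in>K. y k \<in> space_on (idx (V k))"
      by (auto simp: sum_image_def)
    then show "a + b \<in> sum_image V \<phi> K"
      unfolding sum_image_def
      by (intro CollectI exI[of _ "\<lambda>k. x k + y k"]) (auto simp: l space_on_add sum.distrib)
  next
    fix c a assume "a \<in> sum_image V \<phi> K"
    then obtain x where "a = (\<Sum>k\<in>K. \<phi> k (x k))" "\<forall>k\<in>K. x k \<in> space_on (idx (V k))"
      by (auto simp: sum_image_def)
    then show "scl c a \<in> sum_image V \<phi> K"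
      unfolding sum_image_def
      by (intro CollectI exI[of _ "\<lambda>k. scl c (x k)"]) (auto simp: l space_on_scl cvec.scale_sum_right)
  qed
  moreover have "act T g a \<in> sum_image V \<phi> K" if g: "g \<in> lcarrier \<gg>" and a: "a \<in> sum_image V \<phi> K" for g a
  proof -
    obtain x where "a = (\<Sum>k\<in>K. \<phi> k (x k))" "\<forall>k\<in>K. x k \<in> space_on (idx (V k))"
      using a unfolding sum_image_def by blast
    then show ?thesis
      unfolding sum_image_def
      by (intro CollectI exI[of _ "\<lambda>k. act (V k) g (x k)"])
         (auto simp: lie_module_space[OF V g] lin_sum[OF lie_module_lin[OF T g]] module_homs_act[OF \<phi> g])
  qed
  ultimately show ?thesis by (auto simp: submodule_def)
qed

lemma sum_image_insert:
  assumes "finite K" "a \<notin> K"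
  shows "t \<in> sum_image V \<phi> (insert a K) \<longleftrightarrow>
    (\<exists>y r. y \<in> space_on (idx (V a)) \<and> r \<in> sum_image V \<phi> K \<and> t = \<phi> a y + r)"
proof
  assume "t \<in> sum_image V \<phi> (insert a K)"
  then obtain x where "t = (\<Sum>k\<in>insert a K. \<phi> k (x k))" "\<forall>k\<in>insert a K. x k \<in> space_on (idx (V k))"
    by (auto simp: sum_image_def)
  then show "\<exists>y r. y \<in> space_on (idx (V a)) \<and> r \<in> sum_image V \<phi> K \<and> t = \<phi> a y + r"
    using assms by (intro exI[of _ "x a"] exI[of _ "\<Sum>k\<in>K. \<phi> k (x k)"]) (auto simp: sum_image_def)
next
  assume "\<exists>y r. y \<in> space_on (idx (V a)) \<and> r \<in> sum_image V \<phi> K \<and> t = \<phi> a y + r"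
  then obtain y x where *: "y \<in> space_on (idx (V a))" "\<forall>k\<in>K. x k \<in> space_on (idx (V k))"
    "t = \<phi> a y + (\<Sum>k\<in>K. \<phi> k (x k))" by (auto simp: sum_image_def)
  have "(\<Sum>k\<in>K. \<phi> k ((x(a := y)) k)) = (\<Sum>k\<in>K. \<phi> k (x k))"
    using assms by (intro sum.cong) auto
  then have "t = (\<Sum>k\<in>insert a K. \<phi> k ((x(a := y)) k))" using assms * by simp
  then show "t \<in> sum_image V \<phi> (insert a K)"
    unfolding sum_image_def using * by (intro CollectI exI[of _ "x(a := y)"]) auto
qed

text \<open>Greedy selection: the part of the next simple module that is mapped into the sum
  selected so far is a submodule. It is either everything, and the module is skipped, or zero, and
  independence is preserved.\<close>

lemma sum_of_simples:
  assumes "finite K" and T: "lie_module \<gg> T" and "\<And>k. k \<in> K \<Longrightarrow> simple_module \<gg> (V k)"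
    and "\<And>k. k \<in> K \<Longrightarrow> \<phi> k \<in> module_homs \<gg> (V k) T"
  obtains J where "J \<subseteq> K" "sum_indep V \<phi> J" "sum_image V \<phi> J = sum_image V \<phi> K"
proof -
  have "\<exists>J \<subseteq> K. sum_indep V \<phi> J \<and> sum_image V \<phi> J = sum_image V \<phi> K"
    using assms(1,3,4)
  proof (induction K rule: finite_induct)
    case empty
    then show ?case by (auto simp: sum_indep_def)
  next
    case (insert a K)
    then obtain J where J: "J \<subseteq> K" "sum_indep V \<phi> J" "sum_image V \<phi> J = sum_image V \<phi> K" by auto
    have fJ: "finite J" "a \<notin> J" using J insert finite_subset by auto
    have Va: "simple_module \<gg> (V a)" and \<phi>a: "\<phi> a \<in> module_homs \<gg> (V a) T" using insert.prems by auto
    have sub: "submodule \<gg> T (sum_image V \<phi> J)"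
      by (rule submodule_sum_image[OF T]) (use J insert.prems in \<open>auto intro: simple_lie_module\<close>)
    then have sR: "cvec.subspace (sum_image V \<phi> J)" by (simp add: submodule_def)
    define U where "U = {y \<in> space_on (idx (V a)). \<phi> a y \<in> sum_image V \<phi> J}"
    have U: "submodule \<gg> (V a) U"
      using sub unfolding submodule_def U_def cvec.subspace_def
      by (auto simp: lin_simps[OF module_homs_lin[OF \<phi>a]] space_on_0 space_on_add space_on_scl
          lie_module_space[OF simple_lie_module[OF Va]] module_homs_act[OF \<phi>a] image_subset_iff)
    show ?case
    proof (cases "U = {0}")
      case False
      have "0 \<in> U" using U by (auto simp: submodule_def cvec.subspace_def)
      with False obtain y where "y \<in> U" "y \<noteq> 0" by blast
      from simple_submodule[OF Va U this] have "\<phi> a y \<in> sum_image V \<phi> J" if "y \<in> space_on (idx (V a))" for y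
        using that by (auto simp: U_def)
      then have "t \<in> sum_image V \<phi> (insert a K) \<longleftrightarrow> t \<in> sum_image V \<phi> J" for t
        unfolding sum_image_insert[OF insert.hyps] J(3)[symmetric]
        using cvec.subspace_add[OF sR] by (metis add_0 lin_0[OF module_homs_lin[OF \<phi>a]] space_on_0)
      then show ?thesis using J by blast
    next
      case True
      have "sum_image V \<phi> (insert a J) = sum_image V \<phi> (insert a K)"
        using sum_image_insert[OF insert.hyps] sum_image_insert[OF fJ] J(3) by blast
      moreover have "sum_indep V \<phi> (insert a J)"
        unfolding sum_indep_def
      proof (intro allI impI)
        fix x assume x: "\<forall>k\<in>insert a J. x k \<in> space_on (idx (V k))" "(\<Sum>k\<in>insert a J. \<phi> k (x k)) = 0"
        then have e: "\<phi> a (x a) = - (\<Sum>k\<in>J. \<phi> k (x k))" using fJ by (simp add: add_eq_0_iff)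
        have "(\<Sum>k\<in>J. \<phi> k (x k)) \<in> sum_image V \<phi> J" using x by (auto simp: sum_image_def)
        then have "x a \<in> U" using e x cvec.subspace_neg[OF sR] by (auto simp: U_def)
        then have "x a = 0" using True by simp
        moreover from this have "(\<Sum>k\<in>J. \<phi> k (x k)) = 0"
          using e lin_0[OF module_homs_lin[OF \<phi>a]] by simp
        ultimately show "\<forall>k\<in>insert a J. x k = 0" using J(2) x(1) by (auto simp: sum_indep_def)
      qed
      ultimately show ?thesis using J(1) by blast
    qed
  qed
  then show ?thesis using that by blast
qed

text \<open>The projections are the coordinate functions. A choice of coordinates exists by
  spanning; it is unique by independence, and uniqueness makes it linear and equivariant.\<close>

lemma dsum_of_indep:
  assumes T: "lie_module \<gg> T" and V: "\<And>k. k < n \<Longrightarrow> lie_module \<gg> (V k)"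
    and \<phi>: "\<And>k. k < n \<Longrightarrow> \<phi> k \<in> module_homs \<gg> (V k) T"
    and ind: "sum_indep V \<phi> {..<n}" and im: "space_on (idx T) \<subseteq> sum_image V \<phi> {..<n}"
  shows "\<exists>p. dsum \<gg> (map V [0..<n]) T \<phi> p"
proof -
  note l = lin_simps[OF module_homs_lin[OF \<phi>]]
  let ?ok = "\<lambda>x t. (\<forall>k<n. x k \<in> space_on (idx (V k))) \<and> id_on (idx T) t = (\<Sum>k<n. \<phi> k (x k))"
  define co where "co t = (SOME x. ?ok x t)" for t
  have ex: "\<exists>x. ?ok x t" for t
  proof -
    have "id_on (idx T) t \<in> sum_image V \<phi> {..<n}" using im id_on_space by blast
    then obtain x where "\<forall>k\<in>{..<n}. x k \<in> space_on (idx (V k))" "id_on (idx T) t = (\<Sum>k<n. \<phi> k (x k))"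
      unfolding sum_image_def by blast
    then show ?thesis by (intro exI[of _ x]) auto
  qed
  have co: "?ok (co t) t" for t
    unfolding co_def by (rule someI_ex[OF ex])
  have uq: "co t k = x k" if "k < n" "\<forall>k<n. x k \<in> space_on (idx (V k))" "id_on (idx T) t = (\<Sum>k<n. \<phi> k (x k))" for t x k
  proof -
    have "(\<Sum>k<n. \<phi> k (co t k - x k)) = 0"
      using co[of t] that by (simp add: l sum_subtractf)
    moreover have "\<forall>k\<in>{..<n}. co t k - x k \<in> space_on (idx (V k))" using co that by (auto simp: space_on_diff)
    ultimately have "\<forall>k\<in>{..<n}. co t k - x k = 0"
      using ind[unfolded sum_indep_def, rule_format, of "\<lambda>k. co t k - x k"] by blast
    then show ?thesis using that(1) by simp
  qed
  define p where "p k t = co t k" for k t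
  have lp: "lin (p k)" if k: "k < n" for k
  proof (rule linI)
    show "p k (x + y) = p k x + p k y" for x y
      unfolding p_def using co by (intro uq[of k "\<lambda>k. co x k + co y k"] k) (auto simp: l lin_add[OF lin_id_on] space_on_add sum.distrib)
    show "p k (scl c x) = scl c (p k x)" for c x
      unfolding p_def using co by (intro uq[of k "\<lambda>k. scl c (co x k)"] k) (auto simp: l lin_scl[OF lin_id_on] space_on_scl cvec.scale_sum_right)
  qed
  have hp: "p k \<in> module_homs \<gg> T (V k)" if k: "k < n" for k
  proof (rule module_homsI[OF lin_mapsI[OF lp[OF k]]])
    show "p k (bas j) \<in> space_on (idx (V k))" for j using co k by (simp add: p_def)
    show "j \<notin> idx T \<Longrightarrow> p k (bas j) = 0" for j
      unfolding p_def by (rule uq[OF k, of "\<lambda>_. 0"]) (auto simp: l id_on_bas space_on_0)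
    show "p k (act T x t) = act (V k) x (p k t)" if x: "x \<in> lcarrier \<gg>" for x t
      unfolding p_def
    proof (intro uq[of k "\<lambda>k. act (V k) x (co t k)"] k allI impI)
      have "id_on (idx T) (act T x t) = act T x (id_on (idx T) t)"
        by (simp add: lin_maps_id_left[OF lie_module_lin_maps[OF T x]] lin_maps_id_right[OF lie_module_lin_maps[OF T x]])
      then show "id_on (idx T) (act T x t) = (\<Sum>k<n. \<phi> k (act (V k) x (co t k)))"
        using co[of t] by (simp add: lin_sum[OF lie_module_lin[OF T x]] module_homs_act[OF \<phi> x])
    qed (use V x in \<open>auto intro: lie_module_space\<close>)
  qed
  have pi: "p k \<circ> \<phi> m = (if k = m then id_on (idx (V k)) else 0)" if k: "k < n" and m: "m < n" for k m
  proof
    fix v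
    have "co (\<phi> m v) k = (if k = m then id_on (idx (V k)) v else 0)"
    proof (rule uq[OF k, of "\<lambda>k. if k = m then id_on (idx (V k)) v else 0"])
      show "id_on (idx T) (\<phi> m v) = (\<Sum>k<n. \<phi> k (if k = m then id_on (idx (V k)) v else 0))"
      proof -
        have "(\<Sum>k<n. \<phi> k (if k = m then id_on (idx (V k)) v else 0)) = (\<Sum>k<n. if k = m then \<phi> m (id_on (idx (V m)) v) else 0)"
          by (intro sum.cong) (auto simp: l)
        then show ?thesis using m
          by (simp add: lin_maps_id_right[OF module_homs_lin_maps[OF \<phi>]] id_on_id module_homs_space[OF \<phi>])
      qed
    qed (auto simp: id_on_space space_on_0)
    then show "(p k \<circ> \<phi> m) v = (if k = m then id_on (idx (V k)) else 0) v" by (simp add: p_def)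
  qed
  have "(\<Sum>k<n. \<phi> k \<circ> p k) = id_on (idx T)"
    using co by (auto simp: fun_eq_iff sum_fun_apply p_def)
  then show ?thesis
    using T V \<phi> hp pi by (intro exI[of _ p]) (auto simp: dsum_def)
qed

subsection \<open>Semisimple categories of modules\<close>

global_interpretation maps: vector_space "\<lambda>c (f :: cvec \<Rightarrow> cvec) v. scl c (f v)"
  by (rule vector_space_maps)

lemma module_homs_diff:
  "lie_module \<gg> N \<Longrightarrow> f \<in> module_homs \<gg> M N \<Longrightarrow> g \<in> module_homs \<gg> M N \<Longrightarrow> f - g \<in> module_homs \<gg> M N"
  using module_homs_add[OF _ _ module_homs_scl[of \<gg> N g M "-1"], of f]
  by (simp add: fun_diff_def plus_fun_def)

lemma module_homs_sum:
  "lie_module \<gg> N \<Longrightarrow> (\<And>a. a \<in> A \<Longrightarrow> f a \<in> module_homs \<gg> M N) \<Longrightarrow> sum f A \<in> module_homs \<gg> M N"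
  by (induction A rule: infinite_finite_induct) (auto intro: module_homs_0 module_homs_add)

text \<open>Schur's lemma as an axiom on a set of modules. The members may be infinite dimensional,
  so scalar endomorphisms are demanded rather than deduced; distinct members are in particular not
  isomorphic.\<close>

definition schur_family :: "'g::ab_group_add lie_alg \<Rightarrow> 'g lie_mod set \<Rightarrow> bool" where
  "schur_family \<gg> S \<longleftrightarrow> (\<forall>V\<in>S. lie_module \<gg> V \<and> idx V \<noteq> {} \<and>
     (\<forall>f \<in> module_homs \<gg> V V. \<exists>c. f = (\<lambda>v. scl c (id_on (idx V) v))) \<and>
     (\<forall>W\<in>S. V \<noteq> W \<longrightarrow> module_homs \<gg> V W = {0}))"

lemma schur_familyD:
  assumes "schur_family \<gg> S" "V \<in> S"
  shows "lie_module \<gg> V" "idx V \<noteq> {}" "f \<in> module_homs \<gg> V V \<Longrightarrow> \<exists>c. f = (\<lambda>v. scl c (id_on (idx V) v))"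
    "W \<in> S \<Longrightarrow> f \<in> module_homs \<gg> V W \<Longrightarrow> f \<noteq> 0 \<Longrightarrow> V = W"
  using assms by (auto simp: schur_family_def)

text \<open>\<open>Fac \<gg> S X Y\<close> is the ideal of the morphisms that factor through finite direct sums of members of \<open>S\<close>.\<close>

inductive_set Fac :: "'g::ab_group_add lie_alg \<Rightarrow> 'g lie_mod set \<Rightarrow> 'g lie_mod \<Rightarrow> 'g lie_mod \<Rightarrow> (cvec \<Rightarrow> cvec) set"
  for \<gg> S X Y where
    zero: "0 \<in> Fac \<gg> S X Y"
  | step: "f \<in> Fac \<gg> S X Y \<Longrightarrow> V \<in> S \<Longrightarrow> i \<in> module_homs \<gg> X V \<Longrightarrow> p \<in> module_homs \<gg> V Y \<Longrightarrow> (p \<circ> i) + f \<in> Fac \<gg> S X Y"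

lemma Fac_add: "f \<in> Fac \<gg> S X Y \<Longrightarrow> g \<in> Fac \<gg> S X Y \<Longrightarrow> f + g \<in> Fac \<gg> S X Y"
proof (induction rule: Fac.induct)
  case (step f V i p)
   have "(p \<circ> i) + f + g = (p \<circ> i) + (f + g)" by (rule add.assoc)
  then show ?case using Fac.step[OF step.IH[OF step.prems] step.hyps(2-)] by (simp only:)
qed auto

lemma Fac_sum: "(\<And>a. a \<in> A \<Longrightarrow> f a \<in> Fac \<gg> S X Y) \<Longrightarrow> sum f A \<in> Fac \<gg> S X Y"
  by (induction A rule: infinite_finite_induct) (auto intro: Fac.zero Fac_add)

lemma Fac_base: "V \<in> S \<Longrightarrow> i \<in> module_homs \<gg> X V \<Longrightarrow> p \<in> module_homs \<gg> V Y \<Longrightarrow> p \<circ> i \<in> Fac \<gg> S X Y"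
  using Fac.step[OF Fac.zero] by fastforce

lemma Fac_left: "f \<in> Fac \<gg> S X Y \<Longrightarrow> g \<in> module_homs \<gg> Y Z \<Longrightarrow> g \<circ> f \<in> Fac \<gg> S X Z"
proof (induction rule: Fac.induct)
  case zero
  then have "g \<circ> 0 = 0" by (auto simp: lin_0[OF module_homs_lin])
  then show ?case using Fac.zero by metis
next
  case (step f V i p)
  then  have "g \<circ> ((p \<circ> i) + f) = ((g \<circ> p) \<circ> i) + (g \<circ> f)" by (auto simp: lin_add[OF module_homs_lin])
  then show ?case
    using Fac.step[OF step.IH[OF step.prems] step.hyps(2,3) module_homs_comp[OF step.hyps(4) step.prems]] by metis
qed

lemma Fac_right: "f \<in> Fac \<gg> S Y Z \<Longrightarrow> g \<in> module_homs \<gg> X Y \<Longrightarrow> f \<circ> g \<in> Fac \<gg> S X Z"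
proof (induction rule: Fac.induct)
  case zero
  have "0 \<circ> g = 0" by auto
  then show ?case using Fac.zero by metis
next
  case (step f V i p)
   have "((p \<circ> i) + f) \<circ> g = (p \<circ> (i \<circ> g)) + (f \<circ> g)" by auto
  then show ?case
    using Fac.step[OF step.IH[OF step.prems] step.hyps(2) module_homs_comp[OF step.prems step.hyps(3)] step.hyps(4)] by metis
qed

lemma Fac_rep:
  assumes "f \<in> Fac \<gg> S X Y"
  obtains K :: "nat set" and V i p where "finite K" "\<And>k. k \<in> K \<Longrightarrow> V k \<in> S"
    "\<And>k. k \<in> K \<Longrightarrow> i k \<in> module_homs \<gg> X (V k)" "\<And>k. k \<in> K \<Longrightarrow> p k \<in> module_homs \<gg> (V k) Y"
    "f = (\<Sum>k\<in>K. p k \<circ> i k)"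
proof -
  have "\<exists>(n::nat) V i p. (\<forall>k<n. V k \<in> S \<and> i k \<in> module_homs \<gg> X (V k) \<and> p k \<in> module_homs \<gg> (V k) Y) \<and>
      f = (\<Sum>k<n. p k \<circ> i k)" using assms
  proof (induction rule: Fac.induct)
    case zero
    show ?case by (intro exI[of _ "0::nat"]) (auto simp: fun_eq_iff)
  next
    case (step f V0 i0 p0)
    then obtain n :: nat and V i p where "\<forall>k<n. V k \<in> S \<and> i k \<in> module_homs \<gg> X (V k) \<and> p k \<in> module_homs \<gg> (V k) Y"
      "f = (\<Sum>k<n. p k \<circ> i k)" by blast
    with step.hyps show ?case
      by - (rule exI[of _ "Suc n"], rule exI[of _ "case_nat V0 V"], rule exI[of _ "case_nat i0 i"],
          rule exI[of _ "case_nat p0 p"], auto simp: sum.lessThan_Suc_shift fun_eq_iff sum_fun_apply split: nat.split simp del: sum.lessThan_Suc)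
  qed
  then obtain n :: nat and V i p where "\<forall>k<n. V k \<in> S \<and> i k \<in> module_homs \<gg> X (V k) \<and> p k \<in> module_homs \<gg> (V k) Y"
      "f = (\<Sum>k<n. p k \<circ> i k)" by blast
  then show ?thesis using that[of "{..<n}" V i p] by simp
qed

text \<open>A decomposition of the idempotent \<open>e\<close> into orthogonal idempotents with
  images isomorphic to members of \<open>S\<close>. For the identity it is a direct sum
  decomposition.\<close>

definition orth :: "'g::ab_group_add lie_alg \<Rightarrow> 'g lie_mod set \<Rightarrow> 'g lie_mod \<Rightarrow> 'g lie_mod list \<Rightarrow>
   (nat \<Rightarrow> cvec \<Rightarrow> cvec) \<Rightarrow> (nat \<Rightarrow> cvec \<Rightarrow> cvec) \<Rightarrow> (cvec \<Rightarrow> cvec) \<Rightarrow> bool" where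
  "orth \<gg> S X Ws s r e \<longleftrightarrow> set Ws \<subseteq> S \<and>
     (\<forall>m < length Ws. s m \<in> module_homs \<gg> (Ws ! m) X \<and> r m \<in> module_homs \<gg> X (Ws ! m)) \<and>
     (\<forall>m < length Ws. \<forall>n < length Ws. r m \<circ> s n = (if m = n then id_on (idx (Ws ! m)) else 0)) \<and>
     (\<Sum>m < length Ws. s m \<circ> r m) = e"

lemma orth_apply:
  assumes "orth \<gg> S X Ws s r e" "m < length Ws" "n < length Ws"
  shows "r m (s n v) = (if m = n then id_on (idx (Ws ! m)) v else 0)"
proof -
  have "r m \<circ> s n = (if m = n then id_on (idx (Ws ! m)) else 0)" using assms by (simp add: orth_def)
  from fun_cong[OF this, of v] show ?thesis by (cases "m = n") simp_all
qed

lemma dsum_apply: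
  assumes "dsum \<gg> Xs Z i p" "m < length Xs" "n < length Xs"
  shows "p m (i n v) = (if m = n then id_on (idx (Xs ! m)) v else 0)"
proof -
  have "p m \<circ> i n = (if m = n then id_on (idx (Xs ! m)) else 0)" using assms by (simp add: dsum_def)
  from fun_cong[OF this, of v] show ?thesis by (cases "m = n") simp_all
qed

lemma dsum_homs:
  assumes "dsum \<gg> Xs Z i p" "k < length Xs"
  shows "i k \<in> module_homs \<gg> (Xs ! k) Z" "p k \<in> module_homs \<gg> Z (Xs ! k)"
  using assms by (simp_all add: dsum_def)

lemma dsum_id:
  assumes "dsum \<gg> Xs Z i p"
  shows "id_on (idx Z) v = (\<Sum>k<length Xs. i k (p k v))"
proof -
  have "(\<Sum>k<length Xs. i k \<circ> p k) = id_on (idx Z)" using assms by (simp add: dsum_def)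
  from fun_cong[OF this, of v] show ?thesis by (simp add: sum_fun_apply)
qed

text \<open>If \<open>e = \<Sum> p k \<circ> i k\<close> is idempotent and \<open>i k \<circ> e \<circ> p l \<noteq> 0\<close>, then \<open>e \<circ> p l\<close> splits off a
  summand, and the \<open>l\<close>-th term disappears from the complementary idempotent.\<close>

lemma idempotent_orth:
  fixes K :: "nat set"
  assumes S: "schur_family \<gg> S" and X: "lie_module \<gg> X" and "finite K"
    and "e \<in> module_homs \<gg> X X" "e \<circ> e = e"
    and "\<And>k. k \<in> K \<Longrightarrow> V k \<in> S" "\<And>k. k \<in> K \<Longrightarrow> i k \<in> module_homs \<gg> X (V k)"
    and "\<And>k. k \<in> K \<Longrightarrow> p k \<in> module_homs \<gg> (V k) X"
    and "e = (\<Sum>k\<in>K. p k \<circ> i k)"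
  shows "\<exists>Ws s r. orth \<gg> S X Ws s r e"
  using assms(3-)
proof (induction "card K" arbitrary: K e i p rule: less_induct)
  case less
  note e = less.prems(2,3) and V = less.prems(4) and i = less.prems(5) and p = less.prems(6)
    and ee = less.prems(7)
  note le = lin_simps[OF module_homs_lin[OF e(1)]]
  have idem: "e (e v) = e v" for v using fun_cong[OF e(2), of v] by simp
  have ev: "e v = (\<Sum>k\<in>K. p k (i k v))" for v
    using fun_cong[OF ee, of v] by (simp add: sum_fun_apply)
  show ?case
  proof (cases "\<forall>k\<in>K. \<forall>l\<in>K. i k \<circ> e \<circ> p l = 0")
    case True
    then have z: "i k (e (p l v)) = 0" if "k \<in> K" "l \<in> K" for k l v

    proof -
      have "(i k \<circ> e \<circ> p l) v = 0" using True that by simp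
      then show ?thesis by simp
    qed
    \<comment> \<open>An idempotent equals its cube. Expanding the outer and the inner factor of
      \<open>e \<circ> e \<circ> e\<close> leaves only terms through the vanishing
      composites.\<close>
    have "e v = 0" for v
    proof -
      have "e v = e (e (e v))" by (simp add: idem)
      also have "\<dots> = (\<Sum>k\<in>K. p k (i k (e (e v))))" by (rule ev)
      also have "\<dots> = (\<Sum>k\<in>K. p k (\<Sum>l\<in>K. i k (e (p l (i l v)))))"
        by (subst (2) ev) (simp add: le lin_sum[OF module_homs_lin[OF i]])
      also have "\<dots> = 0" by (simp add: z lin_0[OF module_homs_lin[OF p]])
      finally show ?thesis .
    qed
    then have "orth \<gg> S X [] (\<lambda>_. 0) (\<lambda>_. 0) e" by (auto simp: orth_def)
    then show ?thesis by blast
  next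
    case False
    then obtain k l where kl: "k \<in> K" "l \<in> K" "i k \<circ> e \<circ> p l \<noteq> 0" by blast
    have h: "i k \<circ> e \<circ> p l \<in> module_homs \<gg> (V l) (V k)"
      using module_homs_comp[OF p[OF kl(2)] module_homs_comp[OF e(1) i[OF kl(1)]]] by (simp add: comp_assoc)
    have Vlk: "V l = V k" by (rule schur_familyD(4)[OF S V V h kl(3)]) (use kl in auto)
    obtain c where c: "i k \<circ> e \<circ> p l = (\<lambda>v. scl c (id_on (idx (V l)) v))"
      using schur_familyD(3)[OF S V[OF kl(2)]] h Vlk by auto
    have c0: "c \<noteq> 0" using c kl(3) by auto
    define s1 r1 where "s1 = e \<circ> p l" and "r1 v = scl (1 / c) (i k (e v))" for v
    have s1: "s1 \<in> module_homs \<gg> (V l) X" unfolding s1_def by (rule module_homs_comp[OF p[OF kl(2)] e(1)])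
    have r1: "r1 \<in> module_homs \<gg> X (V l)"
      using module_homs_scl[OF schur_familyD(1)[OF S V[OF kl(1)]] module_homs_comp[OF e(1) i[OF kl(1)]], of "1/c"]
      by (simp add: r1_def[abs_def] Vlk)
    note ls1 = lin_simps[OF module_homs_lin[OF s1]] and lr1 = lin_simps[OF module_homs_lin[OF r1]]
    have rs: "r1 (s1 v) = id_on (idx (V l)) v" for v
      using fun_cong[OF c, of v] c0 by (simp add: r1_def s1_def idem)
    have es1: "e (s1 v) = s1 v" and r1e: "r1 (e v) = r1 v" for v by (simp_all add: s1_def r1_def idem)
    have s1id: "s1 (id_on (idx (V l)) v) = s1 v" for v by (rule lin_maps_id_right[OF module_homs_lin_maps[OF s1]])
    have r1id: "id_on (idx (V l)) (r1 v) = r1 v" for v by (rule lin_maps_id_left[OF module_homs_lin_maps[OF r1]])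
    define e' where "e' = e - (s1 \<circ> r1)"
    have e'v: "e' v = e v - s1 (r1 v)" for v by (simp add: e'_def)
    have e': "e' \<in> module_homs \<gg> X X"
      unfolding e'_def by (rule module_homs_diff[OF X e(1) module_homs_comp[OF r1 s1]])
    have ide': "e' (e' v) = e' v" and e'e: "e' (e v) = e' v" and ee': "e (e' v) = e' v"
      and e's1: "e' (s1 v) = 0" and r1e': "r1 (e' v) = 0" for v
      by (simp_all add: e'v le ls1 lr1 idem es1 r1e rs s1id r1id)
    have e'p: "e' (p l v) = 0" for v
      using e'e[of "p l v"] e's1[of v] by (simp add: s1_def)
    have "e' v = (\<Sum>k\<in>K. e' (p k (i k (e' v))))" for v
    proof -
      have "e' v = e' (e (e' v))" by (simp add: ee' ide')
      also have "\<dots> = e' (\<Sum>k\<in>K. p k (i k (e' v)))" using ev[of "e' v"] by simp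
      finally show ?thesis by (simp add: lin_sum[OF module_homs_lin[OF e']])
    qed
    also have "\<dots> v = (\<Sum>k\<in>K - {l}. e' (p k (i k (e' v))))" for v
      by (rule sum.mono_neutral_right) (use less.prems(1) e'p in auto)
    finally have "e' = (\<Sum>k\<in>K - {l}. (e' \<circ> p k) \<circ> (i k \<circ> e'))"
      by (auto simp: fun_eq_iff sum_fun_apply)
    moreover have "card (K - {l}) < card K" using kl(2) less.prems(1) by (intro card_Diff1_less)
    moreover have "e' \<circ> e' = e'" by (auto simp: ide')
    ultimately obtain Ws s r where W: "orth \<gg> S X Ws s r e'"
      using less.hyps[of "K - {l}" e' "\<lambda>k. i k \<circ> e'" "\<lambda>k. e' \<circ> p k"] e' V less.prems(1)
        module_homs_comp[OF e' i] module_homs_comp[OF p e'] by blast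
    have sum_e': "e' v = (\<Sum>m<length Ws. s m (r m v))" for v
      using W by (auto simp: orth_def sum_fun_apply dest: fun_cong[of _ e' v])
    have sh: "s m \<in> module_homs \<gg> (Ws ! m) X" and rh: "r m \<in> module_homs \<gg> X (Ws ! m)" if "m < length Ws" for m
      using W that by (auto simp: orth_def)
    have rsm: "r m (s n v) = (if m = n then id_on (idx (Ws ! m)) v else 0)"
      if "m < length Ws" "n < length Ws" for m n v
      by (rule orth_apply[OF W that])
    have sm: "e' (s m v) = s m v" if m: "m < length Ws" for m v
    proof -
      have "e' (s m v) = (\<Sum>n<length Ws. if n = m then s m (id_on (idx (Ws ! m)) v) else 0)"
        unfolding sum_e' by (intro sum.cong) (auto simp: rsm m lin_0[OF module_homs_lin[OF sh]])
      then show ?thesis using m by (simp add: lin_maps_id_right[OF module_homs_lin_maps[OF sh]])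
    qed
    have rm: "r m (e' v) = r m v" if m: "m < length Ws" for m v
    proof -
      have "r m (e' v) = (\<Sum>n<length Ws. if n = m then id_on (idx (Ws ! m)) (r m v) else 0)"
        unfolding sum_e' lin_sum[OF module_homs_lin[OF rh[OF m]]] by (intro sum.cong) (auto simp: rsm m)
      then show ?thesis using m by (simp add: lin_maps_id_left[OF module_homs_lin_maps[OF rh]])
    qed
    have r1s: "r1 (s m v) = 0" if "m < length Ws" for m v
      using r1e'[of "s m v"] sm[OF that, of v] by simp
    have rs1: "r m (s1 v) = 0" if "m < length Ws" for m v
      using rm[OF that, of "s1 v"] e's1[of v] lin_0[OF module_homs_lin[OF rh[OF that]]] by simp
    have "orth \<gg> S X (V l # Ws) (case_nat s1 s) (case_nat r1 r) e"
      unfolding orth_def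
    proof (intro conjI allI impI)
      show "set (V l # Ws) \<subseteq> S" using W V kl by (auto simp: orth_def)
      show "case_nat s1 s m \<in> module_homs \<gg> ((V l # Ws) ! m) X" "case_nat r1 r m \<in> module_homs \<gg> X ((V l # Ws) ! m)"
        if "m < length (V l # Ws)" for m
        using that s1 r1 sh rh by (auto split: nat.split)
      show "case_nat r1 r m \<circ> case_nat s1 s n = (if m = n then id_on (idx ((V l # Ws) ! m)) else 0)"
        if "m < length (V l # Ws)" "n < length (V l # Ws)" for m n
        using that rs rsm r1s rs1 by (auto split: nat.split simp: fun_eq_iff)
      have "e v = s1 (r1 v) + (\<Sum>m<length Ws. s m (r m v))" for v
        using e'v[of v] sum_e'[of v] by (simp add: algebra_simps)
      then show "(\<Sum>m<length (V l # Ws). case_nat s1 s m \<circ> case_nat r1 r m) = e"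
        by (auto simp: fun_eq_iff sum_fun_apply sum.lessThan_Suc_shift simp del: sum.lessThan_Suc)
    qed
    then show ?thesis by blast
  qed
qed

lemma Fac_idempotent_orth:
  assumes "schur_family \<gg> S" "lie_module \<gg> X" "e \<in> module_homs \<gg> X X" "e \<circ> e = e" "e \<in> Fac \<gg> S X X"
  shows "\<exists>Ws s r. orth \<gg> S X Ws s r e"
proof (rule Fac_rep[OF assms(5)])
  fix K :: "nat set" and V i p
  assume K: "finite K" "\<And>k. k \<in> K \<Longrightarrow> V k \<in> S" "\<And>k. k \<in> K \<Longrightarrow> i k \<in> module_homs \<gg> X (V k)"
    "\<And>k. k \<in> K \<Longrightarrow> p k \<in> module_homs \<gg> (V k) X" "e = (\<Sum>k\<in>K. p k \<circ> i k)"
  show ?thesis by (rule idempotent_orth[OF assms(1,2) K(1) assms(3,4) K(2-5)])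
qed

text \<open>The additive closure, phrased without a complement: being a summand of a finite sum of
  members of \<open>S\<close> amounts to an identity that factors through such sums. Closure under
  sums and retracts becomes formal.\<close>

definition add_cl :: "'g::ab_group_add lie_alg \<Rightarrow> 'g lie_mod set \<Rightarrow> 'g lie_mod set" where
  "add_cl \<gg> S = {X. lie_module \<gg> X \<and> id_on (idx X) \<in> Fac \<gg> S X X}"

lemma id_idem: "id_on I \<circ> id_on I = id_on I"
  by auto

lemma Fac_of_cl:
  assumes "X \<in> add_cl \<gg> S" "f \<in> module_homs \<gg> X Y"
  shows "f \<in> Fac \<gg> S X Y"
proof -
  have "f \<circ> id_on (idx X) \<in> Fac \<gg> S X Y"
    using assms by (intro Fac_left) (auto simp: add_cl_def)
  moreover have "f \<circ> id_on (idx X) = f"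
    by (auto simp: lin_maps_id_right[OF module_homs_lin_maps[OF assms(2)]])
  ultimately show ?thesis by simp
qed

lemma dsum_in_cl:
  assumes "dsum \<gg> Xs Z i p" "set Xs \<subseteq> add_cl \<gg> S"
  shows "Z \<in> add_cl \<gg> S"
proof -
  have "i k \<circ> p k \<in> Fac \<gg> S Z Z" if "k < length Xs" for k
    using assms that by (intro Fac_right[where Y = "Xs ! k"] Fac_of_cl) (auto simp: dsum_def)
  then have "(\<Sum>k<length Xs. i k \<circ> p k) \<in> Fac \<gg> S Z Z" by (intro Fac_sum) auto
  then show ?thesis using assms(1) by (simp add: add_cl_def dsum_def)
qed

lemma retract_in_cl:
  assumes "lie_module \<gg> X" "Z \<in> add_cl \<gg> S" "i \<in> module_homs \<gg> X Z" "p \<in> module_homs \<gg> Z X" "p \<circ> i = id_on (idx X)"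
  shows "X \<in> add_cl \<gg> S"
  using Fac_right[OF Fac_of_cl[OF assms(2,4)] assms(3)] assms(1,5) by (simp add: add_cl_def)

lemma base_in_cl:
  assumes "V \<in> S" "lie_module \<gg> V" shows "V \<in> add_cl \<gg> S"
  using Fac_base[OF assms(1) module_homs_id[OF assms(2)] module_homs_id[OF assms(2)]] assms(2)
  by (simp add: add_cl_def id_idem)

lemma orth_id_dsum:
  "schur_family \<gg> S \<Longrightarrow> lie_module \<gg> X \<Longrightarrow> orth \<gg> S X Ws s r (id_on (idx X)) \<Longrightarrow> dsum \<gg> Ws X s r"
  by (auto simp: orth_def dsum_def schur_family_def)

lemma cl_dsum:
  assumes "schur_family \<gg> S" "X \<in> add_cl \<gg> S"
  obtains Ws i p where "set Ws \<subseteq> S" "dsum \<gg> Ws X i p"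
proof -
  have X: "lie_module \<gg> X" using assms by (simp add: add_cl_def)
  then obtain Ws s r where o: "orth \<gg> S X Ws s r (id_on (idx X))"
    using Fac_idempotent_orth[OF assms(1) X module_homs_id[OF X] id_idem] assms(2) by (auto simp: add_cl_def)
  then show ?thesis using that orth_id_dsum[OF assms(1) X o] by (auto simp: orth_def)
qed

lemma dsum_zero_right:
  assumes "lie_module \<gg> X"
  shows "dsum \<gg> [X, zero_module] X (\<lambda>k. if k = 0 then id_on (idx X) else 0) (\<lambda>k. if k = 0 then id_on (idx X) else 0)"
proof -
  let ?f = "\<lambda>k :: nat. if k = 0 then id_on (idx X) else 0"
  have z: "idx (zero_module :: 'a lie_mod) = {}" by (simp add: zero_module_def)
  have z': "id_on {} = 0" by (rule lin_eqI[OF lin_id_on lin_zero(2)]) (simp add: id_on_bas)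
  have h: "?f k \<in> module_homs \<gg> ([X, zero_module] ! k) X" "?f k \<in> module_homs \<gg> X ([X, zero_module] ! k)"
    if "k < 2" for k
    using that assms by (auto simp: less_2_cases_iff module_homs_id module_homs_0 lie_module_zero)
  have pi: "?f k \<circ> ?f l = (if k = l then id_on (idx ([X, zero_module] ! k)) else 0)" if "k < 2" "l < 2" for k l
    using that by (auto simp: less_2_cases_iff fun_eq_iff lin_0[OF lin_id_on] z z')
  have "(\<Sum>k<2. ?f k \<circ> ?f k) = id_on (idx X)"
    by (simp add: numeral_2_eq_2 fun_eq_iff)
  then show ?thesis unfolding dsum_def using h pi assms lie_module_zero
    by (simp add: numeral_2_eq_2)
qed

text \<open>In one direction a summand is a retract. In the other, splitting the identity presents
  \<open>X\<close> itself as a direct sum of members of \<open>S\<close>, so the zero module serves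
  as complement.\<close>

lemma add_cl_eq:
  assumes "schur_family \<gg> S"
  shows "{X. lie_module \<gg> X \<and> (\<exists>Vs X' Z. set Vs \<subseteq> S \<and> (\<exists>i p. dsum \<gg> Vs Z i p) \<and> (\<exists>i p. dsum \<gg> [X, X'] Z i p))} = add_cl \<gg> S"
proof (intro equalityI subsetI)
  fix X assume "X \<in> {X. lie_module \<gg> X \<and> (\<exists>Vs X' Z. set Vs \<subseteq> S \<and> (\<exists>i p. dsum \<gg> Vs Z i p) \<and> (\<exists>i p. dsum \<gg> [X, X'] Z i p))}"
  then obtain Vs X' Z i p i' p' where X: "lie_module \<gg> X" and Vs: "set Vs \<subseteq> S" and d: "dsum \<gg> Vs Z i p" "dsum \<gg> [X, X'] Z i' p'"
    by blast
  have "Z \<in> add_cl \<gg> S"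
    by (rule dsum_in_cl[OF d(1)]) (use Vs assms in \<open>auto intro!: base_in_cl simp: schur_family_def\<close>)
  then show "X \<in> add_cl \<gg> S"
  proof (rule retract_in_cl[OF X])
    show "i' 0 \<in> module_homs \<gg> X Z" "p' 0 \<in> module_homs \<gg> Z X" using dsum_homs[OF d(2), of 0] by simp_all
    show "p' 0 \<circ> i' 0 = id_on (idx X)" using dsum_apply[OF d(2), of 0 0] by (simp add: fun_eq_iff)
  qed
next
  fix X assume X: "X \<in> add_cl \<gg> S"
  then have l: "lie_module \<gg> X" by (simp add: add_cl_def)
  obtain Ws i p where "set Ws \<subseteq> S" "dsum \<gg> Ws X i p" using cl_dsum[OF assms X] .
  with l dsum_zero_right[OF l]
  show "X \<in> {X. lie_module \<gg> X \<and> (\<exists>Vs X' Z. set Vs \<subseteq> S \<and> (\<exists>i p. dsum \<gg> Vs Z i p) \<and> (\<exists>i p. dsum \<gg> [X, X'] Z i p))}"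
    by blast
qed

subsection \<open>The additive closure of a Schur family is locally finitary\<close>

text \<open>Only the fields of \<open>lin_cat\<close> are prescribed, so the results apply to any
  extension of that record, in particular to the record of a module category with its set of objects
  replaced.\<close>

locale schur_category =
  fixes \<gg> :: "'g::ab_group_add lie_alg" and S :: "'g lie_mod set"
    and M :: "('g lie_mod, cvec \<Rightarrow> cvec, 'z) lin_cat_scheme"
  assumes S: "schur_family \<gg> S"
    and Obj_M [simp]: "Obj M = add_cl \<gg> S" and Hom_M [simp]: "Hom M = module_homs \<gg>"
    and Idn_M [simp]: "\<And>X. Idn M X = id_on (idx X)" and Cmp_M [simp]: "\<And>f g. Cmp M f g = f \<circ> g"
    and Scl_M: "Scl M = (\<lambda>c f v. scl c (f v))"
begin

lemma cl_lie_module: "X \<in> add_cl \<gg> S \<Longrightarrow> lie_module \<gg> X"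
  by (simp add: add_cl_def)

lemma S_cl: "V \<in> S \<Longrightarrow> V \<in> add_cl \<gg> S"
  using base_in_cl[OF _ schur_familyD(1)[OF S]] by blast

lemma direct_sum_in_M:
  "direct_sum_in M Xs Z \<longleftrightarrow> Z \<in> add_cl \<gg> S \<and> set Xs \<subseteq> add_cl \<gg> S \<and> (\<exists>i p. dsum \<gg> Xs Z i p)"
  using cl_lie_module by (auto simp: direct_sum_in_def dsum_def)

lemma linear_M: "linear_category M"
proof -
  have sub: "maps.subspace (module_homs \<gg> X Y)" if "lie_module \<gg> Y" for X Y
    by (auto simp: maps.subspace_def intro: module_homs_add module_homs_scl module_homs_0 that)
  show ?thesis
  proof (intro linear_category.intro linear_category_axioms.intro)
    show "vector_space (Scl M)" by (simp add: Scl_M vector_space_maps)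
  qed (auto simp: Scl_M sub fun_eq_iff lin_maps_id_right[OF module_homs_lin_maps] lin_maps_id_left[OF module_homs_lin_maps]
       lin_simps[OF module_homs_lin] cl_lie_module intro: module_homs_id module_homs_comp)
qed

lemma additive_M: "additive_category M"
  unfolding additive_category_def direct_sum_in_M Obj_M
proof (intro allI impI)
  fix Xs assume Xs: "set Xs \<subseteq> add_cl \<gg> S"
  then obtain Z i p where "dsum \<gg> Xs Z i p" using dsum_exists[of Xs \<gg>] cl_lie_module by blast
  with dsum_in_cl[OF this Xs] Xs
  show "\<exists>Z. Z \<in> add_cl \<gg> S \<and> set Xs \<subseteq> add_cl \<gg> S \<and> (\<exists>i p. dsum \<gg> Xs Z i p)" by blast
qed

lemma idempotent_split_M: "idempotent_split M"
  unfolding idempotent_split_def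
proof (intro ballI impI)
  fix X e assume "X \<in> Obj M" "e \<in> Hom M X X" "e \<cdot>\<^bsub>M\<^esub> e = e"
  then have X: "X \<in> add_cl \<gg> S" and e: "e \<in> module_homs \<gg> X X" "e \<circ> e = e" by simp_all
  obtain Ws s r where o: "orth \<gg> S X Ws s r e"
    using Fac_idempotent_orth[OF S cl_lie_module[OF X] e Fac_of_cl[OF X e(1)]] by blast
  have Ws: "set Ws \<subseteq> S" using o by (simp add: orth_def)
  then have Ws': "\<forall>W\<in>set Ws. lie_module \<gg> W" using S by (auto simp: schur_family_def)
  obtain Y i p where d: "dsum \<gg> Ws Y i p" using dsum_exists[OF Ws'] by blast
  have Y: "Y \<in> add_cl \<gg> S" by (rule dsum_in_cl[OF d]) (use Ws S_cl in auto)
  let ?n = "length Ws"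
  \<comment> \<open>\<open>Y\<close> is an abstract sum of the summands of the idempotent;
    \<open>R\<close> and \<open>T\<close> identify it with the image of \<open>e\<close>, matching
    summands one by one.\<close>
  define R T where "R = (\<Sum>m<?n. i m \<circ> r m)" and "T = (\<Sum>m<?n. s m \<circ> p m)"
  have h: "i m \<in> module_homs \<gg> (Ws ! m) Y" "p m \<in> module_homs \<gg> Y (Ws ! m)"
    "s m \<in> module_homs \<gg> (Ws ! m) X" "r m \<in> module_homs \<gg> X (Ws ! m)" if "m < ?n" for m
    using o d that by (auto simp: orth_def dsum_def)
  have pi: "p m (i n v) = (if m = n then id_on (idx (Ws ! m)) v else 0)"
    and rs: "r m (s n v) = (if m = n then id_on (idx (Ws ! m)) v else 0)" if "m < ?n" "n < ?n" for m n v
    by (rule dsum_apply[OF d that], rule orth_apply[OF o that])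
  have R: "R \<in> module_homs \<gg> X Y" and T: "T \<in> module_homs \<gg> Y X"
    unfolding R_def T_def using cl_lie_module[OF X] cl_lie_module[OF Y]
    by (auto intro!: module_homs_sum module_homs_comp[OF h(4) h(1)] module_homs_comp[OF h(2) h(3)])
  have "(R \<circ> T) v = (\<Sum>m<?n. i m (\<Sum>n<?n. if m = n then p m v else 0))" for v
    unfolding R_def T_def comp_apply sum_fun_apply
    by (intro sum.cong refl arg_cong[where f = "i _"])
       (auto simp: lin_sum[OF module_homs_lin[OF h(4)]] rs intro!: sum.cong lin_maps_id_left[OF module_homs_lin_maps[OF h(2)]])
  also have "\<dots> v = (\<Sum>m<?n. i m \<circ> p m) v" for v by (simp add: sum_fun_apply)
  finally have RT: "R \<circ> T = id_on (idx Y)" using d by (auto simp: dsum_def)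
  have "(T \<circ> R) v = (\<Sum>m<?n. s m (\<Sum>n<?n. if m = n then r m v else 0))" for v
    unfolding R_def T_def comp_apply sum_fun_apply
    by (intro sum.cong refl arg_cong[where f = "s _"])
       (auto simp: lin_sum[OF module_homs_lin[OF h(2)]] pi intro!: sum.cong lin_maps_id_left[OF module_homs_lin_maps[OF h(4)]])
  also have "\<dots> v = (\<Sum>m<?n. s m \<circ> r m) v" for v by (simp add: sum_fun_apply)
  finally have "T \<circ> R = e" using o by (auto simp: orth_def)
  then show "\<exists>Y\<in>Obj M. \<exists>r\<in>Hom M X Y. \<exists>s\<in>Hom M Y X. r \<cdot>\<^bsub>M\<^esub> s = Idn M Y \<and> s \<cdot>\<^bsub>M\<^esub> r = e"
    using Y R T RT by auto
qed

lemma id_nz: "V \<in> S \<Longrightarrow> id_on (idx V) \<noteq> 0"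
  using schur_familyD(2)[OF S] by (metis all_not_in_conv bas_nz id_on_bas zero_fun_apply)

lemma iso_in_scaled_id:
  assumes "V \<in> S" "c \<noteq> 0"
  shows "iso_in M V V (\<lambda>v. scl c (id_on (idx V) v))"
proof -
  have V: "lie_module \<gg> V" using S assms by (simp add: schur_family_def)
  have h: "(\<lambda>v. scl a (id_on (idx V) v)) \<in> module_homs \<gg> V V" for a
    by (rule module_homs_scl[OF V module_homs_id[OF V]])
  show ?thesis
    unfolding iso_in_def using h assms(2)
    by (auto intro!: bexI[OF _ h[of "1 / c"]] simp: fun_eq_iff lin_simps[OF lin_id_on])
qed

lemma local_S:
  assumes V: "V \<in> S" shows "local_endomorphism_ring M V"
  unfolding local_endomorphism_ring_def
proof (intro conjI ballI)
  show "Idn M V \<noteq> 0" using id_nz[OF V] by simp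
  fix f assume "f \<in> Hom M V V"
  then obtain c where c: "f = (\<lambda>v. scl c (id_on (idx V) v))" using schur_familyD(3)[OF S V] by auto
  show "iso_in M V V f \<or> iso_in M V V (Idn M V - f)"
  proof (cases "c = 0")
    case True
    have "(\<lambda>v. scl 1 (id_on (idx V) v)) = Idn M V - f" by (auto simp: c True)
    with iso_in_scaled_id[OF V, of 1] show ?thesis by simp
  next
    case False
    with iso_in_scaled_id[OF V, of c] show ?thesis by (simp add: c)
  qed
qed

lemma krull_schmidt_M: "krull_schmidt M"
  unfolding krull_schmidt_def
proof
  fix X assume X: "X \<in> Obj M"
  then obtain Ws i p where "set Ws \<subseteq> S" "dsum \<gg> Ws X i p" using cl_dsum[OF S, of X] by (metis Obj_M)
  then show "\<exists>Xs. direct_sum_in M Xs X \<and> (\<forall>A\<in>set Xs. local_endomorphism_ring M A)"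
    using X S_cl local_S unfolding direct_sum_in_M Obj_M by (intro exI[of _ Ws]) blast
qed

lemma hom_decompose:
  assumes "dsum \<gg> Xs X i p" "dsum \<gg> Ys Y j q" "f \<in> module_homs \<gg> X Y"
  shows "f = (\<Sum>l<length Ys. \<Sum>k<length Xs. j l \<circ> (q l \<circ> f \<circ> i k) \<circ> p k)"
proof
  fix v
  have jh: "j l \<in> module_homs \<gg> (Ys ! l) Y" "q l \<in> module_homs \<gg> Y (Ys ! l)" if "l < length Ys" for l
    using assms(2) that by (auto simp: dsum_def)
  have X: "id_on (idx X) v = (\<Sum>k<length Xs. i k (p k v))"
    by (rule dsum_id[OF assms(1)])
  have Y: "id_on (idx Y) w = (\<Sum>k<length Ys. j k (q k w))" for w
    by (rule dsum_id[OF assms(2)])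
  have "f v = id_on (idx Y) (f (id_on (idx X) v))"
    by (simp add: lin_maps_id_left[OF module_homs_lin_maps[OF assms(3)]] lin_maps_id_right[OF module_homs_lin_maps[OF assms(3)]])
  also have "\<dots> = (\<Sum>l<length Ys. \<Sum>k<length Xs. j l (q l (f (i k (p k v)))))"
    unfolding X Y by (intro sum.cong)
      (auto simp: lin_sum[OF module_homs_lin[OF assms(3)]] lin_sum[OF module_homs_lin[OF jh(1)]] lin_sum[OF module_homs_lin[OF jh(2)]])
  finally show "f v = (\<Sum>l<length Ys. \<Sum>k<length Xs. j l \<circ> (q l \<circ> f \<circ> i k) \<circ> p k) v"
    by (simp add: sum_fun_apply)
qed

text \<open>A homomorphism is the sum of its matrix entries between simple summands. By Schur an
  entry is zero or a scalar, so the maps \<open>j l \<circ> p k\<close> for pairs of equal summands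
  span.\<close>

lemma finite_dim_M: "finite_dimensional_homs M"
  unfolding finite_dimensional_homs_def
proof (intro ballI)
  fix X Y assume "X \<in> Obj M" "Y \<in> Obj M"
  then obtain Ws i p Us j q where W: "set Ws \<subseteq> S" "dsum \<gg> Ws X i p" and U: "set Us \<subseteq> S" "dsum \<gg> Us Y j q"
    and Y: "lie_module \<gg> Y"
    using cl_dsum[OF S, of X] cl_dsum[OF S, of Y] cl_lie_module by (metis Obj_M)
  have h: "i k \<in> module_homs \<gg> (Ws ! k) X" "p k \<in> module_homs \<gg> X (Ws ! k)" "Ws ! k \<in> S" if "k < length Ws" for k
    using W that by (auto simp: dsum_def)
  have g: "j k \<in> module_homs \<gg> (Us ! k) Y" "q k \<in> module_homs \<gg> Y (Us ! k)" "Us ! k \<in> S" if "k < length Us" for k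
    using U that by (auto simp: dsum_def)
  define B where "B = (\<lambda>(l, k). j l \<circ> p k) ` {(l, k). l < length Us \<and> k < length Ws \<and> Us ! l = Ws ! k}"
  have "{(l, k). l < length Us \<and> k < length Ws \<and> Us ! l = Ws ! k} \<subseteq> {..<length Us} \<times> {..<length Ws}" by auto
  then have "finite B" unfolding B_def by (intro finite_imageI) (rule finite_subset, auto)
  moreover have "maps.span B = module_homs \<gg> X Y"
  proof
    have "maps.subspace (module_homs \<gg> X Y)"
      by (auto simp: maps.subspace_def intro: module_homs_add module_homs_scl module_homs_0 Y)
    moreover have "B \<subseteq> module_homs \<gg> X Y"
    proof -
      have "j l \<circ> p k \<in> module_homs \<gg> X Y" if "l < length Us" "k < length Ws" "Us ! l = Ws ! k" for l k
        using module_homs_comp[OF h(2)[OF that(2)], of "j l" Y] g(1)[OF that(1)] that(3) by simp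
      then show ?thesis by (auto simp: B_def)
    qed
    ultimately show "maps.span B \<subseteq> module_homs \<gg> X Y" by (intro maps.span_minimal)
    show "module_homs \<gg> X Y \<subseteq> maps.span B"
    proof
      fix f assume f: "f \<in> module_homs \<gg> X Y"
      have "j l \<circ> (q l \<circ> f \<circ> i k) \<circ> p k \<in> maps.span B" if l: "l < length Us" and k: "k < length Ws" for l k
      proof (cases "q l \<circ> f \<circ> i k = 0")
        case True
        have "j l \<circ> (q l \<circ> f \<circ> i k) \<circ> p k = 0"
          unfolding True by (auto simp: lin_0[OF module_homs_lin[OF g(1)[OF l]]])
        then show ?thesis by (simp add: maps.span_zero)
      next
        case False
        have "q l \<circ> f \<circ> i k \<in> module_homs \<gg> (Ws ! k) (Us ! l)"
          using module_homs_comp[OF h(1)[OF k] module_homs_comp[OF f g(2)[OF l]]] by (simp add: comp_assoc)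
        moreover from this have e: "Ws ! k = Us ! l" by (rule schur_familyD(4)[OF S h(3)[OF k] g(3)[OF l] _ False])
        ultimately obtain c where c: "q l \<circ> f \<circ> i k = (\<lambda>v. scl c (id_on (idx (Us ! l)) v))"
          using schur_familyD(3)[OF S g(3)[OF l]] by metis
        have "j l \<circ> (q l \<circ> f \<circ> i k) \<circ> p k = (\<lambda>v. scl c ((j l \<circ> p k) v))"
          unfolding c by (auto simp: lin_scl[OF module_homs_lin[OF g(1)[OF l]]] lin_maps_id_right[OF module_homs_lin_maps[OF g(1)[OF l]]])
        moreover have "j l \<circ> p k \<in> B" unfolding B_def using l k e by force
        ultimately show ?thesis using maps.span_scale[OF maps.span_base] by metis
      qed
      then show "f \<in> maps.span B"
        by (subst hom_decompose[OF W(2) U(2) f]) (intro maps.span_sum, auto)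
    qed
  qed
  ultimately show "\<exists>B. finite B \<and> module.span (Scl M) B = Hom M X Y" by (auto simp: Scl_M)
qed

lemma zero_object_M: "zero_object M X \<longleftrightarrow> X \<in> add_cl \<gg> S \<and> id_on (idx X) = 0"
  by (simp add: zero_object_def)

text \<open>The idempotent \<open>i 0 \<circ> p 0\<close> of a summand is a scalar \<open>c\<close>.
  If \<open>c\<close> is zero the first summand vanishes, otherwise the second does.\<close>

lemma indecomposable_S:
  assumes V: "V \<in> S" shows "indecomposable M V"
  unfolding indecomposable_def
proof (intro conjI allI impI)
  show "V \<in> Obj M" "\<not> zero_object M V" using S_cl[OF V] id_nz[OF V] by (auto simp: zero_object_M)
  fix A B assume "direct_sum_in M [A, B] V"
  then obtain i p where d: "dsum \<gg> [A, B] V i p" and AB: "A \<in> add_cl \<gg> S" "B \<in> add_cl \<gg> S" by (auto simp: direct_sum_in_M)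
  have h: "i 0 \<in> module_homs \<gg> A V" "i 1 \<in> module_homs \<gg> B V" "p 0 \<in> module_homs \<gg> V A" "p 1 \<in> module_homs \<gg> V B"
    using dsum_homs[OF d, of 0] dsum_homs[OF d, of 1] by simp_all
  have pi: "p 0 \<circ> i 0 = id_on (idx A)" "p 1 \<circ> i 1 = id_on (idx B)" "p 0 \<circ> i 1 = 0"
    using dsum_apply[OF d, of 0 0] dsum_apply[OF d, of 1 1] dsum_apply[OF d, of 0 1] by (simp_all add: fun_eq_iff)
  obtain c where c: "i 0 \<circ> p 0 = (\<lambda>v. scl c (id_on (idx V) v))"
    using schur_familyD(3)[OF S V module_homs_comp[OF h(3) h(1)]] by blast
  show "zero_object M A \<or> zero_object M B"
  proof (cases "c = 0")
    case True
    then have z: "i 0 (p 0 v) = 0" for v using fun_cong[OF c, of v] by simp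
    have "id_on (idx A) v = 0" for v
    proof -
      have "id_on (idx A) v = p 0 (i 0 (p 0 (i 0 v)))"
          using fun_cong[OF pi(1), of v] fun_cong[OF pi(1), of "id_on (idx A) v"] by simp
      then show ?thesis by (simp add: z lin_0[OF module_homs_lin[OF h(3)]])
    qed
    then show ?thesis using AB by (auto simp: zero_object_M)
  next
    case False
    have "id_on (idx B) v = 0" for v
    proof -
      have "scl c (i 1 v) = scl c (id_on (idx V) (i 1 v))"
        by (subst lin_maps_id_left[OF module_homs_lin_maps[OF h(2)]]) simp
      also have "\<dots> = i 0 (p 0 (i 1 v))" using fun_cong[OF c, of "i 1 v"] by simp
      also have "\<dots> = 0" using fun_cong[OF pi(3), of v] by (simp add: lin_0[OF module_homs_lin[OF h(1)]])
      finally have "i 1 v = 0" using False by simp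
      then show ?thesis using fun_cong[OF pi(2), of v] lin_0[OF module_homs_lin[OF h(4)]] by simp
    qed
    then show ?thesis using AB by (auto simp: zero_object_M)
  qed
qed

text \<open>One simple summand is split off, the complement being the image of the idempotent
  \<open>e = 1 - i 0 \<circ> p 0\<close>. Indecomposability forces this complement to be
  zero.\<close>

lemma indecomposable_iso:
  assumes "indecomposable M X"
  shows "\<exists>V\<in>S. isomorphic M X V"
proof -
  have X: "X \<in> add_cl \<gg> S" and nz: "id_on (idx X) \<noteq> 0" using assms by (auto simp: indecomposable_def zero_object_M)
  obtain Ws i p where W: "set Ws \<subseteq> S" "dsum \<gg> Ws X i p" using cl_dsum[OF S X] by blast
  have "Ws \<noteq> []" using nz W(2) by (auto simp: dsum_def)
  then have n0: "0 < length Ws" by simp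
  have h: "i k \<in> module_homs \<gg> (Ws ! k) X" "p k \<in> module_homs \<gg> X (Ws ! k)" "Ws ! k \<in> S" if "k < length Ws" for k
    using W that by (auto simp: dsum_def)
  have pi: "p 0 (i 0 v) = id_on (idx (Ws ! 0)) v" for v
    using dsum_apply[OF W(2) n0 n0] by simp
  define e where "e = id_on (idx X) - (i 0 \<circ> p 0)"
  have Xl: "lie_module \<gg> X" by (rule cl_lie_module[OF X])
  have e: "e \<in> module_homs \<gg> X X" unfolding e_def
    by (rule module_homs_diff[OF Xl module_homs_id[OF Xl] module_homs_comp[OF h(2,1)[OF n0]]])
  note l0 = lin_simps[OF module_homs_lin[OF h(1)[OF n0]]] lin_simps[OF module_homs_lin[OF h(2)[OF n0]]] lin_simps[OF lin_id_on]
    lin_maps_id_left[OF module_homs_lin_maps[OF h(1)[OF n0]]] lin_maps_id_right[OF module_homs_lin_maps[OF h(1)[OF n0]]]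
    lin_maps_id_left[OF module_homs_lin_maps[OF h(2)[OF n0]]] lin_maps_id_right[OF module_homs_lin_maps[OF h(2)[OF n0]]]
  have ee: "e \<circ> e = e" by (auto simp: e_def l0 pi)
  obtain Y r s where Y: "Y \<in> add_cl \<gg> S" and r: "r \<in> module_homs \<gg> X Y" and s: "s \<in> module_homs \<gg> Y X"
    and rs: "r \<circ> s = id_on (idx Y)" and sr: "s \<circ> r = e"
    using idempotent_split_M[unfolded idempotent_split_def Obj_M Hom_M Cmp_M Idn_M, rule_format, OF X e ee] by blast
  have rs': "r (s v) = id_on (idx Y) v" and sr': "s (r v) = id_on (idx X) v - i 0 (p 0 v)" for v
    using fun_cong[OF rs, of v] fun_cong[OF sr, of v] by (simp_all add: e_def)
  have p0s: "p 0 (s v) = 0" for v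
  proof -
    have "s v = s (r (s v))" by (simp add: rs' lin_maps_id_right[OF module_homs_lin_maps[OF s]])
    then have "p 0 (s v) = p 0 (id_on (idx X) (s v) - i 0 (p 0 (s v)))" by (simp add: sr')
    then show ?thesis by (simp add: l0 pi)
  qed
  have ri0: "r (i 0 v) = 0" for v
  proof -
    have "r (i 0 v) = r (s (r (i 0 v)))" by (simp add: rs' lin_maps_id_left[OF module_homs_lin_maps[OF r]])
    then show ?thesis by (simp add: sr' l0 pi lin_0[OF module_homs_lin[OF r]])
  qed
  have "dsum \<gg> [Ws ! 0, Y] X (case_nat (i 0) (\<lambda>_. s)) (case_nat (p 0) (\<lambda>_. r))"
    unfolding dsum_def
    using h[OF n0] r s Xl cl_lie_module[OF Y] schur_familyD(1)[OF S h(3)[OF n0]]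
    by (auto simp: less_Suc_eq fun_eq_iff pi p0s ri0 rs' sr' sum_fun_apply lessThan_Suc)
  then have "direct_sum_in M [Ws ! 0, Y] X"
    unfolding direct_sum_in_M using X Y S_cl[OF h(3)[OF n0]] by auto
  then have "zero_object M (Ws ! 0) \<or> zero_object M Y" using assms by (auto simp: indecomposable_def)
  then have "id_on (idx Y) = 0" using id_nz[OF h(3)[OF n0]] by (auto simp: zero_object_M)
  then have "s v = 0" for v
    by (metis lin_maps_id_right[OF module_homs_lin_maps[OF s]] lin_0[OF module_homs_lin[OF s]] zero_fun_apply)
  then have "i 0 (p 0 v) = id_on (idx X) v" for v using sr'[of v] by simp
  then have "iso_in M X (Ws ! 0) (p 0)"
    unfolding iso_in_def using h[OF n0] pi by (auto simp: fun_eq_iff intro!: bexI[of _ "i 0"])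
  then show ?thesis using h(3)[OF n0] by (auto simp: isomorphic_def)
qed

lemma locally_finitary_M: "countable S \<Longrightarrow> locally_finitary M"
  unfolding locally_finitary_def countably_many_indecomposables_def
  using linear_M additive_M idempotent_split_M krull_schmidt_M finite_dim_M indecomposable_iso S_cl
  by (intro conjI exI[of _ S]) auto

lemma not_iso_S:
  assumes "V \<in> S" "W \<in> S" "V \<noteq> W"
  shows "\<not> isomorphic M V W"
proof
  assume "isomorphic M V W"
  then obtain f g where "f \<in> module_homs \<gg> V W" "g \<circ> f = id_on (idx V)" "g \<in> module_homs \<gg> W V"
    by (auto simp: isomorphic_def iso_in_def)
  moreover from this have "f = 0" using schur_familyD(4)[OF S assms(1,2)] assms(3) by blast
  ultimately have "id_on (idx V) = 0" by (auto simp: fun_eq_iff lin_0[OF module_homs_lin])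
  with id_nz[OF assms(1)] show False by simp
qed

end

subsection \<open>The operators of \<open>sl\<^sub>2\<close> and of \<open>L(4)\<close> on a module\<close>

lemma lin_funpow: "lin g \<Longrightarrow> lin (g ^^ n)"
  by (induction n) (auto simp: id_def intro: lin_id lin_comp)

lemma funpow_commute:
  assumes "\<And>x. g (g' x) = g' (g x)" shows "(g ^^ n) (g' x) = g' ((g ^^ n) x)"
  by (induction n) (simp_all add: assms)

text \<open>The relations are imposed on all of \<open>cvec\<close>. Operators of a module satisfy
  this because they vanish on basis vectors outside its index set.\<close>

locale sl2_ops =
  fixes e f h :: "cvec \<Rightarrow> cvec"
  assumes lin_e: "lin e" and lin_f: "lin f" and lin_h: "lin h"
    and ef: "e (f x) = f (e x) + h x"
    and he: "h (e x) = e (h x) + scl 2 (e x)"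
    and hf: "h (f x) = f (h x) - scl 2 (f x)"
begin

lemmas sl = lin_simps[OF lin_e] lin_simps[OF lin_f] lin_simps[OF lin_h]

lemma h_f_pow: "h x = scl l x \<Longrightarrow> h ((f ^^ n) x) = scl (l - 2 * of_nat n) ((f ^^ n) x)"
proof (induction n)
  case (Suc n)
  then have "h ((f ^^ Suc n) x) = scl (l - 2 * of_nat n) (f ((f ^^ n) x)) - scl 2 (f ((f ^^ n) x))"
    by (simp add: hf sl)
  also have "\<dots> = scl (l - 2 * of_nat (Suc n)) ((f ^^ Suc n) x)"
    by (rule poly_mapping_eqI) (simp only: lookup_minus lookup_scl, simp add: algebra_simps)
  finally show ?case .
qed simp

lemma e_f_pow: "e x = 0 \<Longrightarrow> h x = scl l x \<Longrightarrow> e ((f ^^ Suc n) x) = scl (of_nat (Suc n) * (l - of_nat n)) ((f ^^ n) x)"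
proof (induction n)
  case 0
  then show ?case by (simp add: ef sl)
next
  case (Suc n)
  have "e ((f ^^ Suc (Suc n)) x) = f (e ((f ^^ Suc n) x)) + h ((f ^^ Suc n) x)"
    by (simp add: ef)
  also have "\<dots> = scl (of_nat (Suc n) * (l - of_nat n)) ((f ^^ Suc n) x) + scl (l - 2 * of_nat (Suc n)) ((f ^^ Suc n) x)"
    by (subst h_f_pow[OF Suc.prems(2)]) (simp only: Suc.IH[OF Suc.prems] sl, simp)
  also have "\<dots> = scl (of_nat (Suc (Suc n)) * (l - of_nat (Suc n))) ((f ^^ Suc n) x)"
    by (rule poly_mapping_eqI) (simp only: lookup_add lookup_scl, simp add: algebra_simps)
  finally show ?case .
qed

end

text \<open>\<open>a, b, c, d, k\<close> stand for the actions of \<open>v\<^sub>4, v\<^sub>2, v\<^sub>0, v\<^sub>-\<^sub>2, v\<^sub>-\<^sub>4\<close>.\<close>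

locale g_ops = sl2_ops +
  fixes a b c d k :: "cvec \<Rightarrow> cvec"
  assumes lin_a: "lin a" and lin_b: "lin b" and lin_c: "lin c" and lin_d: "lin d" and lin_k: "lin k"
    and ea: "e (a x) = a (e x)" and eb: "e (b x) = b (e x) + scl 4 (a x)"
    and ec: "e (c x) = c (e x) + scl 3 (b x)" and ed: "e (d x) = d (e x) + scl 2 (c x)"
    and ek: "e (k x) = k (e x) + d x"
    and fa: "f (a x) = a (f x) + b x" and fb: "f (b x) = b (f x) + scl 2 (c x)"
    and fc: "f (c x) = c (f x) + scl 3 (d x)" and fd: "f (d x) = d (f x) + scl 4 (k x)"
    and fk: "f (k x) = k (f x)"
    and ha: "h (a x) = a (h x) + scl 4 (a x)" and hb: "h (b x) = b (h x) + scl 2 (b x)"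
    and hc: "h (c x) = c (h x)" and hd: "h (d x) = d (h x) - scl 2 (d x)"
    and hk: "h (k x) = k (h x) - scl 4 (k x)"
    and ba: "b (a x) = a (b x)" and ca: "c (a x) = a (c x)" and da: "d (a x) = a (d x)" and ka: "k (a x) = a (k x)"
    and cb: "c (b x) = b (c x)" and db: "d (b x) = b (d x)" and kb: "k (b x) = b (k x)"
    and dc: "d (c x) = c (d x)" and kc: "k (c x) = c (k x)" and kd: "k (d x) = d (k x)"
begin

lemmas gl = sl lin_simps[OF lin_a] lin_simps[OF lin_b] lin_simps[OF lin_c] lin_simps[OF lin_d] lin_simps[OF lin_k]
lemmas comm = ba ca da ka cb db kb dc kc kd
lemmas frel = fa fb fc fd fk

lemma a_pow: "(a ^^ n) (b x) = b ((a ^^ n) x)" "(a ^^ n) (c x) = c ((a ^^ n) x)"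
  "(a ^^ n) (e x) = e ((a ^^ n) x)" "(a ^^ n) (a x) = a ((a ^^ n) x)"
  by (rule funpow_commute; simp add: comm ea)+

lemma b_pow: "(b ^^ n) (a x) = a ((b ^^ n) x)" "(b ^^ n) (c x) = c ((b ^^ n) x)" "(b ^^ n) (b x) = b ((b ^^ n) x)"
  by (rule funpow_commute; simp add: comm)+

lemma e_a_pow: "e ((a ^^ n) x) = (a ^^ n) (e x)" by (simp add: a_pow)

lemma h_a_pow: "h ((a ^^ n) x) = (a ^^ n) (h x) + scl (4 * of_nat n) ((a ^^ n) x)"
proof (induction n)
  case (Suc n)
  then show ?case
    by (intro poly_mapping_eqI) (simp only: funpow.simps comp_apply ha gl lookup_add lookup_scl, simp add: algebra_simps)
qed simp

lemma h_b_pow: "h ((b ^^ n) x) = (b ^^ n) (h x) + scl (2 * of_nat n) ((b ^^ n) x)"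
proof (induction n)
  case (Suc n)
  then show ?case
    by (intro poly_mapping_eqI) (simp only: funpow.simps comp_apply hb gl lookup_add lookup_scl, simp add: algebra_simps)
qed simp

lemma a_pow_f: "(a ^^ Suc n) (f x) = f ((a ^^ Suc n) x) - scl (of_nat (Suc n)) (b ((a ^^ n) x))"
proof (induction n)
  case 0
  then show ?case by (simp add: fa)
next
  case (Suc n)
  have "(a ^^ Suc (Suc n)) (f x) = a (f ((a ^^ Suc n) x)) - scl (of_nat (Suc n)) (b ((a ^^ Suc n) x))"
    by (simp only: funpow.simps(2)[of "Suc n"] comp_apply Suc gl) (simp add: comm)
  also have "\<dots> = f ((a ^^ Suc (Suc n)) x) - scl (of_nat (Suc (Suc n))) (b ((a ^^ Suc n) x))"
    by (rule poly_mapping_eqI)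
      (simp only: funpow.simps(2)[of "Suc n"] comp_apply fa lookup_add lookup_minus lookup_scl, simp add: algebra_simps)
  finally show ?case .
qed

lemma b_pow_f: "(b ^^ Suc n) (f x) = f ((b ^^ Suc n) x) - scl (2 * of_nat (Suc n)) (c ((b ^^ n) x))"
proof (induction n)
  case 0
  then show ?case by (simp add: fb)
next
  case (Suc n)
  have "(b ^^ Suc (Suc n)) (f x) = b (f ((b ^^ Suc n) x)) - scl (2 * of_nat (Suc n)) (c ((b ^^ Suc n) x))"
    by (simp only: funpow.simps(2)[of "Suc n"] comp_apply Suc gl) (simp add: comm)
  also have "\<dots> = f ((b ^^ Suc (Suc n)) x) - scl (2 * of_nat (Suc (Suc n))) (c ((b ^^ Suc n) x))"
    by (rule poly_mapping_eqI)
      (simp only: funpow.simps(2)[of "Suc n"] comp_apply fb lookup_add lookup_minus lookup_scl, simp add: algebra_simps)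
  finally show ?case .
qed

lemma e_b_pow: "e ((b ^^ Suc n) x) = (b ^^ Suc n) (e x) + scl (4 * of_nat (Suc n)) ((b ^^ n) (a x))"
proof (induction n)
  case 0
  then show ?case by (simp add: eb)
next
  case (Suc n)
  have "e ((b ^^ Suc (Suc n)) x) = b (e ((b ^^ Suc n) x)) + scl 4 (a ((b ^^ Suc n) x))"
    by (simp only: funpow.simps(2)[of "Suc n"] comp_apply eb)
  also have "\<dots> = (b ^^ Suc (Suc n)) (e x) + scl (4 * of_nat (Suc (Suc n))) ((b ^^ Suc n) (a x))"
    unfolding Suc by (rule poly_mapping_eqI)
      (simp only: gl funpow.simps comp_apply b_pow lookup_add lookup_scl ba, simp add: algebra_simps)
  finally show ?case .
qed

text \<open>Each e turns one b into 4a, and a commutes with e. Hence the n-th power of e isolates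
  the top term of an expression in powers of b, up to a power of a.\<close>

lemma e_pow_b_pow: "e u = 0 \<Longrightarrow> (e ^^ n) ((b ^^ n) u) = scl (4 ^ n * fact n) ((a ^^ n) u)"
proof (induction n arbitrary: u)
  case (Suc n)
  have "(e ^^ Suc n) ((b ^^ Suc n) u) = (e ^^ n) (e ((b ^^ Suc n) u))" by (simp only: funpow_Suc_right comp_apply)
  also have "\<dots> = scl (4 * of_nat (Suc n)) ((e ^^ n) ((b ^^ n) (a u)))"
    by (simp only: e_b_pow Suc.prems lin_simps[OF lin_funpow[OF lin_b]] lin_simps[OF lin_funpow[OF lin_e]]) simp
  also have "(e ^^ n) ((b ^^ n) (a u)) = scl (4 ^ n * fact n) ((a ^^ n) (a u))"
    using Suc.prems by (intro Suc.IH) (simp add: ea gl)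
  finally show ?case by (simp add: a_pow algebra_simps)
qed simp

lemma e_pow_b_pow_0: "e u = 0 \<Longrightarrow> m < n \<Longrightarrow> (e ^^ n) ((b ^^ m) u) = 0"
proof -
  assume u: "e u = 0" and "m < n"
  then obtain j where n: "n = Suc j + m" by (metis add.commute add_Suc_right less_imp_Suc_add)
  have "(e ^^ n) ((b ^^ m) u) = (e ^^ Suc j) (scl (4 ^ m * fact m) ((a ^^ m) u))"
    by (simp only: n funpow_add comp_apply e_pow_b_pow[OF u])
  also have "\<dots> = (e ^^ j) (scl (4 ^ m * fact m) ((a ^^ m) (e u)))"
    by (simp only: funpow_Suc_right comp_apply gl e_a_pow)
  finally show ?thesis by (simp add: u lin_0[OF lin_funpow[OF lin_a]] lin_0[OF lin_funpow[OF lin_e]])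
qed

text \<open>Count a as 2 and b as 1. Moving an f to the left past the monomial turns an a into a b
  or a b into a c, so each f lowers the count by at most one. With too few f some a or b reaches
  \<open>y\<close> and kills it. With exactly enough, only powers of c survive, and all
  contributions have the same sign, so they cannot cancel.\<close>

lemma X_zero:
  assumes y: "a y = 0" "b y = 0"
  shows "n < 2 * i + j \<Longrightarrow> (a ^^ i) ((b ^^ j) ((f ^^ n) y)) = 0"
    and "n = 2 * i + j \<Longrightarrow> \<exists>r>0. (a ^^ i) ((b ^^ j) ((f ^^ n) y)) = scl (of_real ((-1) ^ n * r)) ((c ^^ (i + j)) y)"
proof -
  note la = lin_simps[OF lin_funpow[OF lin_a]] and lb = lin_simps[OF lin_funpow[OF lin_b]]
  have rec: "(a ^^ i) ((b ^^ j) (f z)) = f ((a ^^ i) ((b ^^ j) z))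
     - scl (of_nat i) ((a ^^ (i - 1)) ((b ^^ (j + 1)) z)) - scl (2 * of_nat j) (c ((a ^^ i) ((b ^^ (j - 1)) z)))" for i j z
  proof -
    have 1: "(b ^^ j) (f z) = f ((b ^^ j) z) - scl (2 * of_nat j) (c ((b ^^ (j - 1)) z))"
      by (cases j) (simp_all only: b_pow_f, simp_all)
    have 2: "(a ^^ i) (f z) = f ((a ^^ i) z) - scl (of_nat i) ((a ^^ (i - 1)) (b z))" for z
      by (cases i) (simp_all only: a_pow_f a_pow, simp_all)
    show ?thesis by (simp add: 1 2 la a_pow)
  qed
  have z: "n < 2 * i + j \<Longrightarrow> (a ^^ i) ((b ^^ j) ((f ^^ n) y)) = 0" for n i j
  proof (induction n arbitrary: i j)
    case 0
    show ?case
    proof (cases j)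
      case 0
      with \<open>0 < 2 * i + j\<close> obtain i' where "i = Suc i'" by (cases i) auto
      then show ?thesis using 0 y by (simp add: a_pow[symmetric] la del: funpow.simps add: funpow_Suc_right)
    next
      case (Suc j')
      then show ?thesis using y by (simp add: la lb del: funpow.simps add: funpow_Suc_right)
    qed
  next
    case (Suc n)
    have 1: "(a ^^ i) ((b ^^ j) ((f ^^ n) y)) = 0" by (rule Suc.IH) (use Suc.prems in simp)
    have 2: "scl (of_nat i) ((a ^^ (i - 1)) ((b ^^ (j + 1)) ((f ^^ n) y))) = 0"
      by (cases i) (use Suc.prems in \<open>simp_all add: Suc.IH del: funpow.simps\<close>)
    have 3: "scl (2 * of_nat j) (c ((a ^^ i) ((b ^^ (j - 1)) ((f ^^ n) y)))) = 0"
      by (cases j) (use Suc.prems in \<open>simp_all add: Suc.IH gl del: funpow.simps\<close>)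
    have "(a ^^ i) ((b ^^ j) ((f ^^ Suc n) y)) = (a ^^ i) ((b ^^ j) (f ((f ^^ n) y)))" by simp
    then show ?case by (simp only: rec 1 2 3 gl) simp
  qed
  show "n < 2 * i + j \<Longrightarrow> (a ^^ i) ((b ^^ j) ((f ^^ n) y)) = 0" by (rule z)
  show "n = 2 * i + j \<Longrightarrow> \<exists>r>0. (a ^^ i) ((b ^^ j) ((f ^^ n) y)) = scl (of_real ((-1) ^ n * r)) ((c ^^ (i + j)) y)"
  proof (induction n arbitrary: i j)
    case 0
    then show ?case by (intro exI[of _ 1]) simp
  next
    case (Suc n)
    have 1: "(a ^^ i) ((b ^^ j) ((f ^^ n) y)) = 0" by (rule z) (use Suc.prems in simp)
    have "\<exists>r\<ge>0. (i > 0 \<longrightarrow> r > 0) \<and> scl (of_nat i) ((a ^^ (i - 1)) ((b ^^ (j + 1)) ((f ^^ n) y))) =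
       scl (of_real ((-1) ^ n * r)) ((c ^^ (i + j)) y)"
    proof (cases i)
      case 0
      then show ?thesis by (intro exI[of _ 0]) simp
    next
      case (Suc i')
      then obtain r where "r > 0" "(a ^^ (i - 1)) ((b ^^ (j + 1)) ((f ^^ n) y)) = scl (of_real ((-1) ^ n * r)) ((c ^^ (i + j)) y)"
        using Suc.IH[of "i - 1" "j + 1"] Suc.prems by auto
      then show ?thesis using Suc
        by (intro exI[of _ "of_nat i * r"]) (simp del: funpow.simps of_nat_Suc add: zero_less_mult_iff mult.left_commute)
    qed
    then obtain r where r: "r \<ge> 0" "i > 0 \<longrightarrow> r > 0" "scl (of_nat i) ((a ^^ (i - 1)) ((b ^^ (j + 1)) ((f ^^ n) y))) =
       scl (of_real ((-1) ^ n * r)) ((c ^^ (i + j)) y)" by blast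
    have "\<exists>r\<ge>0. (j > 0 \<longrightarrow> r > 0) \<and> scl (2 * of_nat j) (c ((a ^^ i) ((b ^^ (j - 1)) ((f ^^ n) y)))) =
       scl (of_real ((-1) ^ n * r)) ((c ^^ (i + j)) y)"
    proof (cases j)
      case 0
      then show ?thesis by (intro exI[of _ 0]) simp
    next
      case (Suc j')
      then obtain r where "r > 0" "(a ^^ i) ((b ^^ j') ((f ^^ n) y)) = scl (of_real ((-1) ^ n * r)) ((c ^^ (i + j')) y)"
        using Suc.IH[of i j'] Suc.prems by auto
      then show ?thesis using Suc
        by (intro exI[of _ "2 * of_nat j * r"]) (simp del: of_nat_Suc add: zero_less_mult_iff mult.left_commute mult.commute gl)
    qed
    then obtain r' where r': "r' \<ge> 0" "j > 0 \<longrightarrow> r' > 0" "scl (2 * of_nat j) (c ((a ^^ i) ((b ^^ (j - 1)) ((f ^^ n) y)))) =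
       scl (of_real ((-1) ^ n * r')) ((c ^^ (i + j)) y)" by blast
    have "i > 0 \<or> j > 0" using Suc.prems by auto
    then have "r + r' > 0" using r r' by auto
    moreover have "(a ^^ i) ((b ^^ j) ((f ^^ Suc n) y)) = scl (of_real ((-1) ^ Suc n * (r + r'))) ((c ^^ (i + j)) y)"
    proof -
      have "(a ^^ i) ((b ^^ j) ((f ^^ Suc n) y)) = (a ^^ i) ((b ^^ j) (f ((f ^^ n) y)))" by simp
      also have "\<dots> = 0 - scl (of_real ((-1) ^ n * r)) ((c ^^ (i + j)) y) - scl (of_real ((-1) ^ n * r')) ((c ^^ (i + j)) y)"
        by (simp only: rec 1 r(3) r'(3) gl)
      also have "\<dots> = scl (of_real ((-1) ^ Suc n * (r + r'))) ((c ^^ (i + j)) y)"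
        by (rule poly_mapping_eqI) (simp only: lookup_minus lookup_scl, simp add: algebra_simps)
      finally show ?thesis .
    qed
    ultimately show ?case by blast
  qed
qed

text \<open>A vector killed by the positive power sums below would be annihilated by a power of \<open>c\<close>,
  which is impossible when \<open>c\<^sup>2 = \<mu>\<^sup>2\<close> on it.\<close>

lemma hw_a_nonzero:
  assumes x: "x \<noteq> 0" "e x = 0" "h x = scl (of_nat m) x" and S: "x \<in> S" "\<And>y. y \<in> S \<Longrightarrow> b y \<in> S"
    and \<mu>: "\<mu> \<noteq> 0"
    and C2: "\<And>y. y \<in> S \<Longrightarrow> c (c y) - scl 3 (d (b y)) + scl 12 (k (a y)) = scl (\<mu>\<^sup>2) y"
    and nil: "\<And>y m. y \<in> S \<Longrightarrow> e y = 0 \<Longrightarrow> h y = scl (of_nat m) y \<Longrightarrow> (f ^^ Suc m) y = 0"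
  shows "a x \<noteq> 0"
proof
  assume ax: "a x = 0"
  note la = lin_simps[OF lin_funpow[OF lin_a]] and lb = lin_simps[OF lin_funpow[OF lin_b]]
  have abn: "a ((b ^^ n) x) = 0" for n
    by (simp add: b_pow(1)[symmetric] ax lb)
  \<comment> \<open>On the kernel of a, the operator \<open>a\<^sup>n f\<^sup>n\<close> is a
    non-zero multiple of \<open>b\<^sup>n\<close>. As f is nilpotent on \<open>x\<close>, so is
    b.\<close>
  have "\<exists>r::real. r \<noteq> 0 \<and> (a ^^ n) ((f ^^ n) y) = scl (of_real r) ((b ^^ n) y)" if y: "a y = 0" for n y
  proof (induction n)
    case 0
    then show ?case by (intro exI[of _ 1]) simp
  next
    case (Suc n)
    then obtain r where r: "r \<noteq> 0" "(a ^^ n) ((f ^^ n) y) = scl (of_real r) ((b ^^ n) y)" by blast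
    have ab: "a ((b ^^ n) y) = 0" by (simp add: b_pow(1)[symmetric] y lb)
    have "(a ^^ Suc n) ((f ^^ Suc n) y) = (a ^^ Suc n) (f ((f ^^ n) y))" by simp
    also have "\<dots> = f (a ((a ^^ n) ((f ^^ n) y))) - scl (of_nat (Suc n)) (b ((a ^^ n) ((f ^^ n) y)))"
      by (simp only: a_pow_f) simp
    also have "\<dots> = scl (of_real (- r * of_nat (Suc n))) ((b ^^ Suc n) y)"
      by (simp only: r gl ab) (rule poly_mapping_eqI, simp only: lookup_minus lookup_scl, simp)
    finally show ?case using r(1) by (intro exI[of _ "- r * of_nat (Suc n)"]) (simp del: of_nat_Suc)
  qed
  from this[OF ax, of "Suc m"] nil[OF S(1) x(2,3)] have "\<exists>n. (b ^^ n) x = 0"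
    by (intro exI[of _ "Suc m"]) (auto simp: la simp del: funpow.simps)
  \<comment> \<open>The last non-zero power of b applied to \<open>x\<close> is a highest weight
    vector killed by both a and b, the situation of \<open>X_zero\<close>.\<close>
  define N where "N = (LEAST n. (b ^^ n) x = 0)"
  have N: "(b ^^ N) x = 0" unfolding N_def by (rule LeastI_ex) fact
  then obtain N' where N': "N = Suc N'" using x(1) by (cases N) auto
  define y where "y = (b ^^ N') x"
  have y0: "y \<noteq> 0" using not_less_Least[of N' "\<lambda>n. (b ^^ n) x = 0"] N' by (simp add: y_def N_def)
  have ay: "a y = 0" and by0: "b y = 0" using abn N N' by (simp_all add: y_def)
  have yS: "y \<in> S" unfolding y_def by (induction N') (use S in auto)
  have ey: "e y = 0"
    by (cases N') (simp_all only: y_def e_b_pow x ax lb, simp_all add: x)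
  have hy: "h y = scl (of_nat (m + 2 * N')) y"
    unfolding y_def h_b_pow x(3)
    by (rule poly_mapping_eqI) (simp only: lb lookup_add lookup_scl, simp add: algebra_simps)
  \<comment> \<open>\<open>f ^^ ?n\<close> already kills \<open>y\<close>. The exponent is doubled
    so that it has the form 2i required by \<open>X_zero\<close> with no factor b.\<close>
  let ?n = "Suc (m + 2 * N')"
  obtain r where r: "r > 0" "(a ^^ ?n) ((b ^^ 0) ((f ^^ (2 * ?n)) y)) = scl (of_real ((-1) ^ (2 * ?n) * r)) ((c ^^ (?n + 0)) y)"
    using X_zero(2)[OF ay by0, of "2 * ?n" ?n 0] by auto
  have "(f ^^ (2 * ?n)) y = (f ^^ ?n) ((f ^^ ?n) y)" by (simp only: mult_2 funpow_add comp_apply)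
  also have "\<dots> = 0" by (simp only: nil[OF yS ey hy] lin_0[OF lin_funpow[OF lin_f]])
  finally have "scl (of_real r) ((c ^^ ?n) y) = 0" using r(2) by (simp add: la del: funpow.simps)
  then have cn: "(c ^^ ?n) y = 0" using r(1) by simp
  have cc: "c (c y) = scl (\<mu>\<^sup>2) y" using C2[OF yS] by (simp add: ay by0 gl)
  have "(c ^^ (2 * n)) y = scl (\<mu> ^ (2 * n)) y" for n
    by (induction n) (simp_all add: gl cc power2_eq_square mult.commute)
  then have "scl (\<mu> ^ (2 * ?n)) y = (c ^^ ?n) ((c ^^ ?n) y)"
    by (metis mult_2 funpow_add comp_apply)
  also have "\<dots> = 0" by (simp only: cn lin_0[OF lin_funpow[OF lin_c]])
  finally show False using \<mu> y0 by simp
qed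

end

subsection \<open>Eigenvectors\<close>

text \<open>Applying \<open>A - l j\<close> removes one term and rescales the others by non-zero
  factors. The general vector space allows a second use for operators, with \<open>A\<close> the
  commutator with h.\<close>

lemma (in vector_space) eigen_indep:
  assumes "Vector_Spaces.linear scale scale A" "finite J" "inj_on l J"
    "\<And>i. i \<in> J \<Longrightarrow> A (x i) = scale (l i) (x i)" "(\<Sum>i\<in>J. x i) = 0" "i \<in> J"
  shows "x i = 0"
  using assms(2-)
proof (induction J arbitrary: x i rule: finite_induct)
  case (insert j J)
  interpret A: Vector_Spaces.linear scale scale A by (rule assms(1))
  define y where "y i = scale (l i - l j) (x i)" for i
  have s: "x j + (\<Sum>i\<in>J. x i) = 0" using insert by simp
  have "A (x j + (\<Sum>i\<in>J. x i)) - scale (l j) (x j + (\<Sum>i\<in>J. x i)) = 0"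
    by (simp only: s A.zero scale_zero_right) simp
  moreover have "A (x j + (\<Sum>i\<in>J. x i)) = scale (l j) (x j) + (\<Sum>i\<in>J. scale (l i) (x i))"
    using insert.prems(2) by (simp add: A.add A.sum)
  ultimately have "(\<Sum>i\<in>J. y i) = 0"
    by (simp add: y_def scale_left_diff_distrib scale_right_distrib scale_sum_right sum_subtractf)
  moreover have "A (y i) = scale (l i) (y i)" if "i \<in> J" for i
    using insert.prems(2)[of i] that by (simp add: y_def A.scale mult.commute)
  ultimately have "y i = 0" if "i \<in> J" for i
    using insert.IH[of y i] insert.prems(1) that by (auto simp: inj_on_def)
  then have z: "x i = 0" if "i \<in> J" for i
    using that insert.prems(1) insert.hyps(2) unfolding y_def inj_on_def
    by (metis eq_iff_diff_eq_0 insertCI scale_eq_0_iff)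
  then have "x j = 0" using s by simp
  with z insert.prems(4) show ?case by auto
qed simp

lemma span_rangeE:
  fixes u :: "nat \<Rightarrow> cvec"
  assumes "x \<in> cvec.span (range u)"
  obtains N c where "x = (\<Sum>t<N. scl (c t) (u t))"
proof -
  have "\<exists>N c. x = (\<Sum>t<N. scl (c t) (u t))" using assms
  proof (induction rule: cvec.span_induct_alt)
    case base
    show ?case by (intro exI[of _ 0]) simp
  next
    case (step c v y)
    then obtain t N c' where v: "v = u t" and y: "y = (\<Sum>t<N. scl (c' t) (u t))" by auto
    let ?c = "\<lambda>s. (if s < N then c' s else 0) + (if s = t then c else 0)"
    have "(\<Sum>s<N + Suc t. scl (?c s) (u s)) =
      (\<Sum>s<N + Suc t. if s < N then scl (c' s) (u s) else 0) + (\<Sum>s<N + Suc t. if s = t then scl c (u s) else 0)"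
      unfolding sum.distrib[symmetric] by (intro sum.cong) (auto simp: cvec.scale_left_distrib)
    also have "(\<Sum>s<N + Suc t. if s < N then scl (c' s) (u s) else 0) = y"
      unfolding y by (rule sum.mono_neutral_cong_right) auto
    also have "(\<Sum>s<N + Suc t. if s = t then scl c (u s) else 0) = scl c v" by (simp add: v sum.delta)
    finally have "scl c v + y = (\<Sum>s<N + Suc t. scl (?c s) (u s))" by (simp add: add.commute)
    then show ?case by - (rule exI[of _ "N + Suc t"], rule exI[of _ ?c])
  qed
  then show ?thesis using that by blast
qed

section \<open>Submodules as spaces closed under the operators; the covariants of the
  quartic\<close>

context g_ops begin

definition closed :: "cvec set \<Rightarrow> bool" where
  "closed T \<longleftrightarrow> cvec.subspace T \<and> (\<forall>x\<in>T. e x \<in> T \<and> f x \<in> T \<and> h x \<in> T \<and> a x \<in> T \<and> b x \<in> T \<and> c x \<in> T \<and> d x \<in> T \<and> k x \<in> T)"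

lemma closedD:
  assumes "closed T" "x \<in> T"
  shows "e x \<in> T" "f x \<in> T" "h x \<in> T" "a x \<in> T" "b x \<in> T" "c x \<in> T" "d x \<in> T" "k x \<in> T"
  using assms by (auto simp: closed_def)

text \<open>The five components of the covariant \<open>8 H(Q) - \<eta> Q\<close> of the quartic \<open>Q\<close>, up to scalars.\<close>

definition q4 where "q4 \<eta> x = scl 8 (a (c x)) - scl 3 (b (b x)) - scl \<eta> (a x)"
definition q2 where "q2 \<eta> x = scl 24 (a (d x)) - scl 4 (b (c x)) - scl \<eta> (b x)"
definition q0 where "q0 \<eta> x = scl 12 (b (d x)) + scl 96 (a (k x)) - scl 8 (c (c x)) - scl (2 * \<eta>) (c x)"
definition qm2 where "qm2 \<eta> x = scl 144 (b (k x)) - scl 24 (c (d x)) - scl (6 * \<eta>) (d x)"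
definition qm4 where "qm4 \<eta> x = scl 192 (c (k x)) - scl 72 (d (d x)) - scl (24 * \<eta>) (k x)"

lemmas q_defs = q4_def q2_def q0_def qm2_def qm4_def
lemmas lk = lookup_add lookup_minus lookup_scl

lemma lin_q4: "lin (q4 \<eta>)"
  by (rule linI; rule poly_mapping_eqI; simp only: q4_def gl lk; simp add: algebra_simps)

lemma lin_q2: "lin (q2 \<eta>)"
  by (rule linI; rule poly_mapping_eqI; simp only: q2_def gl lk; simp add: algebra_simps)

lemma f_q: "f (q4 \<eta> x) = q4 \<eta> (f x) + q2 \<eta> x"
  "f (q2 \<eta> x) = q2 \<eta> (f x) + q0 \<eta> x"
  "f (q0 \<eta> x) = q0 \<eta> (f x) + qm2 \<eta> x"
  "f (qm2 \<eta> x) = qm2 \<eta> (f x) + qm4 \<eta> x"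
  by (rule poly_mapping_eqI; simp only: q_defs gl frel comm lk; simp add: algebra_simps)+

lemma e_q4: "e (q4 \<eta> x) = q4 \<eta> (e x)"
  by (rule poly_mapping_eqI; simp only: q_defs gl ea eb ec comm lk; simp add: algebra_simps)

lemma h_q4: "h (q4 \<eta> x) = q4 \<eta> (h x) + scl 4 (q4 \<eta> x)"
  by (rule poly_mapping_eqI; simp only: q_defs gl ha hb hc comm lk; simp add: algebra_simps)

lemma q4_comm: "q4 \<eta> (a x) = a (q4 \<eta> x)" "q4 \<eta> (b x) = b (q4 \<eta> x)" "q4 \<eta> (c x) = c (q4 \<eta> x)"
  "q4 \<eta> (d x) = d (q4 \<eta> x)" "q4 \<eta> (k x) = k (q4 \<eta> x)"
  by (rule poly_mapping_eqI; simp only: q_defs gl comm lk)+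

lemma q4_q2: "q4 \<eta> (q2 \<eta> x) = q2 \<eta> (q4 \<eta> x)"
  by (rule poly_mapping_eqI; simp only: q2_def lin_simps[OF lin_q4] q4_comm lk)

text \<open>This identity determines the unknown \<eta>. The left side vanishes as soon as the
  covariant does, while the right side is \<open>-8 C\<^sub>3 - 2 \<eta> C\<^sub>2\<close>, whose
  value is known.\<close>

lemma C3_combination:
  "c (q0 \<eta> x) - scl 6 (d (q2 \<eta> x)) + scl 36 (k (q4 \<eta> x)) - scl (1/2) (a (qm4 \<eta> x)) =
   scl (-8) (c (c (c x)) - scl (9/2) (d (c (b x))) + scl (27/2) (d (d (a x))) + scl (27/2) (k (b (b x)))
      - scl 36 (k (c (a x)))) - scl (2 * \<eta>) (c (c x) - scl 3 (d (b x)) + scl 12 (k (a x)))"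
  by (rule poly_mapping_eqI; simp only: q_defs gl comm lk; simp add: algebra_simps)

text \<open>By \<open>f_q\<close> the lowering operator leads from each component of the covariant
  to the next, so on a space stable under f the vanishing of the first one spreads.\<close>

lemma q_zero_imp:
  assumes T: "closed T" and z: "\<And>x. x \<in> T \<Longrightarrow> q4 \<eta> x = 0" and x: "x \<in> T"
  shows "q2 \<eta> x = 0" "q0 \<eta> x = 0" "qm2 \<eta> x = 0" "qm4 \<eta> x = 0"
proof -
  have 2: "q2 \<eta> x = 0" if "x \<in> T" for x using f_q(1)[of \<eta> x] z that closedD(2)[OF T that] by (simp add: gl)
  have 0: "q0 \<eta> x = 0" if "x \<in> T" for x using f_q(2)[of \<eta> x] 2 that closedD(2)[OF T that] by (simp add: gl)
  have m2: "qm2 \<eta> x = 0" if "x \<in> T" for x using f_q(3)[of \<eta> x] 0 that closedD(2)[OF T that] by (simp add: gl)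
  have m4: "qm4 \<eta> x = 0" if "x \<in> T" for x using f_q(4)[of \<eta> x] m2 that closedD(2)[OF T that] by (simp add: gl)
  show "q2 \<eta> x = 0" "q0 \<eta> x = 0" "qm2 \<eta> x = 0" "qm4 \<eta> x = 0" using 2 0 m2 m4 x by auto
qed

lemma q4_pow_h: "(q4 \<eta> ^^ n) (h x) = h ((q4 \<eta> ^^ n) x) - scl (4 * of_nat n) ((q4 \<eta> ^^ n) x)"
proof (induction n)
  case (Suc n)
  have "(q4 \<eta> ^^ Suc n) (h x) = q4 \<eta> (h ((q4 \<eta> ^^ n) x)) - scl (4 * of_nat n) (q4 \<eta> ((q4 \<eta> ^^ n) x))"
    by (simp add: Suc lin_simps[OF lin_q4])
  also have "q4 \<eta> (h ((q4 \<eta> ^^ n) x)) = h (q4 \<eta> ((q4 \<eta> ^^ n) x)) - scl 4 (q4 \<eta> ((q4 \<eta> ^^ n) x))"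
    by (simp add: h_q4)
  finally show ?case
    by (intro poly_mapping_eqI) (simp only: funpow.simps comp_apply lk, simp add: algebra_simps)
qed simp

lemma q4_pow_f: "(q4 \<eta> ^^ Suc n) (f x) = f ((q4 \<eta> ^^ Suc n) x) - scl (of_nat (Suc n)) (q2 \<eta> ((q4 \<eta> ^^ n) x))"
proof (induction n)
  case 0
  then show ?case by (simp add: f_q)
next
  case (Suc n)
  have "(q4 \<eta> ^^ Suc (Suc n)) (f x) = q4 \<eta> (f ((q4 \<eta> ^^ Suc n) x)) - scl (of_nat (Suc n)) (q2 \<eta> (q4 \<eta> ((q4 \<eta> ^^ n) x)))"
    by (simp only: funpow.simps(2)[of "Suc n"] comp_apply Suc lin_simps[OF lin_q4] q4_q2)
  also have "q4 \<eta> (f ((q4 \<eta> ^^ Suc n) x)) = f (q4 \<eta> ((q4 \<eta> ^^ Suc n) x)) - q2 \<eta> ((q4 \<eta> ^^ Suc n) x)"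
    by (simp only: f_q) simp
  finally show ?case
    by (intro poly_mapping_eqI) (simp only: funpow.simps(2) comp_apply lk, simp add: algebra_simps)
qed

text \<open>The kernel of \<open>q4\<close> is not visibly stable under f, since \<open>q4\<close>
  fails to commute with f by the term \<open>q2\<close>. The generalised kernel is stable: by
  \<open>q4_pow_f\<close> one more power of \<open>q4\<close> absorbs this term.\<close>

lemma q4_pow_kernel_closed:
  assumes S: "closed S"
  shows "closed {x \<in> S. \<exists>n. (q4 \<eta> ^^ n) x = 0}"
proof -
  let ?q = "\<lambda>n. q4 \<eta> ^^ n"
  have lq: "lin (?q n)" for n by (rule lin_funpow[OF lin_q4])
  note l = lin_simps[OF lq]
  have sS: "cvec.subspace S" using S by (simp add: closed_def)
  have mono: "?q (n + m) x = 0" if "?q n x = 0" for n m x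
    by (simp add: add.commute[of n m] funpow_add that l)
  have sub: "cvec.subspace {x \<in> S. \<exists>n. ?q n x = 0}"
    unfolding cvec.subspace_def
  proof (intro conjI ballI allI)
    fix x y assume "x \<in> {x \<in> S. \<exists>n. ?q n x = 0}" "y \<in> {x \<in> S. \<exists>n. ?q n x = 0}"
    then obtain n m where "?q n x = 0" "?q m y = 0" "x \<in> S" "y \<in> S" by blast
    then have "?q (n + m) (x + y) = 0" using mono[of n x m] mono[of m y n] by (simp add: l add.commute)
    then show "x + y \<in> {x \<in> S. \<exists>n. ?q n x = 0}" using \<open>x \<in> S\<close> \<open>y \<in> S\<close> sS cvec.subspace_add by blast
  next
    fix r x assume "x \<in> {x \<in> S. \<exists>n. ?q n x = 0}"
    then show "scl r x \<in> {x \<in> S. \<exists>n. ?q n x = 0}" using sS cvec.subspace_scale by (auto simp: l)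
  qed (use sS in \<open>auto simp: l cvec.subspace_0\<close>)
  have "g x \<in> {x \<in> S. \<exists>n. ?q n x = 0}"
    if x: "x \<in> {x \<in> S. \<exists>n. ?q n x = 0}" and g: "lin g" "\<And>x. x \<in> S \<Longrightarrow> g x \<in> S" "\<And>x. q4 \<eta> (g x) = g (q4 \<eta> x)" for g x
  proof -
    obtain n where "x \<in> S" "?q n x = 0" using x by blast
    then have "?q n (g x) = 0" by (simp add: funpow_commute[of "q4 \<eta>" g, OF g(3)] lin_0[OF g(1)])
    then show ?thesis using g(2) \<open>x \<in> S\<close> by blast
  qed
  note cl = this
  have hf: "h x \<in> {x \<in> S. \<exists>n. ?q n x = 0} \<and> f x \<in> {x \<in> S. \<exists>n. ?q n x = 0}"
    if x: "x \<in> {x \<in> S. \<exists>n. ?q n x = 0}" for x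
  proof -
    obtain n where n: "x \<in> S" "?q n x = 0" using x by blast
    have "?q n (h x) = 0" by (simp add: q4_pow_h n gl)
    moreover have "?q (Suc n) (f x) = 0"
      by (simp only: q4_pow_f n lin_simps[OF lin_q2]) (simp add: n lin_simps[OF lin_q4] gl)
    ultimately show ?thesis using closedD[OF S n(1)] by blast
  qed
  have ops: "e x \<in> {x \<in> S. \<exists>n. ?q n x = 0}" "a x \<in> {x \<in> S. \<exists>n. ?q n x = 0}"
    "b x \<in> {x \<in> S. \<exists>n. ?q n x = 0}" "c x \<in> {x \<in> S. \<exists>n. ?q n x = 0}"
    "d x \<in> {x \<in> S. \<exists>n. ?q n x = 0}" "k x \<in> {x \<in> S. \<exists>n. ?q n x = 0}"
    if x: "x \<in> {x \<in> S. \<exists>n. ?q n x = 0}" for x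
    by (rule cl[OF x lin_e closedD(1)[OF S] e_q4[symmetric]] cl[OF x lin_a closedD(4)[OF S] q4_comm(1)]
      cl[OF x lin_b closedD(5)[OF S] q4_comm(2)] cl[OF x lin_c closedD(6)[OF S] q4_comm(3)]
      cl[OF x lin_d closedD(7)[OF S] q4_comm(4)] cl[OF x lin_k closedD(8)[OF S] q4_comm(5)]; assumption)+
  show ?thesis unfolding closed_def
    by (intro conjI ballI; (rule sub hf[THEN conjunct1] hf[THEN conjunct2] ops); assumption?)
qed

end

text \<open>\<open>P t\<close> says that \<open>L (n + 2 * t)\<close> occurs in the restriction of the simple module \<open>S\<close> to \<open>sl\<^sub>2\<close>.\<close>

locale hw_simple = g_ops +
  fixes S :: "cvec set" and \<mu> :: complex and n :: nat and P :: "nat \<Rightarrow> bool"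
  assumes S_closed: "closed S"
    and S_simple: "\<And>T x. closed T \<Longrightarrow> T \<subseteq> S \<Longrightarrow> x \<in> T \<Longrightarrow> x \<noteq> 0 \<Longrightarrow> T = S"
    and \<mu>: "\<mu> \<noteq> 0"
    and C2: "\<And>x. x \<in> S \<Longrightarrow> c (c x) - scl 3 (d (b x)) + scl 12 (k (a x)) = scl (\<mu>\<^sup>2) x"
    and C3: "\<And>x. x \<in> S \<Longrightarrow> c (c (c x)) - scl (9/2) (d (c (b x))) + scl (27/2) (d (d (a x)))
        + scl (27/2) (k (b (b x))) - scl 36 (k (c (a x))) = scl (\<mu> ^ 3) x"
    and hw_ex: "\<And>t. P t \<Longrightarrow> \<exists>x\<in>S. x \<noteq> 0 \<and> e x = 0 \<and> h x = scl (of_nat (n + 2 * t)) x"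
    and hw_wt: "\<And>x l. x \<in> S \<Longrightarrow> x \<noteq> 0 \<Longrightarrow> e x = 0 \<Longrightarrow> h x = scl l x \<Longrightarrow> \<exists>t. P t \<and> l = of_nat (n + 2 * t)"
    and hw_uniq: "\<And>x y l. x \<in> S \<Longrightarrow> y \<in> S \<Longrightarrow> x \<noteq> 0 \<Longrightarrow> e x = 0 \<Longrightarrow> e y = 0 \<Longrightarrow> h x = scl l x \<Longrightarrow> h y = scl l y \<Longrightarrow> \<exists>r. y = scl r x"
    and hw_nil: "\<And>x m. x \<in> S \<Longrightarrow> e x = 0 \<Longrightarrow> h x = scl (of_nat m) x \<Longrightarrow> (f ^^ Suc m) x = 0"
    and e_nil: "\<And>x. x \<in> S \<Longrightarrow> \<exists>N. (e ^^ N) x = 0"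
    and hw_span: "\<And>x. x \<in> S \<Longrightarrow> e x = 0 \<Longrightarrow> x \<in> cvec.span {y \<in> S. e y = 0 \<and> (\<exists>t. h y = scl (of_nat (n + 2 * t)) y)}"
    and P_step: "\<And>t. P (t + 2) = P t" and P_01: "P 0 \<or> P 1"
begin

lemma S_subspace: "cvec.subspace S" using S_closed by (simp add: closed_def)

lemmas S_ops = closedD[OF S_closed]

text \<open>The value 0 at weights that do not occur lets one sequence serve the modules with gaps
  as well as those without.\<close>

definition u0 :: "nat \<Rightarrow> cvec" where
  "u0 t = (if P t then SOME x. x \<in> S \<and> x \<noteq> 0 \<and> e x = 0 \<and> h x = scl (of_nat (n + 2 * t)) x else 0)"

text \<open>Only the members 0 and 1 are chosen; the others are images under powers of a. The
  scalars are thereby normalised consistently along each parity class.\<close>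

definition u :: "nat \<Rightarrow> cvec" where
  "u t = (a ^^ (t div 2)) (u0 (t mod 2))"

lemma u_step: "a (u t) = u (t + 2)"
  by (simp add: u_def)

lemma u0: "u0 t \<in> S" "e (u0 t) = 0" "h (u0 t) = scl (of_nat (n + 2 * t)) (u0 t)" "P t \<Longrightarrow> u0 t \<noteq> 0" "\<not> P t \<Longrightarrow> u0 t = 0"
  using someI_ex[of "\<lambda>x. x \<in> S \<and> x \<noteq> 0 \<and> e x = 0 \<and> h x = scl (of_nat (n + 2 * t)) x"] hw_ex[of t]
  by (auto simp: u0_def cvec.subspace_0[OF S_subspace] gl)

lemma hw_a: "x \<in> S \<Longrightarrow> x \<noteq> 0 \<Longrightarrow> e x = 0 \<Longrightarrow> h x = scl (of_nat m) x \<Longrightarrow> a x \<noteq> 0"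
  using hw_a_nonzero[where S = S and \<mu> = \<mu>] S_ops(5) \<mu> C2 hw_nil by blast

lemma u: "u t \<in> S" "e (u t) = 0" "h (u t) = scl (of_nat (n + 2 * t)) (u t)" "P t \<Longrightarrow> u t \<noteq> 0" "\<not> P t \<Longrightarrow> u t = 0"
proof -
  have "u t \<in> S \<and> e (u t) = 0 \<and> h (u t) = scl (of_nat (n + 2 * t)) (u t) \<and> (P t \<longrightarrow> u t \<noteq> 0) \<and> (\<not> P t \<longrightarrow> u t = 0)"
  proof (induction t rule: less_induct)
    case (less t)
    show ?case
    proof (cases "t < 2")
      case True
      then have "t div 2 = 0" "t mod 2 = t" by auto
      then show ?thesis using u0[of t] by (simp add: u_def)
    next
      case False
      then obtain s where t: "t = s + 2" by (metis add.commute le_Suc_ex not_less)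
      have s: "u s \<in> S" "e (u s) = 0" "h (u s) = scl (of_nat (n + 2 * s)) (u s)" "P s \<longrightarrow> u s \<noteq> 0" "\<not> P s \<longrightarrow> u s = 0"
        using less[of s] t by auto
      have "h (u t) = scl (of_nat (n + 2 * t)) (u t)"
        unfolding t u_step[symmetric] ha s(3)
        by (rule poly_mapping_eqI) (simp only: gl lk, simp add: algebra_simps)
      then show ?thesis
        using s hw_a[OF s(1) _ s(2,3)] S_ops(4)[OF s(1)] P_step[of s] unfolding t u_step[symmetric] by (auto simp: ea gl)
    qed
  qed
  then show "u t \<in> S" "e (u t) = 0" "h (u t) = scl (of_nat (n + 2 * t)) (u t)" "P t \<Longrightarrow> u t \<noteq> 0" "\<not> P t \<Longrightarrow> u t = 0"
    by auto
qed

lemma hw_multiple: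
  assumes "x \<in> S" "e x = 0" "h x = scl (of_nat (n + 2 * t)) x"
  shows "\<exists>r. x = scl r (u t)"
proof (cases "P t")
  case True
  then show ?thesis using hw_uniq[OF u(1) assms(1) u(4) u(2) assms(2) u(3) assms(3)] by blast
next
  case False
  have "x = 0"
  proof (rule ccontr)
    assume "x \<noteq> 0"
    then obtain s where "P s" "(of_nat (n + 2 * t) :: complex) = of_nat (n + 2 * s)" using hw_wt[OF assms(1) _ assms(2,3)] by blast
    then have "s = t" by (simp only: of_nat_eq_iff)
    with \<open>P s\<close> False show False by simp
  qed
  then show ?thesis by (intro exI[of _ 0]) simp
qed

lemma hw_span_u:
  assumes "x \<in> S" "e x = 0"
  shows "x \<in> cvec.span (range u)"
proof -
  have "{y \<in> S. e y = 0 \<and> (\<exists>t. h y = scl (of_nat (n + 2 * t)) y)} \<subseteq> cvec.span (range u)"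
  proof
    fix y assume "y \<in> {y \<in> S. e y = 0 \<and> (\<exists>t. h y = scl (of_nat (n + 2 * t)) y)}"
    then obtain t r where "y = scl r (u t)" using hw_multiple by blast
    then show "y \<in> cvec.span (range u)" by (simp add: cvec.span_base cvec.span_scale)
  qed
  then show ?thesis using hw_span[OF assms] cvec.span_minimal[OF _ cvec.subspace_span] by blast
qed

lemma u_indep:
  assumes "(\<Sum>t<N. scl (r t) (u (t + s))) = 0" "t < N"
  shows "scl (r t) (u (t + s)) = 0"
proof (rule cvec.eigen_indep[OF lin_h finite_lessThan _ _ assms(1)])
  show "inj_on (\<lambda>t. of_nat (n + 2 * (t + s)) :: complex) {..<N}"
    by (auto simp: inj_on_def simp del: of_nat_add of_nat_mult)
  show "h (scl (r i) (u (i + s))) = scl (of_nat (n + 2 * (i + s))) (scl (r i) (u (i + s)))" for i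
    by (simp only: gl u(3)) (simp only: cvec.scale_scale mult.commute)
qed (use assms in auto)

lemma last_nonzero_e:
  assumes "x \<in> S" "x \<noteq> 0"
  obtains m where "(e ^^ m) x \<noteq> 0" "e ((e ^^ m) x) = 0" "(e ^^ m) x \<in> S"
proof -
  define N where "N = (LEAST N. (e ^^ N) x = 0)"
  have N: "(e ^^ N) x = 0" unfolding N_def by (rule LeastI_ex[OF e_nil[OF assms(1)]])
  then obtain m where m: "N = Suc m" using assms(2) by (cases N) auto
  have "(e ^^ m) x \<noteq> 0" using not_less_Least[of m "\<lambda>N. (e ^^ N) x = 0"] m by (simp add: N_def)
  moreover have "(e ^^ i) x \<in> S" for i by (induction i) (auto simp: assms S_ops)
  ultimately show ?thesis using that N m by simp
qed

text \<open>As a commutes with e, a non-zero vector in the kernel of a yields a highest weight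
  vector there. Expanded in the \<open>u t\<close>, it is sent to a combination of the
  \<open>u (t + 2)\<close>, which have distinct weights.\<close>

lemma a_inj:
  assumes x: "x \<in> S" "a x = 0" shows "x = 0"
proof (rule ccontr)
  assume "x \<noteq> 0"
  then obtain m where m: "(e ^^ m) x \<noteq> 0" "e ((e ^^ m) x) = 0" "(e ^^ m) x \<in> S"
    using last_nonzero_e[OF x(1)] by blast
  have "(e ^^ m) (a x) = a ((e ^^ m) x)" by (rule funpow_commute) (simp add: ea)
  then have a0: "a ((e ^^ m) x) = 0" by (simp add: x lin_0[OF lin_funpow[OF lin_e]])
  obtain N r where r: "(e ^^ m) x = (\<Sum>t<N. scl (r t) (u t))" using span_rangeE[OF hw_span_u[OF m(3,2)]] .
  have "(\<Sum>t<N. scl (r t) (u (t + 2))) = 0" using a0 by (simp add: r gl u_step)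
  then have "scl (r t) (u (t + 2)) = 0" if "t < N" for t using u_indep that by blast
  then have "scl (r t) (u t) = 0" if "t < N" for t
    using that u(4)[of "t + 2"] u(5)[of t] P_step[of t] by (cases "P t") auto
  then have "(e ^^ m) x = 0" unfolding r by (intro sum.neutral) blast
  then show False using m(1) by simp
qed

lemma a_pow_inj: "x \<in> S \<Longrightarrow> (a ^^ N) x = 0 \<Longrightarrow> x = 0"
proof (induction N)
  case (Suc N)
  have "(a ^^ N) x \<in> S" for N by (induction N) (auto simp: Suc.prems S_ops)
  then show ?case using Suc a_inj[of "(a ^^ N) x"] by simp
qed simp

lemma q4_S: "x \<in> S \<Longrightarrow> q4 \<eta> x \<in> S"
  unfolding q4_def by (intro cvec.subspace_diff cvec.subspace_scale S_subspace S_ops)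

lemma q4_u: "\<exists>r. \<forall>t. P t \<longrightarrow> q4 0 (u t) = scl (r t) (u (t + 2))"
proof (rule choice_iff[THEN iffD1], intro allI)
  fix t
  have "h (q4 0 (u t)) = scl (of_nat (n + 2 * (t + 2))) (q4 0 (u t))"
    unfolding h_q4 u(3) by (rule poly_mapping_eqI) (simp only: lin_simps[OF lin_q4] lk, simp add: algebra_simps)
  moreover have "e (q4 0 (u t)) = 0" by (simp add: e_q4 u lin_0[OF lin_q4])
  moreover have "q4 0 (u t) \<in> S" by (rule q4_S[OF u(1)])
  ultimately show "\<exists>r. P t \<longrightarrow> q4 0 (u t) = scl r (u (t + 2))" using hw_multiple by blast
qed

text \<open>Multiplicity one makes \<open>q4 0\<close> act on the \<open>u t\<close> as a times a
  scalar. Take \<eta> to be this scalar at one index: the generalised kernel of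
  \<open>q4 \<eta>\<close> is then non-zero, hence everything by simplicity. The remaining scalars
  are nilpotent, so zero, and all highest weight vectors are killed. Other vectors follow by
  induction on the power of e that kills them.\<close>

lemma q4_vanishes: "\<exists>\<eta>. \<forall>x\<in>S. q4 \<eta> x = 0"
proof -
  obtain r where r: "\<And>t. P t \<Longrightarrow> q4 0 (u t) = scl (r t) (u (t + 2))" using q4_u by blast
  obtain t0 where t0: "P t0" using P_01 by blast
  let ?\<eta> = "r t0"
  have q: "q4 ?\<eta> (u t) = scl (r t - ?\<eta>) (u (t + 2))" if "P t" for t
  proof -
    have "q4 ?\<eta> (u t) = q4 0 (u t) - scl ?\<eta> (a (u t))" by (simp add: q4_def)
    then show ?thesis by (simp add: r[OF that] u_step cvec.scale_left_diff_distrib)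
  qed
  have r_step: "r (t + 2) = r t" if "P t" for t
  proof -
    have "q4 0 (u (t + 2)) = a (q4 0 (u t))" using q4_comm(1)[of 0 "u t"] by (simp only: u_step)
    then have eq: "scl (r (t + 2)) (u (t + 2 + 2)) = scl (r t) (u (t + 2 + 2))"
      using r[of t] r[of "t + 2"] that P_step[of t] by (simp only: gl u_step)
    have "u (t + 2 + 2) \<noteq> 0" using u(4)[of "t + 2 + 2"] P_step[of t] P_step[of "t + 2"] that by simp
    with eq show ?thesis using cvec.scale_cancel_right by blast
  qed
  let ?K = "{x \<in> S. \<exists>N. (q4 ?\<eta> ^^ N) x = 0}"
  have "q4 ?\<eta> (u t0) = 0" by (simp add: q[OF t0])
  then have "u t0 \<in> ?K" using u(1) by (auto intro!: exI[of _ 1])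
  then have K: "?K = S" using S_simple[OF q4_pow_kernel_closed[OF S_closed]] u(4)[OF t0] by blast
  have qu: "q4 ?\<eta> (u t) = 0" for t
  proof (cases "P t")
    case True
    have pw: "P (t + 2 * N) \<and> (q4 ?\<eta> ^^ N) (u t) = scl ((r t - ?\<eta>) ^ N) (u (t + 2 * N)) \<and> r (t + 2 * N) = r t" for N
    proof (induction N)
      case (Suc N)
      then show ?case
        using q[of "t + 2 * N"] r_step[of "t + 2 * N"] P_step[of "t + 2 * N"]
        by (simp add: lin_simps[OF lin_q4] mult.commute)
    qed (simp add: True)
    obtain N where "(q4 ?\<eta> ^^ N) (u t) = 0" using K u(1) by blast
    then have "r t = ?\<eta>" using pw[of N] u(4)[of "t + 2 * N"] by auto
    then show ?thesis using q[OF True] by simp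
  next
    case False
    then show ?thesis by (simp add: u(5) lin_0[OF lin_q4])
  qed
  have hw0: "q4 ?\<eta> x = 0" if x: "x \<in> S" "e x = 0" for x
  proof -
    obtain N s where "x = (\<Sum>t<N. scl (s t) (u t))" using span_rangeE[OF hw_span_u[OF x]] .
    then show ?thesis by (simp add: lin_simps[OF lin_q4] qu)
  qed
  have "\<forall>x\<in>S. (e ^^ N) x = 0 \<longrightarrow> q4 ?\<eta> x = 0" for N
  proof (induction N)
    case 0
    then show ?case by (simp add: lin_0[OF lin_q4])
  next
    case (Suc N)
    show ?case
    proof (intro ballI impI)
      fix x assume x: "x \<in> S" "(e ^^ Suc N) x = 0"
      have pS: "(a ^^ i) y \<in> S" "(b ^^ i) y \<in> S" "(e ^^ i) y \<in> S" if "y \<in> S" for i y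
        by (induction i) (auto simp: that S_ops)
      let ?w = "(e ^^ N) x"
      have w: "?w \<in> S" "e ?w = 0" using x pS by auto
      \<comment> \<open>Multiplying by a power of a does no harm, since a is injective. The
        coefficient comes from \<open>e_pow_b_pow\<close> and is chosen so that N powers of e kill
        the difference.\<close>
      let ?y = "(a ^^ N) x - scl (1 / (4 ^ N * fact N)) ((b ^^ N) ?w)"
      have "(e ^^ N) ((a ^^ N) x) = (a ^^ N) ?w"
        by (rule funpow_commute) (simp add: e_a_pow)
      then have "(e ^^ N) ?y = 0"
        by (simp add: lin_simps[OF lin_funpow[OF lin_e]] e_pow_b_pow[OF w(2)])
      moreover have "?y \<in> S" using x pS w S_subspace by (auto intro!: cvec.subspace_diff cvec.subspace_scale)
      ultimately have "q4 ?\<eta> ?y = 0" using Suc by blast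
      moreover have "q4 ?\<eta> ((b ^^ N) ?w) = 0"
        using funpow_commute[of b "q4 ?\<eta>" N ?w] q4_comm hw0[OF w] by (simp add: lin_0[OF lin_funpow[OF lin_b]])
      ultimately have "q4 ?\<eta> ((a ^^ N) x) = 0" by (simp add: lin_simps[OF lin_q4])
      then have "(a ^^ N) (q4 ?\<eta> x) = 0"
        using funpow_commute[of a "q4 ?\<eta>" N x] q4_comm by simp
      then show "q4 ?\<eta> x = 0" by (rule a_pow_inj[OF q4_S[OF x(1)]])
    qed
  qed
  then show ?thesis using e_nil by blast
qed

text \<open>With the covariant zero, \<open>C3_combination\<close> reads
  \<open>-8 \<mu>\<^sup>3 - 2 \<eta> \<mu>\<^sup>2 = 0\<close>, which leaves only
  \<open>\<eta> = -4 \<mu>\<close>.\<close>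

lemma ac_relation: "x \<in> S \<Longrightarrow> q4 (- 4 * \<mu>) x = 0"
proof -
  obtain \<eta> where \<eta>: "\<And>x. x \<in> S \<Longrightarrow> q4 \<eta> x = 0" using q4_vanishes by blast
  obtain t0 where t0: "P t0" using P_01 by blast
  note z = \<eta> q_zero_imp[OF S_closed \<eta>]
  have "scl (-8) (scl (\<mu> ^ 3) (u t0)) - scl (2 * \<eta>) (scl (\<mu>\<^sup>2) (u t0)) = 0"
    using C3_combination[of \<eta> "u t0"] z[of "u t0"] u(1)[of t0] unfolding C2[OF u(1)] C3[OF u(1)] by (simp add: gl)
  then have "scl (-8 * \<mu> ^ 3 - 2 * \<eta> * \<mu>\<^sup>2) (u t0) = 0" by (simp add: cvec.scale_left_diff_distrib)
  then have "-8 * \<mu> ^ 3 - 2 * \<eta> * \<mu>\<^sup>2 = 0" using u(4)[OF t0] by (simp only: cvec.scale_eq_0_iff) simp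
  then have "(\<eta> + 4 * \<mu>) * \<mu>\<^sup>2 = 0" by algebra
  then have "\<eta> = - 4 * \<mu>" using \<mu> by (simp add: add_eq_0_iff2)
  then show "x \<in> S \<Longrightarrow> q4 (- 4 * \<mu>) x = 0" using \<eta> by simp
qed

text \<open>The combination \<open>x t\<close> is designed to be killed by e: with l the weight of
  \<open>u t\<close>, both of its terms contribute \<open>4 l a (u t)\<close>. It has weight
  \<open>n + 2 (t + 1)\<close>, so it is a multiple of \<open>u (t + 1)\<close>. Commutation with a
  gives the period two.\<close>

lemma D_relation:
  "\<exists>\<delta>. \<forall>t. scl 4 (a (f (u t))) = scl (of_nat (n + 2 * t)) (b (u t)) + scl (4 * \<delta> t) (u (t + 1)) \<and> \<delta> (t + 2) = \<delta> t"
proof -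
  define x where "x t = scl 4 (a (f (u t))) - scl (of_nat (n + 2 * t)) (b (u t))" for t
  have xs: "x t \<in> S" "e (x t) = 0" "h (x t) = scl (of_nat (n + 2 * (t + 1))) (x t)" for t
  proof -
    show "x t \<in> S" unfolding x_def using S_ops u(1) S_subspace by (auto intro!: cvec.subspace_diff cvec.subspace_scale)
    show "e (x t) = 0" unfolding x_def
      by (rule poly_mapping_eqI) (simp only: gl ea ef eb u lk, simp)
    show "h (x t) = scl (of_nat (n + 2 * (t + 1))) (x t)" unfolding x_def
      by (rule poly_mapping_eqI) (simp only: gl ha hb hf u lk, simp add: algebra_simps)
  qed
  have ax: "a (x t) = x (t + 2)" for t
    unfolding x_def u_step[symmetric]
    by (rule poly_mapping_eqI) (simp only: gl fa comm lk, simp add: algebra_simps)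
  have "\<exists>r. \<forall>t. x t = scl (r t) (u (t + 1))"
    by (rule choice_iff[THEN iffD1]) (use hw_multiple[OF xs] in blast)
  then obtain r where r: "\<And>t. x t = scl (r t) (u (t + 1))" by blast
  \<comment> \<open>Where \<open>u (t + 1)\<close> is zero the scalar is arbitrary; the default 0
    keeps \<delta> periodic.\<close>
  define \<delta> where "\<delta> t = (if P (t + 1) then r t / 4 else 0)" for t
  have x\<delta>: "x t = scl (4 * \<delta> t) (u (t + 1))" for t
    using r[of t] u(5)[of "t + 1"] by (cases "P (t + 1)") (simp_all add: \<delta>_def)
  have "\<delta> (t + 2) = \<delta> t" for t
  proof (cases "P (t + 1)")
    case True
    then have "P (t + 3)" using P_step[of "t + 1"] by (simp add: numeral_3_eq_3)
    then have nz: "u (t + 3) \<noteq> 0" by (rule u(4))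
    have "x (t + 2) = scl (4 * \<delta> (t + 2)) (u (t + 3))" using x\<delta>[of "t + 2"] by (simp add: numeral_3_eq_3)
    moreover have "x (t + 2) = scl (4 * \<delta> t) (u (t + 3))"
      using ax[of t] x\<delta>[of t] u_step[of "t + 1"] by (simp add: gl numeral_3_eq_3)
    ultimately show ?thesis using nz by simp
  next
    case False
    then have "\<not> P (t + 3)" using P_step[of "t + 1"] by (simp add: numeral_3_eq_3)
    then show ?thesis using False by (simp add: \<delta>_def numeral_3_eq_3)
  qed
  moreover have "scl 4 (a (f (u t))) = scl (of_nat (n + 2 * t)) (b (u t)) + scl (4 * \<delta> t) (u (t + 1))" for t
    unfolding x\<delta>[symmetric] x_def by simp
  ultimately show ?thesis by blast
qed

end

subsection \<open>Systems of highest weight vectors\<close>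

locale g_rel = g_ops +
  fixes \<mu> :: complex
  assumes rel: "q4 (- 4 * \<mu>) x = 0"
begin

lemma ac: "scl 8 (a (c x)) = scl 3 (b (b x)) - scl (4 * \<mu>) (a x)"
  using rel[of x] by (simp add: q4_def algebra_simps)

definition sysl :: "nat \<Rightarrow> (nat \<Rightarrow> complex) \<Rightarrow> (nat \<Rightarrow> cvec) \<Rightarrow> bool" where
  "sysl n \<delta> u \<longleftrightarrow> (\<forall>t. e (u t) = 0 \<and> h (u t) = scl (of_nat (n + 2 * t)) (u t) \<and> a (u t) = u (t + 2) \<and>
     scl 4 (a (f (u t))) = scl (of_nat (n + 2 * t)) (b (u t)) + scl (4 * \<delta> t) (u (t + 1)))"

lemma syslD:
  assumes "sysl n \<delta> u"
  shows "e (u t) = 0" "h (u t) = scl (of_nat (n + 2 * t)) (u t)" "a (u t) = u (t + 2)"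
    "a (f (u t)) = scl (of_nat (n + 2 * t) / 4) (b (u t)) + scl (\<delta> t) (u (t + 1))"
proof -
  show "e (u t) = 0" "h (u t) = scl (of_nat (n + 2 * t)) (u t)" "a (u t) = u (t + 2)"
    using assms by (auto simp: sysl_def)
  have "scl (1/4) (scl 4 (a (f (u t)))) = scl (1/4) (scl (of_nat (n + 2 * t)) (b (u t)) + scl (4 * \<delta> t) (u (t + 1)))"
    using assms by (simp add: sysl_def)
  then show "a (f (u t)) = scl (of_nat (n + 2 * t) / 4) (b (u t)) + scl (\<delta> t) (u (t + 1))"
    by (simp add: cvec.scale_right_distrib)
qed

lemma f_b_pow: "f ((b ^^ i) x) = (b ^^ i) (f x) + scl (2 * of_nat i) (c ((b ^^ (i - 1)) x))"
  by (cases i) (simp_all only: b_pow_f, simp_all)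

text \<open>Moving f past the powers of b produces factors c, and the extra a turns
  \<open>a c\<close> back into \<open>b\<^sup>2\<close> and a. So \<open>a f\<close> preserves the
  span of the \<open>b\<^sup>i u\<^sub>t\<close>, where it acts like a first order differential
  operator in b.\<close>

lemma af_b_pow:
  assumes "sysl n \<delta> u"
  shows "a (f ((b ^^ i) (u t))) = scl ((of_nat (n + 2 * t) + 3 * of_nat i) / 4) ((b ^^ (i + 1)) (u t))
     + scl (\<delta> t) ((b ^^ i) (u (t + 1))) - scl (of_nat i * \<mu>) ((b ^^ (i - 1)) (u (t + 2)))"
proof -
  note lb = lin_simps[OF lin_funpow[OF lin_b]]
  have "a (f ((b ^^ i) (u t))) = (b ^^ i) (a (f (u t))) + scl (of_nat i / 4) (scl 8 (a (c ((b ^^ (i - 1)) (u t)))))"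
    by (simp add: f_b_pow gl b_pow)
  also have "scl (of_nat i / 4) (scl 8 (a (c ((b ^^ (i - 1)) (u t))))) =
     scl (of_nat i / 4) (scl 3 ((b ^^ (i + 1)) (u t)) - scl (4 * \<mu>) ((b ^^ (i - 1)) (u (t + 2))))"
    by (cases i) (simp_all only: ac, simp_all add: syslD(3)[OF assms] b_pow(1)[symmetric])
  also have "(b ^^ i) (a (f (u t))) = scl (of_nat (n + 2 * t) / 4) ((b ^^ (i + 1)) (u t)) + scl (\<delta> t) ((b ^^ i) (u (t + 1)))"
    by (simp only: syslD(4)[OF assms] lb b_pow) (simp add: b_pow)
  finally show ?thesis
    by (intro poly_mapping_eqI) (simp only: lk, simp add: algebra_simps)
qed

lemma a_pow_f': "(a ^^ Suc m) (f x) = a (f ((a ^^ m) x)) - scl (of_nat m) (b ((a ^^ m) x))"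
proof (cases m)
  case (Suc l)
  have "(a ^^ Suc m) (f x) = a ((a ^^ m) (f x))" by simp
  also have "\<dots> = a (f ((a ^^ m) x)) - scl (of_nat m) (b ((a ^^ m) x))"
    by (simp only: Suc a_pow_f gl) (simp add: comm)
  finally show ?thesis .
qed simp

text \<open>The highest power of e annihilates every term except the top one, which it turns into a
  multiple of a power of a applied to \<open>y N\<close>; injectivity of a finishes the
  induction.\<close>

lemma b_indep:
  assumes S: "closed S" "\<And>x. x \<in> S \<Longrightarrow> a x = 0 \<Longrightarrow> x = 0"
    and y: "\<And>i. y i \<in> S" "\<And>i. e (y i) = 0" and z: "(\<Sum>i<N. (b ^^ i) (y i)) = 0"
  shows "i < N \<Longrightarrow> y i = 0"
  using z
proof (induction N)
  case (Suc N)
  have "(e ^^ N) (\<Sum>i<Suc N. (b ^^ i) (y i)) = 0" by (simp only: Suc.prems(2) lin_0[OF lin_funpow[OF lin_e]])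
  moreover have "(e ^^ N) (\<Sum>i<Suc N. (b ^^ i) (y i)) = scl (4 ^ N * fact N) ((a ^^ N) (y N))"
    by (simp add: lin_simps[OF lin_funpow[OF lin_e]] e_pow_b_pow[OF y(2)] e_pow_b_pow_0[OF y(2)])
  ultimately have "(a ^^ N) (y N) = 0" by simp
  moreover have "x = 0" if "x \<in> S" "(a ^^ m) x = 0" for m x
    using that
  proof (induction m)
    case (Suc m)
    have "(a ^^ l) x \<in> S" for l by (induction l) (auto simp: Suc.prems closedD[OF S(1)])
    then show ?case using Suc S(2)[of "(a ^^ m) x"] by simp
  qed simp
  ultimately have yN: "y N = 0" using y(1) by blast
  then have "(\<Sum>i<N. (b ^^ i) (y i)) = 0" using Suc.prems(2) by (simp add: lin_0[OF lin_funpow[OF lin_b]])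
  then show ?case using Suc yN by (cases "i = N") auto
qed simp

text \<open>The polynomial \<open>p\<close> with \<open>a\<^sup>N f\<^sup>N u\<^sub>0 = p(b) u\<close>, homogenized by means of the \<open>u t\<close>.\<close>

fun fpoly :: "complex \<Rightarrow> complex \<Rightarrow> nat \<Rightarrow> complex poly" where
  "fpoly n \<delta> 0 = 1"
| "fpoly n \<delta> (Suc N) = [:\<delta>, (n - 2 * of_nat N) / 4:] * fpoly n \<delta> N + [:- \<mu>, 0, 1/4:] * pderiv (fpoly n \<delta> N)"

lemma coeff_fpoly_Suc:
  "coeff (fpoly n \<delta> (Suc N)) j = \<delta> * coeff (fpoly n \<delta> N) j
     + (if j = 0 then 0 else (n - 2 * of_nat N + of_nat (j - 1)) / 4 * coeff (fpoly n \<delta> N) (j - 1))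
     - \<mu> * of_nat (Suc j) * coeff (fpoly n \<delta> N) (Suc j)"
proof -
  have 1: "[:x, y:] * p = smult x p + pCons 0 (smult y p)" for x y :: complex and p by simp
  have 2: "[:x, 0, y:] * p = smult x p + pCons 0 (pCons 0 (smult y p))" for x y :: complex and p by simp
  show ?thesis
  proof (cases j)
    case (Suc i)
    show ?thesis
      unfolding fpoly.simps 1 2 Suc
      by (cases i) (simp_all add: coeff_pderiv, simp_all add: field_simps)
  next
    case 0
    show ?thesis unfolding fpoly.simps 1 2 0 by (simp add: coeff_pderiv)
  qed
qed

lemma coeff_fpoly_0: "j > N \<Longrightarrow> coeff (fpoly n \<delta> N) j = 0"
proof (induction N arbitrary: j)
  case (Suc N)
  then show ?case by (simp only: coeff_fpoly_Suc) simp
qed (simp add: coeff_eq_0)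

text \<open>For \<open>\<delta> = 0\<close> the recursion of the coefficients involves only the two
  neighbouring indices, so the parity alternates with N.\<close>

lemma fpoly_parity: "odd (N + j) \<Longrightarrow> coeff (fpoly n 0 N) j = 0"
proof (induction N arbitrary: j)
  case 0
  then have "j \<noteq> 0" by (auto simp: odd_pos)
  then show ?case by (simp add: coeff_eq_0)
next
  case (Suc N)
  then have "coeff (fpoly n 0 N) (Suc j) = 0" "j \<noteq> 0 \<Longrightarrow> coeff (fpoly n 0 N) (j - 1) = 0"
    by (auto intro!: Suc.IH)
  then show ?case by (simp only: coeff_fpoly_Suc) simp
qed

lemma af_pow:
  assumes u: "sysl n (\<lambda>_. \<delta>) u"
  shows "(a ^^ N) ((f ^^ N) (u 0)) = (\<Sum>i<Suc N. (b ^^ i) (scl (coeff (fpoly (of_nat n) \<delta> N) i) (u (N - i))))"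
proof (induction N)
  case (Suc N)
  note lb = lin_simps[OF lin_funpow[OF lin_b]]
  define p where "p = fpoly (of_nat n) \<delta> N"
  \<comment> \<open>The exponent of b and the index of u add up to \<open>Suc N\<close>. All three
    kinds of terms produced by \<open>af_b_pow\<close> are among these vectors.\<close>
  define w where "w j = (b ^^ j) (u (Suc N - j))" for j
  have p0: "coeff p j = 0" if "j > N" for j using that by (simp add: p_def coeff_fpoly_0)
  have IH: "(a ^^ N) ((f ^^ N) (u 0)) = (\<Sum>i<Suc N. scl (coeff p i) ((b ^^ i) (u (N - i))))"
    using Suc by (simp only: p_def lb)
  have "(a ^^ Suc N) ((f ^^ Suc N) (u 0)) = a (f ((a ^^ N) ((f ^^ N) (u 0)))) - scl (of_nat N) (b ((a ^^ N) ((f ^^ N) (u 0))))"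
    using a_pow_f'[of N "(f ^^ N) (u 0)"] by simp
  also have "\<dots> = (\<Sum>i<Suc N. scl (coeff p i) (a (f ((b ^^ i) (u (N - i)))) - scl (of_nat N) ((b ^^ Suc i) (u (N - i)))))"
    unfolding IH by (simp only: gl cvec.scale_sum_right sum_subtractf[symmetric] funpow.simps comp_apply
       cvec.scale_right_diff_distrib) (simp add: mult.commute)
  also have "\<dots> = (\<Sum>i<Suc N. scl ((of_nat n - 2 * of_nat N + of_nat i) / 4 * coeff p i) (w (Suc i))
       + scl (\<delta> * coeff p i) (w i) - scl (\<mu> * of_nat i * coeff p i) (w (i - 1)))"
  proof (rule sum.cong[OF refl])
    fix i assume "i \<in> {..<Suc N}"
    then have i: "i \<le> N" by simp
    have w: "w (Suc i) = (b ^^ Suc i) (u (N - i))" "w i = (b ^^ i) (u (Suc (N - i)))"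
      "scl (of_nat i * \<mu>) ((b ^^ (i - 1)) (u (N - i + 2))) = scl (of_nat i * \<mu>) (w (i - 1))"
      using i by (auto simp: w_def Suc_diff_le) (cases i; simp add: Suc_diff_Suc Suc_le_eq numeral_2_eq_2)
    have n: "of_nat (n + 2 * (N - i)) = (of_nat n + 2 * of_nat N - 2 * of_nat i :: complex)"
      using i by (simp add: of_nat_diff)
    show "scl (coeff p i) (a (f ((b ^^ i) (u (N - i)))) - scl (of_nat N) ((b ^^ Suc i) (u (N - i)))) =
      scl ((of_nat n - 2 * of_nat N + of_nat i) / 4 * coeff p i) (w (Suc i))
       + scl (\<delta> * coeff p i) (w i) - scl (\<mu> * of_nat i * coeff p i) (w (i - 1))"
      unfolding af_b_pow[OF u] n w(3) Suc_eq_plus1[symmetric] w(1,2)[symmetric]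
      by (rule poly_mapping_eqI) (simp only: lk, simp add: field_simps)
  qed
  also have "\<dots> = (\<Sum>j<Suc (Suc N). scl (if j = 0 then 0 else (of_nat n - 2 * of_nat N + of_nat (j - 1)) / 4 * coeff p (j - 1)) (w j))
      + (\<Sum>j<Suc (Suc N). scl (\<delta> * coeff p j) (w j)) - (\<Sum>j<Suc (Suc N). scl (\<mu> * of_nat (Suc j) * coeff p (Suc j)) (w j))"
  proof -
    \<comment> \<open>The three sums are brought to one index range; the terms that are added have
      coefficient zero because the degree of \<open>p\<close> is at most \<open>N\<close>.\<close>
    have 1: "(\<Sum>i<Suc N. scl ((of_nat n - 2 * of_nat N + of_nat i) / 4 * coeff p i) (w (Suc i))) =
      (\<Sum>j<Suc (Suc N). scl (if j = 0 then 0 else (of_nat n - 2 * of_nat N + of_nat (j - 1)) / 4 * coeff p (j - 1)) (w j))"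
      by (subst (2) sum.lessThan_Suc_shift) simp
    have 2: "(\<Sum>i<Suc N. scl (\<delta> * coeff p i) (w i)) = (\<Sum>j<Suc (Suc N). scl (\<delta> * coeff p j) (w j))"
      using p0[of "Suc N"] by simp
    have "(\<Sum>i<Suc N. scl (\<mu> * of_nat i * coeff p i) (w (i - 1))) = (\<Sum>i<Suc (Suc (Suc N)). scl (\<mu> * of_nat i * coeff p i) (w (i - 1)))"
      using p0[of "Suc N"] p0[of "Suc (Suc N)"] by simp
    also have "\<dots> = (\<Sum>j<Suc (Suc N). scl (\<mu> * of_nat (Suc j) * coeff p (Suc j)) (w j))"
      by (subst sum.lessThan_Suc_shift) simp
    finally show ?thesis using 1 2 by (simp only: sum.distrib sum_subtractf)
  qed
  also have "\<dots> = (\<Sum>j<Suc (Suc N). scl (coeff (fpoly (of_nat n) \<delta> (Suc N)) j) (w j))"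
    unfolding coeff_fpoly_Suc p_def[symmetric] sum.distrib[symmetric] sum_subtractf[symmetric]
    by (intro sum.cong refl poly_mapping_eqI) (simp only: lk, simp add: algebra_simps)
  finally show ?case by (simp only: w_def lb)
qed simp

text \<open>Vanishing of \<open>f\<^sup>n\<^sup>+\<^sup>1 u\<^sub>0\<close> makes the polynomial of
  degree at most n + 1 zero. At \<open>2 \<sigma>\<close>, a root of
  \<open>x\<^sup>2/4 - \<mu>\<close>, the derivative term of the recursion disappears, so the value
  there is a product of linear factors in \<delta>, one of which must vanish.\<close>

lemma quantization:
  assumes S: "closed S" "\<And>x. x \<in> S \<Longrightarrow> a x = 0 \<Longrightarrow> x = 0"
    and u: "sysl n (\<lambda>_. \<delta>) u" "\<And>t. u t \<in> S" "\<And>t. \<delta> \<noteq> 0 \<or> even t \<Longrightarrow> u t \<noteq> 0"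
    and nil: "(f ^^ Suc n) (u 0) = 0" and \<sigma>: "\<sigma>\<^sup>2 = \<mu>"
  shows "\<exists>N\<le>n. \<delta> = (2 * of_nat N - of_nat n) * \<sigma> / 2"
proof -
  let ?p = "fpoly (of_nat n) \<delta> (Suc n)"
  let ?y = "\<lambda>i. scl (coeff ?p i) (u (Suc n - i))"
  have "(\<Sum>i<Suc (Suc n). (b ^^ i) (?y i)) = (a ^^ Suc n) ((f ^^ Suc n) (u 0))"
    by (rule af_pow[OF u(1), symmetric])
  also have "\<dots> = 0" by (simp only: nil lin_0[OF lin_funpow[OF lin_a]])
  finally have z: "(\<Sum>i<Suc (Suc n). (b ^^ i) (?y i)) = 0" .
  have sS: "cvec.subspace S" using S(1) by (simp add: closed_def)
  have yz: "?y i = 0" if "i < Suc (Suc n)" for i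
    by (rule b_indep[OF S _ _ z that]) (simp_all add: u(2) cvec.subspace_scale[OF sS] gl syslD(1)[OF u(1)])
  \<comment> \<open>If \<open>\<delta> = 0\<close>, the odd members of \<open>u\<close> may be zero,
    and independence says nothing about their coefficients; parity takes care of these.\<close>
  have cz: "coeff ?p i = 0" for i
  proof (cases "i < Suc (Suc n) \<and> (\<delta> \<noteq> 0 \<or> even (Suc n - i))")
    case True
    then have "u (Suc n - i) \<noteq> 0" using u(3) by blast
    then show ?thesis using yz[of i] True by (simp del: fpoly.simps)
  next
    case False
    then show ?thesis
      using coeff_fpoly_0[of "Suc n" i] fpoly_parity[of "Suc n" i] by (cases "i < Suc (Suc n)") (auto simp del: fpoly.simps)
  qed
  have "?p = 0" by (intro poly_eqI) (simp only: cz coeff_0)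
  then have "poly ?p (2 * \<sigma>) = 0" by (simp del: fpoly.simps)
  moreover have "poly (fpoly (of_nat n) \<delta> N) (2 * \<sigma>) = (\<Prod>j<N. \<delta> + (of_nat n - 2 * of_nat j) * \<sigma> / 2)" for N
  proof (induction N)
    case (Suc N)
    have z: "poly [:- \<mu>, 0, 1/4:] (2 * \<sigma>) = 0" by (simp add: \<sigma>[symmetric] power2_eq_square)
    have y: "poly [:\<delta>, (of_nat n - 2 * of_nat N) / 4:] (2 * \<sigma>) = \<delta> + (of_nat n - 2 * of_nat N) * \<sigma> / 2"
      by (simp add: field_simps)
    show ?case by (simp only: fpoly.simps poly_add poly_mult z y Suc prod.lessThan_Suc) simp
  qed simp
  ultimately have "(\<Prod>j<Suc n. \<delta> + (of_nat n - 2 * of_nat j) * \<sigma> / 2) = 0" by (simp del: fpoly.simps prod.lessThan_Suc)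
  then obtain N where "N < Suc n" "\<delta> + (of_nat n - 2 * of_nat N) * \<sigma> / 2 = 0"
    by (auto simp del: prod.lessThan_Suc)
  then show ?thesis by (intro exI[of _ N]) (simp add: field_simps add_eq_0_iff2)
qed

section \<open>The saturated submodule generated by a system\<close>

definition bspan :: "(nat \<Rightarrow> cvec) \<Rightarrow> cvec set" where
  "bspan u = cvec.span {(b ^^ i) (u t) | i t. True}"

text \<open>Saturation replaces the localisation at a: a vector belongs to the hull when some power
  of a moves it into the span.\<close>

definition ahull :: "(nat \<Rightarrow> cvec) \<Rightarrow> cvec set" where
  "ahull u = {x. \<exists>N. (a ^^ N) x \<in> bspan u}"

lemma bspan_stable:
  assumes "lin g" "\<And>i t. g ((b ^^ i) (u t)) \<in> bspan u" "x \<in> bspan u"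
  shows "g x \<in> bspan u"
proof -
  have "g ` bspan u \<subseteq> cvec.span (g ` {(b ^^ i) (u t) | i t. True})"
    unfolding bspan_def using cp.linear_span_image[OF assms(1)] by simp
  also have "\<dots> \<subseteq> bspan u"
    using assms(2) unfolding bspan_def by (intro cvec.span_minimal cvec.subspace_span) auto
  finally show ?thesis using assms(3) by blast
qed

lemma bspan_base: "(b ^^ i) (u t) \<in> bspan u"
  unfolding bspan_def by (intro cvec.span_base) blast

lemma subspace_bspan: "cvec.subspace (bspan u)"
  by (simp add: bspan_def)

lemmas bspan_closed = cvec.subspace_add[OF subspace_bspan] cvec.subspace_diff[OF subspace_bspan]
  cvec.subspace_scale[OF subspace_bspan] cvec.subspace_0[OF subspace_bspan]

text \<open>Only stability under \<open>f\<close> is delicate; it is multiplied by a power of \<open>a\<close>, so that the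
  relation expressing \<open>a c\<close> in terms of \<open>b\<^sup>2\<close> and \<open>a\<close> applies. The rest of \<open>L(4)\<close> is generated by \<open>b\<close> and \<open>f\<close>.\<close>

lemma ahull_closed:
  assumes u: "sysl n \<delta> u"
  shows "closed (ahull u)"
proof -
  let ?B = "bspan u"
  note la = lin_simps[OF lin_funpow[OF lin_a]]
  have Ba: "a x \<in> ?B" if "x \<in> ?B" for x
    by (rule bspan_stable[OF lin_a _ that]) (simp add: b_pow(1)[symmetric] syslD(3)[OF u] bspan_base)
  have Bb: "b x \<in> ?B" if "x \<in> ?B" for x
    by (rule bspan_stable[OF lin_b _ that]) (use bspan_base[of "Suc _" u] in simp)
  have Be: "e x \<in> ?B" if "x \<in> ?B" for x
  proof (rule bspan_stable[OF lin_e _ that])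
    fix i t
    show "e ((b ^^ i) (u t)) \<in> ?B"
      by (cases i) (simp_all only: e_b_pow, simp_all add: syslD[OF u] lin_0[OF lin_funpow[OF lin_b]] gl bspan_closed bspan_base)
  qed
  have Bh: "h x \<in> ?B" if "x \<in> ?B" for x
    by (rule bspan_stable[OF lin_h _ that])
       (simp add: h_b_pow syslD[OF u] lin_simps[OF lin_funpow[OF lin_b]] bspan_closed bspan_base)
  have Baf: "a (f x) \<in> ?B" if "x \<in> ?B" for x
    by (rule bspan_stable[OF lin_comp'[OF lin_a lin_f] _ that])
       (simp only: af_b_pow[OF u] bspan_closed bspan_base)
  have Bpow: "(a ^^ m) x \<in> ?B" if "x \<in> ?B" for m x
    by (induction m) (auto simp: that Ba)
  have sub: "cvec.subspace (ahull u)"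
    unfolding cvec.subspace_def
  proof (intro conjI ballI allI)
    fix x y assume "x \<in> ahull u" "y \<in> ahull u"
    then obtain m l where "(a ^^ m) x \<in> ?B" "(a ^^ l) y \<in> ?B" by (auto simp: ahull_def)
    then have "(a ^^ (m + l)) (x + y) \<in> ?B"
      using Bpow[of "(a ^^ m) x" l] Bpow[of "(a ^^ l) y" m]
      by (simp add: la bspan_closed funpow_add add.commute[of l m]) (metis bspan_closed(1) comp_apply funpow_add add.commute)
    then show "x + y \<in> ahull u" by (auto simp: ahull_def)
  next
    fix r x assume "x \<in> ahull u"
    then obtain m where "(a ^^ m) x \<in> ?B" unfolding ahull_def by blast
    then show "scl r x \<in> ahull u"
      unfolding ahull_def by (intro CollectI exI[of _ m]) (simp add: la bspan_closed)
  qed (auto simp: ahull_def la bspan_closed)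
  have fst: "f x \<in> ahull u" if x: "x \<in> ahull u" for x
  proof -
    obtain m where m: "(a ^^ m) x \<in> ?B" using x by (auto simp: ahull_def)
    then have "(a ^^ Suc m) (f x) \<in> ?B" by (simp only: a_pow_f') (simp add: bspan_closed Baf Bb)
    then show ?thesis unfolding ahull_def by blast
  qed
  have bst: "b x \<in> ahull u" if "x \<in> ahull u" for x
    using that Bb by (auto simp: ahull_def a_pow)
  have ast: "a x \<in> ahull u" if "x \<in> ahull u" for x
    using that Ba by (auto simp: ahull_def a_pow)
  have est: "e x \<in> ahull u" if "x \<in> ahull u" for x
    using that Be by (auto simp: ahull_def a_pow)
  have hst: "h x \<in> ahull u" if x: "x \<in> ahull u" for x
  proof -
    obtain m where m: "(a ^^ m) x \<in> ?B" using x by (auto simp: ahull_def)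
    have "(a ^^ m) (h x) = h ((a ^^ m) x) - scl (4 * of_nat m) ((a ^^ m) x)" by (simp add: h_a_pow)
    then have "(a ^^ m) (h x) \<in> ?B" using m by (simp add: bspan_closed Bh)
    then show ?thesis by (auto simp: ahull_def)
  qed
  note hs = cvec.subspace_diff[OF sub] cvec.subspace_scale[OF sub]
  have cst: "c x \<in> ahull u" if "x \<in> ahull u" for x
  proof -
    have "c x = scl (1/2) (f (b x) - b (f x))" by (simp add: fb)
    then show ?thesis using hs fst bst that by simp
  qed
  have dst: "d x \<in> ahull u" if "x \<in> ahull u" for x
  proof -
    have "d x = scl (1/3) (f (c x) - c (f x))" by (simp add: fc)
    then show ?thesis using hs fst cst that by simp
  qed
  have kst: "k x \<in> ahull u" if "x \<in> ahull u" for x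
  proof -
    have "k x = scl (1/4) (f (d x) - d (f x))" by (simp add: fd)
    then show ?thesis using hs fst dst that by simp
  qed
  show ?thesis unfolding closed_def
    by (intro conjI ballI; (rule sub est fst hst ast bst cst dst kst); assumption?)
qed

lemma ahull_base: "u t \<in> ahull u"
  unfolding ahull_def using bspan_base[of 0 u t] by (auto intro!: exI[of _ 0])

lemma bspan_rep:
  assumes "x \<in> bspan u"
  obtains N y where "\<And>i. y i \<in> cvec.span (range u)" "x = (\<Sum>i<N. (b ^^ i) (y i))"
proof -
  note lb = lin_simps[OF lin_funpow[OF lin_b]]
  have "\<exists>N y. (\<forall>i. y i \<in> cvec.span (range u)) \<and> x = (\<Sum>i<N. (b ^^ i) (y i))"
    using assms unfolding bspan_def
  proof (induction rule: cvec.span_induct_alt)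
    case base
    show ?case by (intro exI[of _ "0::nat"] exI[of _ "\<lambda>_. 0"]) (simp add: cvec.span_zero)
  next
    case (step r v x)
    then obtain j t N y where v: "v = (b ^^ j) (u t)" and y: "\<forall>i. y i \<in> cvec.span (range u)"
      and x: "x = (\<Sum>i<N. (b ^^ i) (y i))" by auto
    let ?y = "\<lambda>i. (if i < N then y i else 0) + (if i = j then scl r (u t) else 0)"
    have "(\<Sum>i<N + Suc j. (b ^^ i) (?y i)) =
      (\<Sum>i<N + Suc j. if i < N then (b ^^ i) (y i) else 0) + (\<Sum>i<N + Suc j. if i = j then scl r ((b ^^ i) (u t)) else 0)"
      unfolding sum.distrib[symmetric] by (intro sum.cong) (auto simp: lb)
    also have "(\<Sum>i<N + Suc j. if i < N then (b ^^ i) (y i) else 0) = x"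
      unfolding x by (rule sum.mono_neutral_cong_right) auto
    also have "(\<Sum>i<N + Suc j. if i = j then scl r ((b ^^ i) (u t)) else 0) = scl r v" by (simp add: v sum.delta)
    finally have "scl r v + x = (\<Sum>i<N + Suc j. (b ^^ i) (?y i))" by (simp add: add.commute)
    moreover have "\<forall>i. ?y i \<in> cvec.span (range u)"
      using y by (auto intro!: cvec.span_add cvec.span_scale cvec.span_zero intro: cvec.span_base)
    ultimately show ?case by - (rule exI[of _ "N + Suc j"], rule exI[of _ ?y], rule conjI)
  qed
  then show ?thesis using that by blast
qed

end

subsection \<open>The operators attached to a module\<close>

definition sE :: mat2 where "sE = vector [vector [0, 1], vector [0, 0]]"
definition sF :: mat2 where "sF = vector [vector [0, 0], vector [1, 0]]"
definition sH :: mat2 where "sH = vector [vector [1, 0], vector [0, -1]]"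

lemma s_entries [simp]:
  "sE $ 1 $ 1 = 0" "sE $ 1 $ 2 = 1" "sE $ 2 $ 1 = 0" "sE $ 2 $ 2 = 0"
  "sF $ 1 $ 1 = 0" "sF $ 1 $ 2 = 0" "sF $ 2 $ 1 = 1" "sF $ 2 $ 2 = 0"
  "sH $ 1 $ 1 = 1" "sH $ 1 $ 2 = 0" "sH $ 2 $ 1 = 0" "sH $ 2 $ 2 = -1"
  by (simp_all add: sE_def sF_def sH_def vector_2)

lemma s_carrier [simp]: "sE \<in> lcarrier sl2" "sF \<in> lcarrier sl2" "sH \<in> lcarrier sl2" "0 \<in> lcarrier sl2"
  by (simp_all add: lcarrier_sl2)

lemma mat2_eqI:
  fixes x y :: mat2
  shows "x $ 1 $ 1 = y $ 1 $ 1 \<Longrightarrow> x $ 1 $ 2 = y $ 1 $ 2 \<Longrightarrow> x $ 2 $ 1 = y $ 2 $ 1 \<Longrightarrow> x $ 2 $ 2 = y $ 2 $ 2 \<Longrightarrow> x = y"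
  by (simp add: vec_eq_iff forall_2)

lemma s_brackets: "lbracket sl2 sE sF = sH" "lbracket sl2 sH sE = lscale sl2 2 sE" "lbracket sl2 sH sF = lscale sl2 (-2) sF"
  by (rule mat2_eqI; simp add: lbracket_sl2 lscale_sl2)+

lemma sl2_ops_mod:
  assumes N: "lie_module sl2 N"
  shows "sl2_ops (act N sE) (act N sF) (act N sH)"
proof (intro sl2_ops.intro)
  note br = lie_module_bracket[OF N]
  show "act N sE (act N sF x) = act N sF (act N sE x) + act N sH x" for x
    using br[of sE sF x] by (simp add: s_brackets algebra_simps)
  show "act N sH (act N sE x) = act N sE (act N sH x) + scl 2 (act N sE x)" for x
    using br[of sH sE x] by (simp add: s_brackets lie_module_scl[OF N] algebra_simps)
  show "act N sH (act N sF x) = act N sF (act N sH x) - scl 2 (act N sF x)" for x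
    using br[of sH sF x] by (simp add: s_brackets lie_module_scl[OF N] algebra_simps)
qed (simp_all add: lie_module_lin[OF N])

lemma sl2_act_decomp:
  assumes N: "lie_module sl2 N" and x: "x \<in> lcarrier sl2"
  shows "act N x v = scl (x $ 1 $ 1) (act N sH v) + scl (x $ 1 $ 2) (act N sE v) + scl (x $ 2 $ 1) (act N sF v)"
proof -
  have c: "lscale sl2 r y \<in> lcarrier sl2" if "y \<in> lcarrier sl2" for r y
    using that by (simp add: lcarrier_sl2 lscale_sl2)
  have c2: "y + z \<in> lcarrier sl2" if "y \<in> lcarrier sl2" "z \<in> lcarrier sl2" for y z
    using that by (simp add: lcarrier_sl2)
  have "x = (lscale sl2 (x $ 1 $ 1) sH + lscale sl2 (x $ 1 $ 2) sE) + lscale sl2 (x $ 2 $ 1) sF"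
    using x by (intro mat2_eqI) (simp_all add: lscale_sl2 lcarrier_sl2)
  then have "act N x v = act N ((lscale sl2 (x $ 1 $ 1) sH + lscale sl2 (x $ 1 $ 2) sE) + lscale sl2 (x $ 2 $ 1) sF) v"
    by simp
  then show ?thesis by (simp add: lie_module_add[OF N] lie_module_scl[OF N] c c2)
qed

lemma lie_module_restrict: "lie_module g_alg M \<Longrightarrow> lie_module sl2 (restrict_sl2 M)"
  unfolding lie_module_def restrict_sl2_def idx_pullback act_pullback
proof (intro conjI ballI allI; elim conjE)
  assume 1: "\<forall>x\<in>lcarrier g_alg. act M x \<in> lin_maps (idx M) (idx M)"
    and 2: "\<forall>x\<in>lcarrier g_alg. \<forall>y\<in>lcarrier g_alg. act M (x + y) = act M x + act M y"
    and 3: "\<forall>c. \<forall>x\<in>lcarrier g_alg. \<forall>v. act M (lscale g_alg c x) v = scl c (act M x v)"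
    and 4: "\<forall>x\<in>lcarrier g_alg. \<forall>y\<in>lcarrier g_alg. \<forall>v. act M (lbracket g_alg x y) v = act M x (act M y v) - act M y (act M x v)"
  fix x assume x: "x \<in> lcarrier sl2"
  then have x': "(x, 0) \<in> lcarrier g_alg" by (simp add: lcarrier_g space_on_0)
  show "act M (x, 0) \<in> lin_maps (idx M) (idx M)" using 1 x' by blast
  show "act M (lscale sl2 c x, 0) v = scl c (act M (x, 0) v)" for c v
  proof -
    have "act M (lscale g_alg c (x, 0)) v = scl c (act M (x, 0) v)" using 3 x' by blast
    then show ?thesis by (simp only: lscale_g cvec.scale_zero_right)
  qed
  fix y assume "y \<in> lcarrier sl2"
  then have y': "(y, 0) \<in> lcarrier g_alg" by (simp add: lcarrier_g space_on_0)
  have "(x + y, 0) = (x, 0 :: cvec) + (y, 0)" by simp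
  then show "act M (x + y, 0) = act M (x, 0) + act M (y, 0)" using 2 x' y' by metis
  have "lbracket g_alg (x, 0) (y, 0) = (lbracket sl2 x y, 0)"
    by (simp add: lbracket_g lin_0[OF lin_act_L])
  then show "act M (lbracket sl2 x y, 0) v = act M (x, 0) (act M (y, 0) v) - act M (y, 0) (act M (x, 0) v)" for v
    using 4 x' y' by metis
qed

abbreviation opE :: "gelt lie_mod \<Rightarrow> cvec \<Rightarrow> cvec" where "opE M \<equiv> act M (sE, 0)"
abbreviation opF :: "gelt lie_mod \<Rightarrow> cvec \<Rightarrow> cvec" where "opF M \<equiv> act M (sF, 0)"
abbreviation opH :: "gelt lie_mod \<Rightarrow> cvec \<Rightarrow> cvec" where "opH M \<equiv> act M (sH, 0)"
abbreviation opv :: "int \<Rightarrow> gelt lie_mod \<Rightarrow> cvec \<Rightarrow> cvec" where "opv j M \<equiv> act M (0, v4 j)"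

lemma lbracket_sl2_0: "lbracket sl2 x 0 = 0" "lbracket sl2 0 0 = 0" "lscale sl2 r 0 = 0"
  by (simp_all add: sl2_def vec_eq_iff map_matrix_def matrix_matrix_mult_def)

lemma act_L_zero: "act (L m) 0 v = 0"
proof -
  have "act (L m) 0 = 0"
    by (rule lin_maps_eqI[OF L_lin_maps lin_maps_0]) (simp add: wb_bas[of _ m] L_act_wb)
  then show ?thesis by simp
qed

lemma carrier_g_0: "x \<in> lcarrier sl2 \<Longrightarrow> (x, 0) \<in> lcarrier g_alg" "w \<in> space_on {..4} \<Longrightarrow> (0, w) \<in> lcarrier g_alg"
  by (simp_all add: lcarrier_g space_on_0)

lemma v4_bas: "v4 4 = bas 0" "v4 2 = bas 1" "v4 0 = bas 2" "v4 (-2) = bas 3" "v4 (-4) = bas 4"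
  by (simp_all add: v4_def)

lemma act_vec_scl:
  assumes "lie_module g_alg M" "w \<in> space_on {..4}"
  shows "act M (0, scl r w) v = scl r (act M (0, w) v)"
  using lie_module_scl[OF assms(1) carrier_g_0(2)[OF assms(2)], of r v] by (simp add: lscale_g lbracket_sl2_0)

lemma act_vec_0: "lie_module g_alg M \<Longrightarrow> act M (0, 0) v = 0"
  using act_vec_scl[of M 0 0 v] by (simp add: space_on_0)

lemma act_vec_neg: "lie_module g_alg M \<Longrightarrow> w \<in> space_on {..4} \<Longrightarrow> act M (0, - w) v = - act M (0, w) v"
  using act_vec_scl[of M w "-1" v] by simp

lemma act_sl2_vec:
  assumes M: "lie_module g_alg M" and x: "x \<in> lcarrier sl2" and w: "w \<in> space_on {..4}"
  shows "act M (x, 0) (act M (0, w) v) = act M (0, w) (act M (x, 0) v) + act M (0, act (L 4) x w) v"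
  using lie_module_bracket[OF M carrier_g_0(1)[OF x] carrier_g_0(2)[OF w], of v]
  by (simp add: lbracket_g lbracket_sl2_0 lin_0[OF lin_act_L] algebra_simps)

lemma act_vec_vec:
  assumes M: "lie_module g_alg M" and u: "u \<in> space_on {..4}" and w: "w \<in> space_on {..4}"
  shows "act M (0, u) (act M (0, w) v) = act M (0, w) (act M (0, u) v)"
  using lie_module_bracket[OF M carrier_g_0(2)[OF u] carrier_g_0(2)[OF w], of v]
  by (simp add: lbracket_g lbracket_sl2_0 act_L_zero act_vec_0[OF M])

lemma L4_act:
  "act (L 4) sE (bas 0) = 0" "act (L 4) sE (bas 1) = scl 4 (bas 0)" "act (L 4) sE (bas 2) = scl 3 (bas 1)"
  "act (L 4) sE (bas 3) = scl 2 (bas 2)" "act (L 4) sE (bas 4) = scl 1 (bas 3)"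
  "act (L 4) sF (bas 0) = scl 1 (bas 1)" "act (L 4) sF (bas 1) = scl 2 (bas 2)" "act (L 4) sF (bas 2) = scl 3 (bas 3)"
  "act (L 4) sF (bas 3) = scl 4 (bas 4)" "act (L 4) sF (bas 4) = 0"
  "act (L 4) sH (bas 0) = scl 4 (bas 0)" "act (L 4) sH (bas 1) = scl 2 (bas 1)" "act (L 4) sH (bas 2) = scl 0 (bas 2)"
  "act (L 4) sH (bas 3) = scl (-2) (bas 3)" "act (L 4) sH (bas 4) = scl (-4) (bas 4)"
  by (simp_all add: L_def flip: numeral_2_eq_2)

lemma g_ops_mod:
  assumes M: "lie_module g_alg M"
  shows "g_ops (opE M) (opF M) (opH M) (opv 4 M) (opv 2 M) (opv 0 M) (opv (-2) M) (opv (-4) M)"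
proof (intro g_ops.intro g_ops_axioms.intro)
  show "sl2_ops (opE M) (opF M) (opH M)"
    using sl2_ops_mod[OF lie_module_restrict[OF M]] by (simp add: restrict_sl2_def)
qed (simp_all add: lie_module_lin[OF M] carrier_g_0 v4_bas act_sl2_vec[OF M] L4_act L4_act[unfolded One_nat_def] act_vec_scl[OF M] act_vec_0[OF M]
      act_vec_neg[OF M] space_on_scl
      act_vec_vec[OF M, of "bas i" "bas j" for i j])

lemma g_act_decomp:
  assumes M: "lie_module g_alg M" and x: "x \<in> lcarrier g_alg"
  shows "act M x v = scl (fst x $ 1 $ 1) (opH M v) + scl (fst x $ 1 $ 2) (opE M v) + scl (fst x $ 2 $ 1) (opF M v)
    + (\<Sum>i\<le>4. scl (Poly_Mapping.lookup (snd x) i) (act M (0, bas i) v))"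
proof -
  obtain A w where xa: "x = (A, w)" by (cases x)
  then have A: "A \<in> lcarrier sl2" and w: "w \<in> space_on {..4}" using x by (auto simp: lcarrier_g)
  have "x = (A, 0) + (0, w)" by (simp add: xa)
  then have "act M x v = act M (A, 0) v + act M (0, w) v"
    using lie_module_add[OF M carrier_g_0(1)[OF A] carrier_g_0(2)[OF w]] by simp
  moreover have "act M (A, 0) v = scl (A $ 1 $ 1) (opH M v) + scl (A $ 1 $ 2) (opE M v) + scl (A $ 2 $ 1) (opF M v)"
    using sl2_act_decomp[OF lie_module_restrict[OF M] A, of v] by (simp add: restrict_sl2_def)
  moreover have "act M (0, w) v = (\<Sum>i\<le>4. scl (Poly_Mapping.lookup w i) (act M (0, bas i) v))"
  proof -
    have "act M (0, \<Sum>i\<in>J. scl (r i) (bas i)) v = (\<Sum>i\<in>J. scl (r i) (act M (0, bas i) v))"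
      if "finite J" "J \<subseteq> {..4}" for J r
      using that
    proof (induction J rule: finite_induct)
      case empty
      then show ?case by (simp add: act_vec_0[OF M])
    next
      case (insert i J)
      have s: "scl (r i) (bas i) \<in> space_on {..4}" "(\<Sum>i\<in>J. scl (r i) (bas i)) \<in> space_on {..4}"
        using insert.prems by (auto intro!: space_on_scl space_on_sum)
      have "(0 :: mat2, scl (r i) (bas i) + (\<Sum>i\<in>J. scl (r i) (bas i))) = (0, scl (r i) (bas i)) + (0, \<Sum>i\<in>J. scl (r i) (bas i))"
        by simp
      then show ?case
        using insert lie_module_add[OF M carrier_g_0(2)[OF s(1)] carrier_g_0(2)[OF s(2)], of v]
        by (simp add: act_vec_scl[OF M])
    qed
    from this[of "{..4}" "Poly_Mapping.lookup w"] show ?thesis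
      using cvec_expand[of "{..4}" w] w by (simp add: space_on_def)
  qed
  ultimately show ?thesis by (simp add: xa)
qed

lemma closed_submodule:
  assumes M: "lie_module g_alg M" and T: "T \<subseteq> space_on (idx M)"
    and cl: "g_ops.closed (opE M) (opF M) (opH M) (opv 4 M) (opv 2 M) (opv 0 M) (opv (-2) M) (opv (-4) M) T"
  shows "submodule g_alg M T"
proof -
  interpret g: g_ops "opE M" "opF M" "opH M" "opv 4 M" "opv 2 M" "opv 0 M" "opv (-2) M" "opv (-4) M"
    by (rule g_ops_mod[OF M])
  have s: "cvec.subspace T" using cl by (simp add: g.closed_def)
  have b: "act M (0, bas i) v \<in> T" if "v \<in> T" "i \<le> 4" for v i
  proof -
    have "i = 0 \<or> i = 1 \<or> i = 2 \<or> i = 3 \<or> i = 4" using that(2) by auto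
    then show ?thesis using g.closedD[OF cl that(1)] by (auto simp: v4_bas)
  qed
  have "act M x v \<in> T" if "x \<in> lcarrier g_alg" "v \<in> T" for x v
    unfolding g_act_decomp[OF M that(1)]
    by (intro cvec.subspace_add[OF s] cvec.subspace_scale[OF s] cvec.subspace_sum[OF s] g.closedD[OF cl that(2)] b[OF that(2)]) auto
  then show ?thesis using s T by (auto simp: submodule_def)
qed

lemma space_closed:
  assumes M: "lie_module g_alg M"
  shows "g_ops.closed (opE M) (opF M) (opH M) (opv 4 M) (opv 2 M) (opv 0 M) (opv (-2) M) (opv (-4) M) (space_on (idx M))"
proof -
  interpret g: g_ops "opE M" "opF M" "opH M" "opv 4 M" "opv 2 M" "opv 0 M" "opv (-2) M" "opv (-4) M"
    by (rule g_ops_mod[OF M])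
  show ?thesis unfolding g.closed_def by (simp add: lie_module_space[OF M] carrier_g_0 v4_bas)
qed

subsection \<open>Highest weight vectors of \<open>L m\<close>\<close>

abbreviation Le where "Le m \<equiv> act (L m) sE"
abbreviation Lf where "Lf m \<equiv> act (L m) sF"
abbreviation Lh where "Lh m \<equiv> act (L m) sH"

lemma L_wb: "Le m (wb m j) = scl (of_nat m + 1 - of_int j) (wb m (j - 1))"
  "Lf m (wb m j) = scl (of_int j + 1) (wb m (j + 1))"
  "Lh m (wb m j) = scl (of_nat m - 2 * of_int j) (wb m j)"
  by (simp_all add: L_act_wb)

lemma Lf_pow: "(Lf m ^^ i) (bas 0) = scl (fact i) (wb m (int i))"
  by (induction i) (simp_all add: wb_bas[of 0 m] L_wb lin_scl[OF lin_act_L] mult.commute add.commute algebra_simps)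

lemma Le_pow: "j < int N \<Longrightarrow> (Le m ^^ N) (wb m j) = 0"
proof (induction N arbitrary: j)
  case 0
  then show ?case by (simp add: wb_def)
next
  case (Suc N)
  then show ?case
    by (simp only: funpow_Suc_right comp_apply L_wb lin_scl[OF lin_funpow[OF lin_act_L]]) simp
qed

lemma Le_nil: "v \<in> space_on {..m} \<Longrightarrow> N > m \<Longrightarrow> (Le m ^^ N) v = 0"
proof (induction v rule: space_on_induct)
  case (bas i)
  then show ?case by (simp add: wb_bas[of i m] Le_pow)
qed (simp_all add: lin_simps[OF lin_funpow[OF lin_act_L]])

text \<open>In coordinates e is a shift combined with multiplication by \<open>m - j\<close>, which
  is non-zero for \<open>j < m\<close>; only the coordinate at 0 can survive in the kernel.\<close>

lemma Le_zero:
  assumes v: "v \<in> space_on {..m}" "Le m v = 0"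
  shows "v = scl (Poly_Mapping.lookup v 0) (bas 0)"
proof -
  have lk: "Poly_Mapping.lookup (Le m v) j = (of_nat m - of_nat j) * Poly_Mapping.lookup v (Suc j)" if "j < m" for j
    using v(1)
  proof (induction v rule: space_on_induct)
    case (bas i)
    then have "bas i = wb m (int i)" by (simp add: wb_bas)
    then have "Poly_Mapping.lookup (Le m (bas i)) j = (of_nat m + 1 - of_nat i) * Poly_Mapping.lookup (wb m (int i - 1)) j"
      by (simp add: L_wb)
    also have "\<dots> = (of_nat m - of_nat j) * Poly_Mapping.lookup (bas i) (Suc j)"
      using bas that by (auto simp: wb_def nat_diff_distrib')
    finally show ?case .
  qed (simp_all add: lin_simps[OF lin_act_L] lookup_add distrib_left mult.left_commute)
  show ?thesis
  proof (rule poly_mapping_eqI)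
    fix i
    consider "i = 0" | j where "i = Suc j" "j < m" | "i > m" using not_less_eq by (cases i) auto
    then show "Poly_Mapping.lookup v i = Poly_Mapping.lookup (scl (Poly_Mapping.lookup v 0) (bas 0)) i"
    proof cases
      case 2
      then show ?thesis using lk[of j] v(2) by simp
    next
      case 3
      then have "i \<notin> Poly_Mapping.keys v" using v(1) by (auto simp: space_on_def)
      then show ?thesis using 3 by (simp add: in_keys_iff)
    qed simp
  qed
qed

lemma simple_L: "simple_module sl2 (L m)"
  unfolding simple_module_def
proof (intro conjI allI impI)
  show "lie_module sl2 (L m)" by (rule lie_module_L)
  show "idx (L m) \<noteq> {}" by auto
  fix T assume T: "cvec.subspace T \<and> T \<subseteq> space_on (idx (L m)) \<and> (\<forall>x\<in>lcarrier sl2. act (L m) x ` T \<subseteq> T)"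
  have hT: "act (L m) x y \<in> T" if "x \<in> lcarrier sl2" "y \<in> T" for x y using T that by blast
  show "T = {0} \<or> T = space_on (idx (L m))"
  proof (cases "T = {0}")
    case False
    have "0 \<in> T" using T cvec.subspace_0 by blast
    then obtain x where x: "x \<in> T" "x \<noteq> 0" using False by blast
    have xs: "x \<in> space_on {..m}" using T x by auto
    define N where "N = (LEAST N. (Le m ^^ N) x = 0)"
    have N: "(Le m ^^ N) x = 0" unfolding N_def by (rule LeastI[of _ "Suc m"]) (simp only: Le_nil[OF xs] lessI)
    then obtain l where l: "N = Suc l" using x(2) by (cases N) auto
    have "(Le m ^^ l) x \<noteq> 0" using not_less_Least[of l "\<lambda>N. (Le m ^^ N) x = 0"] l by (simp add: N_def)
    moreover have lT: "(Le m ^^ l) x \<in> T" for l by (induction l) (use x hT in auto)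
    moreover have "Le m ((Le m ^^ l) x) = 0" using N l by simp
    ultimately have b0: "bas 0 \<in> T"
    proof -
      have s: "(Le m ^^ l) x \<in> space_on {..m}" using lT T by auto
      obtain r where r: "(Le m ^^ l) x = scl r (bas 0)" using Le_zero[OF s] \<open>Le m ((Le m ^^ l) x) = 0\<close> by blast
      then have "r \<noteq> 0" using \<open>(Le m ^^ l) x \<noteq> 0\<close> by auto
      moreover have "scl (1 / r) (scl r (bas 0)) \<in> T" using lT[of l] T cvec.subspace_scale unfolding r by blast
      ultimately show ?thesis by simp
    qed
    have "(Lf m ^^ i) (bas 0) \<in> T" for i by (induction i) (use b0 hT in auto)
    then have "scl (1 / fact i) (scl (fact i) (wb m (int i))) \<in> T" for i
      unfolding Lf_pow using T cvec.subspace_scale by blast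
    then have "bas i \<in> T" if "i \<le> m" for i using that by (simp add: wb_bas[of i m])
    then have "space_on {..m} \<subseteq> T"
      unfolding space_on_eq_span using T by (intro cvec.span_minimal) auto
    then show ?thesis using T by auto
  qed simp
qed

subsection \<open>Modules with prescribed restriction to \<open>sl\<^sub>2\<close>\<close>

lemma ds_rep:
  assumes "v \<in> space_on (idx (infinite_direct_sum N))"
  obtains K where "finite K" "v = (\<Sum>k\<in>K. sinj N k (sproj N k v))" "\<And>k. k \<notin> K \<Longrightarrow> sproj N k v = 0"
proof -
  define K where "K = (\<lambda>n. fst (prod_decode n)) ` Poly_Mapping.keys v"
  let ?I = "{prod_encode (k, i) | k i. k \<in> K \<and> i \<in> idx (N k)}"
  have fK: "finite K" by (simp add: K_def)
  have "v \<in> space_on ?I"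
    unfolding space_on_def
  proof (rule CollectI, rule subsetI)
    fix n assume n: "n \<in> Poly_Mapping.keys v"
    obtain k i where ki: "n = prod_encode (k, i)" by (metis prod_decode_inverse surj_pair)
    then have "k \<in> K" using n by (force simp: K_def)
    moreover have "i \<in> idx (N k)" using assms n ki idx_ds[of k i N] by (auto simp: space_on_def)
    ultimately show "n \<in> ?I" using ki by blast
  qed
  then have "v = (\<Sum>k\<in>K. sinj N k (sproj N k v)) \<and> (\<forall>k. k \<notin> K \<longrightarrow> sproj N k v = 0)"
  proof (induction v rule: space_on_induct)
    case (bas n)
    then obtain k i where ki: "n = prod_encode (k, i)" "k \<in> K" "i \<in> idx (N k)" by blast
    have b: "bas n = tens (bas k) (bas i)" using ki(1) by simp
    have "(\<Sum>l\<in>K. sinj N l (sproj N l (bas n))) = (\<Sum>l\<in>K. if l = k then bas n else 0)"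
      by (intro sum.cong) (auto simp: b sproj_tens id_on_bas ki(3) sinj_def lin_0[OF lin_sinj] lin_0[OF lin_id_on] tens_simps simp del: tens_bas)
    then have "bas n = (\<Sum>l\<in>K. sinj N l (sproj N l (bas n)))" using ki(2) fK by simp
    moreover have "sproj N l (bas n) = 0" if "l \<notin> K" for l
      using that ki(2) by (auto simp: b sproj_tens simp del: tens_bas)
    ultimately show ?case by blast
  qed (auto simp: lin_simps[OF lin_sproj] lin_simps[OF lin_sinj] sum.distrib cvec.scale_sum_right[symmetric])
  then show ?thesis using that fK by blast
qed

text \<open>\<open>\<pi> k\<close> and \<open>\<iota> k\<close> are the projections and inclusions of a decomposition of \<open>M\<close> into the \<open>L (w k)\<close>.\<close>

lemma restriction_decomp:
  assumes "isomorphic (module_cat sl2) R (infinite_direct_sum (\<lambda>k. L (w k)))"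
  obtains \<pi> \<iota> where "\<And>k. \<pi> k \<in> module_homs sl2 R (L (w k))" "\<And>k. \<iota> k \<in> module_homs sl2 (L (w k)) R"
    "\<And>k l v. \<pi> k (\<iota> l v) = (if k = l then id_on {..w k} v else 0)"
    "\<And>x. x \<in> space_on (idx R) \<Longrightarrow> \<exists>K. finite K \<and> x = (\<Sum>k\<in>K. \<iota> k (\<pi> k x)) \<and> (\<forall>k. k \<notin> K \<longrightarrow> \<pi> k x = 0)"
proof -
  let ?N = "\<lambda>k. L (w k)"
  let ?D = "infinite_direct_sum ?N"
  obtain \<phi> \<psi> where \<phi>: "\<phi> \<in> module_homs sl2 R ?D" and \<psi>: "\<psi> \<in> module_homs sl2 ?D R"
    and \<psi>\<phi>: "\<psi> \<circ> \<phi> = id_on (idx R)" and \<phi>\<psi>: "\<phi> \<circ> \<psi> = id_on (idx ?D)"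
    using assms by (auto simp: isomorphic_def iso_in_def)
  have N: "lie_module sl2 (?N k)" for k by (rule lie_module_L)
  have inv: "\<phi> (\<psi> v) = id_on (idx ?D) v" "\<psi> (\<phi> x) = id_on (idx R) x" for v x
    using fun_cong[OF \<phi>\<psi>, of v] fun_cong[OF \<psi>\<phi>, of x] by simp_all
  define \<pi> where "\<pi> k = sproj ?N k \<circ> \<phi>" for k
  define \<iota> where "\<iota> k = \<psi> \<circ> sinj ?N k" for k
  show ?thesis
  proof (rule that[of \<pi> \<iota>])
    show "\<pi> k \<in> module_homs sl2 R (L (w k))" for k
      unfolding \<pi>_def by (rule module_homs_comp[OF \<phi> sproj_hom[of sl2 ?N, OF N]])
    show "\<iota> k \<in> module_homs sl2 (L (w k)) R" for k
      unfolding \<iota>_def by (rule module_homs_comp[OF sinj_hom[of sl2 ?N, OF N] \<psi>])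
    show "\<pi> k (\<iota> l v) = (if k = l then id_on {..w k} v else 0)" for k l v
    proof -
      have "\<pi> k (\<iota> l v) = (sproj ?N k \<circ> sinj ?N l) v"
        using module_homs_space[OF sinj_hom[of sl2 ?N, OF N], of l v] by (simp add: \<pi>_def \<iota>_def inv id_on_id)
      then show ?thesis by (auto simp: sproj_sinj)
    qed
    fix x assume x: "x \<in> space_on (idx R)"
    obtain K where K: "finite K" "\<phi> x = (\<Sum>k\<in>K. sinj ?N k (sproj ?N k (\<phi> x)))" "\<And>k. k \<notin> K \<Longrightarrow> sproj ?N k (\<phi> x) = 0"
      using ds_rep[OF module_homs_space[OF \<phi>, of x]] by blast
    have "x = \<psi> (\<phi> x)" using x by (simp add: inv id_on_id)
    also have "\<dots> = (\<Sum>k\<in>K. \<iota> k (\<pi> k x))"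
      by (subst K(2)) (simp add: lin_sum[OF module_homs_lin[OF \<psi>]] \<iota>_def \<pi>_def)
    finally show "\<exists>K. finite K \<and> x = (\<Sum>k\<in>K. \<iota> k (\<pi> k x)) \<and> (\<forall>k. k \<notin> K \<longrightarrow> \<pi> k x = 0)"
      using K by (auto simp: \<pi>_def)
  qed
qed

text \<open>Every axiom about highest weights is checked in the components \<open>L (w k)\<close>
  and carried over by the projections and inclusions. Injectivity of \<open>w\<close> gives
  multiplicity one; \<open>P\<close> records which of the weights \<open>n + 2 * t\<close>
  occur.\<close>

lemma hw_simple_of_restriction:
  assumes swr: "simple_with_restriction \<mu> (\<lambda>k. L (w k)) M" and \<mu>: "\<mu> \<noteq> 0" and w: "inj w" "\<And>k. \<exists>t. w k = n + 2 * t"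
    and P: "\<And>t. P t \<longleftrightarrow> (\<exists>k. w k = n + 2 * t)" "\<And>t. P (t + 2) = P t" "P 0 \<or> P 1"
  shows "hw_simple (opE M) (opF M) (opH M) (opv 4 M) (opv 2 M) (opv 0 M) (opv (-2) M) (opv (-4) M) (space_on (idx M)) \<mu> n P"
proof -
  let ?S = "space_on (idx M)"
  have M: "simple_module g_alg M" and C2: "\<And>x. x \<in> ?S \<Longrightarrow> C2_op M x = scl (\<mu>\<^sup>2) x" and C3: "\<And>x. x \<in> ?S \<Longrightarrow> C3_op M x = scl (\<mu>^3) x"
    using swr by (auto simp: simple_with_restriction_def)
  have Ml: "lie_module g_alg M" by (rule simple_lie_module[OF M])
  interpret g: g_ops "opE M" "opF M" "opH M" "opv 4 M" "opv 2 M" "opv 0 M" "opv (-2) M" "opv (-4) M"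
    by (rule g_ops_mod[OF Ml])
  obtain \<pi> \<iota> where \<pi>: "\<And>k. \<pi> k \<in> module_homs sl2 (restrict_sl2 M) (L (w k))"
    and \<iota>: "\<And>k. \<iota> k \<in> module_homs sl2 (L (w k)) (restrict_sl2 M)"
    and \<pi>\<iota>: "\<And>k l v. \<pi> k (\<iota> l v) = (if k = l then id_on {..w k} v else 0)"
    and rep': "\<And>x. x \<in> space_on (idx (restrict_sl2 M)) \<Longrightarrow> \<exists>K. finite K \<and> x = (\<Sum>k\<in>K. \<iota> k (\<pi> k x)) \<and> (\<forall>k. k \<notin> K \<longrightarrow> \<pi> k x = 0)"
    by (rule restriction_decomp[of "restrict_sl2 M" w, OF swr[unfolded simple_with_restriction_def, THEN conjunct2, THEN conjunct2]])
       (rule that)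
  have rep: "\<exists>K. finite K \<and> x = (\<Sum>k\<in>K. \<iota> k (\<pi> k x)) \<and> (\<forall>k. k \<notin> K \<longrightarrow> \<pi> k x = 0)" if "x \<in> ?S" for x
    using rep'[of x] that by (simp add: restrict_sl2_def)
  have \<pi>0: "x = 0" if xs: "x \<in> ?S" and xz: "\<And>k. \<pi> k x = 0" for x
  proof -
    obtain K where "x = (\<Sum>k\<in>K. \<iota> k (\<pi> k x))" using rep[OF xs] by blast
    then show ?thesis by (simp only: xz lin_0[OF module_homs_lin[OF \<iota>]] sum.neutral_const)
  qed
  note l\<pi> = lin_simps[OF module_homs_lin[OF \<pi>]] and l\<iota> = lin_simps[OF module_homs_lin[OF \<iota>]]
  have \<pi>act: "\<pi> k (act M (x, 0) v) = act (L (w k)) x (\<pi> k v)" if "x \<in> lcarrier sl2" for k x v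
    using module_homs_act[OF \<pi> that, of k v] by (simp add: restrict_sl2_def)
  have \<iota>act: "\<iota> k (act (L (w k)) x v) = act M (x, 0) (\<iota> k v)" if "x \<in> lcarrier sl2" for k x v
    using module_homs_act[OF \<iota> that, of k v] by (simp add: restrict_sl2_def)
  have \<pi>s: "\<pi> k x \<in> space_on {..w k}" for k x using module_homs_space[OF \<pi>, of k x] by simp
  have \<iota>s: "\<iota> k x \<in> ?S" for k x using module_homs_space[OF \<iota>, of k x] by (simp add: restrict_sl2_def)
  define x0 where "x0 k = \<iota> k (bas 0)" for k
  have x0: "x0 k \<in> ?S" "x0 k \<noteq> 0" "opE M (x0 k) = 0" "opH M (x0 k) = scl (of_nat (w k)) (x0 k)" for k
  proof -
    show "x0 k \<in> ?S" by (simp add: x0_def \<iota>s)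
    have "\<pi> k (x0 k) = bas 0" by (simp add: x0_def \<pi>\<iota> id_on_bas)
    then show "x0 k \<noteq> 0" using lin_0[OF module_homs_lin[OF \<pi>]] bas_nz by metis
    have w0: "bas 0 = wb (w k) 0" by (simp add: wb_def)
    show "opE M (x0 k) = 0"
      unfolding x0_def \<iota>act[OF s_carrier(1), symmetric] by (simp only: w0 L_wb) (simp add: wb_def l\<iota>)
    show "opH M (x0 k) = scl (of_nat (w k)) (x0 k)"
      unfolding x0_def \<iota>act[OF s_carrier(3), symmetric] by (simp only: w0 L_wb l\<iota>) simp
  qed
  have \<pi>hw: "\<pi> k x = scl (Poly_Mapping.lookup (\<pi> k x) 0) (bas 0)" if "opE M x = 0" for k x
    by (rule Le_zero[OF \<pi>s]) (simp add: \<pi>act[symmetric] that l\<pi>)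
  have \<pi>wt: "l = of_nat (w k)" if "opE M x = 0" "opH M x = scl l x" "\<pi> k x \<noteq> 0" for k x l
  proof -
    have "\<pi> k x = scl (Poly_Mapping.lookup (\<pi> k x) 0) (bas 0)" by (rule \<pi>hw[OF that(1)])
    then obtain r where r: "\<pi> k x = scl r (bas 0)" by blast
    have "Lh (w k) (\<pi> k x) = scl l (\<pi> k x)" by (simp add: \<pi>act[symmetric] that l\<pi>)
    moreover have "Lh (w k) (bas 0) = scl (of_nat (w k)) (bas 0)"
      using L_wb(3)[of "w k" 0] by (simp add: wb_def)
    ultimately have "scl (of_nat (w k)) (\<pi> k x) = scl l (\<pi> k x)" by (simp add: r lin_scl[OF lin_act_L] mult.commute)
    then show ?thesis using that(3) by simp
  qed
  have rep_hw: "x = scl (Poly_Mapping.lookup (\<pi> k x) 0) (x0 k)"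
    if x: "x \<in> ?S" "opE M x = 0" "opH M x = scl (of_nat (w k)) x" for x k
  proof -
    obtain K where K: "finite K" "x = (\<Sum>k\<in>K. \<iota> k (\<pi> k x))" "\<forall>k. k \<notin> K \<longrightarrow> \<pi> k x = 0" using rep[OF x(1)] by blast
    have "\<pi> j x = 0" if "j \<noteq> k" for j
      using \<pi>wt[OF \<open>opE M x = 0\<close> \<open>opH M x = scl (of_nat (w k)) x\<close>, of j] that w(1) by (auto simp: inj_def)
    then have "(\<Sum>k\<in>K. \<iota> k (\<pi> k x)) = (\<Sum>j\<in>K. if j = k then \<iota> k (\<pi> k x) else 0)"
      by (intro sum.cong) (auto simp: l\<iota>)
    also have "\<dots> = \<iota> k (\<pi> k x)" using K(1,3) by (auto simp: l\<iota>)
    finally have "x = \<iota> k (\<pi> k x)" using K(2) by simp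
    also have "\<dots> = \<iota> k (scl (Poly_Mapping.lookup (\<pi> k x) 0) (bas 0))" using \<pi>hw[OF x(2), of k] by simp
    finally show ?thesis by (simp add: x0_def l\<iota>)
  qed
  show ?thesis
  proof (unfold_locales)
    show "g.closed ?S" by (rule space_closed[OF Ml])
    show "T = ?S" if "g.closed T" "T \<subseteq> ?S" "x \<in> T" "x \<noteq> 0" for T x
      by (rule simple_submodule[OF M closed_submodule[OF Ml that(2,1)] that(3,4)])
    show "\<mu> \<noteq> 0" by fact
    show "opv 0 M (opv 0 M x) - scl 3 (opv (- 2) M (opv 2 M x)) + scl 12 (opv (- 4) M (opv 4 M x)) = scl (\<mu>\<^sup>2) x"
      if "x \<in> ?S" for x using C2[OF that] by (simp add: C2_op_def Let_def)
    show "opv 0 M (opv 0 M (opv 0 M x)) - scl (9 / 2) (opv (- 2) M (opv 0 M (opv 2 M x))) +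
         scl (27 / 2) (opv (- 2) M (opv (- 2) M (opv 4 M x))) + scl (27 / 2) (opv (- 4) M (opv 2 M (opv 2 M x))) -
         scl 36 (opv (- 4) M (opv 0 M (opv 4 M x))) = scl (\<mu> ^ 3) x"
      if "x \<in> ?S" for x using C3[OF that] by (simp add: C3_op_def Let_def)
    show "\<exists>x\<in>?S. x \<noteq> 0 \<and> opE M x = 0 \<and> opH M x = scl (of_nat (n + 2 * t)) x" if t: "P t" for t
    proof -
      obtain k where "w k = n + 2 * t" using t P by blast
      then show ?thesis using x0[of k] by (intro bexI[of _ "x0 k"]) simp_all
    qed
    show "\<exists>t. P t \<and> l = of_nat (n + 2 * t)" if x: "x \<in> ?S" "x \<noteq> 0" "opE M x = 0" "opH M x = scl l x" for x l
    proof -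
      obtain k where "\<pi> k x \<noteq> 0" using \<pi>0[OF x(1)] x(2) by blast
      then have "l = of_nat (w k)" by (rule \<pi>wt[OF x(3,4)])
      moreover obtain t where "w k = n + 2 * t" using w(2) by blast
      ultimately show ?thesis using P(1) by (intro exI[of _ t]) auto
    qed
    show "\<exists>r. y = scl r x" if xy: "x \<in> ?S" "y \<in> ?S" "x \<noteq> 0" "opE M x = 0" "opE M y = 0" "opH M x = scl l x" "opH M y = scl l y" for x y l
    proof -
      obtain k where "\<pi> k x \<noteq> 0" using \<pi>0[OF xy(1)] xy(3) by blast
      then have l: "l = of_nat (w k)" by (rule \<pi>wt[OF xy(4,6)])
      obtain r s where rs: "x = scl r (x0 k)" "y = scl s (x0 k)"
        using rep_hw[OF xy(1,4)] rep_hw[OF xy(2,5)] xy(6,7) unfolding l by blast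
      then have "r \<noteq> 0" using xy(3) by auto
      then have "y = scl (s / r) x" by (simp add: rs)
      then show ?thesis by blast
    qed
    show "(opF M ^^ Suc m) x = 0" if x: "x \<in> ?S" "opE M x = 0" "opH M x = scl (of_nat m) x" for x m
    proof (rule \<pi>0)
      show "(opF M ^^ Suc m) x \<in> ?S" by (simp add: lie_module_space[OF Ml] carrier_g_0)
      fix k
      have p: "\<pi> k ((opF M ^^ i) x) = (Lf (w k) ^^ i) (\<pi> k x)" for i by (induction i) (simp_all add: \<pi>act)
      show "\<pi> k ((opF M ^^ Suc m) x) = 0"
      proof (cases "\<pi> k x = 0")
        case True
        then show ?thesis by (simp only: p lin_0[OF lin_funpow[OF lin_act_L]])
      next
        case False
        then have "w k = m" using \<pi>wt[OF x(2,3), of k] by simp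
        moreover obtain r where "\<pi> k x = scl r (bas 0)" using \<pi>hw[OF x(2)] by blast
        ultimately show ?thesis
          by (simp only: p lin_scl[OF lin_funpow[OF lin_act_L]] Lf_pow) (simp add: wb_def)
      qed
    qed
    show "\<exists>N. (opE M ^^ N) x = 0" if x: "x \<in> ?S" for x
    proof -
      obtain K where K: "finite K" "\<forall>k. k \<notin> K \<longrightarrow> \<pi> k x = 0" using rep[OF x] by blast
      define N where "N = Suc (\<Sum>k\<in>K. w k)"
      have p: "\<pi> k ((opE M ^^ i) x) = (Le (w k) ^^ i) (\<pi> k x)" for i k by (induction i) (simp_all add: \<pi>act)
      have sN: "(opE M ^^ i) x \<in> ?S" for i by (cases i) (simp_all add: x lie_module_space[OF Ml] carrier_g_0)
      have zN: "\<pi> k ((opE M ^^ N) x) = 0" for k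
      proof (cases "k \<in> K")
        case True
        then have "w k \<le> (\<Sum>k\<in>K. w k)" using K(1) by (intro member_le_sum) auto
        then show ?thesis unfolding p by (intro Le_nil[OF \<pi>s]) (simp add: N_def)
      next
        case False
        then have "\<pi> k x = 0" using K(2) by blast
        then show ?thesis by (simp only: p lin_0[OF lin_funpow[OF lin_act_L]])
      qed
      have "(opE M ^^ N) x = 0" by (rule \<pi>0[OF sN zN])
      then show ?thesis by blast
    qed
    show "x \<in> cvec.span {y \<in> ?S. opE M y = 0 \<and> (\<exists>t. opH M y = scl (of_nat (n + 2 * t)) y)}"
      if x: "x \<in> ?S" "opE M x = 0" for x
    proof -
      obtain K where K: "finite K" "x = (\<Sum>k\<in>K. \<iota> k (\<pi> k x))" using rep[OF x(1)] by blast
      have "\<iota> k (\<pi> k x) \<in> cvec.span {y \<in> ?S. opE M y = 0 \<and> (\<exists>t. opH M y = scl (of_nat (n + 2 * t)) y)}" for k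
      proof -
        obtain t where "w k = n + 2 * t" using w(2) by blast
        then have "x0 k \<in> {y \<in> ?S. opE M y = 0 \<and> (\<exists>t. opH M y = scl (of_nat (n + 2 * t)) y)}"
          using x0[of k] by auto
        moreover obtain r where "\<pi> k x = scl r (bas 0)" using \<pi>hw[OF x(2)] by blast
        then have "\<iota> k (\<pi> k x) = scl r (x0 k)" by (simp add: l\<iota> x0_def)
        ultimately show ?thesis by (simp add: cvec.span_scale cvec.span_base)
      qed
      then have "(\<Sum>k\<in>K. \<iota> k (\<pi> k x)) \<in> cvec.span {y \<in> ?S. opE M y = 0 \<and> (\<exists>t. opH M y = scl (of_nat (n + 2 * t)) y)}"
        by (intro cvec.span_sum)
      then show ?thesis using K(2) by simp
    qed
    show "P (t + 2) = P t" for t by (rule P(2))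
    show "P 0 \<or> P 1" by (rule P(3))
  qed
qed

subsection \<open>Homomorphisms from systems of highest weight vectors\<close>

text \<open>The part of the central character that is used from here on. Unlike simplicity it passes
  to direct sums and to \<open>L(1) \<otimes> M\<close>, because L(4) acts there through the second
  factor only.\<close>

definition good :: "complex \<Rightarrow> gelt lie_mod \<Rightarrow> bool" where
  "good \<mu> M \<longleftrightarrow> lie_module g_alg M \<and>
     (\<forall>x. scl 8 (opv 4 M (opv 0 M x)) = scl 3 (opv 2 M (opv 2 M x)) - scl (4 * \<mu>) (opv 4 M x)) \<and>
     (\<forall>x\<in>space_on (idx M). opv 4 M x = 0 \<longrightarrow> x = 0)"

definition sys :: "gelt lie_mod \<Rightarrow> nat \<Rightarrow> (nat \<Rightarrow> complex) \<Rightarrow> (nat \<Rightarrow> cvec) \<Rightarrow> bool" where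
  "sys M n \<delta> u \<longleftrightarrow> (\<forall>t. u t \<in> space_on (idx M) \<and> opE M (u t) = 0 \<and> opH M (u t) = scl (of_nat (n + 2 * t)) (u t) \<and>
     opv 4 M (u t) = u (t + 2) \<and>
     scl 4 (opv 4 M (opF M (u t))) = scl (of_nat (n + 2 * t)) (opv 2 M (u t)) + scl (4 * \<delta> t) (u (t + 1)))"

lemma good_lie_module: "good \<mu> M \<Longrightarrow> lie_module g_alg M"
  by (simp add: good_def)

lemma g_rel_good:
  assumes "good \<mu> M"
  shows "g_rel (opE M) (opF M) (opH M) (opv 4 M) (opv 2 M) (opv 0 M) (opv (-2) M) (opv (-4) M) \<mu>"
proof (intro g_rel.intro g_rel_axioms.intro)
  show g: "g_ops (opE M) (opF M) (opH M) (opv 4 M) (opv 2 M) (opv 0 M) (opv (-2) M) (opv (-4) M)"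
    by (rule g_ops_mod[OF good_lie_module[OF assms]])
  show "g_ops.q4 (opv 4 M) (opv 2 M) (opv 0 M) (- 4 * \<mu>) x = 0" for x
    using assms by (simp add: g_ops.q4_def[OF g] good_def)
qed

lemma sys_indep:
  assumes M: "lie_module g_alg M" and u: "sys M n \<delta> u" and z: "(\<Sum>t<N. scl (r t) (u t)) = 0" and t: "t < N"
  shows "scl (r t) (u t) = 0"
proof (rule cvec.eigen_indep[OF _ finite_lessThan _ _ z])
  show l: "Vector_Spaces.linear scl scl (opH M)" by (rule lie_module_lin[OF M]) (simp add: carrier_g_0)
  show "inj_on (\<lambda>t. of_nat (n + 2 * t) :: complex) {..<N}"
    by (auto simp: inj_on_def simp del: of_nat_add of_nat_mult)
  show "opH M (scl (r i) (u i)) = scl (of_nat (n + 2 * i)) (scl (r i) (u i))" for i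
    using u by (simp only: lin_scl[OF l] sys_def) (simp only: cvec.scale_scale mult.commute)
qed (use t in auto)

lemma hom_ops:
  assumes "\<phi> \<in> module_homs g_alg M N"
  shows "\<phi> (opE M x) = opE N (\<phi> x)" "\<phi> (opF M x) = opF N (\<phi> x)" "\<phi> (opH M x) = opH N (\<phi> x)"
    "\<phi> (opv 4 M x) = opv 4 N (\<phi> x)" "\<phi> (opv 2 M x) = opv 2 N (\<phi> x)" "\<phi> (opv 0 M x) = opv 0 N (\<phi> x)"
  by (simp_all add: module_homs_act[OF assms] carrier_g_0 v4_bas)

lemma sys_image:
  assumes "\<phi> \<in> module_homs g_alg M N" "sys M n \<delta> u"
  shows "sys N n \<delta> (\<lambda>t. \<phi> (u t))"
proof -
  note l = lin_simps[OF module_homs_lin[OF assms(1)]]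
  show ?thesis
    unfolding sys_def
  proof (intro allI conjI)
    fix t
    show "\<phi> (u t) \<in> space_on (idx N)" by (rule module_homs_space[OF assms(1)])
    show "opE N (\<phi> (u t)) = 0" "opH N (\<phi> (u t)) = scl (of_nat (n + 2 * t)) (\<phi> (u t))" "opv 4 N (\<phi> (u t)) = \<phi> (u (t + 2))"
      using assms(2) by (simp_all only: hom_ops[OF assms(1), symmetric] sys_def l)
    have "\<phi> (scl 4 (opv 4 M (opF M (u t)))) = \<phi> (scl (of_nat (n + 2 * t)) (opv 2 M (u t)) + scl (4 * \<delta> t) (u (t + 1)))"
      using assms(2) by (simp only: sys_def)
    then show "scl 4 (opv 4 N (opF N (\<phi> (u t)))) = scl (of_nat (n + 2 * t)) (opv 2 N (\<phi> (u t))) + scl (4 * \<delta> t) (\<phi> (u (t + 1)))"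
      by (simp only: l hom_ops[OF assms(1)])
  qed
qed

lemma sys_add:
  assumes M: "lie_module g_alg M" and u: "sys M n \<delta> u" "sys M n \<delta> u'"
  shows "sys M n \<delta> (\<lambda>t. u t + u' t)"
proof -
  have l: "lin (opE M)" "lin (opF M)" "lin (opH M)" "lin (opv 4 M)" "lin (opv 2 M)"
    by (rule lie_module_lin[OF M]; simp add: carrier_g_0 v4_bas)+
  note ll = lin_add[OF l(1)] lin_add[OF l(2)] lin_add[OF l(3)] lin_add[OF l(4)] lin_add[OF l(5)]
  show ?thesis
    using u unfolding sys_def by (simp add: ll space_on_add cvec.scale_right_distrib)
qed

lemma dsum2_good:
  assumes d: "dsum g_alg [M, N] Z i p" and M: "good \<mu> M" and N: "good \<mu> N"
  shows "good \<mu> Z"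
proof -
  have Z: "lie_module g_alg Z" using d by (simp add: dsum_def)
  have i: "i 0 \<in> module_homs g_alg M Z" "i 1 \<in> module_homs g_alg N Z"
    and p: "p 0 \<in> module_homs g_alg Z M" "p 1 \<in> module_homs g_alg Z N"
    using dsum_homs[OF d, of 0] dsum_homs[OF d, of 1] by simp_all
  note li = lin_simps[OF module_homs_lin[OF i(1)]] lin_simps[OF module_homs_lin[OF i(2)]]
  have idz: "id_on (idx Z) z = i 0 (p 0 z) + i 1 (p 1 z)" for z
    using dsum_id[OF d, of z] by (simp add: numeral_2_eq_2)
  have ops: "opv j Z z = i 0 (opv j M (p 0 z)) + i 1 (opv j N (p 1 z))" if "j = 4 \<or> j = 2 \<or> j = 0" for j z
  proof -
    have c: "(0, v4 j) \<in> lcarrier g_alg" using that by (auto simp: carrier_g_0 v4_bas)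
    have "opv j Z z = opv j Z (id_on (idx Z) z)" by (simp add: lin_maps_id_right[OF lie_module_lin_maps[OF Z c]])
    then show ?thesis
      by (simp add: idz lin_add[OF lie_module_lin[OF Z c]] module_homs_act[OF i(1) c] module_homs_act[OF i(2) c] del: One_nat_def)
  qed
  have pops: "p 0 (opv j Z z) = opv j M (p 0 z)" "p 1 (opv j Z z) = opv j N (p 1 z)" if "j = 4 \<or> j = 2 \<or> j = 0" for j z
    using that module_homs_act[OF p(1)] module_homs_act[OF p(2)] by (auto simp: carrier_g_0 v4_bas)
  have rM: "scl 8 (opv 4 M (opv 0 M x)) = scl 3 (opv 2 M (opv 2 M x)) - scl (4 * \<mu>) (opv 4 M x)" for x using M by (simp add: good_def)
  have rN: "scl 8 (opv 4 N (opv 0 N x)) = scl 3 (opv 2 N (opv 2 N x)) - scl (4 * \<mu>) (opv 4 N x)" for x using N by (simp add: good_def)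
  have "scl 8 (opv 4 Z (opv 0 Z x)) = scl 3 (opv 2 Z (opv 2 Z x)) - scl (4 * \<mu>) (opv 4 Z x)" for x
  proof -
    have "scl 8 (opv 4 Z (opv 0 Z x)) = i 0 (scl 8 (opv 4 M (opv 0 M (p 0 x)))) + i 1 (scl 8 (opv 4 N (opv 0 N (p 1 x))))"
      by (simp add: ops[of 4 "opv 0 Z x"] pops li cvec.scale_right_distrib del: One_nat_def)
    also have "\<dots> = scl 3 (opv 2 Z (opv 2 Z x)) - scl (4 * \<mu>) (opv 4 Z x)"
      by (simp only: rM rN ops[of 2 "opv 2 Z x"] ops[of 4 x] pops li cvec.scale_right_distrib simp_thms) simp
    finally show ?thesis .
  qed
  moreover have "x = 0" if x: "x \<in> space_on (idx Z)" "opv 4 Z x = 0" for x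
  proof -
    have "opv 4 M (p 0 x) = 0" "opv 4 N (p 1 x) = 0"
      using pops[of 4 x] lin_0[OF module_homs_lin[OF p(1)]] lin_0[OF module_homs_lin[OF p(2)]] x(2) by simp_all
    then have "p 0 x = 0" "p 1 x = 0" using M N module_homs_space[OF p(1)] module_homs_space[OF p(2)] by (auto simp: good_def)
    then show ?thesis using idz[of x] x(1) by (simp add: id_on_id li del: One_nat_def)
  qed
  ultimately show ?thesis using Z by (simp add: good_def)
qed

text \<open>The homomorphism is obtained from its graph, the submodule of the direct sum that is saturated
  with respect to \<open>v\<^sub>4\<close> and generated by the pairs of corresponding highest weight vectors.\<close>

lemma hom_of_systems:
  assumes Ms: "simple_module g_alg M" and M: "good \<mu> M" and N: "good \<mu> N"
    and u: "sys M n \<delta> u" and u': "sys N n \<delta> u'" and uz: "\<And>t. u t = 0 \<Longrightarrow> u' t = 0" and nz: "u t0 \<noteq> 0"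
  obtains \<phi> where "\<phi> \<in> module_homs g_alg M N" "\<And>t. \<phi> (u t) = u' t"
proof -
  have Ml: "lie_module g_alg M" and Nl: "lie_module g_alg N" using M N by (simp_all add: good_def)
  obtain Z i p where d: "dsum g_alg [M, N] Z i p" using dsum_exists[of "[M, N]" g_alg] Ml Nl by auto
  have Zl: "lie_module g_alg Z" using d by (simp add: dsum_def)
  have i: "i 0 \<in> module_homs g_alg M Z" "i 1 \<in> module_homs g_alg N Z"
    and p: "p 0 \<in> module_homs g_alg Z M" "p 1 \<in> module_homs g_alg Z N"
    using dsum_homs[OF d, of 0] dsum_homs[OF d, of 1] by simp_all
  have pi: "p 0 (i 0 v) = id_on (idx M) v" "p 0 (i 1 v) = 0" "p 1 (i 0 v) = 0" "p 1 (i 1 v) = id_on (idx N) v" for v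
    using dsum_apply[OF d, of 0 0 v] dsum_apply[OF d, of 0 1 v] dsum_apply[OF d, of 1 0 v] dsum_apply[OF d, of 1 1 v] by simp_all
  note lp = lin_simps[OF module_homs_lin[OF p(1)]] lin_simps[OF module_homs_lin[OF p(2)]]
    and li = lin_simps[OF module_homs_lin[OF i(1)]] lin_simps[OF module_homs_lin[OF i(2)]]
  have Z: "good \<mu> Z" by (rule dsum2_good[OF d M N])
  interpret Z: g_rel "opE Z" "opF Z" "opH Z" "opv 4 Z" "opv 2 Z" "opv 0 Z" "opv (-2) Z" "opv (-4) Z" \<mu>
    by (rule g_rel_good[OF Z])
  interpret M: g_rel "opE M" "opF M" "opH M" "opv 4 M" "opv 2 M" "opv 0 M" "opv (-2) M" "opv (-4) M" \<mu>
    by (rule g_rel_good[OF M])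
  define w where "w t = i 0 (u t) + i 1 (u' t)" for t
  have w: "sys Z n \<delta> w"
    unfolding w_def by (rule sys_add[OF Zl sys_image[OF i(1) u] sys_image[OF i(2) u']])
  have us: "u t \<in> space_on (idx M)" "opE M (u t) = 0" for t using u by (simp_all add: sys_def)
  have u's: "u' t \<in> space_on (idx N)" for t using u' by (simp add: sys_def)
  have pw: "p 0 (w t) = u t" "p 1 (w t) = u' t" for t
    by (simp_all add: w_def lp pi id_on_id us u's del: One_nat_def)
  have ws: "Z.sysl n \<delta> w" using w by (simp add: Z.sysl_def sys_def)
  \<comment> \<open>Vectors supported outside \<open>idx Z\<close> are killed by
    \<open>opv 4 Z\<close> and hence lie in the hull; the intersection removes them.\<close>
  define T where "T = Z.ahull w \<inter> space_on (idx Z)"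
  have "Z.closed T"
    using Z.ahull_closed[OF ws] space_closed[OF Zl] unfolding T_def Z.closed_def
    by (auto intro: cvec.subspace_inter)
  then have T: "submodule g_alg Z T" by (intro closed_submodule[OF Zl]) (auto simp: T_def)
  have wT: "w t \<in> T" for t using Z.ahull_base w by (auto simp: T_def sys_def)
  have "u t0 \<in> p 0 ` T" using wT[of t0] pw(1)[of t0] by (metis image_eqI)
  then have surj: "p 0 ` T = space_on (idx M)"
    by (rule simple_submodule[OF Ms submodule_image[OF Zl p(1) T] _ nz])
  \<comment> \<open>A power of \<open>v\<^sub>4\<close> moves \<open>z\<close> into the span of the
    \<open>b\<^sup>i w\<^sub>t\<close>. Its projection to \<open>M\<close> is zero, and there both
    the powers of b and the weights separate the terms. Where \<open>u t\<close> is zero,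
    \<open>uz\<close> makes \<open>w t\<close> zero too, so all terms of \<open>z\<close>
    vanish.\<close>
  have inj: "z = 0" if z: "z \<in> T" "p 0 z = 0" for z
  proof -
    obtain K where K: "(opv 4 Z ^^ K) z \<in> Z.bspan w" using z(1) by (auto simp: T_def Z.ahull_def)
    obtain J y where y: "\<And>i. y i \<in> cvec.span (range w)" "(opv 4 Z ^^ K) z = (\<Sum>i<J. (opv 2 Z ^^ i) (y i))"
      using Z.bspan_rep[OF K] by blast
    have pa: "p 0 ((opv 4 Z ^^ m) x) = (opv 4 M ^^ m) (p 0 x)" for m x
      by (induction m) (simp_all add: hom_ops[OF p(1)])
    have pb: "p 0 ((opv 2 Z ^^ m) x) = (opv 2 M ^^ m) (p 0 x)" for m x
      by (induction m) (simp_all add: hom_ops[OF p(1)])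
    have rep: "\<exists>J r. y j = (\<Sum>t<J. scl (r t) (w t))" for j using span_rangeE[OF y(1)[of j]] by metis
    have "(\<Sum>i<J. (opv 2 M ^^ i) (p 0 (y i))) = p 0 ((opv 4 Z ^^ K) z)" by (simp add: y(2) lp pb)
    also have "\<dots> = 0" by (simp only: pa z(2) lin_0[OF lin_funpow[OF M.lin_a]])
    finally have s0: "(\<Sum>i<J. (opv 2 M ^^ i) (p 0 (y i))) = 0" .
    have pe: "opE M (p 0 (y j)) = 0" for j
    proof -
      obtain J r where "y j = (\<Sum>t<J. scl (r t) (w t))" using rep by blast
      then show ?thesis by (simp add: lp pw M.gl us)
    qed
    have yz: "y j = 0" if j: "j < J" for j
    proof -
      have "p 0 (y j) = 0"
        by (rule M.b_indep[OF space_closed[OF Ml] _ _ pe s0 j]) (use M module_homs_space[OF p(1)] in \<open>auto simp: good_def\<close>)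
      moreover obtain L r where r: "y j = (\<Sum>t<L. scl (r t) (w t))" using rep by blast
      ultimately have s: "(\<Sum>t<L. scl (r t) (u t)) = 0" by (simp add: lp pw)
      have "scl (r t) (w t) = 0" if "t < L" for t
        using sys_indep[OF Ml u s that] uz[of t] by (auto simp: w_def li simp del: One_nat_def)
      then show ?thesis unfolding r by (intro sum.neutral) blast
    qed
    have "(opv 4 Z ^^ K) z = (\<Sum>i<J. 0)"
      unfolding y(2) by (intro sum.cong) (simp_all add: yz lin_0[OF lin_funpow[OF Z.lin_b]])
    then have az: "(opv 4 Z ^^ K) z = 0" by simp
    have "z \<in> space_on (idx Z)" using z by (simp add: T_def)
    have ainj: "x = 0" if "x \<in> space_on (idx Z)" "opv 4 Z x = 0" for x using Z that by (simp add: good_def)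
    have "(opv 4 Z ^^ m) z = 0 \<Longrightarrow> z = 0" for m
    proof (induction m)
      case (Suc m)
      have "(opv 4 Z ^^ m) z \<in> space_on (idx Z)"
        using \<open>z \<in> space_on (idx Z)\<close> lie_module_space[OF Zl] by (cases m) (auto simp: carrier_g_0 v4_bas)
      then show ?case using Suc ainj by simp
    qed simp
    then show "z = 0" using az by blast
  qed
  obtain s where s: "s \<in> module_homs g_alg M Z" "\<And>z. z \<in> T \<Longrightarrow> s (p 0 z) = z"
    using section_hom[OF Zl Ml p(1) T inj] surj by (metis order_refl)
  have "s (u t) = w t" for t using s(2)[OF wT[of t]] by (simp add: pw)
  then have "(p 1 \<circ> s) (u t) = u' t" for t by (simp add: pw del: One_nat_def)
  then show ?thesis by (rule that[OF module_homs_comp[OF s(1) p(2)]])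
qed

subsection \<open>The modules \<open>V(n,\<mu>)\<close>, \<open>V'(0,\<mu>)\<close>, \<open>V'(2,\<mu>)\<close>\<close>

definition hwset :: "gelt lie_mod \<Rightarrow> nat set" where
  "hwset M = {m. \<exists>x\<in>space_on (idx M). x \<noteq> 0 \<and> opE M x = 0 \<and> opH M x = scl (of_nat m) x}"

lemma hwset_hom:
  assumes M: "simple_module g_alg M" and N: "lie_module g_alg N" and f: "f \<in> module_homs g_alg M N" "f \<noteq> 0"
  shows "hwset M \<subseteq> hwset N"
proof
  fix m assume "m \<in> hwset M"
  then obtain x where x: "x \<in> space_on (idx M)" "x \<noteq> 0" "opE M x = 0" "opH M x = scl (of_nat m) x"
    by (auto simp: hwset_def)
  then have "f x \<noteq> 0" using simple_hom_inj[OF M N f] by blast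
  then show "m \<in> hwset N"
    unfolding hwset_def using x module_homs_space[OF f(1)]
    by (intro CollectI bexI[of _ "f x"])
       (simp_all add: hom_ops[OF f(1), symmetric] lin_simps[OF module_homs_lin[OF f(1)]])
qed

lemma hwset_simple:
  assumes M: "simple_module g_alg M" and N: "simple_module g_alg N" and f: "f \<in> module_homs g_alg M N" "f \<noteq> 0"
  shows "hwset M = hwset N"
proof -
  obtain g where g: "g \<in> module_homs g_alg N M" "f \<circ> g = id_on (idx N)" using simple_hom_inverse[OF M N f] by blast
  obtain k where "bas k \<in> space_on (idx N)" using simple_space_nz[OF N] by blast
  then have "f (g (bas k)) \<noteq> 0" using fun_cong[OF g(2), of "bas k"] by (simp add: id_on_bas)
  then have "g \<noteq> 0" using lin_0[OF module_homs_lin[OF f(1)]] by auto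
  then show ?thesis using hwset_hom[OF M simple_lie_module[OF N] f] hwset_hom[OF N simple_lie_module[OF M] g(1)] by blast
qed

abbreviation hw_mod :: "complex \<Rightarrow> nat \<Rightarrow> (nat \<Rightarrow> bool) \<Rightarrow> gelt lie_mod \<Rightarrow> bool" where
  "hw_mod \<mu> n P M \<equiv> hw_simple (opE M) (opF M) (opH M) (opv 4 M) (opv 2 M) (opv 0 M) (opv (-2) M) (opv (-4) M) (space_on (idx M)) \<mu> n P"

lemma hw_mod_good:
  assumes M: "simple_module g_alg M" and h: "hw_mod \<mu> n P M"
  shows "good \<mu> M"
proof -
  have Ml: "lie_module g_alg M" by (rule simple_lie_module[OF M])
  interpret hw_simple "opE M" "opF M" "opH M" "opv 4 M" "opv 2 M" "opv 0 M" "opv (-2) M" "opv (-4) M" "space_on (idx M)" \<mu> n P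
    by (rule h)
  have r: "opv j M x = opv j M (id_on (idx M) x)" if "j = 4 \<or> j = 2 \<or> j = 0" for x j
    using that by (subst lin_maps_id_right[OF lie_module_lin_maps[OF Ml]]) (auto simp: carrier_g_0 v4_bas)
  have "scl 8 (opv 4 M (opv 0 M x)) = scl 3 (opv 2 M (opv 2 M x)) - scl (4 * \<mu>) (opv 4 M x)" for x
    using ac_relation[OF id_on_space, of x] r[of 4 x] r[of 2 x] r[of 0 x] by (simp add: q4_def algebra_simps)
  then show ?thesis using Ml a_inj by (simp add: good_def)
qed

lemma hw_mod_sys:
  assumes M: "simple_module g_alg M" and h: "hw_mod \<mu> n P M"
  obtains u \<delta> where "sys M n \<delta> u" "\<And>t. u t \<noteq> 0 \<longleftrightarrow> P t" "\<And>t. \<delta> (t + 2) = \<delta> t"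
proof -
  interpret hw_simple "opE M" "opF M" "opH M" "opv 4 M" "opv 2 M" "opv 0 M" "opv (-2) M" "opv (-4) M" "space_on (idx M)" \<mu> n P
    by (rule h)
  obtain \<delta> where \<delta>: "\<And>t. scl 4 (opv 4 M (opF M (u t))) = scl (of_nat (n + 2 * t)) (opv 2 M (u t)) + scl (4 * \<delta> t) (u (t + 1))"
    "\<And>t. \<delta> (t + 2) = \<delta> t" using D_relation by blast
  have "sys M n \<delta> u" unfolding sys_def using u \<delta> u_step by blast
  moreover have "u t \<noteq> 0 \<longleftrightarrow> P t" for t using u(4,5) by blast
  ultimately show ?thesis using that \<delta>(2) by blast
qed

lemma hw_mod_hwset:
  assumes h: "hw_mod \<mu> n P M"
  shows "hwset M = {n + 2 * t | t. P t}"
proof -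
  interpret hw_simple "opE M" "opF M" "opH M" "opv 4 M" "opv 2 M" "opv 0 M" "opv (-2) M" "opv (-4) M" "space_on (idx M)" \<mu> n P
    by (rule h)
  show ?thesis
  proof (intro equalityI subsetI)
    fix m assume "m \<in> hwset M"
    then obtain x where "x \<in> space_on (idx M)" "x \<noteq> 0" "opE M x = 0" "opH M x = scl (of_nat m) x" by (auto simp: hwset_def)
    then obtain t where "P t" "(of_nat m :: complex) = of_nat (n + 2 * t)" using hw_wt by blast
    then show "m \<in> {n + 2 * t | t. P t}" by (simp only: of_nat_eq_iff) blast
  next
    fix m assume "m \<in> {n + 2 * t | t. P t}"
    then show "m \<in> hwset M" using hw_ex unfolding hwset_def by blast
  qed
qed

text \<open>An endomorphism preserves a one-dimensional space of highest weight vectors and acts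
  there by a scalar. The difference with this scalar has a kernel, so it is zero by
  simplicity.\<close>

lemma hw_mod_schur:
  assumes M: "simple_module g_alg M" and h: "hw_mod \<mu> n P M" and f: "f \<in> module_homs g_alg M M"
  shows "\<exists>r. f = (\<lambda>v. scl r (id_on (idx M) v))"
proof -
  have Ml: "lie_module g_alg M" by (rule simple_lie_module[OF M])
  interpret hw_simple "opE M" "opF M" "opH M" "opv 4 M" "opv 2 M" "opv 0 M" "opv (-2) M" "opv (-4) M" "space_on (idx M)" \<mu> n P
    by (rule h)
  obtain t where "P t" using P_01 by blast
  then obtain x where x: "x \<in> space_on (idx M)" "x \<noteq> 0" "opE M x = 0" "opH M x = scl (of_nat (n + 2 * t)) x" using hw_ex by blast
  note lf = lin_simps[OF module_homs_lin[OF f]]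
  have "opE M (f x) = 0" "opH M (f x) = scl (of_nat (n + 2 * t)) (f x)"
    by (simp_all only: hom_ops[OF f, symmetric] x lf)
  then obtain r where r: "f x = scl r x" using hw_uniq[OF x(1) module_homs_space[OF f] x(2,3) _ x(4)] by blast
  let ?g = "f - (\<lambda>v. scl r (id_on (idx M) v))"
  have g: "?g \<in> module_homs g_alg M M"
    by (rule module_homs_diff[OF Ml f module_homs_scl[OF Ml module_homs_id[OF Ml]]])
  have "?g x = 0" using x r by (simp add: id_on_id)
  then have "?g = 0" using simple_hom_inj[OF M Ml g _ x(1)] x(2) by blast
  then have "f = (\<lambda>v. scl r (id_on (idx M) v))" by (simp only: right_minus_eq)
  then show ?thesis by blast
qed

lemma is_V_simple: "is_V n \<mu> M \<Longrightarrow> simple_module g_alg M" "is_V'0 \<mu> M \<Longrightarrow> simple_module g_alg M" "is_V'2 \<mu> M \<Longrightarrow> simple_module g_alg M"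
  by (simp_all add: is_V_def is_V'0_def is_V'2_def simple_with_restriction_def)

text \<open>Both primed modules are described with \<open>n = 0\<close>, one by the even and one by
  the odd indices, so that they appear as the two halves of a single sequence of weights.\<close>

lemma is_V_hw_mod:
  assumes "\<mu> \<noteq> 0"
  shows "is_V n \<mu> M \<Longrightarrow> hw_mod \<mu> n (\<lambda>_. True) M" "is_V'0 \<mu> M \<Longrightarrow> hw_mod \<mu> 0 even M" "is_V'2 \<mu> M \<Longrightarrow> hw_mod \<mu> 0 odd M"
proof -
  show "is_V n \<mu> M \<Longrightarrow> hw_mod \<mu> n (\<lambda>_. True) M"
    by (rule hw_simple_of_restriction[of \<mu> "\<lambda>k. n + 2 * k"]) (auto simp: is_V_def assms inj_def)
  have ev: "even t \<longleftrightarrow> (\<exists>k. 4 * k = 0 + 2 * t)" and od: "odd t \<longleftrightarrow> (\<exists>k. 4 * k + 2 = 0 + 2 * t)" for t :: nat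
    by presburger+
  have e2: "\<exists>t. 4 * k = 0 + 2 * t" "\<exists>t. 4 * k + 2 = 0 + 2 * t" for k :: nat by presburger+
  show "is_V'0 \<mu> M \<Longrightarrow> hw_mod \<mu> 0 even M"
    by (rule hw_simple_of_restriction[of \<mu> "\<lambda>k. 4 * k", OF _ _ _ _ ev])
       (use e2 in \<open>simp_all add: is_V'0_def assms inj_def\<close>)
  show "is_V'2 \<mu> M \<Longrightarrow> hw_mod \<mu> 0 odd M"
    by (rule hw_simple_of_restriction[of \<mu> "\<lambda>k. 4 * k + 2", OF _ _ _ _ od])
       (use e2 in \<open>simp_all add: is_V'2_def assms inj_def\<close>)
qed

lemma sys_quantization:
  assumes M: "good \<mu> M" and u: "sys M n (\<lambda>_. \<delta>) u" "\<And>t. \<delta> \<noteq> 0 \<or> even t \<Longrightarrow> u t \<noteq> 0"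
    and nil: "(opF M ^^ Suc n) (u 0) = 0" and \<sigma>: "\<sigma>\<^sup>2 = \<mu>"
  shows "\<exists>N\<le>n. \<delta> = (2 * of_nat N - of_nat n) * \<sigma> / 2"
proof -
  interpret M: g_rel "opE M" "opF M" "opH M" "opv 4 M" "opv 2 M" "opv 0 M" "opv (-2) M" "opv (-4) M" \<mu>
    by (rule g_rel_good[OF M])
  have s: "M.sysl n (\<lambda>_. \<delta>) u" using u by (simp add: M.sysl_def sys_def)
  show ?thesis
    by (rule M.quantization[OF space_closed[OF good_lie_module[OF M]] _ s _ u(2) nil \<sigma>])
       (use M u in \<open>auto simp: good_def sys_def\<close>)
qed

lemma sys_nonzero_hom_hwset:
  assumes "simple_module g_alg M" "good \<mu> M" "simple_module g_alg N" "good \<mu> N" "sys M n \<delta> u" "sys N n \<delta> u'"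
    "\<And>t. u t = 0 \<Longrightarrow> u' t = 0" "u' t0 \<noteq> 0"
  shows "hwset M = hwset N"
proof -
  obtain \<phi> where \<phi>: "\<phi> \<in> module_homs g_alg M N" "\<And>t. \<phi> (u t) = u' t"
    using hom_of_systems[OF assms(1,2,4,5,6,7), of t0] assms(7,8) by blast
  then have "\<phi> \<noteq> 0" using assms(8) by auto
  then show ?thesis by (rule hwset_simple[OF assms(1,3) \<phi>(1)])
qed

lemma sys_shift: "sys M n \<delta> u \<Longrightarrow> n' = n + 2 * s \<Longrightarrow> sys M n' (\<lambda>t. \<delta> (t + s)) (\<lambda>t. u (t + s))"
  unfolding sys_def
proof (intro allI)
  fix t assume *: "\<forall>t. u t \<in> space_on (idx M) \<and> opE M (u t) = 0 \<and> opH M (u t) = scl (of_nat (n + 2 * t)) (u t) \<and>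
     opv 4 M (u t) = u (t + 2) \<and>
     scl 4 (opv 4 M (opF M (u t))) = scl (of_nat (n + 2 * t)) (opv 2 M (u t)) + scl (4 * \<delta> t) (u (t + 1))" and n: "n' = n + 2 * s"
  have e: "n' + 2 * t = n + 2 * (t + s)" "t + 2 + s = t + s + 2" "t + 1 + s = t + s + 1" using n by auto
  show "u (t + s) \<in> space_on (idx M) \<and> opE M (u (t + s)) = 0 \<and> opH M (u (t + s)) = scl (of_nat (n' + 2 * t)) (u (t + s)) \<and>
     opv 4 M (u (t + s)) = u (t + 2 + s) \<and>
     scl 4 (opv 4 M (opF M (u (t + s)))) = scl (of_nat (n' + 2 * t)) (opv 2 M (u (t + s))) + scl (4 * \<delta> (t + s)) (u (t + 1 + s))"
    unfolding e using * by blast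
qed

text \<open>If \<delta> vanishes on one parity class, the relations at its indices no longer mention
  their neighbours; setting the other members to zero leaves a system with constant 0.\<close>

lemma sys_parity:
  assumes M: "lie_module g_alg M" and u: "sys M n \<delta> u" and z: "\<And>t. Q t \<Longrightarrow> \<delta> t = 0" and Q: "\<And>t. Q (t + 1) = (\<not> Q t)"
  shows "sys M n (\<lambda>_. 0) (\<lambda>t. if Q t then u t else 0)"
proof -
  have l: "lin (opE M)" "lin (opF M)" "lin (opH M)" "lin (opv 4 M)" "lin (opv 2 M)"
    by (rule lie_module_lin[OF M]; simp add: carrier_g_0 v4_bas)+
  note l0 = lin_0[OF l(1)] lin_0[OF l(2)] lin_0[OF l(3)] lin_0[OF l(4)] lin_0[OF l(5)]
  have Q2: "Q (t + 2) = Q t" for t using Q[of t] Q[of "t + 1"] by simp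
  show ?thesis
    unfolding sys_def
  proof (intro allI conjI)
    fix t
    have ut: "u t \<in> space_on (idx M)" "opE M (u t) = 0" "opH M (u t) = scl (of_nat (n + 2 * t)) (u t)"
      "opv 4 M (u t) = u (t + 2)"
      "scl 4 (opv 4 M (opF M (u t))) = scl (of_nat (n + 2 * t)) (opv 2 M (u t)) + scl (4 * \<delta> t) (u (t + 1))"
      using u unfolding sys_def by blast+
    show "(if Q t then u t else 0) \<in> space_on (idx M)" "opE M (if Q t then u t else 0) = 0"
      "opH M (if Q t then u t else 0) = scl (of_nat (n + 2 * t)) (if Q t then u t else 0)"
      "opv 4 M (if Q t then u t else 0) = (if Q (t + 2) then u (t + 2) else 0)"
      using ut by (simp_all only: Q2 l0 space_on_0 cvec.scale_zero_right split: if_split) simp_all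
    show "scl 4 (opv 4 M (opF M (if Q t then u t else 0))) = scl (of_nat (n + 2 * t)) (opv 2 M (if Q t then u t else 0))
      + scl (4 * 0) (if Q (t + 1) then u (t + 1) else 0)"
      using ut(5) z[of t] by (cases "Q t") (simp_all only: Q l0 simp_thms if_True if_False cvec.scale_zero_right, simp_all)
  qed
qed

lemma hw_nil_mod:
  assumes "hw_mod \<mu> n P M" "x \<in> space_on (idx M)" "opE M x = 0" "opH M x = scl (of_nat m) x"
  shows "(opF M ^^ Suc m) x = 0"
proof -
  interpret hw_simple "opE M" "opF M" "opH M" "opv 4 M" "opv 2 M" "opv 0 M" "opv (-2) M" "opv (-4) M" "space_on (idx M)" \<mu> n P
    by (rule assms(1))
  show ?thesis by (rule hw_nil[OF assms(2-4)])
qed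

lemma periodic2: "(\<And>t. \<delta> (t + 2) = \<delta> t) \<Longrightarrow> \<delta> t = (if even t then \<delta> 0 else \<delta> (1::nat))"
  for \<delta> :: "nat \<Rightarrow> complex"
proof (induction t rule: less_induct)
  case (less t)
  show ?case
  proof (cases "t < 2")
    case True
    then show ?thesis by (auto simp: less_2_cases_iff)
  next
    case False
    then have "\<delta> (t - 2) = (if even (t - 2) then \<delta> 0 else \<delta> 1)" using less by auto
    moreover have "t - 2 + 2 = t" using False by simp
    then have "\<delta> t = \<delta> (t - 2)" using less.prems[of "t - 2"] by (simp only:)
    ultimately show ?thesis using False by simp
  qed
qed

text \<open>The constant of a system in \<open>V(n,\<mu>)\<close> is \<open>n \<surd>\<mu> / 2\<close>: the other values allowed by the
  quantization would embed \<open>V(n,\<mu>)\<close> into one of the modules with a smaller lowest constituent.\<close>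

lemma V_system:
  assumes \<mu>: "\<mu> \<noteq> 0" and \<sigma>: "\<sigma>\<^sup>2 = \<mu>" and V0: "is_V'0 \<mu> V0" and V2: "is_V'2 \<mu> V2" and V: "\<And>n. n \<ge> 1 \<Longrightarrow> is_V n \<mu> (V n)"
  shows "n \<ge> 1 \<Longrightarrow> \<exists>u. sys (V n) n (\<lambda>_. of_nat n * \<sigma> / 2) u \<and> (\<forall>t. u t \<noteq> 0)"
proof (induction n rule: less_induct)
  case (less n)
  let ?M = "V n"
  have Ms: "simple_module g_alg ?M" and h: "hw_mod \<mu> n (\<lambda>_. True) ?M"
    using is_V_simple(1)[OF V[OF less.prems]] is_V_hw_mod(1)[OF \<mu> V[OF less.prems]] by auto
  have Mg: "good \<mu> ?M" by (rule hw_mod_good[OF Ms h])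
  have Ml: "lie_module g_alg ?M" by (rule simple_lie_module[OF Ms])
  have hM: "hwset ?M = {n + 2 * t | t. True}" using hw_mod_hwset[OF h] by simp
  obtain u \<delta> where u: "sys ?M n \<delta> u" "\<And>t. u t \<noteq> 0" and \<delta>: "\<And>t. \<delta> (t + 2) = \<delta> t"
    by (rule hw_mod_sys[OF Ms h]) blast
  have u': "u t \<in> space_on (idx ?M)" "opE ?M (u t) = 0" "opH ?M (u t) = scl (of_nat (n + 2 * t)) (u t)"
    "opv 4 ?M (u t) = u (t + 2)"
    "scl 4 (opv 4 ?M (opF ?M (u t))) = scl (of_nat (n + 2 * t)) (opv 2 ?M (u t)) + scl (4 * \<delta> t) (u (t + 1))" for t
    using u unfolding sys_def by blast+
  note per = periodic2[of \<delta>, OF \<delta>]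
  have nil: "(opF ?M ^^ Suc n) (u 0) = 0" by (rule hw_nil_mod[OF h u'(1,2)]) (use u'(3)[of 0] in simp)
  \<comment> \<open>Otherwise a parity class is a system with constant 0, and quantization makes n
    even. Then there is a non-zero map to \<open>V0\<close> or \<open>V2\<close>, whose highest
    weights are four apart, whereas n and n + 2 both occur in \<open>V n\<close>.\<close>
  have pq: "\<delta> 0 * \<delta> 1 \<noteq> 0"
  proof
    assume z: "\<delta> 0 * \<delta> 1 = 0"
    define Q where "Q t = (if \<delta> 0 = 0 then even t else odd t)" for t :: nat
    have Q\<delta>: "\<delta> t = 0" if "Q t" for t using that z per[of t] by (auto simp: Q_def split: if_splits)
    have Q1: "Q (t + 1) = (\<not> Q t)" for t by (simp add: Q_def)
    have n: "even n"
    proof (cases "\<delta> 0 = 0")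
      case True
      have "sys ?M n (\<lambda>_. 0) (\<lambda>t. if Q t then u t else 0)" by (rule sys_parity[where Q = Q and \<delta> = \<delta>, OF Ml u(1) Q\<delta> Q1])
      from sys_quantization[OF Mg this _ _ \<sigma>] obtain N where "(0::complex) = (2 * of_nat N - of_nat n) * \<sigma> / 2"
        using True u(2) nil by (auto simp: Q_def)
      then have "(of_nat n :: complex) = of_nat (2 * N)" using \<sigma> \<mu> by auto
      then show ?thesis by (simp only: of_nat_eq_iff) simp
    next
      case False
      have "sys ?M n (\<lambda>_. 0) (\<lambda>t. if Q t then u t else 0)" by (rule sys_parity[where Q = Q and \<delta> = \<delta>, OF Ml u(1) Q\<delta> Q1])
      from sys_shift[OF this, of "n + 2" 1] have s: "sys ?M (n + 2) (\<lambda>_. 0) (\<lambda>t. if Q (t + 1) then u (t + 1) else 0)" by simp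
      have nil1: "(opF ?M ^^ Suc (n + 2)) (u 1) = 0" by (rule hw_nil_mod[OF h u'(1,2)]) (use u'(3)[of 1] in simp)
      from sys_quantization[OF Mg s _ _ \<sigma>] obtain N where "(0::complex) = (2 * of_nat N - of_nat (n + 2)) * \<sigma> / 2"
        using False u(2) nil1 by (auto simp: Q_def simp del: funpow.simps)
      then have "(of_nat (n + 2) :: complex) = of_nat (2 * N)" using \<sigma> \<mu> by auto
      then show ?thesis by (simp only: of_nat_eq_iff) presburger
    qed
    then obtain m where m: "n = 2 * m" by blast
    \<comment> \<open>With \<open>n = 2 * m\<close>, the parity is chosen so that the shifted system
      of \<open>W\<close> is supported outside \<open>Q\<close>. At indices in \<open>Q\<close> the
      relation then holds because \<delta> vanishes, at the others because the next member
      does.\<close>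
    define W where "W = (if even (m + (if \<delta> 0 = 0 then 1 else 0)) then V0 else V2)"
    define P where "P = (if even (m + (if \<delta> 0 = 0 then 1 else 0)) then even else (odd :: nat \<Rightarrow> bool))"
    have Ws: "simple_module g_alg W" and hW: "hw_mod \<mu> 0 P W"
      using is_V_simple(2)[OF V0] is_V_simple(3)[OF V2] is_V_hw_mod(2)[OF \<mu> V0] is_V_hw_mod(3)[OF \<mu> V2]
      by (auto simp: W_def P_def)
    have Wg: "good \<mu> W" by (rule hw_mod_good[OF Ws hW])
    have Wl: "lie_module g_alg W" by (rule simple_lie_module[OF Ws])
    obtain v \<gamma> where v: "sys W 0 \<gamma> v" "\<And>t. v t \<noteq> 0 \<longleftrightarrow> P t" by (rule hw_mod_sys[OF Ws hW]) blast
    have PQ: "P (t + m) \<longleftrightarrow> \<not> Q t" for t by (auto simp: P_def Q_def)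
    have "sys W n (\<lambda>t. \<gamma> (t + m)) (\<lambda>t. v (t + m))" by (rule sys_shift[OF v(1)]) (simp add: m)
    then have *: "v (t + m) \<in> space_on (idx W)" "opE W (v (t + m)) = 0" "opH W (v (t + m)) = scl (of_nat (n + 2 * t)) (v (t + m))"
      "opv 4 W (v (t + m)) = v (t + 2 + m)"
      "scl 4 (opv 4 W (opF W (v (t + m)))) = scl (of_nat (n + 2 * t)) (opv 2 W (v (t + m))) + scl (4 * \<gamma> (t + m)) (v (t + 1 + m))" for t
      unfolding sys_def by blast+
    have vz: "v (t + m) = 0" if "Q t" for t using v(2)[of "t + m"] PQ that by simp
    have "scl (4 * \<gamma> (t + m)) (v (t + 1 + m)) = scl (4 * \<delta> t) (v (t + 1 + m))" for t
    proof (cases "Q t")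
      case True
      have "scl (4 * \<gamma> (t + m)) (v (t + 1 + m)) = 0"
        using *(5)[of t] vz[OF True] Wl by (simp add: lin_0[OF lie_module_lin[OF Wl]] carrier_g_0 v4_bas)
      then show ?thesis by (simp add: Q\<delta>[OF True])
    next
      case False
      then show ?thesis using vz[of "t + 1"] Q1[of t] by simp
    qed
    then have "sys W n \<delta> (\<lambda>t. v (t + m))" unfolding sys_def using * by metis
    moreover obtain t0 where "v (t0 + m) \<noteq> 0" using v(2) PQ Q1 by metis
    ultimately have "hwset ?M = hwset W"
      by (intro sys_nonzero_hom_hwset[where u' = "\<lambda>t. v (t + m)", OF Ms Mg Ws Wg u(1)]) (use u(2) in auto)
    moreover have "n \<in> hwset ?M" "n + 2 \<in> hwset ?M" unfolding hM by (auto intro: exI[of _ "0::nat"] exI[of _ "1::nat"])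
    ultimately obtain t t' where t: "P t" "n = 0 + 2 * t" "P t'" "n + 2 = 0 + 2 * t'"
      unfolding hw_mod_hwset[OF hW] by blast
    moreover have "t = m" "t' = m + 1" using t m by auto
    ultimately have "P m" "P (m + 1)" by auto
    then show False by (auto simp: P_def split: if_splits)
  qed
  define \<gamma>0 where "\<gamma>0 = csqrt (\<delta> 0 * \<delta> 1)"
  have sq: "\<gamma>0 * \<gamma>0 = \<delta> 0 * \<delta> 1" using power2_csqrt[of "\<delta> 0 * \<delta> 1"] by (simp add: \<gamma>0_def power2_eq_square)
  \<comment> \<open>Rescaling the odd members changes \<open>\<delta> 0\<close> and
    \<open>\<delta> 1\<close> but not their product, so any square root of the product can serve as
    common constant.\<close>
  have resc: "\<exists>w. sys ?M n (\<lambda>_. \<gamma>) w \<and> (\<forall>t. w t \<noteq> 0)" if g: "\<gamma> * \<gamma> = \<delta> 0 * \<delta> 1" for \<gamma>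
  proof -
    have g0: "\<gamma> \<noteq> 0" "\<delta> 0 \<noteq> 0" "\<delta> 1 \<noteq> 0" using pq g by auto
    define r where "r t = (if even t then 1 else \<delta> 0 / \<gamma>)" for t :: nat
    define w where "w t = scl (r t) (u t)" for t
    have r: "r t * \<delta> t = \<gamma> * r (t + 1)" for t
      using g0 g per[of t] by (auto simp: r_def field_simps)
    have r2: "r (t + 2) = r t" for t by (simp add: r_def)
    have l: "lin (opE ?M)" "lin (opF ?M)" "lin (opH ?M)" "lin (opv 4 ?M)" "lin (opv 2 ?M)"
      by (rule lie_module_lin[OF Ml]; simp add: carrier_g_0 v4_bas)+
    note ls = lin_scl[OF l(1)] lin_scl[OF l(2)] lin_scl[OF l(3)] lin_scl[OF l(4)] lin_scl[OF l(5)]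
    have "sys ?M n (\<lambda>_. \<gamma>) w"
      unfolding sys_def
    proof (intro allI conjI)
      fix t
      show "w t \<in> space_on (idx ?M)" "opE ?M (w t) = 0" "opH ?M (w t) = scl (of_nat (n + 2 * t)) (w t)"
        "opv 4 ?M (w t) = w (t + 2)"
        unfolding w_def r2 by (simp_all only: ls u') (simp_all add: space_on_scl u' mult.commute)
      have "scl 4 (opv 4 ?M (opF ?M (w t))) = scl (r t) (scl 4 (opv 4 ?M (opF ?M (u t))))"
        by (simp add: w_def ls mult.commute)
      also have "\<dots> = scl (of_nat (n + 2 * t)) (opv 2 ?M (w t)) + scl (4 * (r t * \<delta> t)) (u (t + 1))"
        unfolding u'(5) by (simp add: w_def ls cvec.scale_right_distrib mult.commute mult.left_commute)
      also have "scl (4 * (r t * \<delta> t)) (u (t + 1)) = scl (4 * \<gamma>) (w (t + 1))"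
        unfolding r by (simp add: w_def mult.assoc)
      finally show "scl 4 (opv 4 ?M (opF ?M (w t))) = scl (of_nat (n + 2 * t)) (opv 2 ?M (w t)) + scl (4 * \<gamma>) (w (t + 1))" .
    qed
    moreover have "w t \<noteq> 0" for t using u(2) g0 by (simp add: w_def r_def)
    ultimately show ?thesis by blast
  qed
  obtain w0 where w0: "sys ?M n (\<lambda>_. \<gamma>0) w0" "\<And>t. w0 t \<noteq> 0" using resc[OF sq] by blast
  have w0': "w0 0 \<in> space_on (idx ?M)" "opE ?M (w0 0) = 0" "opH ?M (w0 0) = scl (of_nat n) (w0 0)"
    using w0(1)[unfolded sys_def, rule_format, of 0] by simp_all
  obtain N where N: "N \<le> n" "\<gamma>0 = (2 * of_nat N - of_nat n) * \<sigma> / 2"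
    using sys_quantization[OF Mg w0 hw_nil_mod[OF h w0'] \<sigma>] by blast
  \<comment> \<open>As the sign of the square root is free, \<open>2 * N - n\<close> may be replaced
    by its absolute value \<open>j\<close>.\<close>
  have "\<exists>j\<le>n. even (n + j) \<and> (of_nat j * \<sigma> / 2) * (of_nat j * \<sigma> / 2) = \<delta> 0 * \<delta> 1"
  proof (cases "2 * N \<ge> n")
    case True
    then have "of_nat (2 * N - n) = (2 * of_nat N - of_nat n :: complex)" by (simp add: of_nat_diff)
    then have "of_nat (2 * N - n) * \<sigma> / 2 = \<gamma>0" using N(2) by (simp only:)
    then have "(of_nat (2 * N - n) * \<sigma> / 2) * (of_nat (2 * N - n) * \<sigma> / 2) = \<delta> 0 * \<delta> 1" by (simp only: sq)
    then show ?thesis using True N(1) by (intro exI[of _ "2 * N - n"] conjI) auto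
  next
    case False
    then have "of_nat (n - 2 * N) = (of_nat n - 2 * of_nat N :: complex)" by (simp add: of_nat_diff)
    then have "of_nat (n - 2 * N) * \<sigma> / 2 = - \<gamma>0" unfolding N(2) by (simp only:) (simp add: field_simps)
    then have "(of_nat (n - 2 * N) * \<sigma> / 2) * (of_nat (n - 2 * N) * \<sigma> / 2) = \<delta> 0 * \<delta> 1" by (simp only: minus_mult_minus sq)
    then show ?thesis using False by (intro exI[of _ "n - 2 * N"] conjI) auto
  qed
  then obtain j where j: "j \<le> n" "even (n + j)" "(of_nat j * \<sigma> / 2) * (of_nat j * \<sigma> / 2) = \<delta> 0 * \<delta> 1" by blast
  obtain w where w: "sys ?M n (\<lambda>_. of_nat j * \<sigma> / 2) w" "\<And>t. w t \<noteq> 0" using resc[OF j(3)] by blast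
  \<comment> \<open>A smaller \<open>j\<close> has the parity of n, so the system of
    \<open>V j\<close> provided by the induction hypothesis, shifted by
    \<open>(n - j) div 2\<close>, has the weights and the constant of that of \<open>V n\<close>.
    The resulting map would be an isomorphism, but \<open>j\<close> is a highest weight of
    \<open>V j\<close> only.\<close>
  have "j = n"
  proof (rule ccontr)
    assume "j \<noteq> n"
    then have jn: "j < n" using j by simp
    have j1: "j \<ge> 1" using j(3) pq by (cases j) auto
    obtain v where v: "sys (V j) j (\<lambda>_. of_nat j * \<sigma> / 2) v" "\<And>t. v t \<noteq> 0" using less.IH[OF jn j1] by blast
    have Ns: "simple_module g_alg (V j)" and hN: "hw_mod \<mu> j (\<lambda>_. True) (V j)"
      using is_V_simple(1)[OF V[OF j1]] is_V_hw_mod(1)[OF \<mu> V[OF j1]] by auto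
    have Ng: "good \<mu> (V j)" by (rule hw_mod_good[OF Ns hN])
    have "n = j + 2 * ((n - j) div 2)" using j jn by auto
    then have "sys (V j) n (\<lambda>_. of_nat j * \<sigma> / 2) (\<lambda>t. v (t + (n - j) div 2))" by (rule sys_shift[OF v(1)])
    then have "hwset ?M = hwset (V j)"
      by (intro sys_nonzero_hom_hwset[where u' = "\<lambda>t. v (t + (n - j) div 2)", OF Ms Mg Ns Ng w(1)]) (use w(2) v(2) in auto)
    moreover have "j \<in> hwset (V j)" unfolding hw_mod_hwset[OF hN] by (auto intro: exI[of _ "0::nat"])
    ultimately have "j \<in> {n + 2 * t | t. True}" unfolding hM by blast
    then show False using jn by auto
  qed
  then show ?case using w by blast
qed

text \<open>Two consecutive members are never both non-zero, so the term with \<delta> vanishes in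
  every relation and the constant may be replaced by 0.\<close>

lemma V02_system:
  assumes "\<mu> \<noteq> 0" and M: "simple_module g_alg M" and h: "hw_mod \<mu> 0 P M" and P: "P = even \<or> P = odd"
  shows "\<exists>u. sys M 0 (\<lambda>_. 0) u \<and> (\<forall>t. u t \<noteq> 0 \<longleftrightarrow> P t)"
proof -
  obtain u \<delta> where u: "sys M 0 \<delta> u" "\<And>t. u t \<noteq> 0 \<longleftrightarrow> P t" by (rule hw_mod_sys[OF M h]) blast
  have Ml: "lie_module g_alg M" by (rule simple_lie_module[OF M])
  have "scl (4 * \<delta> t) (u (t + 1)) = scl (4 * 0) (u (t + 1))" for t
  proof (cases "P t")
    case True
    then have "u (t + 1) = 0" using u(2)[of "t + 1"] P by auto
    then show ?thesis by simp
  next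
    case False
    then have "u t = 0" using u(2) by blast
    then show ?thesis using u(1)[unfolded sys_def, rule_format, of t]
      by (simp add: lin_0[OF lie_module_lin[OF Ml]] carrier_g_0 v4_bas)
  qed
  then have "sys M 0 (\<lambda>_. 0) u" using u(1) unfolding sys_def by metis
  then show ?thesis using u(2) by blast
qed

subsection \<open>Complete reducibility of finite dimensional \<open>sl\<^sub>2\<close>-modules\<close>

text \<open>The selected indices are returned as a sorted list without repetition, so that a proof
  that all indices were selected identifies the list itself.\<close>

lemma dsum_of_sum_of_simples:
  fixes n :: nat
  assumes T: "lie_module \<gg> T" and V: "\<And>k. k < n \<Longrightarrow> simple_module \<gg> (V k)"
    and \<phi>: "\<And>k. k < n \<Longrightarrow> \<phi> k \<in> module_homs \<gg> (V k) T" and im: "space_on (idx T) \<subseteq> sum_image V \<phi> {..<n}"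
  obtains js i p where "set js \<subseteq> {..<n}" "sorted js" "distinct js" "dsum \<gg> (map V js) T i p"
proof -
  obtain J where J: "J \<subseteq> {..<n}" "sum_indep V \<phi> J" "sum_image V \<phi> J = sum_image V \<phi> {..<n}"
    using sum_of_simples[of "{..<n}" \<gg> T V \<phi>] T V \<phi> by (metis finite_lessThan lessThan_iff)
  have fJ: "finite J" using J(1) finite_subset by blast
  define js where "js = sorted_list_of_set J"
  have js: "set js = J" "distinct js" using fJ by (simp_all add: js_def)
  let ?m = "length js"
  have bij: "bij_betw ((!) js) {..<?m} J" using js bij_betw_nth[of js "{..<?m}" J] by simp
  let ?V = "\<lambda>k. V (js ! k)" and ?\<phi> = "\<lambda>k. \<phi> (js ! k)"
  have mem: "js ! k < n" if "k < ?m" for k using that js(1) J(1) nth_mem by blast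
  let ?g = "the_inv_into {..<?m} ((!) js)"
  have g: "?g (js ! k) = k" if "k < ?m" for k
    using that bij by (intro the_inv_into_f_f) (auto simp: bij_betw_def)
  have re: "(\<Sum>j\<in>J. F j) = (\<Sum>k<?m. F (js ! k))" for F :: "nat \<Rightarrow> cvec"
    using sum.reindex_bij_betw[OF bij, of F] by simp
  have "sum_indep ?V ?\<phi> {..<?m}"
    unfolding sum_indep_def
  proof (intro allI impI)
    fix x assume x: "\<forall>k\<in>{..<?m}. x k \<in> space_on (idx (?V k))" "(\<Sum>k<?m. ?\<phi> k (x k)) = 0"
    define y where "y j = x (?g j)" for j
    have yx: "y (js ! k) = x k" if "k < ?m" for k using g[OF that] by (simp add: y_def)
    have "\<forall>j\<in>J. y j \<in> space_on (idx (V j))"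
    proof
      fix j assume "j \<in> J"
      then obtain k where "k < ?m" "j = js ! k" using js(1) by (metis in_set_conv_nth)
      then show "y j \<in> space_on (idx (V j))" using x(1) yx by auto
    qed
    moreover have "(\<Sum>j\<in>J. \<phi> j (y j)) = 0" unfolding re using x(2) yx by simp
    ultimately have "\<forall>j\<in>J. y j = 0" using J(2) unfolding sum_indep_def by blast
    then show "\<forall>k\<in>{..<?m}. x k = 0" using yx js(1) nth_mem by fastforce
  qed
  moreover have "space_on (idx T) \<subseteq> sum_image ?V ?\<phi> {..<?m}"
  proof
    fix t assume "t \<in> space_on (idx T)"
    then have "t \<in> sum_image V \<phi> J" using im J(3) by blast
    then obtain x where x: "t = (\<Sum>j\<in>J. \<phi> j (x j))" "\<forall>j\<in>J. x j \<in> space_on (idx (V j))"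
      unfolding sum_image_def by blast
    then have "t = (\<Sum>k<?m. ?\<phi> k (x (js ! k)))" by (simp add: re)
    moreover have "\<forall>k\<in>{..<?m}. x (js ! k) \<in> space_on (idx (?V k))" using x(2) js(1) nth_mem by auto
    ultimately show "t \<in> sum_image ?V ?\<phi> {..<?m}"
      unfolding sum_image_def by (intro CollectI exI[of _ "\<lambda>k. x (js ! k)"]) simp
  qed
  ultimately obtain p where "dsum \<gg> (map ?V [0..<?m]) T ?\<phi> p"
    using dsum_of_indep[OF T, of ?m ?V ?\<phi>] V \<phi> mem simple_lie_module by metis
  moreover have "map ?V [0..<?m] = map V js" by (rule nth_equalityI) auto
  ultimately show ?thesis using that[of js] js J(1) by (auto simp: js_def)
qed

lemma lin_maps_finite_span:
  assumes "finite I" "finite J"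
  shows "\<exists>B. finite B \<and> lin_maps I J \<subseteq> maps.span B"
proof -
  define E where "E = (\<lambda>(i, j). lin_ext (\<lambda>k. if k = i then bas j else 0))"
  let ?B = "E ` (I \<times> J)"
  have "f \<in> maps.span ?B" if f: "f \<in> lin_maps I J" for f
  proof -
    have "f = (\<Sum>i\<in>I. \<Sum>j\<in>J. (\<lambda>v. scl (Poly_Mapping.lookup (f (bas i)) j) (E (i, j) v)))"
    proof (rule lin_eqI[OF lin_maps_lin[OF f]])
      show "lin (\<Sum>i\<in>I. \<Sum>j\<in>J. (\<lambda>v. scl (Poly_Mapping.lookup (f (bas i)) j) (E (i, j) v)))"
        by (rule linI) (simp_all add: sum_fun_apply E_def lin_simps[OF lin_lin_ext] cvec.scale_right_distrib
          sum.distrib cvec.scale_sum_right mult.commute)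
      fix k
      have "(\<Sum>i\<in>I. \<Sum>j\<in>J. scl (Poly_Mapping.lookup (f (bas i)) j) (E (i, j) (bas k))) =
        (\<Sum>i\<in>I. if i = k then (\<Sum>j\<in>J. scl (Poly_Mapping.lookup (f (bas k)) j) (bas j)) else 0)"
        by (intro sum.cong) (auto simp: E_def)
      also have "\<dots> = (if k \<in> I then f (bas k) else 0)"
        using assms cvec_expand[of J "f (bas k)"] lin_maps_space[OF f, of "bas k"] by (simp add: space_on_def)
      also have "\<dots> = f (bas k)" using lin_maps_off[OF f] by simp
      finally show "f (bas k) = (\<Sum>i\<in>I. \<Sum>j\<in>J. (\<lambda>v. scl (Poly_Mapping.lookup (f (bas i)) j) (E (i, j) v))) (bas k)"
        by (simp add: sum_fun_apply)
    qed
    also have "\<dots> \<in> maps.span ?B"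
      by (intro maps.span_sum maps.span_scale maps.span_base) auto
    finally show ?thesis .
  qed
  then show ?thesis using assms by (intro exI[of _ ?B]) auto
qed

text \<open>The powers of \<open>g\<close> are eigenvectors of \<open>ad h\<close> with distinct eigenvalues.\<close>

lemma nilpotent_of_ad:
  assumes I: "finite I" and g: "g \<in> lin_maps I I" and h: "lin h" and c: "c \<noteq> 0"
    and hg: "\<And>x. h (g x) = g (h x) + scl c (g x)"
  shows "\<exists>N. \<forall>x. (g ^^ N) x = 0"
proof (rule ccontr)
  assume "\<nexists>N. \<forall>x. (g ^^ N) x = 0"
  then have nz: "g ^^ N \<noteq> 0" for N by (auto simp: fun_eq_iff)
  note lg = lin_maps_lin[OF g]
  define A where "A f = (\<lambda>x. h (f x) - f (h x))" for f :: "cvec \<Rightarrow> cvec"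
  have A: "Vector_Spaces.linear (\<lambda>c f v. scl c (f v)) (\<lambda>c f v. scl c (f v)) A"
    unfolding Vector_Spaces.linear_iff
    using maps.vector_space_axioms by (auto simp: A_def fun_eq_iff lin_simps[OF h] cvec.scale_right_diff_distrib)
  have hgN: "h ((g ^^ N) x) = (g ^^ N) (h x) + scl (of_nat N * c) ((g ^^ N) x)" for N x
  proof (induction N)
    case (Suc N)
    have "h ((g ^^ Suc N) x) = g (h ((g ^^ N) x)) + scl c (g ((g ^^ N) x))" by (simp add: hg)
    then show ?case by (intro poly_mapping_eqI) (simp only: Suc lin_simps[OF lg] lookup_add lookup_scl funpow.simps comp_apply, simp add: algebra_simps)
  qed simp
  have AN: "A (\<lambda>v. scl r ((g ^^ N) v)) = (\<lambda>v. scl (of_nat N * c) (scl r ((g ^^ N) v)))" for N r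
    by (auto simp: A_def fun_eq_iff lin_simps[OF h] hgN cvec.scale_right_distrib mult.commute)
  obtain B where B: "finite B" "lin_maps I I \<subseteq> maps.span B" using lin_maps_finite_span[OF I I] by blast
  \<comment> \<open>One power more than \<open>B\<close> has elements. The exponent 0 is left out
    because the identity of the whole space of vectors is not in
    \<open>lin_maps I I\<close>.\<close>
  let ?J = "{1..Suc (card B)}"
  let ?S = "(\<lambda>N. g ^^ N) ` ?J"
  have inj: "inj_on (\<lambda>N. g ^^ N) ?J"
  proof (rule inj_onI)
    fix N M assume "g ^^ N = g ^^ M"
    then have eq: "(\<lambda>v. scl (of_nat N * c) (scl 1 ((g ^^ N) v))) = (\<lambda>v. scl (of_nat M * c) (scl 1 ((g ^^ N) v)))"
      using AN[of 1 N] AN[of 1 M] by simp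
    have "scl (of_nat N * c) ((g ^^ N) v) = scl (of_nat M * c) ((g ^^ N) v)" for v using fun_cong[OF eq, of v] by simp
    moreover obtain v where "(g ^^ N) v \<noteq> 0" using nz[of N] by (auto simp: fun_eq_iff)
    ultimately have "of_nat N * c = of_nat M * c" using cvec.scale_cancel_right by blast
    then show "N = M" using c by simp
  qed
  have "maps.independent ?S"
  proof (rule maps.independent_if_scalars_zero)
    fix r x assume s: "(\<Sum>x\<in>?S. (\<lambda>v. scl (r x) (x v))) = 0" and x: "x \<in> ?S"
    then obtain M where M: "M \<in> ?J" "x = g ^^ M" by blast
    have s': "(\<Sum>N\<in>?J. (\<lambda>v. scl (r (g ^^ N)) ((g ^^ N) v))) = 0"
      using s unfolding sum.reindex[OF inj] comp_def .
    have rz: "(\<lambda>v. scl (r (g ^^ M)) ((g ^^ M) v)) = 0"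
      by (rule maps.eigen_indep[OF A, of ?J "\<lambda>N. of_nat N * c", OF _ _ AN s' M(1)]) (use c in \<open>auto simp: inj_on_def\<close>)
    then have "scl (r (g ^^ M)) ((g ^^ M) v) = 0" for v
      using fun_cong[OF rz, of v] by simp
    moreover obtain v where "(g ^^ M) v \<noteq> 0" using nz[of M] by (auto simp: fun_eq_iff)
    ultimately show "r x = 0" using M(2) cvec.scale_eq_0_iff by blast
  qed auto
  moreover have "g ^^ N \<in> lin_maps I I" if "N \<ge> 1" for N
    using that
  proof (induction N rule: nat_induct_at_least)
    case base
    then show ?case using g by simp
  next
    case (Suc N)
    show ?case unfolding funpow.simps by (rule lin_maps_comp[OF Suc.IH g])
  qed
  then have "?S \<subseteq> maps.span B" using B(2) by auto
  ultimately have "card ?S \<le> card B" using maps.independent_span_bound[OF B(1)] by blast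
  then show False unfolding card_image[OF inj] by simp
qed

section \<open>The span of the simple submodules of a finite dimensional module\<close>

context sl2_ops begin

lemma e_f_pow_gen: "e ((f ^^ Suc n) y) = (f ^^ Suc n) (e y) + scl (of_nat (Suc n)) ((f ^^ n) (h y - scl (of_nat n) y))"
proof (induction n)
  case 0
  then show ?case by (simp add: ef)
next
  case (Suc n)
  have hfn: "h ((f ^^ m) y) = (f ^^ m) (h y) - scl (2 * of_nat m) ((f ^^ m) y)" for m
  proof (induction m)
    case (Suc m)
    then show ?case by (intro poly_mapping_eqI) (simp only: funpow.simps comp_apply hf sl lookup_add lookup_minus lookup_scl, simp add: algebra_simps)
  qed simp
  have "e ((f ^^ Suc (Suc n)) y) = f (e ((f ^^ Suc n) y)) + h ((f ^^ Suc n) y)" by (simp add: ef)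
  also have "\<dots> = (f ^^ Suc (Suc n)) (e y) + scl (of_nat (Suc (Suc n))) ((f ^^ Suc n) (h y - scl (of_nat (Suc n)) y))"
    unfolding Suc hfn
    by (rule poly_mapping_eqI) (simp only: funpow.simps comp_apply sl lin_simps[OF lin_funpow[OF lin_f]] lookup_add lookup_minus lookup_scl, simp add: algebra_simps)
  finally show ?case .
qed

text \<open>The falling factorial \<open>h (h - 1) \<dots> (h - n + 1)\<close> applied to
  \<open>y\<close>.\<close>

fun hpoly :: "nat \<Rightarrow> cvec \<Rightarrow> cvec" where
  "hpoly 0 y = y"
| "hpoly (Suc n) y = h (hpoly n y) - scl (of_nat n) (hpoly n y)"

lemma lin_hpoly: "lin (hpoly n)"
proof (induction n)
  case 0
  then show ?case by (rule linI) auto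
next
  case (Suc n)
  show ?case by (rule linI; rule poly_mapping_eqI; simp only: hpoly.simps sl lin_simps[OF Suc] lookup_add lookup_minus lookup_scl; simp add: algebra_simps)
qed

lemma hpoly_h: "hpoly n (h y) = h (hpoly n y)"
  by (induction n) (simp_all add: sl)

text \<open>On vectors killed by e, \<open>e\<^sup>n f\<^sup>n\<close> is n! times the falling
  factorial of h. The congruence modulo a submodule is needed twice, for the zero submodule and for
  the socle; the induction replaces \<open>y\<close> by \<open>h y - n y\<close>.\<close>

lemma e_f_pow_mod:
  assumes G: "cvec.subspace G" "\<And>x. x \<in> G \<Longrightarrow> e x \<in> G" "\<And>x. x \<in> G \<Longrightarrow> f x \<in> G" "\<And>x. x \<in> G \<Longrightarrow> h x \<in> G"
  shows "e y \<in> G \<Longrightarrow> (e ^^ n) ((f ^^ n) y) - scl (fact n) (hpoly n y) \<in> G"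
proof (induction n arbitrary: y)
  case 0
  then show ?case using cvec.subspace_0[OF G(1)] by simp
next
  case (Suc n)
  note le = lin_simps[OF lin_funpow[OF lin_e]]
  define y' where "y' = h y - scl (of_nat n) y"
  have "e y' = h (e y) - scl (of_nat n + 2) (e y)"
    unfolding y'_def by (rule poly_mapping_eqI) (simp add: sl he lookup_minus lookup_add algebra_simps)
  then have "e y' \<in> G" by (simp only:) (intro cvec.subspace_diff[OF G(1)] cvec.subspace_scale[OF G(1)] G(4) Suc.prems)
  then have IH: "(e ^^ n) ((f ^^ n) y') - scl (fact n) (hpoly n y') \<in> G" by (rule Suc.IH)
  have fG: "(f ^^ m) x \<in> G" if "x \<in> G" for m x by (induction m) (use that G in auto)
  have eG: "(e ^^ m) x \<in> G" if "x \<in> G" for m x by (induction m) (use that G in auto)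
  have "(e ^^ Suc n) ((f ^^ Suc n) y) = (e ^^ n) (e ((f ^^ Suc n) y))" by (simp only: funpow_Suc_right comp_apply)
  also have "\<dots> = (e ^^ n) ((f ^^ Suc n) (e y)) + scl (of_nat (Suc n)) ((e ^^ n) ((f ^^ n) y'))"
    unfolding e_f_pow_gen y'_def[symmetric] le ..
  finally have 1: "(e ^^ Suc n) ((f ^^ Suc n) y) = (e ^^ n) ((f ^^ Suc n) (e y)) + scl (of_nat (Suc n)) ((e ^^ n) ((f ^^ n) y'))" .
  have 2: "hpoly (Suc n) y = hpoly n y'" by (simp add: y'_def lin_simps[OF lin_hpoly] hpoly_h)
  have "(e ^^ Suc n) ((f ^^ Suc n) y) - scl (fact (Suc n)) (hpoly (Suc n) y) =
     (e ^^ n) ((f ^^ Suc n) (e y)) + scl (of_nat (Suc n)) ((e ^^ n) ((f ^^ n) y') - scl (fact n) (hpoly n y'))"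
    unfolding 1 2 by (rule poly_mapping_eqI) (simp only: lookup_add lookup_minus lookup_scl, simp add: algebra_simps)
  also have "\<dots> \<in> G"
    by (intro cvec.subspace_add[OF G(1)] cvec.subspace_scale[OF G(1)] IH eG fG Suc.prems)
  finally show ?case .
qed

definition hwvec :: "nat \<Rightarrow> cvec \<Rightarrow> bool" where
  "hwvec m x \<longleftrightarrow> e x = 0 \<and> h x = scl (of_nat m) x"

lemma hpoly_eigen: "h x = scl (of_nat m) x \<Longrightarrow> hpoly n x = scl (\<Prod>j<n. of_nat m - of_nat j) x"
proof (induction n)
  case (Suc n)
  have "hpoly (Suc n) x = scl (\<Prod>j<n. of_nat m - of_nat j) (h x) - scl (of_nat n) (scl (\<Prod>j<n. of_nat m - of_nat j) x)"
    using Suc by (simp add: sl)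
  then show ?case by (simp only: Suc.prems prod.lessThan_Suc, intro poly_mapping_eqI) (simp add: lookup_minus algebra_simps)
qed simp

text \<open>The falling factorial has simple roots, all of them natural numbers, so a vector in its
  kernel is a sum of weight vectors. The component of weight n is \<open>hpoly n v\<close> divided
  by n!, which is the scalar \<open>r\<close>.\<close>

lemma hpoly_kernel:
  assumes G: "cvec.subspace G" "\<And>m x. x \<in> S \<Longrightarrow> hwvec m x \<Longrightarrow> x \<in> G"
    and S: "cvec.subspace S" "\<And>x. x \<in> S \<Longrightarrow> h x \<in> S"
  shows "v \<in> S \<Longrightarrow> e v = 0 \<Longrightarrow> hpoly n v = 0 \<Longrightarrow> v \<in> G"
proof (induction n arbitrary: v)
  case 0
  then show ?case using cvec.subspace_0[OF G(1)] by simp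
next
  case (Suc n)
  define z where "z = hpoly n v"
  have hS: "hpoly m v \<in> S" and eh: "e (hpoly m v) = 0" for m
  proof (induction m)
    case (Suc m)
    { case 1 show ?case using Suc.IH(1) S cvec.subspace_diff cvec.subspace_scale by auto }
    { case 2
      have "e (h (hpoly m v)) = h (e (hpoly m v)) - scl 2 (e (hpoly m v))" by (simp add: he)
      then show ?case using Suc.IH(2) by (simp add: sl) }
  qed (use Suc.prems in auto)
  have hz: "h z = scl (of_nat n) z" using Suc.prems(3) by (simp add: z_def)
  have zG: "z \<in> G" using G(2)[of z n] hS[of n] eh[of n] hz by (simp add: z_def hwvec_def)
  define r where "r = (\<Prod>j<n. of_nat n - of_nat j :: complex)"
  have r0: "r \<noteq> 0" by (auto simp: r_def)
  define v' where "v' = v - scl (1 / r) z"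
  have zr: "hpoly n z = scl r z" unfolding r_def by (rule hpoly_eigen[OF hz])
  have "hpoly n v' = z - scl (1 / r) (hpoly n z)" by (simp add: v'_def lin_simps[OF lin_hpoly] z_def)
  also have "\<dots> = 0" using r0 by (simp add: zr)
  finally have "v' \<in> G"
    using Suc.prems(1,2) hS[of n] eh[of n] S by (intro Suc.IH) (auto simp: v'_def z_def sl cvec.subspace_diff cvec.subspace_scale)
  then have "v' + scl (1 / r) z \<in> G" using zG G(1) cvec.subspace_add cvec.subspace_scale by blast
  then show ?case by (simp add: v'_def)
qed

definition wvecs :: "cvec set \<Rightarrow> complex \<Rightarrow> cvec set" where
  "wvecs S l = {(f ^^ i) u | i u m. u \<in> S \<and> hwvec m u \<and> l = of_nat m - 2 * of_nat i}"

text \<open>By finite dimensional highest weight theory this is the sum of the simple submodules.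
  The generators are sorted by weight because the argument needs decompositions into weight vectors
  before h is known to be diagonalisable.\<close>

definition socle :: "cvec set \<Rightarrow> cvec set" where
  "socle S = cvec.span (\<Union>l. wvecs S l)"

lemma wvecs_h: "x \<in> wvecs S l \<Longrightarrow> h x = scl l x"
  using h_f_pow by (auto simp: wvecs_def hwvec_def)

lemma socle_decomp:
  assumes "x \<in> socle S"
  obtains J g where "finite J" "\<And>l. g l \<in> cvec.span (wvecs S l)" "x = (\<Sum>l\<in>J. g l)"
proof -
  have "\<exists>J g. finite J \<and> (\<forall>l. g l \<in> cvec.span (wvecs S l)) \<and> x = (\<Sum>l\<in>J. g l)"
    using assms unfolding socle_def
  proof (induction rule: cvec.span_induct_alt)
    case base
    show ?case by (intro exI[of _ "{}"] exI[of _ "\<lambda>_. 0"]) (simp add: cvec.span_zero)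
  next
    case (step c v y)
    then obtain l J g where v: "v \<in> wvecs S l" and J: "finite J" "\<forall>l. g l \<in> cvec.span (wvecs S l)" "y = (\<Sum>l\<in>J. g l)" by blast
    let ?g = "\<lambda>k. (if k \<in> J then g k else 0) + (if k = l then scl c v else 0)"
    have "(\<Sum>k\<in>insert l J. ?g k) = (\<Sum>k\<in>insert l J. if k \<in> J then g k else 0) + (\<Sum>k\<in>insert l J. if k = l then scl c v else 0)"
      by (rule sum.distrib)
    also have "(\<Sum>k\<in>insert l J. if k \<in> J then g k else 0) = y"
      unfolding J(3) by (rule sum.mono_neutral_cong_right) (use J(1) in auto)
    also have "(\<Sum>k\<in>insert l J. if k = l then scl c v else 0) = scl c v" using J(1) by (simp add: sum.delta)
    finally have "scl c v + y = (\<Sum>k\<in>insert l J. ?g k)" by (simp add: add.commute)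
    moreover have "\<forall>k. ?g k \<in> cvec.span (wvecs S k)"
      using J(2) v by (auto intro!: cvec.span_add cvec.span_scale cvec.span_zero intro: cvec.span_base)
    ultimately show ?case using J(1) by - (rule exI[of _ "insert l J"], rule exI[of _ ?g], auto)
  qed
  then show ?thesis using that by blast
qed

lemma span_wvecs_h: "x \<in> cvec.span (wvecs S l) \<Longrightarrow> h x = scl l x"
proof (induction rule: cvec.span_induct_alt)
  case (step c v y)
  then show ?case by (simp add: sl wvecs_h cvec.scale_right_distrib mult.commute)
qed (simp add: sl)

lemma span_wvecs_socle: "cvec.span (wvecs S l) \<subseteq> socle S"
  unfolding socle_def by (intro cvec.span_mono) auto

text \<open>For \<open>v\<close> equal to \<open>f\<^sup>i u\<close> the factor in
  \<open>e f v\<close> is \<open>(i + 1) (m - i)\<close>. Since \<open>m - 2 i = j + 2\<close>, this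
  equals \<open>(i + 1) (j + 2 + i)\<close>, which is positive.\<close>

lemma socle_e_surj:
  assumes "y \<in> cvec.span (wvecs S (of_nat j + 2))"
  shows "\<exists>w\<in>cvec.span (wvecs S (of_nat j)). e w = y"
  using assms
proof (induction rule: cvec.span_induct_alt)
  case base
  show ?case by (intro bexI[of _ 0]) (simp_all add: sl cvec.span_zero)
next
  case (step c v y)
  obtain i u m where v: "v = (f ^^ i) u" "u \<in> S" "hwvec m u" "of_nat j + 2 = (of_nat m - 2 * of_nat i :: complex)"
    using step.hyps by (auto simp: wvecs_def)
  let ?w = "(f ^^ Suc i) u"
  have mi: "of_nat m - of_nat i = (of_nat (j + 2 + i) :: complex)" using v(4) by (simp add: algebra_simps)
  have "e ?w = scl (of_nat (Suc i) * of_nat (j + 2 + i)) v"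
    using e_f_pow[of u "of_nat m" i] v(1,3) mi by (simp add: hwvec_def del: of_nat_Suc of_nat_add funpow.simps)
  moreover have "(of_nat (Suc i) * of_nat (j + 2 + i) :: complex) \<noteq> 0" by (simp del: of_nat_Suc of_nat_add)
  ultimately have ew: "e (scl (c / (of_nat (Suc i) * of_nat (j + 2 + i))) ?w) = scl c v"
    by (simp only: sl) (simp del: of_nat_Suc of_nat_add)
  have "of_nat j = (of_nat m - 2 * of_nat (Suc i) :: complex)" using v(4) by (simp add: algebra_simps)
  then have "?w \<in> wvecs S (of_nat j)" unfolding wvecs_def using v by blast
  then have "scl (c / (of_nat (Suc i) * of_nat (j + 2 + i))) ?w \<in> cvec.span (wvecs S (of_nat j))"
    by (intro cvec.span_scale cvec.span_base)
  moreover obtain w where "w \<in> cvec.span (wvecs S (of_nat j))" "e w = y" using step.IH by blast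
  ultimately show ?case using ew
    by (intro bexI[of _ "scl (c / (of_nat (Suc i) * of_nat (j + 2 + i))) ?w + w"]) (simp_all only: sl cvec.span_add)
qed

lemma socle_closed:
  assumes "x \<in> socle S"
  shows "e x \<in> socle S" "f x \<in> socle S" "h x \<in> socle S"
proof -
  have st: "g x \<in> socle S" if "lin g" "\<And>l v. v \<in> wvecs S l \<Longrightarrow> g v \<in> socle S" for g
    using assms unfolding socle_def
  proof (induction rule: cvec.span_induct_alt)
    case base
    then show ?case using lin_0[OF that(1)] by (simp add: cvec.span_zero)
  next
    case (step c v y)
    then show ?case using that(2) by (auto simp: lin_simps[OF that(1)] socle_def intro!: cvec.span_add cvec.span_scale)
  qed
  have base: "(f ^^ i) u \<in> socle S" if "u \<in> S" "hwvec m u" for i u m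
    unfolding socle_def using that by (intro cvec.span_base) (auto simp: wvecs_def)
  have ss: "cvec.subspace (socle S)" by (simp add: socle_def)
  show "f x \<in> socle S"
  proof (rule st[OF lin_f])
    fix l v assume "v \<in> wvecs S l"
    then obtain i u m where "v = (f ^^ i) u" "u \<in> S" "hwvec m u" by (auto simp: wvecs_def)
    then show "f v \<in> socle S" using base[of u m "Suc i"] by simp
  qed
  show "h x \<in> socle S"
  proof (rule st[OF lin_h])
    fix l v assume v: "v \<in> wvecs S l"
    then have "v \<in> socle S" unfolding socle_def by (intro cvec.span_base) auto
    then show "h v \<in> socle S" using wvecs_h[OF v] cvec.subspace_scale[OF ss] by simp
  qed
  show "e x \<in> socle S"
  proof (rule st[OF lin_e])
    fix l v assume "v \<in> wvecs S l"
    then obtain i u m where v: "v = (f ^^ i) u" "u \<in> S" "hwvec m u" by (auto simp: wvecs_def)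
    show "e v \<in> socle S"
    proof (cases i)
      case 0
      then show ?thesis using v cvec.subspace_0[OF ss] by (simp add: hwvec_def)
    next
      case (Suc i')
      then show ?thesis using v base[of u m i'] cvec.subspace_scale[OF ss] e_f_pow[of u "of_nat m" i']
        by (simp add: hwvec_def del: funpow.simps)
    qed
  qed
qed

text \<open>The kernel of e lies in the socle, because nilpotency of e and f makes a falling
  factorial of h vanish there. A vector outside the socle is corrected until it is killed by e: it
  is made an eigenvector of h modulo the socle with natural eigenvalue, its image under e is shown
  to have a pure weight, and that image is matched by an element of the socle.\<close>

lemma socle_eq:
  assumes S: "cvec.subspace S" "\<And>x. x \<in> S \<Longrightarrow> e x \<in> S" "\<And>x. x \<in> S \<Longrightarrow> f x \<in> S" "\<And>x. x \<in> S \<Longrightarrow> h x \<in> S"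
    and en: "\<And>x. (e ^^ N) x = 0" and fn: "\<And>x. (f ^^ N) x = 0"
  shows "socle S = S"
proof
  let ?G = "socle S"
  have fS: "(f ^^ i) u \<in> S" if "u \<in> S" for i u by (induction i) (use that S in auto)
  then show "?G \<subseteq> S" unfolding socle_def using S(1) by (intro cvec.span_minimal) (auto simp: wvecs_def)
  then have GS: "x \<in> S" if "x \<in> ?G" for x using that by blast
  have G: "cvec.subspace ?G" by (simp add: socle_def)
  note gs = cvec.subspace_add[OF G] cvec.subspace_diff[OF G] cvec.subspace_scale[OF G] cvec.subspace_sum[OF G]
  note ss = cvec.subspace_add[OF S(1)] cvec.subspace_diff[OF S(1)] cvec.subspace_scale[OF S(1)] cvec.subspace_sum[OF S(1)]
  have hwG: "x \<in> ?G" if "x \<in> S" "hwvec m x" for m x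
  proof -
    have "(f ^^ 0) x \<in> wvecs S (of_nat m - 2 * of_nat 0)" unfolding wvecs_def using that by blast
    then show ?thesis unfolding socle_def by (intro cvec.span_base) auto
  qed
  have ker: "v \<in> ?G" if "v \<in> S" "e v = 0" for v
  proof (rule hpoly_kernel[OF G hwG S(1,4) that])
    have "(e ^^ N) ((f ^^ N) v) - scl (fact N) (hpoly N v) \<in> {0}"
      by (rule e_f_pow_mod) (auto simp: that sl)
    then show "hpoly N v = 0" by (simp add: fn en)
  qed
  show "S \<subseteq> ?G"
  proof (rule ccontr)
    assume "\<not> S \<subseteq> ?G"
    then obtain x where x: "x \<in> S" "x \<notin> ?G" by blast
    define n where "n = (LEAST n. (e ^^ n) x \<in> ?G)"
    have n: "(e ^^ n) x \<in> ?G" unfolding n_def by (rule LeastI[of _ N]) (simp add: en cvec.subspace_0[OF G])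
    then obtain n' where n': "n = Suc n'" using x(2) by (cases n) auto
    define y where "y = (e ^^ n') x"
    have eS: "(e ^^ m) x \<in> S" for m by (induction m) (use x S in auto)
    have y: "y \<in> S" "y \<notin> ?G" "e y \<in> ?G"
      using eS not_less_Least[of n' "\<lambda>n. (e ^^ n) x \<in> ?G"] n n' by (auto simp: y_def n_def)
    have hyS: "hpoly m y \<in> S" and ehy: "e (hpoly m y) \<in> ?G" for m
    proof (induction m)
      case (Suc m)
      { case 1 show ?case using Suc.IH(1) S(4) ss by simp }
      { case 2
        have "e (hpoly (Suc m) y) = h (e (hpoly m y)) - scl (of_nat m + 2) (e (hpoly m y))"
          by (rule poly_mapping_eqI) (simp add: sl he lookup_minus lookup_add algebra_simps)
        then show ?case using Suc.IH(2) socle_closed(3) gs by simp }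
    qed (use y in auto)
    have "scl (fact N) (hpoly N y) \<in> ?G"
    proof -
      have "(e ^^ N) ((f ^^ N) y) - scl (fact N) (hpoly N y) \<in> ?G"
        by (rule e_f_pow_mod[OF G socle_closed y(3)])
      then show ?thesis using cvec.subspace_neg[OF G] en[of "(f ^^ N) y"] by fastforce
    qed
    then have "scl (1 / fact N) (scl (fact N) (hpoly N y)) \<in> ?G" by (rule gs(3))
    then have "hpoly N y \<in> ?G" by simp
    \<comment> \<open>The last falling factorial outside the socle is an eigenvector of h modulo the
      socle, and its eigenvalue \<open>m - 1\<close> is natural, as \<open>socle_e_surj\<close>
      requires.\<close>
    define m where "m = (LEAST m. hpoly m y \<in> ?G)"
    have m: "hpoly m y \<in> ?G" unfolding m_def by (rule LeastI) fact
    then obtain j where j: "m = Suc j" using y(2) by (cases m) auto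
    define z where "z = hpoly j y"
    have z: "z \<in> S" "z \<notin> ?G" "e z \<in> ?G" "h z - scl (of_nat j) z \<in> ?G"
      using hyS ehy not_less_Least[of j "\<lambda>m. hpoly m y \<in> ?G"] m j by (auto simp: z_def m_def)
    obtain J g where g: "finite J" "\<And>l. g l \<in> cvec.span (wvecs S l)" "h z - scl (of_nat j) z = (\<Sum>l\<in>J. g l)"
      using socle_decomp[OF z(4)] by blast
    have gG: "g l \<in> ?G" for l using g(2) span_wvecs_socle by blast
    have hg: "h (g l) = scl l (g l)" for l by (rule span_wvecs_h[OF g(2)])
    define J' where "J' = J - {of_nat j}"
    \<comment> \<open>\<open>h - j\<close> is inverted on all components of weight different from j.
      After subtracting \<open>q\<close>, the defect \<open>gj\<close> has weight j.\<close>
    define q where "q = (\<Sum>l\<in>J'. scl (1 / (l - of_nat j)) (g l))"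
    define x' where "x' = z - q"
    have qG: "q \<in> ?G" unfolding q_def by (intro gs gG)
    have x': "x' \<in> S" "x' \<notin> ?G" "e x' \<in> ?G"
      using z qG gs(1)[of x' q] GS[OF qG] ss socle_closed(1)[OF qG] gs by (auto simp: x'_def sl)
    define gj where "gj = (if of_nat j \<in> J then g (of_nat j) else 0)"
    have hq: "h q - scl (of_nat j) q = (\<Sum>l\<in>J'. g l)"
    proof -
      have "h q - scl (of_nat j) q = (\<Sum>l\<in>J'. scl (1 / (l - of_nat j)) (scl l (g l)) - scl (of_nat j) (scl (1 / (l - of_nat j)) (g l)))"
        by (simp add: q_def sl hg cvec.scale_sum_right sum_subtractf)
      also have "\<dots> = (\<Sum>l\<in>J'. g l)"
      proof (rule sum.cong[OF refl])
        fix l assume "l \<in> J'"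
        then have "l - of_nat j \<noteq> 0" by (auto simp: J'_def)
        then have "l / (l - of_nat j) - of_nat j / (l - of_nat j) = 1" by (simp add: diff_divide_distrib[symmetric])
        then show "scl (1 / (l - of_nat j)) (scl l (g l)) - scl (of_nat j) (scl (1 / (l - of_nat j)) (g l)) = g l"
          by (simp add: cvec.scale_left_diff_distrib[symmetric])
      qed
      finally show ?thesis .
    qed
    have "h x' - scl (of_nat j) x' = (h z - scl (of_nat j) z) - (h q - scl (of_nat j) q)"
      by (simp add: x'_def sl cvec.scale_right_diff_distrib)
    also have "\<dots> = (\<Sum>l\<in>J. g l) - (\<Sum>l\<in>J'. g l)" unfolding g(3) hq ..
    also have "\<dots> = gj" unfolding J'_def gj_def using g(1) by (auto simp: sum_diff1)
    finally have hx': "h x' = scl (of_nat j) x' + gj" by (simp add: algebra_simps)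
    have hgj: "h gj = scl (of_nat j) gj" by (simp add: gj_def hg sl)
    obtain L y' where y': "finite L" "\<And>l. y' l \<in> cvec.span (wvecs S l)" "e x' = (\<Sum>l\<in>L. y' l)"
      using socle_decomp[OF x'(3)] by blast
    have hy': "h (y' l) = scl l (y' l)" for l by (rule span_wvecs_h[OF y'(2)])
    let ?l = "of_nat j + 2 :: complex"
    have hex: "h (e x') - scl ?l (e x') = e gj"
    proof -
      have "h (e x') - scl ?l (e x') = e (h x') - scl (of_nat j) (e x')"
        by (rule poly_mapping_eqI) (simp add: he lookup_add lookup_minus algebra_simps)
      then show ?thesis by (simp add: hx' sl)
    qed
    \<comment> \<open>The weight components of the identity
      \<open>h (e x') - (j + 2) e x' - e gj = 0\<close>; by independence each of them vanishes,
      which leaves in \<open>e x'\<close> only the weight j + 2.\<close>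
    define t where "t l = (if l = ?l then - e gj else 0) + (if l \<in> L then scl (l - ?l) (y' l) else 0)" for l
    have "(\<Sum>l\<in>insert ?l L. t l) = (\<Sum>l\<in>insert ?l L. if l = ?l then - e gj else 0) + (\<Sum>l\<in>insert ?l L. if l \<in> L then scl (l - ?l) (y' l) else 0)"
      unfolding t_def by (rule sum.distrib)
    also have "(\<Sum>l\<in>insert ?l L. if l = ?l then - e gj else 0) = - e gj" using y'(1) by (simp add: sum.delta)
    also have "(\<Sum>l\<in>insert ?l L. if l \<in> L then scl (l - ?l) (y' l) else 0) = (\<Sum>l\<in>L. scl (l - ?l) (y' l))"
      by (rule sum.mono_neutral_cong_right) (use y'(1) in auto)
    also have "(\<Sum>l\<in>L. scl (l - ?l) (y' l)) = h (e x') - scl ?l (e x')"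
      by (simp add: y'(3) sl hy' cvec.scale_left_diff_distrib sum_subtractf cvec.scale_sum_right)
    finally have t0: "(\<Sum>l\<in>insert ?l L. t l) = 0" by (simp add: hex)
    have heg: "h (e gj) = scl ?l (e gj)"
      by (simp add: he hgj sl) (rule poly_mapping_eqI, simp add: lookup_add algebra_simps)
    have ht: "h (t l) = scl l (t l)" for l
      by (simp add: t_def sl hy' heg cvec.scale_right_distrib mult.commute)
    have y0: "y' l = 0" if "l \<in> L" "l \<noteq> ?l" for l
    proof -
      have "t l = 0"
        by (rule cvec.eigen_indep[OF lin_h _ _ ht t0]) (use y'(1) that in auto)
      then show ?thesis using that by (simp add: t_def)
    qed
    have "e x' = (\<Sum>l\<in>L. if l = ?l then y' ?l else 0)"
      unfolding y'(3) by (intro sum.cong) (auto simp: y0)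
    then have "e x' = (if ?l \<in> L then y' ?l else 0)" using y'(1) by simp
    then have "e x' \<in> cvec.span (wvecs S ?l)" using y'(2) by (auto simp: cvec.span_zero)
    \<comment> \<open>Since e is onto from weight j to weight j + 2 within the socle, the remaining
      image under e can be cancelled.\<close>
    then obtain w where w: "w \<in> cvec.span (wvecs S (of_nat j))" "e w = e x'" using socle_e_surj by blast
    have wG: "w \<in> ?G" using w(1) span_wvecs_socle by blast
    have "x' - w \<in> ?G" by (rule ker) (use x' wG GS ss w in \<open>auto simp: sl\<close>)
    then have "x' - w + w \<in> ?G" using wG gs by blast
    then show False using x'(2) by simp
  qed
qed

end

text \<open>The basis vector \<open>w\<^sub>i\<close> of \<open>L m\<close> is
  \<open>f\<^sup>i w\<^sub>0 / i!\<close>, which dictates the images. The relation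
  \<open>nil\<close> is what compatibility with f at the last basis vector requires.\<close>

lemma L_hom:
  assumes F: "lie_module sl2 F" and u: "u \<in> space_on (idx F)" "act F sE u = 0" "act F sH u = scl (of_nat m) u"
    and nil: "(act F sF ^^ Suc m) u = 0"
  obtains \<phi> where "\<phi> \<in> module_homs sl2 (L m) F" "\<And>i. i \<le> m \<Longrightarrow> \<phi> (bas i) = scl (1 / fact i) ((act F sF ^^ i) u)"
proof -
  interpret F: sl2_ops "act F sE" "act F sF" "act F sH" by (rule sl2_ops_mod[OF F])
  define \<phi> where "\<phi> = lin_ext (\<lambda>i. if i \<le> m then scl (1 / fact i) ((act F sF ^^ i) u) else 0)"
  have lp: "lin \<phi>" by (simp add: \<phi>_def lin_lin_ext)
  note l\<phi> = lin_simps[OF lp]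
  have b: "\<phi> (bas i) = scl (1 / fact i) ((act F sF ^^ i) u)" if "i \<le> m" for i using that by (simp add: \<phi>_def)
  have fs: "(act F sF ^^ i) u \<in> space_on (idx F)" for i
    by (cases i) (simp_all add: u lie_module_space[OF F])
  have lm: "\<phi> \<in> lin_maps {..m} (idx F)"
    by (rule lin_mapsI[OF lp]) (simp_all add: \<phi>_def fs space_on_scl)
  have E: "\<phi> (Le m (bas i)) = act F sE (\<phi> (bas i))" and H: "\<phi> (Lh m (bas i)) = act F sH (\<phi> (bas i))"
    and Fc: "\<phi> (Lf m (bas i)) = act F sF (\<phi> (bas i))" if i: "i \<le> m" for i
  proof -
    have w: "bas i = wb m (int i)" using i by (simp add: wb_bas)
    have hh: "act F sH ((act F sF ^^ i) u) = scl (of_nat m - 2 * of_nat i) ((act F sF ^^ i) u)" by (rule F.h_f_pow[OF u(3)])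
    have "\<phi> (Lh m (bas i)) = scl (of_nat m - 2 * of_nat i) (\<phi> (bas i))"
      unfolding w L_wb l\<phi> by simp
    then show "\<phi> (Lh m (bas i)) = act F sH (\<phi> (bas i))" by (simp add: b[OF i] F.sl hh mult.commute)
    show "\<phi> (Le m (bas i)) = act F sE (\<phi> (bas i))"
    proof (cases i)
      case 0
      have "\<phi> (Le m (bas 0)) = 0" using L_wb(1)[of m 0] by (simp add: wb_def l\<phi>)
      then show ?thesis using 0 by (simp add: b u F.sl)
    next
      case (Suc l)
      have lm: "l \<le> m" using i Suc by simp
      have "Le m (bas i) = scl (of_nat m - of_nat l) (bas l)"
        unfolding w L_wb using Suc lm by (simp add: wb_def)
      then have "\<phi> (Le m (bas i)) = scl ((of_nat m - of_nat l) / fact l) ((act F sF ^^ l) u)" by (simp add: l\<phi> b[OF lm])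
      moreover have "act F sE (\<phi> (bas i)) = scl (1 / fact i * (of_nat (Suc l) * (of_nat m - of_nat l))) ((act F sF ^^ l) u)"
        unfolding b[OF i] F.sl unfolding Suc F.e_f_pow[OF u(2,3)] by simp
      moreover have "1 / fact i * (of_nat (Suc l) * (of_nat m - of_nat l)) = ((of_nat m - of_nat l) / fact l :: complex)"
        unfolding Suc fact_Suc by (simp del: of_nat_Suc)
      ultimately show ?thesis by simp
    qed
    show "\<phi> (Lf m (bas i)) = act F sF (\<phi> (bas i))"
    proof (cases "i = m")
      case True
      have "Lf m (bas i) = 0" unfolding w L_wb by (simp add: wb_def True)
      then show ?thesis using nil True by (simp add: l\<phi> b F.sl)
    next
      case False
      then have lm: "Suc i \<le> m" using i by simp
      have n: "nat (int i + 1) = Suc i" by simp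
      have "Lf m (bas i) = scl (of_nat (Suc i)) (bas (Suc i))"
        unfolding w L_wb using lm by (simp add: wb_def n)
      then have "\<phi> (Lf m (bas i)) = scl (of_nat (Suc i) * (1 / fact (Suc i))) ((act F sF ^^ Suc i) u)"
        by (simp only: l\<phi> b[OF lm]) simp
      moreover have "of_nat (Suc i) * (1 / fact (Suc i)) = (1 / fact i :: complex)"
        unfolding fact_Suc by (simp del: of_nat_Suc)
      ultimately show ?thesis by (simp add: b[OF i] F.sl)
    qed
  qed
  have "\<phi> \<in> module_homs sl2 (L m) F"
  proof (rule module_homsI)
    show "\<phi> \<in> lin_maps (idx (L m)) (idx F)" using lm by simp
    fix x v assume x: "x \<in> lcarrier sl2"
    have "\<phi> \<circ> act (L m) x = act F x \<circ> \<phi>"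
    proof (rule lin_maps_eqI[OF lin_maps_comp[OF L_lin_maps lm] lin_maps_comp[OF lm lie_module_lin_maps[OF F x]]])
      fix i assume "i \<in> {..m}"
      then have i: "i \<le> m" by simp
      show "(\<phi> \<circ> act (L m) x) (bas i) = (act F x \<circ> \<phi>) (bas i)"
        unfolding comp_apply sl2_act_decomp[OF lie_module_L x] sl2_act_decomp[OF F x]
        by (simp add: l\<phi> E[OF i] H[OF i] Fc[OF i])
    qed
    from fun_cong[OF this, of v] show "\<phi> (act (L m) x v) = act F x (\<phi> v)" by simp
  qed
  then show ?thesis using that b by blast
qed

section \<open>Decomposition into the modules \<open>L m\<close>\<close>

lemma sl2_nilpotent:
  assumes F: "lie_module sl2 F" "finite (idx F)"
  obtains N where "\<And>x. (act F sE ^^ N) x = 0" "\<And>x. (act F sF ^^ N) x = 0"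
proof -
  interpret F: sl2_ops "act F sE" "act F sF" "act F sH" by (rule sl2_ops_mod[OF F(1)])
  obtain N where N: "\<And>x. (act F sE ^^ N) x = 0"
    using nilpotent_of_ad[OF F(2) lie_module_lin_maps[OF F(1) s_carrier(1)] F.lin_h, of 2] F.he by auto
  obtain M where M: "\<And>x. (act F sF ^^ M) x = 0"
    using nilpotent_of_ad[OF F(2) lie_module_lin_maps[OF F(1) s_carrier(2)] F.lin_h, of "-2"] F.hf by auto
  have "(act F sE ^^ (N + M)) x = 0" for x by (simp add: funpow_add N)
  moreover have "(act F sF ^^ (N + M)) x = 0" for x by (simp add: funpow_add M lin_0[OF lin_funpow[OF F.lin_f]])
  ultimately show ?thesis using that by blast
qed

text \<open>Applying e to the first vanishing power, with exponent l + 1, gives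
  \<open>(l + 1) (m - l) = 0\<close>, so \<open>l = m\<close>.\<close>

lemma hw_nil_fd:
  assumes F: "lie_module sl2 F" "finite (idx F)" and u: "act F sE u = 0" "act F sH u = scl (of_nat m) u"
  shows "(act F sF ^^ Suc m) u = 0"
proof (cases "u = 0")
  case True
  interpret F: sl2_ops "act F sE" "act F sF" "act F sH" by (rule sl2_ops_mod[OF F(1)])
  show ?thesis unfolding True by (rule lin_0[OF lin_funpow[OF F.lin_f]])
next
  case False
  interpret F: sl2_ops "act F sE" "act F sF" "act F sH" by (rule sl2_ops_mod[OF F(1)])
  obtain N where N: "(act F sF ^^ N) u = 0" using sl2_nilpotent[OF F] by metis
  define K where "K = (LEAST K. (act F sF ^^ K) u = 0)"
  have K: "(act F sF ^^ K) u = 0" unfolding K_def by (rule LeastI) (rule N)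
  then obtain l where l: "K = Suc l" using False by (cases K) auto
  have nz: "(act F sF ^^ l) u \<noteq> 0" using not_less_Least[of l "\<lambda>K. (act F sF ^^ K) u = 0"] l by (simp add: K_def)
  have "scl (of_nat (Suc l) * (of_nat m - of_nat l)) ((act F sF ^^ l) u) = 0"
    using F.e_f_pow[OF u, of l] K l by (simp only: F.sl)
  then have "of_nat m = (of_nat l :: complex)" using nz by (simp del: of_nat_Suc)
  then have "m = l" by (simp only: of_nat_eq_iff)
  then show ?thesis using K l by simp
qed

text \<open>Finitely many generators of the socle span the module, each lies in the image of some
  \<open>L m\<close>, and a sum of simple modules is a direct sum of some of them.\<close>

theorem sl2_complete_reducibility:
  assumes F: "lie_module sl2 F" "finite (idx F)"
  obtains ms i p where "dsum sl2 (map L ms) F i p"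
proof -
  interpret F: sl2_ops "act F sE" "act F sF" "act F sH" by (rule sl2_ops_mod[OF F(1)])
  let ?S = "space_on (idx F)"
  obtain N where N: "\<And>x. (act F sE ^^ N) x = 0" "\<And>x. (act F sF ^^ N) x = 0" using sl2_nilpotent[OF F] by blast
  have soc: "F.socle ?S = ?S"
    by (rule F.socle_eq[OF subspace_space_on _ _ _ N]) (simp_all add: lie_module_space[OF F(1)])
  let ?X = "\<Union>l. F.wvecs ?S l"
  have "\<exists>t. finite t \<and> t \<subseteq> ?X \<and> bas k \<in> cvec.span t" if "k \<in> idx F" for k
  proof -
    have "bas k \<in> cvec.span ?X" using that soc by (simp add: F.socle_def)
    then obtain t r where t: "bas k = (\<Sum>a\<in>t. scl (r a) a)" "finite t" "t \<subseteq> ?X" unfolding cvec.span_explicit by blast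
    have "bas k \<in> cvec.span t" unfolding t(1) by (intro cvec.span_sum cvec.span_scale cvec.span_base)
    then show ?thesis using t(2,3) by blast
  qed
  then have "\<exists>t. \<forall>k\<in>idx F. finite (t k) \<and> t k \<subseteq> ?X \<and> bas k \<in> cvec.span (t k)" by (intro bchoice) blast
  then obtain t where t: "\<And>k. k \<in> idx F \<Longrightarrow> finite (t k) \<and> t k \<subseteq> ?X \<and> bas k \<in> cvec.span (t k)" by blast
  define X0 where "X0 = (\<Union>k\<in>idx F. t k)"
  have X0: "finite X0" "X0 \<subseteq> ?X" using t F(2) by (auto simp: X0_def)
  have "bas ` idx F \<subseteq> cvec.span X0"
  proof
    fix v assume "v \<in> bas ` idx F"
    then obtain k where k: "k \<in> idx F" "v = bas k" by blast
    then have "cvec.span (t k) \<subseteq> cvec.span X0" by (intro cvec.span_mono) (auto simp: X0_def)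
    then show "v \<in> cvec.span X0" using t[OF k(1)] k(2) by blast
  qed
  then have spX: "?S \<subseteq> cvec.span X0"
    unfolding space_on_eq_span by (rule cvec.span_minimal) (rule cvec.subspace_span)
  obtain xs where xs: "set xs = X0" using finite_list[OF X0(1)] by blast
  have "\<exists>m \<phi>. \<phi> \<in> module_homs sl2 (L m) F \<and> x \<in> \<phi> ` space_on {..m}" if x: "x \<in> X0" for x
  proof -
    obtain i u m where u: "x = (act F sF ^^ i) u" "u \<in> ?S" "F.hwvec m u" using X0(2) x by (auto simp: F.wvecs_def)
    have hu: "act F sE u = 0" "act F sH u = scl (of_nat m) u" using u(3) by (auto simp: F.hwvec_def)
    note nil = hw_nil_fd[OF F hu]
    obtain \<phi> where \<phi>: "\<phi> \<in> module_homs sl2 (L m) F" "\<And>i. i \<le> m \<Longrightarrow> \<phi> (bas i) = scl (1 / fact i) ((act F sF ^^ i) u)"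
      using L_hom[OF F(1) u(2) hu nil] by blast
    have "x \<in> \<phi> ` space_on {..m}"
    proof (cases "i \<le> m")
      case True
      then have "x = \<phi> (scl (fact i) (bas i))" by (simp add: u(1) \<phi>(2) lin_simps[OF module_homs_lin[OF \<phi>(1)]])
      then show ?thesis using True by (intro image_eqI[of _ _ "scl (fact i) (bas i)"]) (auto intro: space_on_scl)
    next
      case False
      then obtain j where "i = j + Suc m" using that[of "i - Suc m"] by simp
      then have "x = 0" by (simp only: u(1) funpow_add comp_apply nil lin_0[OF lin_funpow[OF F.lin_f]])
      then show ?thesis using lin_0[OF module_homs_lin[OF \<phi>(1)]] by (intro image_eqI[of _ _ 0]) (auto simp: space_on_0)
    qed
    then show ?thesis using \<phi>(1) by blast
  qed
  then have "\<exists>m. \<forall>x\<in>X0. \<exists>\<phi>. \<phi> \<in> module_homs sl2 (L (m x)) F \<and> x \<in> \<phi> ` space_on {..m x}" by (intro bchoice) blast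
  then obtain m where "\<forall>x\<in>X0. \<exists>\<phi>. \<phi> \<in> module_homs sl2 (L (m x)) F \<and> x \<in> \<phi> ` space_on {..m x}" by blast
  then have "\<exists>\<phi>. \<forall>x\<in>X0. \<phi> x \<in> module_homs sl2 (L (m x)) F \<and> x \<in> \<phi> x ` space_on {..m x}" by (rule bchoice)
  then obtain \<phi> where m\<phi>: "\<And>x. x \<in> X0 \<Longrightarrow> \<phi> x \<in> module_homs sl2 (L (m x)) F \<and> x \<in> \<phi> x ` space_on {..m x}" by blast
  let ?n = "length xs"
  let ?V = "\<lambda>k. L (m (xs ! k))" and ?\<phi> = "\<lambda>k. \<phi> (xs ! k)"
  have hom: "?\<phi> k \<in> module_homs sl2 (?V k) F" if "k < ?n" for k using m\<phi> that xs nth_mem by blast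
  have sub: "submodule sl2 F (sum_image ?V ?\<phi> {..<?n})"
    by (rule submodule_sum_image[OF F(1) lie_module_L]) (use hom in auto)
  have "X0 \<subseteq> sum_image ?V ?\<phi> {..<?n}"
  proof
    fix x assume x: "x \<in> X0"
    then obtain k where k: "k < ?n" "x = xs ! k" using xs by (metis in_set_conv_nth)
    obtain v where v: "v \<in> space_on {..m x}" "x = \<phi> x v" using m\<phi>[OF x] by blast
    let ?x = "\<lambda>l. if l = k then v else 0"
    have "(\<Sum>l<?n. ?\<phi> l (?x l)) = (\<Sum>l<?n. if l = k then x else 0)"
      by (intro sum.cong) (use k v lin_0[OF module_homs_lin[OF hom]] in auto)
    then have "x = (\<Sum>l<?n. ?\<phi> l (?x l))" using k by simp
    then show "x \<in> sum_image ?V ?\<phi> {..<?n}"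
      unfolding sum_image_def using k v by (intro CollectI exI[of _ ?x]) (auto simp: space_on_0)
  qed
  then have "cvec.span X0 \<subseteq> sum_image ?V ?\<phi> {..<?n}"
    using sub by (intro cvec.span_minimal) (auto simp: submodule_def)
  then have im: "?S \<subseteq> sum_image ?V ?\<phi> {..<?n}" using spX by blast
  obtain js i p where d: "dsum sl2 (map ?V js) F i p"
    using dsum_of_sum_of_simples[of sl2 F ?n ?V ?\<phi>, OF F(1) simple_L hom im] by blast
  have "map ?V js = map L (map (\<lambda>k. m (xs ! k)) js)" by simp
  then show ?thesis using that[of "map (\<lambda>k. m (xs ! k)) js" i p] d by (simp only:)
qed

text \<open>The tensor product of the highest weight vectors has weight n + 1 and defines a map from
  \<open>L (Suc n)\<close>. Some projection of a decomposition is non-zero on that vector; between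
  simple modules the composite is invertible.\<close>

lemma L_retract:
  obtains i p where "i \<in> module_homs sl2 (L (Suc n)) (tens_module (L 1) (L n))"
    "p \<in> module_homs sl2 (tens_module (L 1) (L n)) (L (Suc n))" "p \<circ> i = id_on (idx (L (Suc n)))"
proof -
  let ?T = "tens_module (L 1) (L n)"
  have T: "lie_module sl2 ?T" "finite (idx ?T)" by (simp_all add: lie_module_tens lie_module_L)
  let ?t = "tens (bas 0) (bas 0)"
  have b: "bas 0 \<in> space_on (idx (L k))" for k by simp
  have at: "act ?T x ?t = tens (act (L 1) x (bas 0)) (bas 0) + tens (bas 0) (act (L n) x (bas 0))" for x
    by (rule act_tens[OF lin_act_L lin_act_L b b])
  have w0: "bas 0 = wb k 0" for k by (simp add: wb_def)
  have e0: "Le k (bas 0) = 0" "Lh k (bas 0) = scl (of_nat k) (bas 0)" for k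
    using L_wb(1)[of k 0] L_wb(3)[of k 0] by (simp_all add: wb_def)
  have te: "act ?T sE ?t = 0" by (simp only: at e0 tens_simps) simp
  have th: "act ?T sH ?t = scl (of_nat (Suc n)) ?t"
    by (simp only: at e0 tens_simps) (simp add: cvec.scale_left_distrib)
  have ts: "?t \<in> space_on (idx ?T)" unfolding idx_tens by (rule tens_space[OF b b])
  have "\<exists>\<phi>. \<phi> \<in> module_homs sl2 (L (Suc n)) ?T \<and> \<phi> (bas 0) = ?t"
  proof (rule L_hom[OF T(1) ts te th hw_nil_fd[OF T te th]])
    fix \<phi> assume "\<phi> \<in> module_homs sl2 (L (Suc n)) ?T"
      "\<And>i. i \<le> Suc n \<Longrightarrow> \<phi> (bas i) = scl (1 / fact i) ((act ?T sF ^^ i) ?t)"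
    from this(1) this(2)[of 0] show ?thesis by (intro exI[of _ \<phi>]) (simp del: tens_bas)
  qed
  then obtain \<phi> where \<phi>: "\<phi> \<in> module_homs sl2 (L (Suc n)) ?T" "\<phi> (bas 0) = ?t" by blast
  obtain ms i p where d: "dsum sl2 (map L ms) ?T i p" using sl2_complete_reducibility[OF T] by blast
  have "\<exists>k<length ms. p k ?t \<noteq> 0"
  proof (rule ccontr)
    assume "\<not> ?thesis"
    then have "(\<Sum>k<length ms. i k (p k ?t)) = 0"
      using lin_0[OF module_homs_lin[OF dsum_homs(1)[OF d]]] by (intro sum.neutral) auto
    then have "?t = 0" using dsum_id[OF d, of ?t] ts by (simp add: id_on_id del: tens_bas)
    then show False by simp
  qed
  then obtain k where k: "k < length ms" "p k ?t \<noteq> 0" by blast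
  have pk: "p k \<in> module_homs sl2 ?T (L (ms ! k))" using dsum_homs(2)[OF d, of k] k(1) by simp
  have h: "p k \<circ> \<phi> \<in> module_homs sl2 (L (Suc n)) (L (ms ! k))" by (rule module_homs_comp[OF \<phi>(1) pk])
  have "(p k \<circ> \<phi>) (bas 0) \<noteq> 0" using k(2) \<phi>(2) by (simp del: tens_bas)
  then have "p k \<circ> \<phi> \<noteq> 0" by (intro notI) (simp only: zero_fun_apply, simp)
  then obtain g where g: "g \<in> module_homs sl2 (L (ms ! k)) (L (Suc n))" "g \<circ> (p k \<circ> \<phi>) = id_on (idx (L (Suc n)))"
    using simple_hom_inverse[OF simple_L simple_L h] by blast
  show ?thesis
    by (rule that[OF \<phi>(1) module_homs_comp[OF pk g(1)]]) (use g(2) in \<open>simp add: comp_assoc\<close>)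
qed

subsection \<open>Tensor products with \<open>L(1)\<close>\<close>

lemma dsum_of_distinct_simples:
  assumes T: "lie_module \<gg> T" and V: "\<And>X. X \<in> set Xs \<Longrightarrow> simple_module \<gg> X"
    and \<phi>: "\<And>k. k < length Xs \<Longrightarrow> \<phi> k \<in> module_homs \<gg> (Xs ! k) T" "\<And>k. k < length Xs \<Longrightarrow> \<phi> k \<noteq> 0"
    and di: "\<And>k l. k < length Xs \<Longrightarrow> l < length Xs \<Longrightarrow> k \<noteq> l \<Longrightarrow> module_homs \<gg> (Xs ! k) (Xs ! l) = {0}"
    and im: "space_on (idx T) \<subseteq> sum_image (\<lambda>k. Xs ! k) \<phi> {..<length Xs}"
  shows "\<exists>i p. dsum \<gg> Xs T i p"
proof -
  let ?n = "length Xs"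
  obtain js i p where js: "set js \<subseteq> {..<?n}" "sorted js" "distinct js" and d: "dsum \<gg> (map (\<lambda>k. Xs ! k) js) T i p"
    using dsum_of_sum_of_simples[OF T, of ?n "\<lambda>k. Xs ! k" \<phi>] V \<phi>(1) im nth_mem by blast
  have "k \<in> set js" if k: "k < ?n" for k
  proof (rule ccontr)
    assume nk: "k \<notin> set js"
    have z: "p l \<circ> \<phi> k = 0" if l: "l < length js" for l
    proof -
      have "js ! l \<in> set js" using l by simp
      then have jl: "js ! l < ?n" "k \<noteq> js ! l" using js(1) nk by auto
      have "p l \<in> module_homs \<gg> T (Xs ! (js ! l))" using dsum_homs(2)[OF d, of l] l by simp
      then have "p l \<circ> \<phi> k \<in> module_homs \<gg> (Xs ! k) (Xs ! (js ! l))" by (rule module_homs_comp[OF \<phi>(1)[OF k]])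
      then show ?thesis using di[OF k jl] by simp
    qed
    have "\<phi> k v = 0" for v
    proof -
      have "\<phi> k v = id_on (idx T) (\<phi> k v)" by (simp add: id_on_id module_homs_space[OF \<phi>(1)[OF k]])
      also have "\<dots> = (\<Sum>l<length js. i l (p l (\<phi> k v)))" using dsum_id[OF d] by simp
      also have "\<dots> = 0"
      proof (rule sum.neutral, rule ballI)
        fix l assume "l \<in> {..<length js}"
        then have l: "l < length js" by simp
        have "p l (\<phi> k v) = 0" using fun_cong[OF z[OF l], of v] by simp
        then show "i l (p l (\<phi> k v)) = 0" using lin_0[OF module_homs_lin[OF dsum_homs(1)[OF d, of l]]] l by simp
      qed
      finally show ?thesis .
    qed
    then show False using \<phi>(2)[OF k] by (auto simp: fun_eq_iff)
  qed
  then have "set js = set [0..<?n]" using js(1) by auto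
  then have "js = [0..<?n]" using js(2,3) by (intro sorted_distinct_set_unique) auto
  then have "dsum \<gg> (map (\<lambda>k. Xs ! k) [0..<?n]) T i p" using d by simp
  then show ?thesis by (auto simp: map_nth)
qed

abbreviation L1_tens :: "gelt lie_mod \<Rightarrow> gelt lie_mod" where
  "L1_tens M \<equiv> tens_module (pullback fst (L 1)) M"

text \<open>Elements of \<open>L(1) \<otimes> M\<close> are written as pairs of vectors of
  \<open>M\<close>, the coordinates with respect to the two basis vectors of L(1).\<close>

definition J :: "cvec \<Rightarrow> cvec \<Rightarrow> cvec" where
  "J x y = tens (bas 0) x + tens (bas 1) y"

lemma J_simps: "J x y + J x' y' = J (x + x') (y + y')" "J x y - J x' y' = J (x - x') (y - y')"
  "scl r (J x y) = J (scl r x) (scl r y)" "J 0 0 = 0"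
  by (simp_all add: J_def tens_simps cvec.scale_right_distrib algebra_simps del: tens_bas One_nat_def)

lemma J_eq_0:
  assumes "x \<in> space_on I" "y \<in> space_on I" "J x y = 0"
  shows "x = 0" "y = 0"
proof -
  \<comment> \<open>Tensor products and infinite direct sums encode pairs of indices alike, so the
    projections of a constant family, with a dummy action, read off the two coordinates.\<close>
  let ?N = "\<lambda>_::nat. \<lparr>idx = I, act = (\<lambda>(_::mat2) v. v)\<rparr>"
  have "sproj ?N 0 (J x y) = x" "sproj ?N 1 (J x y) = y"
    unfolding J_def lin_add[OF lin_sproj] sproj_tens using assms(1,2) by (simp_all add: id_on_id)
  then show "x = 0" "y = 0" unfolding assms(3) lin_0[OF lin_sproj] by simp_all
qed

lemma L1_act: "Le 1 (bas 0) = 0" "Le 1 (bas 1) = bas 0" "Lf 1 (bas 0) = bas 1" "Lf 1 (bas 1) = 0"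
  "Lh 1 (bas 0) = bas 0" "Lh 1 (bas 1) = - bas 1"
  using L_wb(1)[of 1 0] L_wb(1)[of 1 1] L_wb(2)[of 1 0] L_wb(2)[of 1 1] L_wb(3)[of 1 0] L_wb(3)[of 1 1]
  by (simp_all add: wb_def cvec.scale_minus_left)

lemma lie_module_L1_tens: "lie_module g_alg M \<Longrightarrow> lie_module g_alg (L1_tens M)"
  by (intro lie_module_tens lie_module_pullback_fst lie_module_L)

lemma J_space: "x \<in> space_on (idx M) \<Longrightarrow> y \<in> space_on (idx M) \<Longrightarrow> J x y \<in> space_on (idx (L1_tens M))"
  unfolding J_def idx_tens by (intro space_on_add tens_space) simp_all

lemma act_J:
  assumes M: "lie_module g_alg M" and g: "g \<in> lcarrier g_alg" and xy: "x \<in> space_on (idx M)" "y \<in> space_on (idx M)"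
  shows "act (L1_tens M) g (J x y) = tens (act (L 1) (fst g) (bas 0)) x + tens (act (L 1) (fst g) (bas 1)) y + J (act M g x) (act M g y)"
proof -
  have "act (L1_tens M) g (tens (bas i) z) = tens (act (L 1) (fst g) (bas i)) z + tens (bas i) (act M g z)"
    if "i \<le> 1" "z \<in> space_on (idx M)" for i z
    using act_tens[of "pullback fst (L 1)" g M "bas i" z] lie_module_lin[OF M g] that by (simp add: lin_act_L)
  then show ?thesis
    using xy by (simp add: J_def lin_add[OF lie_module_lin[OF lie_module_L1_tens[OF M] g]] del: One_nat_def)
qed

lemma ops_J:
  assumes M: "lie_module g_alg M" and xy: "x \<in> space_on (idx M)" "y \<in> space_on (idx M)"
  shows "opE (L1_tens M) (J x y) = J (opE M x + y) (opE M y)"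
    "opF (L1_tens M) (J x y) = J (opF M x) (x + opF M y)"
    "opH (L1_tens M) (J x y) = J (opH M x + x) (opH M y - y)"
    "j = 4 \<or> j = 2 \<or> j = 0 \<Longrightarrow> opv j (L1_tens M) (J x y) = J (opv j M x) (opv j M y)"
proof -
  have c: "(sE, 0) \<in> lcarrier g_alg" "(sF, 0) \<in> lcarrier g_alg" "(sH, 0) \<in> lcarrier g_alg" by (simp_all add: carrier_g_0)
  show "opE (L1_tens M) (J x y) = J (opE M x + y) (opE M y)"
    unfolding act_J[OF M c(1) xy] fst_conv L1_act by (simp add: J_def tens_simps del: One_nat_def tens_bas)
  show "opF (L1_tens M) (J x y) = J (opF M x) (x + opF M y)"
    unfolding act_J[OF M c(2) xy] fst_conv L1_act by (simp add: J_def tens_simps del: One_nat_def tens_bas)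
  show "opH (L1_tens M) (J x y) = J (opH M x + x) (opH M y - y)"
    unfolding act_J[OF M c(3) xy] fst_conv L1_act by (simp add: J_def tens_simps algebra_simps del: One_nat_def tens_bas)
  assume "j = 4 \<or> j = 2 \<or> j = 0"
  then have "(0, v4 j) \<in> lcarrier g_alg" by (auto simp: carrier_g_0 v4_bas)
  then show "opv j (L1_tens M) (J x y) = J (opv j M x) (opv j M y)"
    using act_J[OF M _ xy, of "(0, v4 j)"] by (simp add: act_L_zero tens_simps del: One_nat_def)
qed

lemma space_L1_tens:
  assumes "z \<in> space_on (idx (L1_tens M))"
  obtains x y where "x \<in> space_on (idx M)" "y \<in> space_on (idx M)" "z = J x y"
proof -
  have "z \<in> cvec.span (bas ` idx (L1_tens M))" using assms by (simp add: space_on_eq_span)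
  then have "\<exists>x\<in>space_on (idx M). \<exists>y\<in>space_on (idx M). z = J x y"
  proof (induction rule: cvec.span_induct_alt)
    case base
    show ?case by (intro bexI[of _ 0]) (simp_all add: J_simps space_on_0)
  next
    case (step r v w)
    obtain x y where xy: "x \<in> space_on (idx M)" "y \<in> space_on (idx M)" "w = J x y" using step.IH by blast
    obtain i k where "v = bas (prod_encode (i, k))" and i: "i \<in> {..1}" and k: "k \<in> idx M"
      using step.hyps unfolding idx_tens by auto
    then have v: "v = tens (bas i) (bas k)" by simp
    have "i = 0 \<or> i = 1" using i by auto
    then show ?case
    proof
      assume "i = 0"
      then have "scl r v + w = J (scl r (bas k) + x) y"
        unfolding v xy(3) J_def by (simp add: tens_simps add.assoc del: tens_bas One_nat_def)
      moreover have "scl r (bas k) + x \<in> space_on (idx M)" using xy k by (simp add: space_on_add space_on_scl)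
      ultimately show ?thesis using xy(2) by blast
    next
      assume "i = 1"
      then have "scl r v + w = J x (scl r (bas k) + y)"
        unfolding v xy(3) J_def by (simp add: tens_simps add_ac del: tens_bas One_nat_def)
      moreover have "scl r (bas k) + y \<in> space_on (idx M)" using xy k by (simp add: space_on_add space_on_scl)
      ultimately show ?thesis using xy(1) by blast
    qed
  qed
  then show ?thesis using that by blast
qed

lemma good_L1_tens:
  assumes g: "good \<mu> M" shows "good \<mu> (L1_tens M)"
proof -
  let ?T = "L1_tens M"
  have M: "lie_module g_alg M" by (rule good_lie_module[OF g])
  have T: "lie_module g_alg ?T" by (rule lie_module_L1_tens[OF M])
  have c: "(0, v4 4) \<in> lcarrier g_alg" "(0, v4 2) \<in> lcarrier g_alg" "(0, v4 0) \<in> lcarrier g_alg" by (auto simp: carrier_g_0 v4_bas)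
  note sp = lie_module_space[OF M c(1)] lie_module_space[OF M c(2)] lie_module_space[OF M c(3)]
  have rel: "scl 8 (opv 4 M (opv 0 M x)) = scl 3 (opv 2 M (opv 2 M x)) - scl (4 * \<mu>) (opv 4 M x)" for x using g by (simp add: good_def)
  have "scl 8 (opv 4 ?T (opv 0 ?T z)) = scl 3 (opv 2 ?T (opv 2 ?T z)) - scl (4 * \<mu>) (opv 4 ?T z)" for z
  proof -
    have idz: "act ?T k (id_on (idx ?T) z) = act ?T k z" if "k \<in> lcarrier g_alg" for k
      by (rule lin_maps_id_right[OF lie_module_lin_maps[OF T that]])
    obtain x y where xy: "x \<in> space_on (idx M)" "y \<in> space_on (idx M)" "id_on (idx ?T) z = J x y"
      using space_L1_tens[OF id_on_space[of "idx ?T" z]] by blast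
    have o: "opv 4 ?T z = J (opv 4 M x) (opv 4 M y)" "opv 2 ?T z = J (opv 2 M x) (opv 2 M y)" "opv 0 ?T z = J (opv 0 M x) (opv 0 M y)"
      using idz[OF c(1)] idz[OF c(2)] idz[OF c(3)] ops_J(4)[OF M xy(1,2)] by (simp_all only: xy(3) simp_thms)
    show ?thesis unfolding o by (simp add: ops_J(4)[OF M] sp J_simps rel del: One_nat_def)
  qed
  moreover have "z = 0" if z: "z \<in> space_on (idx ?T)" "opv 4 ?T z = 0" for z
  proof -
    obtain x y where xy: "x \<in> space_on (idx M)" "y \<in> space_on (idx M)" "z = J x y" using space_L1_tens[OF z(1)] by blast
    then have "J (opv 4 M x) (opv 4 M y) = 0" using z(2) ops_J(4)[OF M xy(1,2)] by simp
    then have "opv 4 M x = 0" "opv 4 M y = 0" using J_eq_0[OF sp(1) sp(1)] by blast+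
    then have "x = 0" "y = 0" using g xy(1,2) by (auto simp: good_def)
    then show ?thesis using xy(3) by (simp add: J_simps)
  qed
  ultimately show ?thesis using T unfolding good_def by blast
qed

section \<open>Highest weight vectors in the tensor product with L(1)\<close>

context g_ops begin

text \<open>In these lemmas \<open>u, u1, u2\<close> are consecutive members of a system, \<open>P\<close> is the preceding member scaled
  by \<open>\<epsilon> + \<delta> / l\<close>, and the system in the tensor product consists of the vectors
  \<open>w\<^sub>0 \<otimes> (P - f u / l) + w\<^sub>1 \<otimes> u\<close>.\<close>

lemma tensor_raise:
  assumes l: "l \<noteq> 0" "l + 4 \<noteq> 0" and u: "scl 4 (a (f u)) = scl l (b u) + scl (4 * \<delta>) u1"
    and P: "a P = scl (\<epsilon> + \<delta> / l) u1"
  shows "a (P - scl (1 / l) (f u)) = scl (\<epsilon> + \<delta> / (l + 4)) u1 - scl (1 / (l + 4)) (f (a u))"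
proof (rule poly_mapping_eqI)
  fix i
  let ?L = "\<lambda>x :: cvec. Poly_Mapping.lookup x i"
  have "4 * ?L (a (f u)) = l * ?L (b u) + 4 * \<delta> * ?L u1"
    using arg_cong[OF u, of ?L] by (simp add: lookup_add)
  then have B: "?L (b u) = (4 * ?L (a (f u)) - 4 * \<delta> * ?L u1) / l" using l(1) by (simp add: field_simps)
  have "?L (a (P - scl (1 / l) (f u))) = (\<epsilon> + \<delta> / l) * ?L u1 - (1 / l) * ?L (a (f u))"
    by (simp add: lin_simps[OF lin_a] P lookup_minus)
  also have "\<dots> = (\<epsilon> + \<delta> / (l + 4)) * ?L u1 - (1 / (l + 4)) * (?L (a (f u)) + ?L (b u))"
  proof -
    have "(\<delta> / l) * X - (1 / l) * A = (\<delta> / (l + 4)) * X - (1 / (l + 4)) * (A + (4 * A - 4 * \<delta> * X) / l)" for X A :: complex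
      using l by (simp add: divide_simps) (simp add: algebra_simps)
    from this[of "?L u1" "?L (a (f u))"] show ?thesis unfolding B by (simp only: distrib_right) simp
  qed
  finally show "?L (a (P - scl (1 / l) (f u))) = ?L (scl (\<epsilon> + \<delta> / (l + 4)) u1 - scl (1 / (l + 4)) (f (a u)))"
    by (simp only: lookup_minus lookup_scl fa lookup_add)
qed

lemma tensor_lower_2:
  assumes l: "l \<noteq> 0" and u: "scl 4 (a (f u)) = scl l (b u) + scl (4 * \<delta>) u1"
    and P: "a P = scl (\<epsilon> + \<delta> / l) u1"
  shows "scl 4 (a ((P - scl (1 / l) (f u)) + f u)) = scl (l - 1) (b u) + scl (4 * (\<delta> + \<epsilon>)) u1"
proof (rule poly_mapping_eqI)
  fix i
  let ?L = "\<lambda>x :: cvec. Poly_Mapping.lookup x i"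
  have "4 * ?L (a (f u)) = l * ?L (b u) + 4 * \<delta> * ?L u1"
    using arg_cong[OF u, of ?L] by (simp add: lookup_add)
  then have A: "?L (a (f u)) = (l * ?L (b u) + 4 * \<delta> * ?L u1) / 4" by (simp add: mult.commute)
  have "4 * ((\<epsilon> + \<delta> / l) * X - (1 / l) * ((l * B + 4 * \<delta> * X) / 4) + (l * B + 4 * \<delta> * X) / 4)
      = (l - 1) * B + 4 * (\<delta> + \<epsilon>) * X" for X B :: complex
    using l by (simp add: divide_simps) (simp add: algebra_simps)
  then show "?L (scl 4 (a ((P - scl (1 / l) (f u)) + f u))) = ?L (scl (l - 1) (b u) + scl (4 * (\<delta> + \<epsilon>)) u1)"
    by (simp only: lin_simps[OF lin_a] P lookup_minus lookup_scl lookup_add A)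
qed

lemma tensor_lower_1:
  assumes l: "l \<noteq> 0" "l + 2 \<noteq> 0" and rel: "scl 8 (a (c u)) = scl 3 (b (b u)) - scl (4 * \<mu>) (a u)" and \<mu>: "\<mu> = 4 * \<epsilon>\<^sup>2"
    and u: "scl 4 (a (f u)) = scl l (b u) + scl (4 * \<delta>) u1"
    and u1: "scl 4 (a (f u1)) = scl (l + 2) (b u1) + scl (4 * \<delta>) (a u)"
    and P: "a P = scl (\<epsilon> + \<delta> / l) u1" "scl 4 (a (f P)) = scl (l - 2) (b P) + scl (4 * \<delta> * (\<epsilon> + \<delta> / l)) u"
  shows "a (scl 4 (a (f (P - scl (1 / l) (f u)))) - scl (l - 1) (b (P - scl (1 / l) (f u)))
     - scl (4 * (\<delta> + \<epsilon>)) (scl (\<epsilon> + \<delta> / (l + 2)) u - scl (1 / (l + 2)) (f u1))) = 0"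
proof (rule poly_mapping_eqI)
  fix i
  let ?L = "\<lambda>x :: cvec. Poly_Mapping.lookup x i"
  note la = lin_simps[OF lin_a] lin_simps[OF lin_b] sl
  \<comment> \<open>After one more multiplication by a, every term becomes a combination of
    \<open>b b u\<close>, \<open>b u1\<close> and \<open>a u\<close>; the claim reduces to an
    identity between their coefficients.\<close>
  define X Y Z where "X = ?L (b (b u))" and "Y = ?L (b u1)" and "Z = ?L (a u)"
  have bP: "?L (a (b P)) = (\<epsilon> + \<delta> / l) * Y" by (simp add: ba[symmetric] P(1) la Y_def)
  have "a (scl 4 (a (f P))) = a (scl (l - 2) (b P) + scl (4 * \<delta> * (\<epsilon> + \<delta> / l)) u)" by (simp only: P(2))
  from arg_cong[OF this, of ?L] have "4 * ?L (a (a (f P))) = (l - 2) * ?L (a (b P)) + 4 * \<delta> * (\<epsilon> + \<delta> / l) * ?L (a u)"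
    by (simp only: la lookup_add lookup_scl)
  then have aafP: "4 * ?L (a (a (f P))) = (l - 2) * ((\<epsilon> + \<delta> / l) * Y) + 4 * \<delta> * (\<epsilon> + \<delta> / l) * Z"
    by (simp only: bP Z_def)
  have "b (scl 4 (a (f u))) = b (scl l (b u) + scl (4 * \<delta>) u1)" by (simp only: u)
  from arg_cong[OF this, of ?L] have "4 * ?L (a (b (f u))) = l * ?L (b (b u)) + 4 * \<delta> * ?L (b u1)" by (simp only: la lookup_add lookup_scl ba)
  then have abfu: "?L (a (b (f u))) = (l * X + 4 * \<delta> * Y) / 4" by (simp add: X_def Y_def mult.commute)
  have "8 * ?L (a (c u)) = 3 * ?L (b (b u)) - 4 * \<mu> * ?L (a u)" using arg_cong[OF rel, of ?L] by (simp only: lookup_minus lookup_scl)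
  then have acu: "?L (a (c u)) = (3 * X - 4 * \<mu> * Z) / 8" by (simp add: X_def Z_def mult.commute)
  have "4 * ?L (a (f u1)) = (l + 2) * ?L (b u1) + 4 * \<delta> * ?L (a u)" using arg_cong[OF u1, of ?L] by (simp only: lookup_add lookup_scl)
  then have afu1: "?L (a (f u1)) = ((l + 2) * Y + 4 * \<delta> * Z) / 4" by (simp add: Y_def Z_def mult.commute)
  have "a (f (scl 4 (a (f u)))) = a (f (scl l (b u) + scl (4 * \<delta>) u1))" by (simp only: u)
  from arg_cong[OF this, of ?L] have "4 * (?L (a (a (f (f u)))) + ?L (a (b (f u)))) = l * (?L (a (b (f u))) + 2 * ?L (a (c u))) + 4 * \<delta> * ?L (a (f u1))"
    by (simp only: la lookup_add lookup_scl fa fb)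
  then have aaffu: "?L (a (a (f (f u)))) = ((l - 4) * ?L (a (b (f u))) + 2 * l * ?L (a (c u)) + 4 * \<delta> * ?L (a (f u1))) / 4"
    by (simp add: algebra_simps)
  have "?L (a (scl 4 (a (f (P - scl (1 / l) (f u)))) - scl (l - 1) (b (P - scl (1 / l) (f u)))
     - scl (4 * (\<delta> + \<epsilon>)) (scl (\<epsilon> + \<delta> / (l + 2)) u - scl (1 / (l + 2)) (f u1))))
    = 4 * (?L (a (a (f P))) - (1 / l) * ?L (a (a (f (f u))))) - (l - 1) * (?L (a (b P)) - (1 / l) * ?L (a (b (f u))))
      - (4 * (\<delta> + \<epsilon>)) * ((\<epsilon> + \<delta> / (l + 2)) * Z - (1 / (l + 2)) * ?L (a (f u1)))"
    by (simp only: la lookup_minus lookup_scl Z_def)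
  also have "\<dots> = (l - 2) * ((\<epsilon> + \<delta> / l) * Y) + 4 * \<delta> * (\<epsilon> + \<delta> / l) * Z
      - (1 / l) * ((l - 4) * ((l * X + 4 * \<delta> * Y) / 4) + 2 * l * ((3 * X - 4 * (4 * \<epsilon>\<^sup>2) * Z) / 8) + 4 * \<delta> * (((l + 2) * Y + 4 * \<delta> * Z) / 4))
      - (l - 1) * ((\<epsilon> + \<delta> / l) * Y - (1 / l) * ((l * X + 4 * \<delta> * Y) / 4))
      - (4 * (\<delta> + \<epsilon>)) * ((\<epsilon> + \<delta> / (l + 2)) * Z - (1 / (l + 2)) * (((l + 2) * Y + 4 * \<delta> * Z) / 4))"
    unfolding aaffu bP abfu acu afu1 \<mu> right_diff_distrib[of 4 "?L (a (a (f P)))"] aafP using l(1) by (simp add: divide_simps)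
  also have "\<dots> = 0"
  proof -
    \<comment> \<open>Naming the inverses turns the identity of rational functions into a polynomial
      one modulo \<open>r l = 1\<close> and \<open>q (l + 2) = 1\<close>.\<close>
    define r where "r = 1 / l"
    define q where "q = 1 / (l + 2)"
    have rl: "r * l = 1" "q * (l + 2) = 1" "\<And>z. z / l = z * r" "\<And>z. z / (l + 2) = z * q"
      using l by (simp_all add: r_def q_def divide_inverse)
    show ?thesis unfolding rl(3,4) using rl(1,2) by algebra
  qed
  finally show "?L (a (scl 4 (a (f (P - scl (1 / l) (f u)))) - scl (l - 1) (b (P - scl (1 / l) (f u)))
     - scl (4 * (\<delta> + \<epsilon>)) (scl (\<epsilon> + \<delta> / (l + 2)) u - scl (1 / (l + 2)) (f u1)))) = ?L 0" by simp
qed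

end

text \<open>The coefficient of \<open>f u\<close> is dictated by the vanishing under e, and the form
  \<epsilon> + \<delta> / l of the other one by compatibility with \<open>v\<^sub>4\<close>. The
  predecessor of \<open>u 0\<close> is replaced by 0, which yields a correct initial member only if
  \<epsilon> + \<delta> / n is zero.\<close>

definition tens_vec :: "gelt lie_mod \<Rightarrow> nat \<Rightarrow> complex \<Rightarrow> complex \<Rightarrow> (nat \<Rightarrow> cvec) \<Rightarrow> nat \<Rightarrow> cvec" where
  "tens_vec M n \<delta> \<epsilon> u s = J (scl (\<epsilon> + \<delta> / of_nat (n + 2 * s)) (case s of 0 \<Rightarrow> 0 | Suc r \<Rightarrow> u r)
     - scl (1 / of_nat (n + 2 * s)) (opF M (u s))) (u s)"

text \<open>The vector with index s has weight n + 2 s - 1. A sequence started at s = 1 thus belongs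
  to n + 1, and one started at s = 0 to n - 1. The condition on \<mu> leaves the two choices
  \<epsilon> = \<plusminus>\<sigma>/2.\<close>

lemma tens_vec_system:
  assumes g: "good \<mu> M" and u: "sys M n (\<lambda>_. \<delta>) u" and \<mu>: "\<mu> = 4 * \<epsilon>\<^sup>2"
    and s: "s > 0 \<or> n > 0 \<and> \<epsilon> + \<delta> / of_nat n = 0"
  defines "T \<equiv> L1_tens M" and "U \<equiv> tens_vec M n \<delta> \<epsilon> u" and "l \<equiv> of_nat (n + 2 * s) :: complex"
  shows "U s \<in> space_on (idx T)" "opE T (U s) = 0" "opH T (U s) = scl (l - 1) (U s)" "opv 4 T (U s) = U (s + 2)"
    "scl 4 (opv 4 T (opF T (U s))) = scl (l - 1) (opv 2 T (U s)) + scl (4 * (\<delta> + \<epsilon>)) (U (s + 1))"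
proof -
  have M: "lie_module g_alg M" by (rule good_lie_module[OF g])
  interpret g_ops "opE M" "opF M" "opH M" "opv 4 M" "opv 2 M" "opv 0 M" "opv (-2) M" "opv (-4) M" by (rule g_ops_mod[OF M])
  note la = lin_simps[OF lin_a] lin_simps[OF lin_b] sl
  have l: "l \<noteq> 0" "l + 2 \<noteq> 0" "l + 4 \<noteq> 0"
  proof -
    have "n + 2 * s \<noteq> 0" using s by auto
    then show "l \<noteq> 0" unfolding l_def by (simp only: of_nat_eq_0_iff) simp
    have "l + 2 = of_nat (n + 2 * s + 2)" "l + 4 = of_nat (n + 2 * s + 4)" by (simp_all add: l_def)
    then show "l + 2 \<noteq> 0" "l + 4 \<noteq> 0" by (simp_all only: of_nat_eq_0_iff)
  qed
  have us: "u t \<in> space_on (idx M)" "opE M (u t) = 0" "opH M (u t) = scl (of_nat (n + 2 * t)) (u t)" "opv 4 M (u t) = u (t + 2)"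
     "scl 4 (opv 4 M (opF M (u t))) = scl (of_nat (n + 2 * t)) (opv 2 M (u t)) + scl (4 * \<delta>) (u (t + 1))" for t
    using u by (simp_all only: sys_def)
  define P where "P = scl (\<epsilon> + \<delta> / l) (case s of 0 \<Rightarrow> 0 | Suc r \<Rightarrow> u r)"
  have P: "P \<in> space_on (idx M)" "opE M P = 0" "opH M P = scl (l - 2) P" "opv 4 M P = scl (\<epsilon> + \<delta> / l) (u (s + 1))"
    "scl 4 (opv 4 M (opF M P)) = scl (l - 2) (opv 2 M P) + scl (4 * \<delta> * (\<epsilon> + \<delta> / l)) (u s)"
  proof -
    consider "s = 0" "\<epsilon> + \<delta> / l = 0" | r where "s = Suc r" using s by (cases s) (auto simp: l_def)
    then have "P \<in> space_on (idx M) \<and> opE M P = 0 \<and> opH M P = scl (l - 2) P \<and> opv 4 M P = scl (\<epsilon> + \<delta> / l) (u (s + 1)) \<and>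
       scl 4 (opv 4 M (opF M P)) = scl (l - 2) (opv 2 M P) + scl (4 * \<delta> * (\<epsilon> + \<delta> / l)) (u s)"
    proof cases
      case 1
      then show ?thesis by (simp add: P_def la space_on_0)
    next
      case 2
      have l2: "of_nat (n + 2 * r) = l - 2" by (simp add: l_def 2)
      have Pr: "P = scl (\<epsilon> + \<delta> / l) (u r)" by (simp add: P_def 2)
      have "scl 4 (opv 4 M (opF M P)) = scl (\<epsilon> + \<delta> / l) (scl 4 (opv 4 M (opF M (u r))))"
        by (simp add: Pr la mult.commute)
      also have "\<dots> = scl (l - 2) (opv 2 M P) + scl (4 * \<delta> * (\<epsilon> + \<delta> / l)) (u s)"
        unfolding us(5) l2 Pr la 2 by (simp add: cvec.scale_right_distrib mult.commute mult.left_commute)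
      finally show ?thesis using us[of r] l2 by (simp add: Pr la space_on_scl 2 mult.commute)
    qed
    then show "P \<in> space_on (idx M)" "opE M P = 0" "opH M P = scl (l - 2) P" "opv 4 M P = scl (\<epsilon> + \<delta> / l) (u (s + 1))"
      "scl 4 (opv 4 M (opF M P)) = scl (l - 2) (opv 2 M P) + scl (4 * \<delta> * (\<epsilon> + \<delta> / l)) (u s)" by blast+
  qed
  define x where "x = P - scl (1 / l) (opF M (u s))"
  have Us: "U s = J x (u s)" by (simp add: U_def tens_vec_def x_def P_def l_def)
  have c: "(sE, 0) \<in> lcarrier g_alg" "(sF, 0) \<in> lcarrier g_alg" "(0, v4 4) \<in> lcarrier g_alg" "(0, v4 2) \<in> lcarrier g_alg"
    by (simp_all add: carrier_g_0 v4_bas)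
  note sp = lie_module_space[OF M c(1)] lie_module_space[OF M c(2)] lie_module_space[OF M c(3)] lie_module_space[OF M c(4)]
  note sps = cvec.subspace_add[OF subspace_space_on] cvec.subspace_diff[OF subspace_space_on] cvec.subspace_scale[OF subspace_space_on]
  have xs: "x \<in> space_on (idx M)" unfolding x_def by (intro sps sp P)
  have ul: "opH M (u s) = scl l (u s)" by (simp add: us l_def)
  have u5: "scl 4 (opv 4 M (opF M (u s))) = scl l (opv 2 M (u s)) + scl (4 * \<delta>) (u (s + 1))" using us(5)[of s] by (simp only: l_def)
  have l2: "of_nat (n + 2 * (s + 1)) = l + 2" "of_nat (n + 2 * (s + 2)) = l + 4" by (simp_all add: l_def)
  have u15: "scl 4 (opv 4 M (opF M (u (s + 1)))) = scl (l + 2) (opv 2 M (u (s + 1))) + scl (4 * \<delta>) (opv 4 M (u s))"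
    using us(5)[of "s + 1"] unfolding l2 us(4) by (simp add: add.assoc)
  show "U s \<in> space_on (idx T)" unfolding Us T_def by (rule J_space[OF xs us(1)])
  have ex: "opE M x + u s = 0"
    unfolding x_def la P ef ul us(2) using l by (simp add: la)
  show "opE T (U s) = 0" unfolding Us T_def ops_J(1)[OF M xs us(1)] ex us(2) by (rule J_simps)
  have "opH M x + x = scl (l - 1) x"
    unfolding x_def la P hf ul by (rule poly_mapping_eqI) (simp add: lookup_add lookup_minus algebra_simps)
  moreover have "opH M (u s) - u s = scl (l - 1) (u s)" by (simp add: ul cvec.scale_left_diff_distrib)
  ultimately show "opH T (U s) = scl (l - 1) (U s)" unfolding Us T_def ops_J(3)[OF M xs us(1)] J_simps by (simp only:)
  have ax: "opv 4 M x = scl (\<epsilon> + \<delta> / (l + 4)) (u (s + 1)) - scl (1 / (l + 4)) (opF M (opv 4 M (u s)))"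
    unfolding x_def by (rule tensor_raise[OF l(1,3) u5 P(4)])
  have "opv 4 T (U s) = J (opv 4 M x) (opv 4 M (u s))" unfolding Us T_def by (rule ops_J(4)[OF M xs us(1)]) simp
  also have "\<dots> = U (s + 2)" unfolding ax us(4) U_def tens_vec_def l2 by simp
  finally show "opv 4 T (U s) = U (s + 2)" .
  have U1: "U (s + 1) = J (scl (\<epsilon> + \<delta> / (l + 2)) (u s) - scl (1 / (l + 2)) (opF M (u (s + 1)))) (u (s + 1))"
    unfolding U_def tens_vec_def l2 by simp
  let ?G = "scl 4 (opv 4 M (opF M x)) - scl (l - 1) (opv 2 M x)
     - scl (4 * (\<delta> + \<epsilon>)) (scl (\<epsilon> + \<delta> / (l + 2)) (u s) - scl (1 / (l + 2)) (opF M (u (s + 1))))"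
  \<comment> \<open>The relation for the first coordinate is accessible only after multiplication by
    \<open>v\<^sub>4\<close>, and is recovered from injectivity.\<close>
  have "opv 4 M ?G = 0"
    unfolding x_def by (rule tensor_lower_1[OF l(1,2) _ \<mu> u5 u15 P(4,5)]) (use g in \<open>simp add: good_def\<close>)
  moreover have "?G \<in> space_on (idx M)" by (intro sps sp xs us)
  ultimately have "?G = 0" using g by (simp only: good_def)
  then have 1: "scl 4 (opv 4 M (opF M x)) = scl (l - 1) (opv 2 M x)
     + scl (4 * (\<delta> + \<epsilon>)) (scl (\<epsilon> + \<delta> / (l + 2)) (u s) - scl (1 / (l + 2)) (opF M (u (s + 1))))"
    by (simp only: diff_diff_eq right_minus_eq)
  have 2: "scl 4 (opv 4 M (x + opF M (u s))) = scl (l - 1) (opv 2 M (u s)) + scl (4 * (\<delta> + \<epsilon>)) (u (s + 1))"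
    unfolding x_def by (rule tensor_lower_2[OF l(1) u5 P(4)])
  have o: "opv 4 T (opF T (U s)) = J (opv 4 M (opF M x)) (opv 4 M (x + opF M (u s)))" "opv 2 T (U s) = J (opv 2 M x) (opv 2 M (u s))"
    unfolding Us T_def ops_J(2)[OF M xs us(1)]
    by (rule ops_J(4)[OF M]; (intro sps sp xs us | simp))+
  show "scl 4 (opv 4 T (opF T (U s))) = scl (l - 1) (opv 2 T (U s)) + scl (4 * (\<delta> + \<epsilon>)) (U (s + 1))"
    unfolding o U1 J_simps 1 2 ..
qed

lemma sys_tens_plus:
  assumes "good \<mu> M" "sys M n (\<lambda>_. \<delta>) u" "\<mu> = 4 * \<epsilon>\<^sup>2"
  shows "sys (L1_tens M) (n + 1) (\<lambda>_. \<delta> + \<epsilon>) (\<lambda>s. tens_vec M n \<delta> \<epsilon> u (s + 1))"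
proof -
  have e: "of_nat (n + 2 * (s + 1)) - 1 = (of_nat (n + 1 + 2 * s) :: complex)" for s by simp
  note t = tens_vec_system[OF assms, of "s + 1" for s, unfolded e]
  show ?thesis
    unfolding sys_def
  proof (intro allI conjI)
    fix s
    show "opv 4 (L1_tens M) (tens_vec M n \<delta> \<epsilon> u (s + 1)) = tens_vec M n \<delta> \<epsilon> u (s + 2 + 1)" using t(4)[of s] by simp
  qed (rule t; simp)+
qed

lemma sys_tens_minus:
  assumes "good \<mu> M" "sys M n (\<lambda>_. \<delta>) u" "\<mu> = 4 * \<epsilon>\<^sup>2" and n: "n > 0" "\<epsilon> + \<delta> / of_nat n = 0"
  shows "sys (L1_tens M) (n - 1) (\<lambda>_. \<delta> + \<epsilon>) (tens_vec M n \<delta> \<epsilon> u)"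
proof -
  have e: "of_nat (n + 2 * s) - 1 = (of_nat (n - 1 + 2 * s) :: complex)" for s using n(1) by (cases n) simp_all
  have "s > 0 \<or> n > 0 \<and> \<epsilon> + \<delta> / of_nat n = 0" for s :: nat using n by blast
  note t = tens_vec_system[OF assms(1-3) this, unfolded e]
  show ?thesis
    unfolding sys_def by (intro allI conjI) (rule t)+
qed

lemma tens_vec_nz:
  assumes "sys M n \<eta> u" "lie_module g_alg M" "u s \<noteq> 0"
  shows "tens_vec M n \<delta> \<epsilon> u s \<noteq> 0"
proof
  assume z: "tens_vec M n \<delta> \<epsilon> u s = 0"
  have us: "u t \<in> space_on (idx M)" for t using assms(1) by (simp only: sys_def)
  have f: "(sF, 0) \<in> lcarrier g_alg" by (simp add: carrier_g_0)
  define p where "p = (case s of 0 \<Rightarrow> 0 | Suc r \<Rightarrow> u r)"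
  have p: "p \<in> space_on (idx M)" unfolding p_def using us by (cases s) (simp_all add: space_on_0)
  define x where "x = scl (\<epsilon> + \<delta> / of_nat (n + 2 * s)) p - scl (1 / of_nat (n + 2 * s)) (opF M (u s))"
  have x: "x \<in> space_on (idx M)"
    unfolding x_def by (rule cvec.subspace_diff[OF subspace_space_on space_on_scl[OF p] space_on_scl[OF lie_module_space[OF assms(2) f]]])
  have "J x (u s) = 0" using z by (simp only: tens_vec_def x_def p_def)
  then have "u s = 0" by (rule J_eq_0(2)[OF x us])
  then show False using assms(3) by simp
qed

text \<open>The vectors whose two copies \<open>J x 0\<close> and \<open>J 0 x\<close> both lie in
  \<open>W\<close> form a submodule of the simple module \<open>M\<close>. So it suffices to find
  one non-zero such vector; applying f and then \<open>v\<^sub>4\<close> to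
  \<open>J (u t0) 0\<close> produces \<open>u (t0 + 2)\<close> in the second coordinate.\<close>

lemma submodule_L1_tens_full:
  assumes Ms: "simple_module g_alg M" and g: "good \<mu> M" and u: "sys M n (\<lambda>_. \<delta>) u" and t0: "u t0 \<noteq> 0"
    and W: "submodule g_alg (L1_tens M) W" and uW: "\<And>t. J (u t) 0 \<in> W"
  shows "W = space_on (idx (L1_tens M))"
proof -
  let ?T = "L1_tens M" and ?S = "space_on (idx M)"
  have M: "lie_module g_alg M" by (rule good_lie_module[OF g])
  interpret g_ops "opE M" "opF M" "opH M" "opv 4 M" "opv 2 M" "opv 0 M" "opv (-2) M" "opv (-4) M" by (rule g_ops_mod[OF M])
  have Ws: "cvec.subspace W" "W \<subseteq> space_on (idx ?T)" and Wa: "\<And>y w. y \<in> lcarrier g_alg \<Longrightarrow> w \<in> W \<Longrightarrow> act ?T y w \<in> W"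
    using W by (auto simp: submodule_def)
  note wc = cvec.subspace_add[OF Ws(1)] cvec.subspace_diff[OF Ws(1)] cvec.subspace_scale[OF Ws(1)]
  have us: "u t \<in> ?S" "opv 4 M (u t) = u (t + 2)"
     "scl 4 (opv 4 M (opF M (u t))) = scl (of_nat (n + 2 * t)) (opv 2 M (u t)) + scl (4 * \<delta>) (u (t + 1))" for t
    using u by (simp_all only: sys_def)
  have c: "(sF, 0) \<in> lcarrier g_alg" "(0, v4 4) \<in> lcarrier g_alg" "(0, v4 2) \<in> lcarrier g_alg"
    by (simp_all add: carrier_g_0 v4_bas)
  have s0: "0 \<in> ?S" by (rule space_on_0)
  define N where "N = {x \<in> ?S. J x 0 \<in> W \<and> J 0 x \<in> W}"
  have "submodule g_alg M N"
    unfolding submodule_def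
  proof (intro conjI ballI)
    show "cvec.subspace N"
      unfolding cvec.subspace_def N_def
    proof (intro conjI ballI allI; clarsimp simp: space_on_0 space_on_add space_on_scl J_simps)
      show "0 \<in> W" by (rule cvec.subspace_0[OF Ws(1)])
    next
      fix x y assume "J x 0 \<in> W" "J 0 x \<in> W" "J y 0 \<in> W" "J 0 y \<in> W"
      then show "J (x + y) 0 \<in> W \<and> J 0 (x + y) \<in> W" using wc(1)[of "J x 0" "J y 0"] wc(1)[of "J 0 x" "J 0 y"] by (simp add: J_simps)
    next
      fix r x assume "J x 0 \<in> W" "J 0 x \<in> W"
      then show "J (scl r x) 0 \<in> W \<and> J 0 (scl r x) \<in> W" using wc(3)[of "J x 0" r] wc(3)[of "J 0 x" r] by (simp add: J_simps)
    qed
    show "N \<subseteq> ?S" by (auto simp: N_def)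
    fix y assume y: "y \<in> lcarrier g_alg"
    show "act M y ` N \<subseteq> N"
    proof
      fix z assume "z \<in> act M y ` N"
      then obtain x where x: "x \<in> ?S" "J x 0 \<in> W" "J 0 x \<in> W" and z: "z = act M y x" by (auto simp: N_def)
      have tW: "tens w x \<in> W" if "w \<in> space_on {..1}" for w
      proof -
        define r0 where "r0 = Poly_Mapping.lookup w 0"
        define r1 where "r1 = Poly_Mapping.lookup w 1"
        have lb: "Poly_Mapping.lookup (bas k) i = (if k = i then 1 else 0)" for k i by (simp add: bas_def lookup_single when_def)
        have w: "w = scl r0 (bas 0) + scl r1 (bas 1)"
        proof (rule poly_mapping_eqI)
          fix i
          have "Poly_Mapping.lookup w i = 0" if "i > 1"
            using \<open>w \<in> space_on {..1}\<close> that by (auto simp: space_on_def in_keys_iff)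
          then show "Poly_Mapping.lookup w i = Poly_Mapping.lookup (scl r0 (bas 0) + scl r1 (bas 1)) i"
            by (cases "i > 1") (auto simp: lookup_add lb r0_def r1_def not_less le_Suc_eq)
        qed
        have "tens w x = scl r0 (J x 0) + scl r1 (J 0 x)"
          unfolding w J_def tens_simps by (simp only: add_0_left add_0_right)
        then show ?thesis using wc x by simp
      qed
      have Lw: "act (L 1) (fst y) (bas i) \<in> space_on {..1}" for i by (rule lin_maps_space[OF L_lin_maps])
      have "J (act M y x) 0 = act ?T y (J x 0) - tens (act (L 1) (fst y) (bas 0)) x"
        "J 0 (act M y x) = act ?T y (J 0 x) - tens (act (L 1) (fst y) (bas 1)) x"
        unfolding act_J[OF M y x(1) s0] act_J[OF M y s0 x(1)] by (simp_all add: lin_0[OF lie_module_lin[OF M y]] tens_simps del: One_nat_def)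
      then have "J z 0 \<in> W" "J 0 z \<in> W" unfolding z using wc(2) Wa[OF y] x tW[OF Lw] by simp_all
      then show "z \<in> N" using lie_module_space[OF M y] by (simp add: N_def z)
    qed
  qed
  moreover have "u (t0 + 2) \<in> N"
  proof -
    let ?x = "u t0"
    have "opF ?T (J ?x 0) \<in> W" by (rule Wa[OF c(1) uW])
    then have "J (opF M ?x) ?x \<in> W" by (simp add: ops_J(2)[OF M us(1) s0] sl del: One_nat_def)
    then have "opv 4 ?T (J (opF M ?x) ?x) \<in> W" by (rule Wa[OF c(2)])
    then have 1: "J (opv 4 M (opF M ?x)) (u (t0 + 2)) \<in> W"
      using ops_J(4)[OF M lie_module_space[OF M c(1)] us(1), of 4] by (simp add: us(2) del: One_nat_def)
    have "opv 2 ?T (J ?x 0) \<in> W" by (rule Wa[OF c(3) uW])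
    then have 2: "J (opv 2 M ?x) 0 \<in> W"
      using ops_J(4)[OF M us(1) s0, of 2] by (simp add: lin_0[OF lin_b] del: One_nat_def)
    \<comment> \<open>The defining relation of the system cancels the first coordinate.\<close>
    have "scl 4 (J (opv 4 M (opF M ?x)) (u (t0 + 2))) - scl (of_nat (n + 2 * t0)) (J (opv 2 M ?x) 0) - scl (4 * \<delta>) (J (u (t0 + 1)) 0) \<in> W"
      by (intro wc 1 2 uW)
    also have "scl 4 (J (opv 4 M (opF M ?x)) (u (t0 + 2))) - scl (of_nat (n + 2 * t0)) (J (opv 2 M ?x) 0) - scl (4 * \<delta>) (J (u (t0 + 1)) 0)
       = J 0 (scl 4 (u (t0 + 2)))"
      unfolding J_simps us(3) by simp
    finally have "scl (1 / 4) (J 0 (scl 4 (u (t0 + 2)))) \<in> W" by (rule wc(3))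
    then show ?thesis using us(1) uW by (simp add: N_def J_simps)
  qed
  moreover have "u (t0 + 2) \<noteq> 0" using g t0 us(1)[of t0] us(2)[of t0] by (auto simp: good_def)
  ultimately have N: "N = ?S" by (rule simple_submodule[OF Ms])
  have "space_on (idx ?T) \<subseteq> W"
  proof
    fix z assume "z \<in> space_on (idx ?T)"
    then obtain x y where xy: "x \<in> ?S" "y \<in> ?S" "z = J x y" by (rule space_L1_tens)
    then have "J x 0 + J 0 y \<in> W" using N by (intro wc(1)) (auto simp: N_def)
    then show "z \<in> W" by (simp add: J_simps xy)
  qed
  then show ?thesis using Ws(2) by blast
qed

subsection \<open>The decomposition of \<open>L(1) \<otimes> V\<close>\<close>

lemma homs_zero_of_hwset:
  assumes "simple_module g_alg X" "simple_module g_alg Y" "hwset X \<noteq> hwset Y"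
  shows "module_homs g_alg X Y = {0}"
  using hwset_simple[OF assms(1,2)] assms(3) module_homs_0[OF simple_lie_module[OF assms(2)]] by blast

lemma sum_image_mem:
  assumes "finite K" "k \<in> K" "v \<in> space_on (idx (V k))" "\<And>l. l \<in> K \<Longrightarrow> lin (\<phi> l)"
  shows "\<phi> k v \<in> sum_image V \<phi> K"
proof -
  have "(\<Sum>l\<in>K. \<phi> l (if l = k then v else 0)) = (\<Sum>l\<in>K. if l = k then \<phi> k v else 0)"
    by (intro sum.cong) (simp_all add: lin_0[OF assms(4)])
  then have "\<phi> k v = (\<Sum>l\<in>K. \<phi> l (if l = k then v else 0))" using assms(1,2) by simp
  then show ?thesis
    unfolding sum_image_def using assms(3) by (intro CollectI exI[of _ "\<lambda>l. if l = k then v else 0"]) (simp add: space_on_0)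
qed

text \<open>Decomposing the tensor product is reduced to finding non-zero maps from simple modules
  with different sets of highest weights, whose images together contain the vectors
  \<open>J (u t) 0\<close>.\<close>

lemma L1_tens_dsum:
  assumes M: "simple_module g_alg M" "good \<mu> M" and u: "sys M n (\<lambda>_. \<delta>) u" "u t0 \<noteq> 0"
    and X: "\<And>X. X \<in> set Xs \<Longrightarrow> simple_module g_alg X" "distinct (map hwset Xs)"
    and \<phi>: "\<And>k. k < length Xs \<Longrightarrow> \<phi> k \<in> module_homs g_alg (Xs ! k) (L1_tens M)" "\<And>k. k < length Xs \<Longrightarrow> \<phi> k \<noteq> 0"
    and im: "\<And>t W. cvec.subspace W \<Longrightarrow> (\<And>k v. k < length Xs \<Longrightarrow> v \<in> space_on (idx (Xs ! k)) \<Longrightarrow> \<phi> k v \<in> W) \<Longrightarrow> J (u t) 0 \<in> W"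
  shows "\<exists>i p. dsum g_alg Xs (L1_tens M) i p"
proof (rule dsum_of_distinct_simples[OF _ X(1) \<phi>])
  show T: "lie_module g_alg (L1_tens M)" by (rule lie_module_L1_tens[OF simple_lie_module[OF M(1)]])
  let ?W = "sum_image (\<lambda>k. Xs ! k) \<phi> {..<length Xs}"
  have sub: "submodule g_alg (L1_tens M) ?W"
    by (rule submodule_sum_image[OF T]) (use X(1) \<phi>(1) in \<open>auto intro: simple_lie_module\<close>)
  have "\<phi> k v \<in> ?W" if "k < length Xs" "v \<in> space_on (idx (Xs ! k))" for k v
    by (rule sum_image_mem) (use that module_homs_lin[OF \<phi>(1)] in auto)
  then have "J (u t) 0 \<in> ?W" for t using sub by (intro im) (auto simp: submodule_def)
  then show "space_on (idx (L1_tens M)) \<subseteq> ?W" using submodule_L1_tens_full[OF M u sub] by blast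
  fix k l assume kl: "k < length Xs" "l < length Xs" "k \<noteq> l"
  then have "hwset (Xs ! k) \<noteq> hwset (Xs ! l)" using X(2) by (auto simp: distinct_conv_nth)
  then show "module_homs g_alg (Xs ! k) (Xs ! l) = {0}" using kl X(1) by (intro homs_zero_of_hwset) auto
qed

lemma hom_from_system:
  assumes X: "simple_module g_alg X" "good \<mu> X" and w: "\<exists>w. sys X n (\<lambda>_. \<delta>) w \<and> (\<forall>t. w t \<noteq> 0 \<longleftrightarrow> P t)"
    and T: "good \<mu> T" and U: "sys T n (\<lambda>_. \<delta>) U" "\<And>t. \<not> P t \<Longrightarrow> U t = 0" "U t0 \<noteq> 0"
  shows "\<exists>\<phi>. \<phi> \<in> module_homs g_alg X T \<and> \<phi> \<noteq> 0 \<and> (\<forall>t. \<exists>v\<in>space_on (idx X). \<phi> v = U t)"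
proof -
  obtain w where w: "sys X n (\<lambda>_. \<delta>) w" "\<And>t. w t \<noteq> 0 \<longleftrightarrow> P t" using w by blast
  have wz: "w t = 0 \<Longrightarrow> U t = 0" for t using w(2)[of t] U(2)[of t] by blast
  have "w t0 \<noteq> 0" using wz U(3) by blast
  then obtain \<phi> where \<phi>: "\<phi> \<in> module_homs g_alg X T" "\<And>t. \<phi> (w t) = U t"
    using hom_of_systems[OF X T w(1) U(1) wz] by blast
  have "\<phi> \<noteq> 0" using \<phi>(2)[of t0] U(3) by auto
  moreover have "w t \<in> space_on (idx X)" for t using w(1) by (simp add: sys_def)
  ultimately show ?thesis using \<phi> by blast
qed

text \<open>The vectors for \<epsilon> and for -\<epsilon> with the same index have the same second
  coordinate. Their difference is a vector of the kind needed to show that the images span.\<close>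

lemma tens_vec_diff:
  "tens_vec M n \<delta> \<epsilon> u (t + 1) - tens_vec M n \<delta> (- \<epsilon>) u (t + 1) = J (scl (2 * \<epsilon>) (u t)) 0"
proof -
  have "scl (\<epsilon> + z) x - y - (scl (- \<epsilon> + z) x - y) = scl (2 * \<epsilon>) x" for z x y
    by (rule poly_mapping_eqI) (simp only: lookup_minus lookup_scl, simp add: algebra_simps)
  then show ?thesis by (simp add: tens_vec_def J_simps del: of_nat_add of_nat_mult)
qed

section \<open>The given simple modules and their tensor products with L(1)\<close>

locale V_family =
  fixes \<mu> :: complex and V0 V2 :: "gelt lie_mod" and V :: "nat \<Rightarrow> gelt lie_mod"
  assumes \<mu>: "\<mu> \<noteq> 0" and V0: "is_V'0 \<mu> V0" and V2: "is_V'2 \<mu> V2" and V: "\<And>n. n \<ge> 1 \<Longrightarrow> is_V n \<mu> (V n)"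
begin

lemma hwset_V: "hwset V0 = {2 * t | t. even t}" "hwset V2 = {2 * t | t. odd t}" "n \<ge> 1 \<Longrightarrow> hwset (V n) = {n + 2 * t | t. True}"
  using hw_mod_hwset[OF is_V_hw_mod(2)[OF \<mu> V0]] hw_mod_hwset[OF is_V_hw_mod(3)[OF \<mu> V2]] hw_mod_hwset[OF is_V_hw_mod(1)[OF \<mu> V]]
  by simp_all

lemma hwset_ne: "hwset V0 \<noteq> hwset V2" "n \<ge> 1 \<Longrightarrow> hwset V0 \<noteq> hwset (V n)" "n \<ge> 1 \<Longrightarrow> hwset V2 \<noteq> hwset (V n)"
  "n \<ge> 1 \<Longrightarrow> m \<ge> 1 \<Longrightarrow> n \<noteq> m \<Longrightarrow> hwset (V n) \<noteq> hwset (V m)"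
proof -
  have 0: "0 \<in> hwset V0" "0 \<notin> hwset V2" by (auto simp: hwset_V)
  then show "hwset V0 \<noteq> hwset V2" by blast
  { assume n: "n \<ge> 1"
    then have "0 \<notin> hwset (V n)" by (auto simp: hwset_V)
    then show "hwset V0 \<noteq> hwset (V n)" using 0 by blast
    show "hwset V2 \<noteq> hwset (V n)"
    proof
      assume eq: "hwset V2 = hwset (V n)"
      \<comment> \<open>If 2 is a highest weight of \<open>V n\<close>, so is 4, which does not
        occur in \<open>V2\<close>.\<close>
      have "2 * 1 \<in> hwset V2" unfolding hwset_V by (intro CollectI exI[of _ 1]) simp
      then obtain t where t: "2 * 1 = n + 2 * t" unfolding eq hwset_V(3)[OF n] by blast
      have "n + 2 * (t + 1) \<in> hwset (V n)" unfolding hwset_V(3)[OF n] by blast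
      moreover have "n + 2 * (t + 1) = 4" using t by simp
      ultimately have "4 \<in> hwset V2" unfolding eq by (simp only:)
      then show False unfolding hwset_V by auto
    qed }
  assume n: "n \<ge> 1" and m: "m \<ge> 1" and nm: "n \<noteq> m"
  have mem: "n + 2 * 0 \<in> hwset (V n)" "m + 2 * 0 \<in> hwset (V m)" unfolding hwset_V(3)[OF n] hwset_V(3)[OF m] by blast+
  show "hwset (V n) \<noteq> hwset (V m)"
  proof
    assume eq: "hwset (V n) = hwset (V m)"
    obtain t where "n + 2 * 0 = m + 2 * t" using mem(1) unfolding eq hwset_V(3)[OF m] by blast
    moreover obtain t' where "m + 2 * 0 = n + 2 * t'" using mem(2) unfolding eq[symmetric] hwset_V(3)[OF n] by blast
    ultimately show False using nm by simp
  qed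
qed

lemma V_simple: "simple_module g_alg V0" "simple_module g_alg V2" "n \<ge> 1 \<Longrightarrow> simple_module g_alg (V n)"
  using is_V_simple V0 V2 V by blast+

lemma V_good: "good \<mu> V0" "good \<mu> V2" "n \<ge> 1 \<Longrightarrow> good \<mu> (V n)"
  using hw_mod_good[OF _ is_V_hw_mod(2)[OF \<mu> V0]] hw_mod_good[OF _ is_V_hw_mod(3)[OF \<mu> V2]] hw_mod_good[OF _ is_V_hw_mod(1)[OF \<mu> V]] V_simple
  by blast+

lemma V02_sys: "\<exists>u. sys V0 0 (\<lambda>_. 0) u \<and> (\<forall>t. u t \<noteq> 0 \<longleftrightarrow> even t)" "\<exists>u. sys V2 0 (\<lambda>_. 0) u \<and> (\<forall>t. u t \<noteq> 0 \<longleftrightarrow> odd t)"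
  using V02_system[OF \<mu> V_simple(1) is_V_hw_mod(2)[OF \<mu> V0]] V02_system[OF \<mu> V_simple(2) is_V_hw_mod(3)[OF \<mu> V2]] by blast+

text \<open>Here n and \<delta> are 0, and only the raised system exists; it has the weights and the
  constant of the system of \<open>V 1\<close>.\<close>

lemma L1_tens_V02:
  assumes M: "simple_module g_alg M" "good \<mu> M" and u: "sys M 0 (\<lambda>_. 0) u" "\<And>t. u t \<noteq> 0 \<longleftrightarrow> P t" and P: "\<And>t. P (t + 1) = (\<not> P t)"
  shows "\<exists>i p. dsum g_alg [V 1] (L1_tens M) i p"
proof -
  define \<epsilon> where "\<epsilon> = csqrt \<mu> / 2"
  have \<epsilon>: "\<mu> = 4 * \<epsilon>\<^sup>2" "\<epsilon> \<noteq> 0" using \<mu> by (simp_all add: \<epsilon>_def power_divide)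
  define U where "U s = tens_vec M 0 0 \<epsilon> u (s + 1)" for s
  have U: "sys (L1_tens M) 1 (\<lambda>_. \<epsilon>) U" using sys_tens_plus[OF M(2) u(1) \<epsilon>(1)] by (simp add: U_def[abs_def])
  obtain t0 where t0: "P (t0 + 1)" using P[of 0] P[of 1] by fastforce
  then have Unz: "U t0 \<noteq> 0" unfolding U_def using u(2) by (intro tens_vec_nz[OF u(1) simple_lie_module[OF M(1)]]) blast
  have w: "\<exists>w. sys (V 1) 1 (\<lambda>_. \<epsilon>) w \<and> (\<forall>t. w t \<noteq> 0 \<longleftrightarrow> True)"
    using V_system[OF \<mu> _ V0 V2 V, of "csqrt \<mu>" 1] by (simp add: \<epsilon>_def del: One_nat_def)
  have "\<exists>\<phi>. \<phi> \<in> module_homs g_alg (V 1) (L1_tens M) \<and> \<phi> \<noteq> 0 \<and> (\<forall>t. \<exists>v\<in>space_on (idx (V 1)). \<phi> v = U t)"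
    by (rule hom_from_system[OF V_simple(3) V_good(3) w good_L1_tens[OF M(2)] U _ Unz]) simp_all
  then obtain \<phi> where \<phi>: "\<phi> \<in> module_homs g_alg (V 1) (L1_tens M)" "\<phi> \<noteq> 0" "\<And>t. \<exists>v\<in>space_on (idx (V 1)). \<phi> v = U t" by blast
  have unz: "u (t0 + 1) \<noteq> 0" using t0 u(2) by blast
  show ?thesis
  proof (rule L1_tens_dsum[OF M u(1) unz, of _ "\<lambda>_. \<phi>"])
    fix t W assume W: "cvec.subspace W" and i: "\<And>k v. k < length [V 1] \<Longrightarrow> v \<in> space_on (idx ([V 1] ! k)) \<Longrightarrow> \<phi> v \<in> W"
    obtain v where v: "v \<in> space_on (idx (V 1))" "\<phi> v = U t" using \<phi>(3) by blast
    then have UW: "U t \<in> W" using i[of 0 v] by simp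
    show "J (u t) 0 \<in> W"
    proof (cases "P t")
      case True
      then have z: "u (t + 1) = 0" using u(2) P by blast
      have lF: "lin (opF M)" by (rule lie_module_lin[OF simple_lie_module[OF M(1)]]) (simp add: carrier_g_0)
      \<comment> \<open>Where \<open>u t\<close> is non-zero the next member vanishes, so the raised
        vector already has the form needed for spanning.\<close>
      have "U t = J (scl \<epsilon> (u t)) 0" using z by (simp add: U_def tens_vec_def lin_0[OF lF])
      then have "scl (1 / \<epsilon>) (J (scl \<epsilon> (u t)) 0) \<in> W" using UW cvec.subspace_scale[OF W] by simp
      then show ?thesis using \<epsilon>(2) by (simp add: J_simps)
    next
      case False
      then have "u t = 0" using u(2) by blast
      then show ?thesis by (simp add: J_simps cvec.subspace_0[OF W])
    qed
  qed (use \<phi>(1,2) V_simple(3) in simp_all)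
qed

text \<open>\<open>Xs\<close> lists the constituents that receive the lowered system. For n at least
  2 it consists of \<open>V (n - 1)\<close>. For n = 1 the constant of the lowered system is 0, so
  by \<open>sys_parity\<close> it breaks into its even and its odd half, which belong to
  \<open>V0\<close> and \<open>V2\<close>: this is the fork of the graph.\<close>

lemma L1_tens_V:
  assumes n: "n \<ge> 1" and X: "\<And>X. X \<in> set Xs \<Longrightarrow> simple_module g_alg X \<and> good \<mu> X" and di: "distinct (map hwset Xs)" "hwset (V (n + 1)) \<notin> hwset ` set Xs"
    and w: "\<And>k. k < length Xs \<Longrightarrow> \<exists>w. sys (Xs ! k) (n - 1) (\<lambda>_. of_nat (n - 1) * csqrt \<mu> / 2) w \<and> (\<forall>t. w t \<noteq> 0 \<longleftrightarrow> P k t)"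
    and P: "\<And>t. \<exists>k<length Xs. P k t" "\<And>k. k < length Xs \<Longrightarrow> \<exists>t. P k t"
    and Q: "\<And>k. k < length Xs \<Longrightarrow> (\<forall>t. P k t) \<or> n = 1 \<and> (\<forall>t. P k (t + 1) = (\<not> P k t))"
  shows "\<exists>i p. dsum g_alg (Xs @ [V (n + 1)]) (L1_tens (V n)) i p"
proof -
  let ?T = "L1_tens (V n)" and ?Ys = "Xs @ [V (n + 1)]"
  define \<sigma> where "\<sigma> = csqrt \<mu>"
  have \<sigma>: "\<sigma>\<^sup>2 = \<mu>" "\<sigma> \<noteq> 0" using \<mu> by (simp_all add: \<sigma>_def)
  have \<epsilon>: "\<mu> = 4 * (\<sigma> / 2)\<^sup>2" "\<mu> = 4 * (- (\<sigma> / 2))\<^sup>2" using \<sigma> by (simp_all add: power_divide)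
  note Ms = V_simple(3)[OF n] and Mg = V_good(3)[OF n]
  have Ml: "lie_module g_alg (V n)" by (rule simple_lie_module[OF Ms])
  obtain u where u: "sys (V n) n (\<lambda>_. of_nat n * \<sigma> / 2) u" "\<And>t. u t \<noteq> 0"
    using V_system[OF \<mu> \<sigma>(1) V0 V2 V n] by blast
  let ?\<delta> = "of_nat n * \<sigma> / 2"
  define Up where "Up s = tens_vec (V n) n ?\<delta> (\<sigma> / 2) u (s + 1)" for s
  define Um where "Um = tens_vec (V n) n ?\<delta> (- (\<sigma> / 2)) u"
  have dp: "?\<delta> + \<sigma> / 2 = of_nat (n + 1) * \<sigma> / 2" by (simp add: field_simps)
  have dm: "?\<delta> + - (\<sigma> / 2) = of_nat (n - 1) * \<sigma> / 2" using n by (simp add: of_nat_diff field_simps)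
  have Up: "sys ?T (n + 1) (\<lambda>_. of_nat (n + 1) * \<sigma> / 2) Up"
    using sys_tens_plus[OF Mg u(1) \<epsilon>(1)] unfolding dp Up_def .
  \<comment> \<open>Since \<delta> / n is \<sigma>/2, the coefficient of the missing predecessor
    vanishes for \<epsilon> = -\<sigma>/2, so the lowered sequence may start at index 0.\<close>
  have n0: "n > 0" "- (\<sigma> / 2) + ?\<delta> / of_nat n = 0" using n by simp_all
  have Um: "sys ?T (n - 1) (\<lambda>_. of_nat (n - 1) * \<sigma> / 2) Um"
    using sys_tens_minus[OF Mg u(1) \<epsilon>(2) n0] unfolding dm Um_def .
  have Tg: "good \<mu> ?T" by (rule good_L1_tens[OF Mg])
  have Unz: "Up s \<noteq> 0" "Um s \<noteq> 0" for s unfolding Up_def Um_def by (rule tens_vec_nz[OF u(1) Ml u(2)])+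
  have w': "\<exists>w. sys (V (n + 1)) (n + 1) (\<lambda>_. of_nat (n + 1) * \<sigma> / 2) w \<and> (\<forall>t. w t \<noteq> 0 \<longleftrightarrow> True)"
    using V_system[OF \<mu> \<sigma>(1) V0 V2 V, of "n + 1"] by simp
  have "\<exists>\<phi>. \<phi> \<in> module_homs g_alg (V (n + 1)) ?T \<and> \<phi> \<noteq> 0 \<and> (\<forall>t. \<exists>v\<in>space_on (idx (V (n + 1))). \<phi> v = Up t)"
    by (rule hom_from_system[OF V_simple(3) V_good(3) w' Tg Up _ Unz(1)]) simp_all
  then obtain \<psi> where \<psi>: "\<psi> \<in> module_homs g_alg (V (n + 1)) ?T" "\<psi> \<noteq> 0" "\<And>t. \<exists>v\<in>space_on (idx (V (n + 1))). \<psi> v = Up t" by blast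
  have "\<exists>\<phi>. \<phi> \<in> module_homs g_alg (Xs ! k) ?T \<and> \<phi> \<noteq> 0 \<and> (\<forall>t. \<exists>v\<in>space_on (idx (Xs ! k)). \<phi> v = (if P k t then Um t else 0))"
    if k: "k < length Xs" for k
  proof -
    have sU: "sys ?T (n - 1) (\<lambda>_. of_nat (n - 1) * \<sigma> / 2) (\<lambda>t. if P k t then Um t else 0)"
      using Q[OF k]
    proof
      assume "\<forall>t. P k t"
      then show ?thesis using Um by simp
    next
      assume a: "n = 1 \<and> (\<forall>t. P k (t + 1) = (\<not> P k t))"
      then have z: "of_nat (n - 1) * \<sigma> / 2 = 0" by simp
      show ?thesis unfolding z
        by (rule sys_parity[OF good_lie_module[OF Tg] Um[unfolded z]]) (use a in simp_all)
    qed
    obtain t0 where "P k t0" using P(2)[OF k] by blast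
    then have nz: "(if P k t0 then Um t0 else 0) \<noteq> 0" using Unz by simp
    have "Xs ! k \<in> set Xs" using k by simp
    then have X: "simple_module g_alg (Xs ! k)" "good \<mu> (Xs ! k)" using X by blast+
    show ?thesis
      by (rule hom_from_system[OF X w[OF k, folded \<sigma>_def] Tg sU _ nz]) simp
  qed
  then have "\<exists>\<phi>. \<forall>k\<in>{..<length Xs}. \<phi> k \<in> module_homs g_alg (Xs ! k) ?T \<and> \<phi> k \<noteq> 0 \<and> (\<forall>t. \<exists>v\<in>space_on (idx (Xs ! k)). \<phi> k v = (if P k t then Um t else 0))"
    by (intro bchoice) blast
  then obtain \<phi> where \<phi>: "\<And>k. k < length Xs \<Longrightarrow> \<phi> k \<in> module_homs g_alg (Xs ! k) ?T" "\<And>k. k < length Xs \<Longrightarrow> \<phi> k \<noteq> 0"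
    "\<And>k t. k < length Xs \<Longrightarrow> \<exists>v\<in>space_on (idx (Xs ! k)). \<phi> k v = (if P k t then Um t else 0)" by blast
  let ?\<phi> = "\<lambda>k. if k < length Xs then \<phi> k else \<psi>"
  show ?thesis
  proof (rule L1_tens_dsum[OF Ms Mg u, of _ ?\<phi>])
    show "simple_module g_alg Y" if "Y \<in> set ?Ys" for Y using that X V_simple(3)[of "n + 1"] by auto
    show "distinct (map hwset ?Ys)" using di by simp
    fix k assume k: "k < length ?Ys"
    show "?\<phi> k \<in> module_homs g_alg (?Ys ! k) ?T" "?\<phi> k \<noteq> 0"
      using \<phi>(1,2)[of k] \<psi>(1,2) k by (auto simp: nth_append)
  next
    fix t W assume W: "cvec.subspace W" and i: "\<And>k v. k < length ?Ys \<Longrightarrow> v \<in> space_on (idx (?Ys ! k)) \<Longrightarrow> ?\<phi> k v \<in> W"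
    obtain k where k: "k < length Xs" "P k (t + 1)" using P(1) by blast
    obtain v where "v \<in> space_on (idx (Xs ! k))" "\<phi> k v = Um (t + 1)" using \<phi>(3)[OF k(1), of "t + 1"] k(2) by auto
    then have m: "Um (t + 1) \<in> W" using i[of k v] k(1) by (simp add: nth_append)
    obtain v where "v \<in> space_on (idx (V (n + 1)))" "\<psi> v = Up t" using \<psi>(3) by blast
    then have p: "Up t \<in> W" using i[of "length Xs" v] by simp
    have "Up t - Um (t + 1) = J (scl \<sigma> (u t)) 0"
      using tens_vec_diff[of "V n" n ?\<delta> "\<sigma> / 2" u t] by (simp add: Up_def Um_def)
    then have "J (scl \<sigma> (u t)) 0 \<in> W" using cvec.subspace_diff[OF W p m] by simp
    then have "scl (1 / \<sigma>) (J (scl \<sigma> (u t)) 0) \<in> W" by (rule cvec.subspace_scale[OF W])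
    then show "J (u t) 0 \<in> W" using \<sigma>(2) by (simp add: J_simps)
  qed
qed

theorem L1_tens_decomposition:
  "\<exists>i p. dsum g_alg [V 1] (L1_tens V0) i p" "\<exists>i p. dsum g_alg [V 1] (L1_tens V2) i p"
  "\<exists>i p. dsum g_alg [V0, V2, V 2] (L1_tens (V 1)) i p"
  "n \<ge> 2 \<Longrightarrow> \<exists>i p. dsum g_alg [V (n - 1), V (n + 1)] (L1_tens (V n)) i p"
proof -
  obtain u0 where u0: "sys V0 0 (\<lambda>_. 0) u0" "\<And>t. u0 t \<noteq> 0 \<longleftrightarrow> even t" using V02_sys(1) by blast
  obtain u2 where u2: "sys V2 0 (\<lambda>_. 0) u2" "\<And>t. u2 t \<noteq> 0 \<longleftrightarrow> odd t" using V02_sys(2) by blast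
  show "\<exists>i p. dsum g_alg [V 1] (L1_tens V0) i p"
    by (rule L1_tens_V02[OF V_simple(1) V_good(1) u0]) simp
  show "\<exists>i p. dsum g_alg [V 1] (L1_tens V2) i p"
    by (rule L1_tens_V02[OF V_simple(2) V_good(2) u2]) simp
  have "\<exists>i p. dsum g_alg ([V0, V2] @ [V (1 + 1)]) (L1_tens (V 1)) i p"
  proof (rule L1_tens_V[where P = "\<lambda>k. if k = 0 then even else odd"])
    show "distinct (map hwset [V0, V2])" "hwset (V (1 + 1)) \<notin> hwset ` set [V0, V2]"
      using hwset_ne(1) hwset_ne(2,3)[of "1 + 1"] by auto
    fix k assume "k < length [V0, V2]"
    then have "k = 0 \<or> k = 1" by auto
    then show "\<exists>w. sys ([V0, V2] ! k) (1 - 1) (\<lambda>_. of_nat (1 - 1) * csqrt \<mu> / 2) w \<and> (\<forall>t. w t \<noteq> 0 \<longleftrightarrow> (if k = 0 then even else odd) t)"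
      using V02_sys by auto
    show "\<exists>t. (if k = 0 then even else odd) (t::nat)" by (intro exI[of _ k]) (use \<open>k = 0 \<or> k = 1\<close> in auto)
  next
    fix t :: nat
    have "(if even t then 0 else 1) < length [V0, V2]" "(if (if even t then 0 else 1) = (0::nat) then even else odd) t" by simp_all
    then show "\<exists>k<length [V0, V2]. (if k = 0 then even else odd) t" by blast
  qed (use V_simple(1,2) V_good(1,2) in auto)
  then show "\<exists>i p. dsum g_alg [V0, V2, V 2] (L1_tens (V 1)) i p" by (simp add: numeral_2_eq_2)
  assume n: "n \<ge> 2"
  have "\<exists>i p. dsum g_alg ([V (n - 1)] @ [V (n + 1)]) (L1_tens (V n)) i p"
  proof (rule L1_tens_V[where P = "\<lambda>k t. True"])
    show "hwset (V (n + 1)) \<notin> hwset ` set [V (n - 1)]" using hwset_ne(4)[of "n + 1" "n - 1"] n by auto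
    show "\<exists>w. sys ([V (n - 1)] ! k) (n - 1) (\<lambda>_. of_nat (n - 1) * csqrt \<mu> / 2) w \<and> (\<forall>t. (w t \<noteq> 0) = True)"
      if "k < length [V (n - 1)]" for k
      using V_system[OF \<mu> _ V0 V2 V, of "csqrt \<mu>" "n - 1"] n that by simp
  qed (use n V_simple(3)[of "n - 1"] V_good(3)[of "n - 1"] in auto)
  then show "\<exists>i p. dsum g_alg [V (n - 1), V (n + 1)] (L1_tens (V n)) i p" by simp
qed

end

subsection \<open>Closure of additive closures under the action\<close>

text \<open>A resolution of the identity by maps through members of the closure puts the identity of
  \<open>Z\<close> into \<open>Fac\<close>.\<close>

lemma sum_retract_in_cl:
  fixes n :: nat
  assumes Z: "lie_module \<gg> Z" and X: "\<And>k. k < n \<Longrightarrow> X k \<in> add_cl \<gg> S"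
    and h: "\<And>k. k < n \<Longrightarrow> a k \<in> module_homs \<gg> Z (X k)" "\<And>k. k < n \<Longrightarrow> b k \<in> module_homs \<gg> (X k) Z"
    and s: "(\<Sum>k<n. b k \<circ> a k) = id_on (idx Z)"
  shows "Z \<in> add_cl \<gg> S"
proof -
  have "b k \<circ> a k \<in> Fac \<gg> S Z Z" if "k < n" for k
    by (rule Fac_right[OF Fac_of_cl[OF X[OF that] h(2)[OF that]] h(1)[OF that]])
  then have "(\<Sum>k<n. b k \<circ> a k) \<in> Fac \<gg> S Z Z" by (intro Fac_sum) simp
  then show ?thesis using Z s by (simp add: add_cl_def)
qed

lemma lin_sum_maps: "(\<And>a. a \<in> A \<Longrightarrow> lin (g a)) \<Longrightarrow> lin (\<Sum>a\<in>A. g a)"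
  by (induction A rule: infinite_finite_induct) (auto intro: lin_zero lin_plus)

lemma tens_map_sum:
  assumes "lin f" "\<And>a. a \<in> A \<Longrightarrow> lin (g a)"
  shows "tens_map f (\<Sum>a\<in>A. g a) = (\<Sum>a\<in>A. tens_map f (g a))" "tens_map (\<Sum>a\<in>A. g a) f = (\<Sum>a\<in>A. tens_map (g a) f)"
proof -
  have l0: "lin (0 :: cvec \<Rightarrow> cvec)" by (rule lin_zero)
  have z: "tens_map f 0 = 0" "tens_map 0 f = 0"
    using tens_map_add_right[OF assms(1) l0 l0] tens_map_add_left[OF l0 l0 assms(1)] by simp_all
  have "tens_map f (\<Sum>a\<in>A. g a) = (\<Sum>a\<in>A. tens_map f (g a)) \<and> tens_map (\<Sum>a\<in>A. g a) f = (\<Sum>a\<in>A. tens_map (g a) f)"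
    using assms(2)
  proof (induction A rule: infinite_finite_induct)
    case (insert a A)
    have l: "lin (g a)" "lin (\<Sum>a\<in>A. g a)" using insert.prems by (auto intro: lin_sum_maps)
    have "tens_map f (\<Sum>a\<in>A. g a) = (\<Sum>a\<in>A. tens_map f (g a)) \<and> tens_map (\<Sum>a\<in>A. g a) f = (\<Sum>a\<in>A. tens_map (g a) f)"
      by (rule insert.IH) (use insert.prems in auto)
    then show ?case
      unfolding sum.insert[OF insert.hyps] tens_map_add_right[OF assms(1) l(2,1)] tens_map_add_left[OF l assms(1)] by (simp only: simp_thms)
  qed (simp_all add: z)
  then show "tens_map f (\<Sum>a\<in>A. g a) = (\<Sum>a\<in>A. tens_map f (g a))" "tens_map (\<Sum>a\<in>A. g a) f = (\<Sum>a\<in>A. tens_map (g a) f)" by blast+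
qed

lemma tens_map_id_comp:
  assumes "lin g" "lin g'"
  shows "tens_map (id_on I) g' \<circ> tens_map (id_on I) g = tens_map (id_on I) (g' \<circ> g)"
    "tens_map g' (id_on I) \<circ> tens_map g (id_on I) = tens_map (g' \<circ> g) (id_on I)"
  using tens_map_comp[OF lin_id_on assms(1) lin_id_on assms(2), of I I] tens_map_comp[OF assms(1) lin_id_on assms(2) lin_id_on, of I I]
  by (simp_all add: id_idem)

abbreviation actm :: "mat2 lie_mod \<Rightarrow> gelt lie_mod \<Rightarrow> gelt lie_mod" where
  "actm F X \<equiv> tens_module (pullback fst F) X"

lemma lie_module_actm: "lie_module sl2 F \<Longrightarrow> lie_module g_alg X \<Longrightarrow> lie_module g_alg (actm F X)"
  by (intro lie_module_tens lie_module_pullback_fst)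

lemma actm_hom:
  assumes "lie_module sl2 F" "lie_module sl2 F'" "lie_module g_alg X" "lie_module g_alg X'"
    "a \<in> module_homs sl2 F F'" "b \<in> module_homs g_alg X X'"
  shows "tens_map a b \<in> module_homs g_alg (actm F X) (actm F' X')"
  by (rule tens_map_hom[OF lie_module_pullback_fst[OF assms(1)] lie_module_pullback_fst[OF assms(2)] assms(3,4) pullback_hom[OF assms(5)] assms(6)])

lemma actm_dsum_right:
  assumes F: "lie_module sl2 F" and d: "dsum g_alg Ws X i p" and W: "\<And>V. V \<in> set Ws \<Longrightarrow> actm F V \<in> add_cl g_alg S"
  shows "actm F X \<in> add_cl g_alg S"
proof -
  have X: "lie_module g_alg X" "\<And>k. k < length Ws \<Longrightarrow> lie_module g_alg (Ws ! k)" using d by (auto simp: dsum_def)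
  note h = dsum_homs[OF d]
  note idF = module_homs_id[OF F]
  show ?thesis
  proof (rule sum_retract_in_cl[OF lie_module_actm[OF F X(1)]])
    fix k assume k: "k < length Ws"
    show "actm F (Ws ! k) \<in> add_cl g_alg S" using W k by simp
    show "tens_map (id_on (idx F)) (p k) \<in> module_homs g_alg (actm F X) (actm F (Ws ! k))"
      by (rule actm_hom[OF F F X(1) X(2)[OF k] idF h(2)[OF k]])
    show "tens_map (id_on (idx F)) (i k) \<in> module_homs g_alg (actm F (Ws ! k)) (actm F X)"
      by (rule actm_hom[OF F F X(2)[OF k] X(1) idF h(1)[OF k]])
  next
    have l: "lin (p k)" "lin (i k)" if "k < length Ws" for k using module_homs_lin h[OF that] by blast+
    have "(\<Sum>k<length Ws. tens_map (id_on (idx F)) (i k) \<circ> tens_map (id_on (idx F)) (p k)) = (\<Sum>k<length Ws. tens_map (id_on (idx F)) (i k \<circ> p k))"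
      by (rule sum.cong) (simp_all add: tens_map_id_comp l)
    also have "\<dots> = tens_map (id_on (idx F)) (\<Sum>k<length Ws. i k \<circ> p k)"
      by (rule tens_map_sum(1)[OF lin_id_on, symmetric]) (simp add: lin_comp l)
    also have "(\<Sum>k<length Ws. i k \<circ> p k) = id_on (idx X)" using d by (simp add: dsum_def)
    finally show "(\<Sum>k<length Ws. tens_map (id_on (idx F)) (i k) \<circ> tens_map (id_on (idx F)) (p k)) = id_on (idx (actm F X))"
      by (simp only: idx_tens idx_pullback tens_map_id)
  qed
qed

lemma actm_dsum_left:
  assumes d: "dsum sl2 Ws F i p" and X: "lie_module g_alg X" and W: "\<And>V. V \<in> set Ws \<Longrightarrow> actm V X \<in> add_cl g_alg S"
  shows "actm F X \<in> add_cl g_alg S"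
proof -
  have F: "lie_module sl2 F" "\<And>k. k < length Ws \<Longrightarrow> lie_module sl2 (Ws ! k)" using d by (auto simp: dsum_def)
  note h = dsum_homs[OF d]
  note idX = module_homs_id[OF X]
  show ?thesis
  proof (rule sum_retract_in_cl[OF lie_module_actm[OF F(1) X]])
    fix k assume k: "k < length Ws"
    show "actm (Ws ! k) X \<in> add_cl g_alg S" using W k by simp
    show "tens_map (p k) (id_on (idx X)) \<in> module_homs g_alg (actm F X) (actm (Ws ! k) X)"
      by (rule actm_hom[OF F(1) F(2)[OF k] X X h(2)[OF k] idX])
    show "tens_map (i k) (id_on (idx X)) \<in> module_homs g_alg (actm (Ws ! k) X) (actm F X)"
      by (rule actm_hom[OF F(2)[OF k] F(1) X X h(1)[OF k] idX])
  next
    have l: "lin (p k)" "lin (i k)" if "k < length Ws" for k using module_homs_lin h[OF that] by blast+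
    have "(\<Sum>k<length Ws. tens_map (i k) (id_on (idx X)) \<circ> tens_map (p k) (id_on (idx X))) = (\<Sum>k<length Ws. tens_map (i k \<circ> p k) (id_on (idx X)))"
      by (rule sum.cong) (simp_all add: tens_map_id_comp l)
    also have "\<dots> = tens_map (\<Sum>k<length Ws. i k \<circ> p k) (id_on (idx X))"
      by (rule tens_map_sum(2)[OF lin_id_on, symmetric]) (simp add: lin_comp l)
    also have "(\<Sum>k<length Ws. i k \<circ> p k) = id_on (idx F)" using d by (simp add: dsum_def)
    finally show "(\<Sum>k<length Ws. tens_map (i k) (id_on (idx X)) \<circ> tens_map (p k) (id_on (idx X))) = id_on (idx (actm F X))"
      by (simp only: idx_tens idx_pullback tens_map_id)
  qed
qed

lemma iso_g_in_cl:
  assumes i: "iso_in g_module_cat X Z f" and X: "lie_module g_alg X" and Z: "Z \<in> add_cl g_alg S"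
  shows "X \<in> add_cl g_alg S"
proof -
  obtain g where "f \<in> module_homs g_alg X Z" "g \<in> module_homs g_alg Z X" "g \<circ> f = id_on (idx X)"
    using i by (auto simp: iso_in_def)
  then show ?thesis by (intro retract_in_cl[OF X Z])
qed

lemma actm_in_cl:
  assumes L1: "\<And>X. X \<in> add_cl g_alg S \<Longrightarrow> actm (L 1) X \<in> add_cl g_alg S"
    and F: "lie_module sl2 F" "finite (idx F)" and X: "X \<in> add_cl g_alg S"
  shows "actm F X \<in> add_cl g_alg S"
proof -
  interpret M: module_category fd_sl2_cat g_module_cat by (rule module_category_g)
  have cl: "lie_module g_alg X" if "X \<in> add_cl g_alg S" for X using that by (simp add: add_cl_def)
  have Lm: "L m \<in> Obj fd_sl2_cat" for m by (simp add: lie_module_L)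
  have LX: "actm (L m) X \<in> add_cl g_alg S" if X: "X \<in> add_cl g_alg S" for m X
  proof (induction m)
    case 0
    have "X \<in> Obj g_module_cat" using cl[OF X] by simp
    from M.act_unit_iso[OF this] have "iso_in g_module_cat (actm (L 0) X) X (ActUnit g_module_cat X)" by simp
    then show ?case by (rule iso_g_in_cl[OF _ lie_module_actm[OF lie_module_L cl[OF X]] X])
  next
    case (Suc m)
    let ?F = "tens_module (L 1) (L m)"
    have F: "lie_module sl2 ?F" by (rule lie_module_tens[OF lie_module_L lie_module_L])
    have "X \<in> Obj g_module_cat" using cl[OF X] by simp
    from M.act_assoc_iso[OF Lm[of 1] Lm[of m] this]
    have "iso_in g_module_cat (actm ?F X) (actm (L 1) (actm (L m) X)) (ActAssoc g_module_cat (L 1) (L m) X)" by simp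
    then have FX: "actm ?F X \<in> add_cl g_alg S" by (rule iso_g_in_cl[OF _ lie_module_actm[OF F cl[OF X]] L1[OF Suc.IH]])
    obtain i p where ip: "i \<in> module_homs sl2 (L (Suc m)) ?F" "p \<in> module_homs sl2 ?F (L (Suc m))" "p \<circ> i = id_on (idx (L (Suc m)))"
      by (rule L_retract)
    let ?id = "id_on (idx X)"
    note h = actm_hom[OF lie_module_L F cl[OF X] cl[OF X] ip(1) module_homs_id[OF cl[OF X]]]
      actm_hom[OF F lie_module_L cl[OF X] cl[OF X] ip(2) module_homs_id[OF cl[OF X]]]
    have "tens_map p ?id \<circ> tens_map i ?id = tens_map (p \<circ> i) ?id"
      by (rule tens_map_id_comp(2)[OF module_homs_lin[OF ip(1)] module_homs_lin[OF ip(2)]])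
    also have "\<dots> = id_on (idx (actm (L (Suc m)) X))" unfolding ip(3) by (simp add: tens_map_id)
    finally show ?case by (rule retract_in_cl[OF lie_module_actm[OF lie_module_L cl[OF X]] FX h])
  qed
  obtain ms i p where d: "dsum sl2 (map L ms) F i p" by (rule sl2_complete_reducibility[OF F])
  show ?thesis by (rule actm_dsum_left[OF d cl[OF X]]) (use LX[OF X] in auto)
qed

text \<open>All coherence conditions are statements about the objects involved, so they are
  inherited by a full subcategory that is stable under the action.\<close>

lemma module_category_restrict:
  assumes sub: "\<And>X. X \<in> A \<Longrightarrow> lie_module g_alg X" and lin: "linear_category (g_module_cat\<lparr>Obj := A\<rparr>)"
    and cl: "\<And>F X. lie_module sl2 F \<Longrightarrow> finite (idx F) \<Longrightarrow> X \<in> A \<Longrightarrow> actm F X \<in> A"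
  shows "module_category fd_sl2_cat (g_module_cat\<lparr>Obj := A\<rparr>)"
proof -
  interpret M: module_category fd_sl2_cat g_module_cat by (rule module_category_g)
  let ?N = "g_module_cat\<lparr>Obj := A\<rparr>"
  have eqs: "Hom ?N = Hom g_module_cat" "Idn ?N = Idn g_module_cat" "Cmp ?N = Cmp g_module_cat" "Scl ?N = Scl g_module_cat"
    "Act ?N = Act g_module_cat" "ActM ?N = ActM g_module_cat" "ActAssoc ?N = ActAssoc g_module_cat" "ActUnit ?N = ActUnit g_module_cat"
    by simp_all
  have iso: "iso_in ?N X Y f = iso_in g_module_cat X Y f" for X Y f unfolding iso_in_def eqs ..
  have sub': "X \<in> Obj ?N \<Longrightarrow> X \<in> Obj g_module_cat" for X using sub by simp
  have cl': "F \<in> Obj fd_sl2_cat \<Longrightarrow> X \<in> Obj ?N \<Longrightarrow> Act g_module_cat F X \<in> Obj ?N" for F X using cl by simp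
  show ?thesis
    apply (intro module_category.intro module_category_axioms.intro monoidal_fd lin)
    unfolding eqs iso
    by (rule cl' M.act_hom M.act_id M.act_comp M.act_add_left M.act_add_right M.act_scale_left M.act_scale_right
        M.act_assoc_iso M.act_assoc_natural M.act_unit_iso M.act_unit_natural M.act_pentagon M.act_triangle; (assumption | erule sub'))+
qed

subsection \<open>The module category generated by the simple modules\<close>

lemma dsum_single_iso:
  assumes "dsum \<gg> [X] Z i p"
  shows "iso_in (module_cat \<gg>) Z X (p 0)"
proof -
  have "p 0 \<circ> i 0 = id_on (idx X)" "i 0 \<circ> p 0 = id_on (idx Z)" "i 0 \<in> module_homs \<gg> X Z" "p 0 \<in> module_homs \<gg> Z X"
    using assms by (auto simp: dsum_def)
  then show ?thesis unfolding iso_in_def by (auto simp: module_cat_def)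
qed

context V_family begin

definition S :: "gelt lie_mod set" where "S = {V0, V2} \<union> V ` {1..}"

lemma S_cases:
  assumes "X \<in> S" obtains "X = V0" | "X = V2" | n where "n \<ge> 1" "X = V n"
  using assms by (auto simp: S_def)

lemma S_mem: "V0 \<in> S" "V2 \<in> S" "n \<ge> 1 \<Longrightarrow> V n \<in> S"
  by (auto simp: S_def)

lemma S_hw_mod: "X \<in> S \<Longrightarrow> simple_module g_alg X \<and> (\<exists>n P. hw_mod \<mu> n P X)"
  by (erule S_cases) (use V_simple is_V_hw_mod(2)[OF \<mu> V0] is_V_hw_mod(3)[OF \<mu> V2] is_V_hw_mod(1)[OF \<mu> V] in blast)+

text \<open>The numbering of the nodes prescribed by \<open>type_D_infinity\<close>: the indices 0
  and 1 are the two ends of the fork, and \<open>V n\<close> gets the index n + 1.\<close>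

definition D :: "nat \<Rightarrow> gelt lie_mod" where
  "D i = (if i = 0 then V0 else if i = 1 then V2 else V (i - 1))"

lemma D_simps: "D 0 = V0" "D 1 = V2" "i \<ge> 2 \<Longrightarrow> D i = V (i - 1)"
  by (simp_all add: D_def)

lemma D_S: "D i \<in> S"
  using S_mem by (simp add: D_def)

lemma S_D: "X \<in> S \<Longrightarrow> \<exists>i. X = D i"
proof (erule S_cases)
  fix n :: nat assume "n \<ge> 1" "X = V n"
  then have "X = D (n + 1)" by (simp add: D_def)
  then show "\<exists>i. X = D i" ..
qed (use D_simps(1,2) in metis)+

lemma hwset_D: "i \<noteq> j \<Longrightarrow> hwset (D i) \<noteq> hwset (D j)"
proof (induction i j rule: linorder_less_wlog)
  case (less i j)
  consider "i = 0" "j = 1" | "i = 0" "j \<ge> 2" | "i = 1" "j \<ge> 2" | "i \<ge> 2" "j \<ge> 2" using less.hyps by linarith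
  then show ?case
  proof cases
    case 1
    show ?thesis unfolding 1 D_simps(1,2) by (rule hwset_ne(1))
  next
    case 2
    then show ?thesis using hwset_ne(2)[of "j - 1"] by (simp add: D_simps)
  next
    case 3
    then show ?thesis using hwset_ne(3)[of "j - 1"] D_simps(2) by (simp add: D_simps(3))
  next
    case 4
    then show ?thesis using hwset_ne(4)[of "i - 1" "j - 1"] less.hyps by (simp add: D_simps(3))
  qed
next
  case (sym i j)
  then show ?case by (metis)
qed simp

lemma S_hwset_ne:
  assumes "X \<in> S" "Y \<in> S" "X \<noteq> Y" shows "hwset X \<noteq> hwset Y"
proof -
  obtain i j where ij: "X = D i" "Y = D j" using S_D assms(1,2) by blast
  then have "i \<noteq> j" using assms(3) by blast
  then show ?thesis using hwset_D ij by blast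
qed

lemma schur_family_S: "schur_family g_alg S"
  unfolding schur_family_def
proof (intro ballI conjI impI)
  fix X assume X: "X \<in> S"
  then have Xs: "simple_module g_alg X" using S_hw_mod by blast
  then show "lie_module g_alg X" "idx X \<noteq> {}" by (auto simp: simple_module_def)
  show "\<exists>c. f = (\<lambda>v. scl c (id_on (idx X) v))" if "f \<in> module_homs g_alg X X" for f
    using S_hw_mod[OF X] hw_mod_schur[OF Xs _ that] by blast
  fix Y assume Y: "Y \<in> S" "X \<noteq> Y"
  then have "simple_module g_alg Y" using S_hw_mod by blast
  then show "module_homs g_alg X Y = {0}" by (rule homs_zero_of_hwset[OF Xs _ S_hwset_ne[OF X Y]])
qed

abbreviation Y' where "Y' \<equiv> g_module_cat\<lparr>Obj := add_cl g_alg S\<rparr>"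

lemma additive_closure_eq: "additive_closure g_module_cat S = Y'"
proof -
  have "direct_sum_in g_module_cat Xs Z \<longleftrightarrow> (\<exists>i p. dsum g_alg Xs Z i p)" for Xs Z
    by (auto simp: direct_sum_in_def dsum_def)
  then show ?thesis
    using add_cl_eq[OF schur_family_S] by (simp add: additive_closure_def full_subcategory_def)
qed

sublocale Y: schur_category g_alg S Y'
proof
  show "schur_family g_alg S" by (rule schur_family_S)
  show "Scl Y' = (\<lambda>c f v. scl c (f v))" by (intro ext) simp
qed simp_all

lemma L1_in_cl:
  assumes "X \<in> add_cl g_alg S" shows "actm (L 1) X \<in> add_cl g_alg S"
proof -
  have LW: "actm (L 1) W \<in> add_cl g_alg S" if "W \<in> S" for W
  proof -
    have "\<exists>Xs i p. set Xs \<subseteq> S \<and> dsum g_alg Xs (actm (L 1) W) i p"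
      using that
    proof (cases rule: S_cases)
      case 1
      obtain i p where "dsum g_alg [V 1] (actm (L 1) V0) i p" using L1_tens_decomposition(1) by blast
      then show ?thesis using S_mem(3)[of 1] unfolding 1 by (intro exI[of _ "[V 1]"] exI[of _ i] exI[of _ p]) simp
    next
      case 2
      obtain i p where "dsum g_alg [V 1] (actm (L 1) V2) i p" using L1_tens_decomposition(2) by blast
      then show ?thesis using S_mem(3)[of 1] unfolding 2 by (intro exI[of _ "[V 1]"] exI[of _ i] exI[of _ p]) simp
    next
      case (3 n)
      show ?thesis
      proof (cases "n = 1")
        case True
        obtain i p where "dsum g_alg [V0, V2, V 2] (actm (L 1) (V 1)) i p" using L1_tens_decomposition(3) by blast
        then show ?thesis using S_mem(1,2) S_mem(3)[of 2] unfolding 3 True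
          by (intro exI[of _ "[V0, V2, V 2]"] exI[of _ i] exI[of _ p]) simp
      next
        case False
        then have n: "n \<ge> 2" using 3 by simp
        obtain i p where "dsum g_alg [V (n - 1), V (n + 1)] (actm (L 1) (V n)) i p" using L1_tens_decomposition(4)[OF n] by blast
        then show ?thesis using S_mem(3)[of "n - 1"] S_mem(3)[of "n + 1"] n unfolding 3
          by (intro exI[of _ "[V (n - 1), V (n + 1)]"] exI[of _ i] exI[of _ p]) simp
      qed
    qed
    then obtain Xs i p where "set Xs \<subseteq> S" "dsum g_alg Xs (actm (L 1) W) i p" by blast
    then show ?thesis using Y.S_cl dsum_in_cl[of g_alg Xs] by blast
  qed
  obtain Ws i p where Ws: "set Ws \<subseteq> S" "dsum g_alg Ws X i p" by (rule cl_dsum[OF schur_family_S assms])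
  show ?thesis by (rule actm_dsum_right[OF lie_module_L Ws(2)]) (use LW Ws(1) in blast)
qed

lemma locally_finitary_Y': "locally_finitary_module_category fd_sl2_cat Y'"
  unfolding locally_finitary_module_category_def
proof
  show "module_category fd_sl2_cat Y'"
    by (rule module_category_restrict[OF Y.cl_lie_module Y.linear_M actm_in_cl[OF L1_in_cl]])
  show "locally_finitary Y'" by (rule Y.locally_finitary_M) (simp add: S_def)
qed

lemma simple_transitive_Y': "simple_transitive fd_sl2_cat Y'"
  unfolding simple_transitive_def
proof (intro allI impI)
  fix I assume inv: "invariant_ideal fd_sl2_cat Y' I"
  then have ci: "category_ideal Y' I" by (simp only: invariant_ideal_def)
  have hom: "f \<in> module_homs g_alg X Y" if "X \<in> add_cl g_alg S" "Y \<in> add_cl g_alg S" "f \<in> I X Y" for X Y f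
    using ci that unfolding category_ideal_def by auto
  have sub: "maps.subspace (I X Y)" if "X \<in> add_cl g_alg S" "Y \<in> add_cl g_alg S" for X Y
    using ci that unfolding category_ideal_def Y.Scl_M by simp
  have left: "g \<circ> f \<in> I X Z" if "X \<in> add_cl g_alg S" "Y \<in> add_cl g_alg S" "Z \<in> add_cl g_alg S" "f \<in> I X Y" "g \<in> module_homs g_alg Y Z" for X Y Z f g
    using ci that unfolding category_ideal_def by simp
  have right: "g \<circ> f \<in> I X Z" if "X \<in> add_cl g_alg S" "Y \<in> add_cl g_alg S" "Z \<in> add_cl g_alg S" "f \<in> module_homs g_alg X Y" "g \<in> I Y Z" for X Y Z f g
    using ci that unfolding category_ideal_def by simp
  have act: "tens_map (id_on (idx (L 1))) f \<in> I (actm (L 1) X) (actm (L 1) Y)"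
    if "X \<in> add_cl g_alg S" "Y \<in> add_cl g_alg S" "f \<in> I X Y" for X Y f
  proof -
    have "L 1 \<in> Obj fd_sl2_cat" by (simp add: lie_module_L)
    then have "ActM Y' (Idn fd_sl2_cat (L 1)) f \<in> I (Act Y' (L 1) X) (Act Y' (L 1) Y)"
      using inv that unfolding invariant_ideal_def Y.Obj_M by blast
    then show ?thesis by simp
  qed
  \<comment> \<open>The nodes of the graph whose identity lies in the ideal. By invariance and the
    ideal property this set is closed under passing to neighbours.\<close>
  define R where "R = {W \<in> S. id_on (idx W) \<in> I W W}"
  have step: "U \<in> R" if W: "W \<in> R" and d: "dsum g_alg Xs (actm (L 1) W) i p" and U: "U \<in> set Xs" "U \<in> S" for W U Xs i p
  proof -
    have WS: "W \<in> add_cl g_alg S" and idW: "id_on (idx W) \<in> I W W" using W Y.S_cl by (auto simp: R_def)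
    note T = L1_in_cl[OF WS] and US = Y.S_cl[OF U(2)]
    have "tens_map (id_on (idx (L 1))) (id_on (idx W)) \<in> I (actm (L 1) W) (actm (L 1) W)" by (rule act[OF WS WS idW])
    then have idT: "id_on (idx (actm (L 1) W)) \<in> I (actm (L 1) W) (actm (L 1) W)" by (simp add: tens_map_id)
    obtain k where k: "k < length Xs" "Xs ! k = U" using U(1) by (auto simp: in_set_conv_nth)
    have h: "i k \<in> module_homs g_alg U (actm (L 1) W)" "p k \<in> module_homs g_alg (actm (L 1) W) U"
      using dsum_homs[OF d k(1)] k(2) by simp_all
    have "p k \<circ> (id_on (idx (actm (L 1) W)) \<circ> i k) \<in> I U U"
      by (rule left[OF US T US right[OF US T T h(1) idT] h(2)])
    also have "p k \<circ> (id_on (idx (actm (L 1) W)) \<circ> i k) = id_on (idx U)"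
      using dsum_apply[OF d k(1) k(1)] k(2) lin_maps_id_left[OF module_homs_lin_maps[OF h(1)]] by (auto simp: fun_eq_iff)
    finally show ?thesis using U(2) by (simp add: R_def)
  qed
  show "(\<forall>X\<in>Obj Y'. \<forall>Z\<in>Obj Y'. I X Z = {0}) \<or> (\<forall>X\<in>Obj Y'. \<forall>Z\<in>Obj Y'. I X Z = Hom Y' X Z)"
  proof (rule disjCI)
    assume "\<not> (\<forall>X\<in>Obj Y'. \<forall>Z\<in>Obj Y'. I X Z = Hom Y' X Z)"
    then obtain A B where AB: "A \<in> add_cl g_alg S" "B \<in> add_cl g_alg S" "I A B \<noteq> module_homs g_alg A B" by auto
    show "\<forall>X\<in>Obj Y'. \<forall>Z\<in>Obj Y'. I X Z = {0}"
    proof (rule ccontr)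
      assume "\<not> ?thesis"
      then obtain X Z where XZ: "X \<in> add_cl g_alg S" "Z \<in> add_cl g_alg S" "I X Z \<noteq> {0}" by auto
      then obtain f where f: "f \<in> I X Z" "f \<noteq> 0" using maps.subspace_0[OF sub[OF XZ(1,2)]] by blast
      obtain Ws i p where W: "set Ws \<subseteq> S" "dsum g_alg Ws X i p" by (rule cl_dsum[OF schur_family_S XZ(1)])
      obtain Us j q where U: "set Us \<subseteq> S" "dsum g_alg Us Z j q" by (rule cl_dsum[OF schur_family_S XZ(2)])
      \<comment> \<open>A non-zero morphism has a non-zero matrix entry between simple summands. By
        Schur it is a multiple of an identity, which provides the first node.\<close>
      have "\<exists>l<length Us. \<exists>k<length Ws. q l \<circ> f \<circ> i k \<noteq> 0"
      proof (rule ccontr)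
        assume "\<not> ?thesis"
        then have z: "q l \<circ> f \<circ> i k = 0" if "l < length Us" "k < length Ws" for l k using that by blast
        have "j l \<circ> (q l \<circ> f \<circ> i k) \<circ> p k = 0" if "l < length Us" "k < length Ws" for l k
          unfolding z[OF that] using lin_0[OF module_homs_lin[OF dsum_homs(1)[OF U(2) that(1)]]] by (simp add: fun_eq_iff)
        then have "f = 0" using Y.hom_decompose[OF W(2) U(2) hom[OF XZ(1,2) f(1)]] by simp
        then show False using f(2) by simp
      qed
      then obtain l k where lk: "l < length Us" "k < length Ws" and nz: "q l \<circ> f \<circ> i k \<noteq> 0" by blast
      have S: "Ws ! k \<in> S" "Us ! l \<in> S" using W(1) U(1) lk by auto
      note c = Y.S_cl[OF S(1)] Y.S_cl[OF S(2)]
      have m: "q l \<circ> (f \<circ> i k) \<in> I (Ws ! k) (Us ! l)"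
        by (rule left[OF c(1) XZ(2) c(2) right[OF c(1) XZ(1,2) dsum_homs(1)[OF W(2) lk(2)] f(1)] dsum_homs(2)[OF U(2) lk(1)]])
      then have m': "q l \<circ> f \<circ> i k \<in> I (Ws ! k) (Us ! l)" by (simp only: comp_assoc)
      have eq: "Ws ! k = Us ! l" by (rule schur_familyD(4)[OF schur_family_S S hom[OF c m'] nz])
      let ?W = "Ws ! k"
      have mW: "q l \<circ> f \<circ> i k \<in> I ?W ?W" using m' eq by simp
      obtain r where r: "q l \<circ> f \<circ> i k = (\<lambda>v. scl r (id_on (idx ?W) v))"
        using schur_familyD(3)[OF schur_family_S S(1) hom[OF c(1) c(1) mW]] by blast
      have "r \<noteq> 0" using nz r by (auto simp: fun_eq_iff)
      moreover have "(\<lambda>v. scl (1 / r) ((q l \<circ> f \<circ> i k) v)) \<in> I ?W ?W"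
        by (rule maps.subspace_scale[OF sub[OF c(1) c(1)] mW])
      ultimately have "id_on (idx ?W) \<in> I ?W ?W" unfolding r by (simp add: eta_contract_eq)
      then have WR: "?W \<in> R" using S(1) by (simp add: R_def)
      obtain i0 p0 where d0: "dsum g_alg [V 1] (actm (L 1) V0) i0 p0" using L1_tens_decomposition(1) by blast
      obtain i2 p2 where d2: "dsum g_alg [V 1] (actm (L 1) V2) i2 p2" using L1_tens_decomposition(2) by blast
      obtain i1 p1 where d1: "dsum g_alg [V0, V2, V 2] (actm (L 1) (V 1)) i1 p1" using L1_tens_decomposition(3) by blast
      have dn: "\<exists>i p. dsum g_alg [V (n - 1), V (n + 1)] (actm (L 1) (V n)) i p" if "n \<ge> 2" for n
        by (rule L1_tens_decomposition(4)[OF that])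
      have S1: "V 1 \<in> S" "V 2 \<in> S" by (simp_all add: S_mem(3))
      \<comment> \<open>Connectedness of the graph: every node leads to \<open>V 1\<close>, and from
        there all nodes are reached.\<close>
      have down: "V n \<in> R \<Longrightarrow> V 1 \<in> R" if "n \<ge> 1" for n
        using that
      proof (induction n rule: nat_induct_at_least)
        case (Suc n)
        obtain i p where d: "dsum g_alg [V (Suc n - 1), V (Suc n + 1)] (actm (L 1) (V (Suc n))) i p" using dn[of "Suc n"] Suc.hyps by auto
        have "V n \<in> R" by (rule step[OF Suc.prems d]) (use Suc.hyps S_mem(3) in simp_all)
        then show ?case by (rule Suc.IH)
      qed
      have V1: "V 1 \<in> R"
        using S(1)
      proof (cases rule: S_cases)
        case 1
        then show ?thesis using step[OF _ d0 _ S1(1)] WR by simp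
      next
        case 2
        then show ?thesis using step[OF _ d2 _ S1(1)] WR by simp
      next
        case (3 n)
        then show ?thesis using down[of n] WR by simp
      qed
      have up: "V n \<in> R" if "n \<ge> 1" for n
        using that
      proof (induction n rule: nat_induct_at_least)
        case base
        show ?case by (rule V1)
      next
        case (Suc n)
        show ?case
        proof (cases "n = 1")
          case True
          have "V 2 \<in> R" by (rule step[OF V1 d1 _ S1(2)]) simp
          then show ?thesis using True by (simp add: numeral_2_eq_2)
        next
          case False
          then have "n \<ge> 2" using Suc.hyps by simp
          then obtain i p where d: "dsum g_alg [V (n - 1), V (n + 1)] (actm (L 1) (V n)) i p" using dn by blast
          show ?thesis by (rule step[OF Suc.IH d]) (use S_mem(3)[of "Suc n"] in simp_all)
        qed
      qed
      have V02: "V0 \<in> R" "V2 \<in> R" by (rule step[OF V1 d1]; simp add: S_mem)+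
      have all: "id_on (idx U) \<in> I U U" if "U \<in> S" for U
      proof -
        have "U \<in> R" by (rule S_cases[OF that]) (simp_all only: V02 up)
        then show ?thesis by (simp add: R_def)
      qed
      \<comment> \<open>The identity of \<open>A\<close> is the sum of its projectors onto simple
        summands, each of which factors through an identity in the ideal.\<close>
      obtain Ws' i' p' where W': "set Ws' \<subseteq> S" "dsum g_alg Ws' A i' p'" by (rule cl_dsum[OF schur_family_S AB(1)])
      have "i' k \<circ> p' k \<in> I A A" if k: "k < length Ws'" for k
      proof -
        have KS: "Ws' ! k \<in> S" using W'(1) k by auto
        note K = Y.S_cl[OF KS] and h = dsum_homs[OF W'(2) k]
        have "i' k \<circ> (id_on (idx (Ws' ! k)) \<circ> p' k) \<in> I A A"
          by (rule left[OF AB(1) K AB(1) right[OF AB(1) K K h(2) all[OF KS]] h(1)])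
        moreover have "id_on (idx (Ws' ! k)) \<circ> p' k = p' k" using lin_maps_id_left[OF module_homs_lin_maps[OF h(2)]] by (auto simp: fun_eq_iff)
        ultimately show ?thesis by simp
      qed
      then have "(\<Sum>k<length Ws'. i' k \<circ> p' k) \<in> I A A" by (intro maps.subspace_sum[OF sub[OF AB(1,1)]]) simp
      then have idA: "id_on (idx A) \<in> I A A" using W'(2) by (simp add: dsum_def)
      have "g \<in> I A B" if g: "g \<in> module_homs g_alg A B" for g
      proof -
        have "g \<circ> id_on (idx A) \<in> I A B" by (rule left[OF AB(1,1,2) idA g])
        moreover have "g \<circ> id_on (idx A) = g" using lin_maps_id_right[OF module_homs_lin_maps[OF g]] by (auto simp: fun_eq_iff)
        ultimately show ?thesis by simp
      qed
      then show False using AB(3) hom[OF AB(1,2)] by blast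
    qed
  qed
qed

lemma type_D_infinity_Y': "type_D_infinity (L 1) Y'"
  unfolding type_D_infinity_def
proof (intro exI[of _ D] conjI allI impI)
  have inj: "D i \<noteq> D j" if "i \<noteq> j" for i j using hwset_D[OF that] by auto
  have iso: "isomorphic Y' (Act Y' (L 1) W) (V 1)" if "\<exists>i p. dsum g_alg [V 1] (actm (L 1) W) i p" for W
  proof -
    obtain i p where d: "dsum g_alg [V 1] (actm (L 1) W) i p" using \<open>\<exists>i p. dsum g_alg [V 1] (actm (L 1) W) i p\<close> by blast
    have "iso_in (module_cat g_alg) (actm (L 1) W) (V 1) (p 0)" by (rule dsum_single_iso[OF d])
    then show ?thesis unfolding isomorphic_def by (intro exI[of _ "p 0"]) (simp add: iso_in_def module_cat_def)
  qed
  fix i j :: nat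
  show "indecomposable Y' (D i)" by (rule Y.indecomposable_S[OF D_S])
  show "\<exists>i. isomorphic Y' X (D i)" if X: "indecomposable Y' X" for X
  proof -
    obtain U where U: "U \<in> S" "isomorphic Y' X U" using Y.indecomposable_iso[OF X] by blast
    then show ?thesis using S_D by blast
  qed
  show "\<not> isomorphic Y' (D i) (D j)" if "i \<noteq> j" by (rule Y.not_iso_S[OF D_S D_S inj[OF that]])
  have Dn: "D 2 = V 1" "D 3 = V 2" by (simp_all add: D_def)
  show "isomorphic Y' (Act Y' (L 1) (D 0)) (D 2)" unfolding D_simps(1) Dn by (rule iso[OF L1_tens_decomposition(1)])
  show "isomorphic Y' (Act Y' (L 1) (D 1)) (D 2)" unfolding D_simps(2) Dn by (rule iso[OF L1_tens_decomposition(2)])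
  have cl: "D i \<in> add_cl g_alg S" for i by (rule Y.S_cl[OF D_S])
  have actY: "Act Y' F X = actm F X" for F X by simp
  show "direct_sum_in Y' [D 0, D 1, D 3] (Act Y' (L 1) (D 2))"
    unfolding Y.direct_sum_in_M actY
  proof (intro conjI)
    show "actm (L 1) (D 2) \<in> add_cl g_alg S" by (rule L1_in_cl[OF cl])
    show "set [D 0, D 1, D 3] \<subseteq> add_cl g_alg S" using cl by (simp only: list.set insert_subset empty_subsetI simp_thms)
    show "\<exists>i p. dsum g_alg [D 0, D 1, D 3] (actm (L 1) (D 2)) i p" unfolding Dn D_simps(1,2) by (rule L1_tens_decomposition(3))
  qed
  show "direct_sum_in Y' [D (i - 1), D (i + 1)] (Act Y' (L 1) (D i))" if i: "3 \<le> i"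
    unfolding Y.direct_sum_in_M actY
  proof (intro conjI)
    show "actm (L 1) (D i) \<in> add_cl g_alg S" by (rule L1_in_cl[OF cl])
    show "set [D (i - 1), D (i + 1)] \<subseteq> add_cl g_alg S" using cl by (simp only: list.set insert_subset empty_subsetI simp_thms)
    have Di: "D i = V (i - 1)" "D (i - 1) = V (i - 1 - 1)" "D (i + 1) = V (i - 1 + 1)" using i by (simp_all add: D_def)
    show "\<exists>k p. dsum g_alg [D (i - 1), D (i + 1)] (actm (L 1) (D i)) k p"
      unfolding Di by (rule L1_tens_decomposition(4)) (use i in simp)
  qed
qed

end

theorem proposition19:
  fixes \<mu> :: complex and V0 V2 :: "gelt lie_mod" and V :: "nat \<Rightarrow> gelt lie_mod"
  assumes "\<mu> \<noteq> 0"
    and "is_V'0 \<mu> V0" and "is_V'2 \<mu> V2" and "\<And>n. n \<ge> 1 \<Longrightarrow> is_V n \<mu> (V n)"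
  shows "let Y' = additive_closure g_module_cat ({V0, V2} \<union> V ` {1..}) in
         locally_finitary_module_category fd_sl2_cat Y' \<and>
         simple_transitive fd_sl2_cat Y' \<and>
         type_D_infinity (L 1) Y'"
proof -
  interpret V_family \<mu> V0 V2 V by unfold_locales (rule assms; assumption?)+
  show ?thesis
    unfolding Let_def S_def[symmetric] additive_closure_eq
    by (intro conjI locally_finitary_Y' simple_transitive_Y' type_D_infinity_Y')
qed

end
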